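(* Assume the setting and Assumption (A1) described in the context, and let $\mathcal F$ be a pointwise measurable class of real functions on $\mathcal Y$ satisfying condition (A3) described in the context. Let $\mathbb G$ be the centered Gaussian process on $\mathcal F$ with covariance kernel $K(f_1,f_2)=\sum_{i=1}^k\lambda_i\mathrm{Cov}\big(\sum_{\ell=1}^{N_{\mathbf 1}}f_1(Y_{\ell,\mathbf 1}),\sum_{\ell=1}^{N_{\mathbf 2_i}}f_2(Y_{\ell,\mathbf 2_i})\big)$ (the weak limit of $\mathbb G_C$). Then the pigeonhole bootstrap process $\mathbb G^*_C$ converges weakly to $\mathbb G$ in probability conditionally on the data, i.e. $$\sup_{h\in \mathrm{BL}_1}\Big|E\big(h(\mathbb G^*_C)\,\big|\,(N_{\mathbf j},(Y_{\ell,\mathbf j})_{\ell\ge1})_{\mathbf j\ge\mathbf 1}\big)-E\big(h(\mathbb G)\big)\Big|\to0\quad\text{in probability as }\underline C\to\infty,$$ where $\mathrm{BL}_1$ is the set of functions $h:\ell^\infty(\mathcal F)\to\mathbb R$ bounded by $1$ and $1$-Lipschitz.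
   Context: Fix integers $k\ge1$, $l\ge1$ and $\mathcal Y\subset\mathbb R^l$. Cells are indexed by $\mathbf j=(j_1,\dots,j_k)\in(\mathbb N^* )^k$; $\mathbf j\le\mathbf j'$ means $j_i\le j'_i$ for all $i$; $\mathbf 1=(1,\dots,1)$; $\mathbf 2_i$ is the $k$-tuple with $1$ in position $i$ and $2$ elsewhere. Data: an array $(N_{\mathbf j},(Y_{\ell,\mathbf j})_{\ell\ge1})_{\mathbf j\ge\mathbf 1}$, $N_{\mathbf j}\in\mathbb N$, $Y_{\ell,\mathbf j}\in\mathcal Y$. For $\mathbf C=(C_1,\dots,C_k)$, $\underline C=\min_iC_i$, $\Pi_C=\prod_iC_i$. Assumption (A1): (i) separate exchangeability: for any permutations $\pi_1,\dots,\pi_k$ of $\mathbb N^*$, the array has the same joint law as the array with cell $\mathbf j$ replaced by cell $(\pi_1(j_1),\dots,\pi_k(j_k))$; (ii) for any $\mathbf c\ge\mathbf 1$, the cells $\mathbf 1\le\mathbf j\le\mathbf c$ are jointly independent of the cells $\mathbf j'\ge\mathbf c+\mathbf 1$; (iii) $E(N_{\mathbf 1})>0$; (iv) one observes $(N_{\mathbf j},(Y_{\ell,\mathbf j})_{\ell\le N_{\mathbf j}})_{\mathbf 1\le\mathbf j\le\mathbf C}$ and asymptotics are $\underline C\to\infty$ with $\underline C/C_i\to\lambda_i\ge0$ for all $i$. $\mathcal F$ pointwise measurable: there is a countable subclass such that every $f\in\mathcal F$ is a pointwise limit of its elements. Envelope: measurable $F\ge\sup_{f\in\mathcal F}|f|$.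 $\|f\|_{Q,2}=(\int f^2dQ)^{1/2}$; $N(\varepsilon,\mathcal F,\|\cdot\|)$ = minimal number of closed balls of radius $\varepsilon$ centered in $\mathcal F$ covering $\mathcal F$. Condition (A3): there is an envelope $F$ with either (a) $\mathcal F$ finite and $E[(\sum_{\ell=1}^{N_{\mathbf 1}}F(Y_{\ell,\mathbf 1}))^2]<\infty$, or (b) $E[N_{\mathbf 1}^2]<\infty$, $E[N_{\mathbf 1}\sum_{\ell=1}^{N_{\mathbf 1}}F(Y_{\ell,\mathbf 1})^2]<\infty$ and $\int_0^\infty\sup_Q\sqrt{\log N(\varepsilon\|F\|_{Q,2},\mathcal F,\|\cdot\|_{Q,2})}d\varepsilon<\infty$ (sup over finitely supported probability measures on $\mathcal Y$). Pigeonhole bootstrap: independently for each $i\in\{1,\dots,k\}$ and independently of the data, draw $C_i$ elements with replacement and equal probabilities from $\{1,\dots,C_i\}$, and let $W^i_{j}$ be the number of times $j$ is drawn; set $W_{\mathbf j}=\prod_{i=1}^kW^i_{j_i}$. The bootstrap process is $\mathbb G^*_Cf=\frac{\sqrt{\underline C}}{\Pi_C}\sum_{\mathbf 1\le\mathbf j\le\mathbf C}(W_{\mathbf j}-1)\sum_{\ell=1}^{N_{\mathbf j}}f(Y_{\ell,\mathbf j})$, $f\in\mathcal F$. *)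

theory Defs
  imports "HOL-Probability.Probability"
begin

(* Cells are indexed 0-based: j :: 'k \<Rightarrow> nat, cell 1 of the paper is (\<lambda>_. 0).
   Units inside a cell are indexed 0-based: l < N j. *)

definition cell1 :: "'k \<Rightarrow> nat" where
  "cell1 = (\<lambda>_. 0)"

(* the paper's 2_i : first coordinate-index i gets 1, the others 2 (here 0 and 1) *)
definition cell2 :: "'k \<Rightarrow> 'k \<Rightarrow> nat" where
  "cell2 i = (\<lambda>i'. if i' = i then 0 else 1)"

definition cellspace :: "(nat \<times> (nat \<Rightarrow> 'y::topological_space)) measure" where
  "cellspace = count_space UNIV \<Otimes>\<^sub>M (\<Pi>\<^sub>M l\<in>UNIV. borel)"

definition data :: "('a \<Rightarrow> ('k \<Rightarrow> nat) \<Rightarrow> nat) \<Rightarrow> ('a \<Rightarrow> ('k \<Rightarrow> nat) \<Rightarrow> nat \<Rightarrow> 'y)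
     \<Rightarrow> 'a \<Rightarrow> ('k \<Rightarrow> nat) \<Rightarrow> nat \<times> (nat \<Rightarrow> 'y)" where
  "data N Y \<omega> = (\<lambda>j. (N \<omega> j, \<lambda>l. Y \<omega> j l))"

definition A1 :: "'a measure \<Rightarrow> ('a \<Rightarrow> ('k \<Rightarrow> nat) \<Rightarrow> nat) \<Rightarrow> ('a \<Rightarrow> ('k \<Rightarrow> nat) \<Rightarrow> nat \<Rightarrow> 'y::topological_space) \<Rightarrow> bool" where
  "A1 M N Y \<longleftrightarrow>
     (\<forall>j. (\<lambda>\<omega>. N \<omega> j) \<in> measurable M (count_space UNIV)) \<and>
     (\<forall>j l. (\<lambda>\<omega>. Y \<omega> j l) \<in> borel_measurable M) \<and>
     (\<forall>\<pi> :: 'k \<Rightarrow> nat \<Rightarrow> nat. (\<forall>i. bij (\<pi> i)) \<longrightarrow>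
        distr M (\<Pi>\<^sub>M j\<in>UNIV. cellspace) (data N Y)
        = distr M (\<Pi>\<^sub>M j\<in>UNIV. cellspace) (\<lambda>\<omega>. data N Y \<omega> \<circ> (\<lambda>j i. \<pi> i (j i)))) \<and>
     (\<forall>c :: 'k \<Rightarrow> nat. prob_space.indep_var M
        (\<Pi>\<^sub>M j\<in>{j. j \<le> c}. cellspace) (\<lambda>\<omega>. restrict (data N Y \<omega>) {j. j \<le> c})
        (\<Pi>\<^sub>M j\<in>{j. \<forall>i. c i < j i}. cellspace) (\<lambda>\<omega>. restrict (data N Y \<omega>) {j. \<forall>i. c i < j i})) \<and>
     (\<integral>\<^sup>+ \<omega>. ennreal (real (N \<omega> cell1)) \<partial>M) > 0"

definition pointwise_measurable :: "'y set \<Rightarrow> ('y \<Rightarrow> real) set \<Rightarrow> bool" where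
  "pointwise_measurable Ysp \<F> \<longleftrightarrow>
     (\<exists>\<G>. \<G> \<subseteq> \<F> \<and> countable \<G> \<and>
        (\<forall>f\<in>\<F>. \<exists>s. (\<forall>n. s n \<in> \<G>) \<and> (\<forall>y\<in>Ysp. (\<lambda>n. s n y) \<longlonglongrightarrow> f y)))"

definition fin_prob :: "'y set \<Rightarrow> ('y \<Rightarrow> real) set" where
  "fin_prob Ysp = {q. finite {y. q y \<noteq> 0} \<and> {y. q y \<noteq> 0} \<subseteq> Ysp \<and> (\<forall>y. q y \<ge> 0)
                    \<and> (\<Sum>y\<in>{y. q y \<noteq> 0}. q y) = 1}"

definition L2norm :: "('y \<Rightarrow> real) \<Rightarrow> ('y \<Rightarrow> real) \<Rightarrow> real" where
  "L2norm q f = sqrt (\<Sum>y\<in>{y. q y \<noteq> 0}. q y * (f y)\<^sup>2)"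

definition covering_number :: "real \<Rightarrow> 'b set \<Rightarrow> ('b \<Rightarrow> 'b \<Rightarrow> real) \<Rightarrow> ennreal" where
  "covering_number eps \<F> d =
     (INF G\<in>{G. finite G \<and> G \<subseteq> \<F> \<and> (\<forall>f\<in>\<F>. \<exists>g\<in>G. d f g \<le> eps)}. of_nat (card G))"

definition sqrt_log :: "ennreal \<Rightarrow> ennreal" where
  "sqrt_log n = (if n = \<top> then \<top> else ennreal (sqrt (ln (max 1 (enn2real n)))))"

definition uniform_entropy_integral :: "'y set \<Rightarrow> ('y \<Rightarrow> real) set \<Rightarrow> ('y \<Rightarrow> real) \<Rightarrow> ennreal" where
  "uniform_entropy_integral Ysp \<F> Fenv =
     (\<integral>\<^sup>+ eps. indicator {0<..} eps *
        (SUP q\<in>fin_prob Ysp. sqrt_log (covering_number (eps * L2norm q Fenv) \<F>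
                                   (\<lambda>f g. L2norm q (\<lambda>y. f y - g y)))) \<partial>lborel)"

definition cellsum :: "('a \<Rightarrow> ('k \<Rightarrow> nat) \<Rightarrow> nat) \<Rightarrow> ('a \<Rightarrow> ('k \<Rightarrow> nat) \<Rightarrow> nat \<Rightarrow> 'y)
     \<Rightarrow> ('y \<Rightarrow> real) \<Rightarrow> ('k \<Rightarrow> nat) \<Rightarrow> 'a \<Rightarrow> real" where
  "cellsum N Y f j \<omega> = (\<Sum>l<N \<omega> j. f (Y \<omega> j l))"

definition A3 :: "'a measure \<Rightarrow> ('a \<Rightarrow> ('k \<Rightarrow> nat) \<Rightarrow> nat) \<Rightarrow> ('a \<Rightarrow> ('k \<Rightarrow> nat) \<Rightarrow> nat \<Rightarrow> 'y::topological_space)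
     \<Rightarrow> 'y set \<Rightarrow> ('y \<Rightarrow> real) set \<Rightarrow> ('y \<Rightarrow> real) \<Rightarrow> bool" where
  "A3 M N Y Ysp \<F> Fenv \<longleftrightarrow>
     Fenv \<in> borel_measurable (restrict_space borel Ysp) \<and>
     (\<forall>f\<in>\<F>. \<forall>y\<in>Ysp. \<bar>f y\<bar> \<le> Fenv y) \<and>
     ((finite \<F> \<and> (\<integral>\<^sup>+ \<omega>. ennreal ((cellsum N Y Fenv cell1 \<omega>)\<^sup>2) \<partial>M) < \<infinity>) \<or>
      ((\<integral>\<^sup>+ \<omega>. ennreal ((real (N \<omega> cell1))\<^sup>2) \<partial>M) < \<infinity> \<and>
       (\<integral>\<^sup>+ \<omega>. ennreal (real (N \<omega> cell1) * cellsum N Y (\<lambda>y. (Fenv y)\<^sup>2) cell1 \<omega>) \<partial>M) < \<infinity> \<and>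
       uniform_entropy_integral Ysp \<F> Fenv < \<infinity>))"

definition covar :: "'a measure \<Rightarrow> ('a \<Rightarrow> real) \<Rightarrow> ('a \<Rightarrow> real) \<Rightarrow> real" where
  "covar M X Z = (\<integral>\<omega>. X \<omega> * Z \<omega> \<partial>M) - (\<integral>\<omega>. X \<omega> \<partial>M) * (\<integral>\<omega>. Z \<omega> \<partial>M)"

definition kernel :: "'a measure \<Rightarrow> ('a \<Rightarrow> ('k::finite \<Rightarrow> nat) \<Rightarrow> nat) \<Rightarrow> ('a \<Rightarrow> ('k \<Rightarrow> nat) \<Rightarrow> nat \<Rightarrow> 'y)
     \<Rightarrow> ('k \<Rightarrow> real) \<Rightarrow> ('y \<Rightarrow> real) \<Rightarrow> ('y \<Rightarrow> real) \<Rightarrow> real" where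
  "kernel M N Y lam f g =
     (\<Sum>i\<in>UNIV. lam i * covar M (cellsum N Y f cell1) (cellsum N Y g (cell2 i)))"

(* BL_1: functions on l^\<infinity>(F) (represented by all real functions on functions, with
   sup-distance over F) bounded by 1 and 1-Lipschitz *)
definition BL1 :: "('y \<Rightarrow> real) set \<Rightarrow> ((('y \<Rightarrow> real) \<Rightarrow> real) \<Rightarrow> real) set" where
  "BL1 \<F> = {h. (\<forall>x. \<bar>h x\<bar> \<le> 1) \<and>
                (\<forall>x z. ennreal \<bar>h x - h z\<bar> \<le> (SUP f\<in>\<F>. ennreal \<bar>x f - z f\<bar>))}"

definition tight_gaussian_process :: "'w measure \<Rightarrow> ('w \<Rightarrow> ('y \<Rightarrow> real) \<Rightarrow> real)
     \<Rightarrow> ('y \<Rightarrow> real) set \<Rightarrow> (('y \<Rightarrow> real) \<Rightarrow> ('y \<Rightarrow> real) \<Rightarrow> real) \<Rightarrow> bool" where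
  "tight_gaussian_process Q G \<F> K \<longleftrightarrow>
     prob_space Q \<and>
     (\<forall>S a. finite S \<and> S \<subseteq> \<F> \<longrightarrow>
        (let X = (\<lambda>w. \<Sum>f\<in>S. a f * G w f); v = (\<Sum>f\<in>S. \<Sum>g\<in>S. a f * a g * K f g) in
          X \<in> borel_measurable Q \<and>
          (v > 0 \<longrightarrow> distributed Q lborel X (normal_density 0 (sqrt v))) \<and>
          (v \<le> 0 \<longrightarrow> (AE w in Q. X w = 0)))) \<and>
     (let \<rho> = (\<lambda>f g. sqrt (K f f + K g g - 2 * K f g)) in
        (\<forall>e>0. \<exists>T. finite T \<and> T \<subseteq> \<F> \<and> (\<forall>f\<in>\<F>. \<exists>t\<in>T. \<rho> f t < e)) \<and>
        (\<forall>w\<in>space Q. (\<exists>B. \<forall>f\<in>\<F>. \<bar>G w f\<bar> \<le> B) \<and>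
           (\<forall>e>0. \<exists>d>0. \<forall>f\<in>\<F>. \<forall>g\<in>\<F>. \<rho> f g < d \<longrightarrow> \<bar>G w f - G w g\<bar> < e))) \<and>
     (\<forall>h\<in>BL1 \<F>. (\<lambda>w. h (G w)) \<in> borel_measurable Q)"

definition boot_weights :: "('k::finite \<Rightarrow> nat) \<Rightarrow> ('k \<Rightarrow> nat \<Rightarrow> nat) pmf" where
  "boot_weights C = Pi_pmf UNIV (\<lambda>_. 0)
     (\<lambda>i. map_pmf (\<lambda>d j. card {m\<in>{..<C i}. d m = j})
            (Pi_pmf {..<C i} 0 (\<lambda>_. pmf_of_set {..<C i})))"

definition Cmin :: "('k::finite \<Rightarrow> nat) \<Rightarrow> nat" where
  "Cmin C = Min (range C)"

definition boot_process :: "('k::finite \<Rightarrow> nat) \<Rightarrow> ('a \<Rightarrow> ('k \<Rightarrow> nat) \<Rightarrow> nat) \<Rightarrow> ('a \<Rightarrow> ('k \<Rightarrow> nat) \<Rightarrow> nat \<Rightarrow> 'y)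
     \<Rightarrow> 'a \<Rightarrow> ('k \<Rightarrow> nat \<Rightarrow> nat) \<Rightarrow> ('y \<Rightarrow> real) \<Rightarrow> real" where
  "boot_process C N Y \<omega> W f =
     sqrt (real (Cmin C)) / real (\<Prod>i\<in>UNIV. C i) *
     (\<Sum>j\<in>{j. \<forall>i. j i < C i}. (real (\<Prod>i\<in>UNIV. W i (j i)) - 1) * cellsum N Y f j \<omega>)"

definition outer_prob :: "'a measure \<Rightarrow> 'a set \<Rightarrow> real" where
  "outer_prob M A = Inf {measure M B | B. B \<in> sets M \<and> A \<subseteq> B}"

end

theory Submission
  imports Defs
begin

text \<open>Write the bootstrap process as \<open>\<surd>C\<^sub>m\<^sub>i\<^sub>n\<close> times the difference between the average of the
  array over the drawn box and its average over the original box. For finitely many functions, a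
  Hajek projection reduces the conditional characteristic function to a product over the \<open>k\<close>
  coordinates, each factor being a power of an empirical characteristic function of the slice means;
  the slice variances converge by a law of large numbers for dissociated exchangeable arrays, and
  trigonometric approximation passes to bounded Lipschitz functions. Asymptotic equicontinuity
  follows from symmetrization: averaging over cyclic shifts of the box writes the bootstrap
  average as an average of means over diagonals of length \<open>C\<^sub>m\<^sub>i\<^sub>n\<close>, whose increments are conditionally
  subgaussian, and chaining with the uniform entropy bounds them; the random semimetric is
  controlled by its mean through the same argument applied to squares.\<close>

section \<open>Finite averages\<close>

text \<open>Two obstacles shape the proof. Cells that share a coordinate are dependent, in the data
  and in the draws alike, so the box is not a sample of independent cells. Along a diagonal any two
  cells differ in every coordinate, which permits symmetrization, and its length
  \<open>Cmin C\<close> matches the normalization \<open>sqrt (Cmin C)\<close>. Secondly, suprema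
  over \<open>\<F>\<close> or \<open>BL1 \<F>\<close> need not be measurable. Estimates are
  therefore made for maxima over finite index sets and end in one format: an integrable
  \<open>U\<close> with small integral dominates the conditional error for every outcome and every
  \<open>h\<close> at once, after which Markov's inequality bounds the outer probability.
  Conditional expectations given the data appear as finite averages, because the bootstrap is
  uniform over a finite set of draws. The link between cells and entropy is \<open>cQ\<close>, the
  number of units times the sum of squares: it dominates the squared cell sum, and its average over
  cells is, up to scale, a squared \<open>L2\<close> norm for a discrete measure, to which uniform
  covering numbers apply.\<close>

definition avg :: "'a set \<Rightarrow> ('a \<Rightarrow> 'b::real_normed_field) \<Rightarrow> 'b" where
  "avg A f = (\<Sum>x\<in>A. f x) / of_nat (card A)"

lemma avg_cong: "A = B \<Longrightarrow> (\<And>x. x \<in> B \<Longrightarrow> f x = g x) \<Longrightarrow> avg A f = avg B g"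
  by (simp add: avg_def)

lemma avg_add: "avg A (\<lambda>x. f x + g x) = avg A f + avg A g"
  by (simp add: avg_def sum.distrib add_divide_distrib)

lemma avg_diff: "avg A (\<lambda>x. f x - g x) = avg A f - avg A g"
  by (simp add: avg_def sum_subtractf diff_divide_distrib)

lemma avg_cmult: "avg A (\<lambda>x. c * f x) = c * avg A f"
  by (simp add: avg_def sum_distrib_left)

lemma avg_multc: "avg A (\<lambda>x. f x * c) = avg A f * c"
  by (simp add: avg_def sum_distrib_right)

lemma avg_divide: "avg A (\<lambda>x. f x / c) = avg A f / c"
  by (simp add: avg_def sum_divide_distrib [symmetric])

lemma avg_sum: "avg A (\<lambda>x. \<Sum>i\<in>I. f i x) = (\<Sum>i\<in>I. avg A (f i))"
  unfolding avg_def sum_divide_distrib [symmetric] by (subst sum.swap) simp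

lemma avg_const [simp]: "finite A \<Longrightarrow> A \<noteq> {} \<Longrightarrow> avg A (\<lambda>_. c) = c"
  by (simp add: avg_def)

lemma avg_zero [simp]: "avg A (\<lambda>_. 0) = 0"
  by (simp add: avg_def)

lemma avg_mono:
  fixes f g :: "'a \<Rightarrow> real"
  shows "(\<And>x. x \<in> A \<Longrightarrow> f x \<le> g x) \<Longrightarrow> avg A f \<le> avg A g"
  by (simp add: avg_def divide_right_mono sum_mono)

lemma avg_nonneg:
  fixes f :: "'a \<Rightarrow> real"
  shows "(\<And>x. x \<in> A \<Longrightarrow> 0 \<le> f x) \<Longrightarrow> 0 \<le> avg A f"
  by (simp add: avg_def sum_nonneg)

lemma avg_le_const:
  fixes f :: "'a \<Rightarrow> real"
  assumes "finite A" "A \<noteq> {}" "\<And>x. x \<in> A \<Longrightarrow> f x \<le> c"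
  shows "avg A f \<le> c"
  using avg_mono[of A f "\<lambda>_. c"] assms by simp

lemma norm_avg_le: "norm (avg A f) \<le> avg A (\<lambda>x. norm (f x))"
  by (simp add: avg_def norm_divide divide_right_mono norm_sum)

lemma abs_avg_le: "\<bar>avg A f\<bar> \<le> avg A (\<lambda>x. \<bar>f x :: real\<bar>)"
  using norm_avg_le[of A f] by simp

lemma avg_swap: "avg A (\<lambda>x. avg B (f x)) = avg B (\<lambda>y. avg A (\<lambda>x. f x y))"
  unfolding avg_def sum_divide_distrib [symmetric] by (subst sum.swap) (simp add: mult.commute)

lemma avg_Times: "avg (A \<times> B) (\<lambda>(x, y). f x y) = avg A (\<lambda>x. avg B (f x))"
  unfolding avg_def sum_divide_distrib [symmetric] sum.cartesian_product
  by (simp add: card_cartesian_product mult.commute)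

lemma avg_reindex: 
  assumes "bij_betw h A B"
  shows "avg A (\<lambda>x. f (h x)) = avg B f"
  using sum.reindex_bij_betw[OF assms, of f] bij_betw_same_card[OF assms] by (simp add: avg_def)

lemma avg_PiE_prod:
  assumes "finite I" "\<And>i. i \<in> I \<Longrightarrow> finite (B i)"
  shows "avg (PiE I B) (\<lambda>g. \<Prod>i\<in>I. f i (g i)) = (\<Prod>i\<in>I. avg (B i) (f i))"
  using prod_sum_PiE[where f = f, OF assms] by (simp add: avg_def prod_dividef card_PiE[OF assms(1)])

lemma avg_square_le:
  fixes f :: "'a \<Rightarrow> real"
  shows "(avg A f)\<^sup>2 \<le> avg A (\<lambda>x. (f x)\<^sup>2)"
proof (cases "finite A \<and> A \<noteq> {}")
  case True
  define c where "c = avg A f"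
  have "0 \<le> avg A (\<lambda>x. (f x - c)\<^sup>2)" by (rule avg_nonneg) simp
  also have "avg A (\<lambda>x. (f x - c)\<^sup>2) = avg A (\<lambda>x. (f x)\<^sup>2 - 2 * c * f x + c\<^sup>2)"
    by (simp add: power2_eq_square algebra_simps)
  also have "\<dots> = avg A (\<lambda>x. (f x)\<^sup>2) - 2 * c * c + c\<^sup>2"
    using True by (simp add: avg_add avg_diff avg_cmult c_def)
  finally show ?thesis by (simp add: c_def power2_eq_square)
next
  \<comment> \<open>A sum over an infinite set and a division by 0 are both 0, so \<open>avg\<close>
    vanishes on an infinite or empty set and both sides are 0.\<close>
  case False
  then show ?thesis by (auto simp: avg_def)
qed

lemma avg_sqrt_le:
  assumes "\<And>x. x \<in> A \<Longrightarrow> 0 \<le> f x"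
  shows "avg A (\<lambda>x. sqrt (f x)) \<le> sqrt (avg A f)"
proof -
  have "(avg A (\<lambda>x. sqrt (f x)))\<^sup>2 \<le> avg A (\<lambda>x. (sqrt (f x))\<^sup>2)" by (rule avg_square_le)
  also have "\<dots> = avg A f" by (rule avg_cong) (auto simp: assms)
  finally show ?thesis by (rule real_le_rsqrt)
qed

lemma avg_abs_le_sqrt: "avg A (\<lambda>x. \<bar>f x :: real\<bar>) \<le> sqrt (avg A (\<lambda>x. (f x)\<^sup>2))"
  using avg_sqrt_le[of A "\<lambda>x. (f x)\<^sup>2"] by simp

lemma sum_mult_le_sqrt:
  fixes f g :: "'a \<Rightarrow> real"
  shows "(\<Sum>x\<in>A. f x * g x) \<le> sqrt (\<Sum>x\<in>A. (f x)\<^sup>2) * sqrt (\<Sum>x\<in>A. (g x)\<^sup>2)"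
proof -
  have "(\<Sum>x\<in>A. f x * g x) \<le> (\<Sum>x\<in>A. \<bar>f x\<bar> * \<bar>g x\<bar>)"
    by (intro sum_mono) (simp add: abs_mult [symmetric])
  also have "\<dots> \<le> L2_set f A * L2_set g A" by (rule L2_set_mult_ineq)
  finally show ?thesis by (simp add: L2_set_def)
qed

lemma avg_mult_le_sqrt:
  fixes f g :: "'a \<Rightarrow> real"
  shows "avg A (\<lambda>x. f x * g x) \<le> sqrt (avg A (\<lambda>x. (f x)\<^sup>2)) * sqrt (avg A (\<lambda>x. (g x)\<^sup>2))"
  using divide_right_mono[OF sum_mult_le_sqrt[where A = A and f = f and g = g], of "real (card A)"]
  by (simp add: avg_def real_sqrt_divide)

text \<open>Jensen's inequality, by averaging the tangent line of exp at the mean.\<close>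

lemma avg_exp_ge: 
  fixes f :: "'a \<Rightarrow> real"
  assumes "finite A" "A \<noteq> {}"
  shows "exp (avg A f) \<le> avg A (\<lambda>x. exp (f x))"
proof -
  define c where "c = avg A f"
  have "exp c * (1 + (x - c)) \<le> exp x" for x :: real
    using mult_left_mono[OF exp_ge_add_one_self[of "x - c"], of "exp c"] by (simp add: exp_add [symmetric])
  then have "avg A (\<lambda>x. exp c * (1 + (f x - c))) \<le> avg A (\<lambda>x. exp (f x))"
    by (intro avg_mono)
  moreover have "avg A (\<lambda>x. exp c * (1 + (f x - c))) = exp c"
    using assms by (simp add: avg_cmult avg_add avg_diff c_def)
  ultimately show ?thesis by (simp add: c_def)
qed

section \<open>Maxima over finite index sets\<close>

definition mx :: "'i set \<Rightarrow> ('i \<Rightarrow> real) \<Rightarrow> real" where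
  "mx I f = Max (f ` I)"

lemma mx_ge: "finite I \<Longrightarrow> i \<in> I \<Longrightarrow> f i \<le> mx I f"
  by (simp add: mx_def)

lemma mx_le: "finite I \<Longrightarrow> I \<noteq> {} \<Longrightarrow> (\<And>i. i \<in> I \<Longrightarrow> f i \<le> c) \<Longrightarrow> mx I f \<le> c"
  by (simp add: mx_def)

lemma mx_mono: "finite I \<Longrightarrow> I \<noteq> {} \<Longrightarrow> (\<And>i. i \<in> I \<Longrightarrow> f i \<le> g i) \<Longrightarrow> mx I f \<le> mx I g"
  by (rule mx_le) (auto intro: order_trans[OF _ mx_ge[where f = g]])

lemma mx_cong: "(\<And>i. i \<in> I \<Longrightarrow> f i = g i) \<Longrightarrow> mx I f = mx I g"
  by (simp add: mx_def cong: image_cong)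

lemma mx_nonneg: "finite I \<Longrightarrow> I \<noteq> {} \<Longrightarrow> (\<And>i. i \<in> I \<Longrightarrow> 0 \<le> f i) \<Longrightarrow> 0 \<le> mx I f"
  using mx_ge[of I _ f] by (metis all_not_in_conv order_trans)

lemma mx_add: "finite I \<Longrightarrow> I \<noteq> {} \<Longrightarrow> mx I (\<lambda>i. f i + g i) \<le> mx I f + mx I g"
  by (rule mx_le) (simp_all add: add_mono mx_ge[of I _ f] mx_ge[of I _ g])

lemma mx_cmult: "finite I \<Longrightarrow> I \<noteq> {} \<Longrightarrow> 0 \<le> c \<Longrightarrow> mx I (\<lambda>i. c * f i) = c * mx I f"
proof (rule antisym)
  assume I: "finite I" "I \<noteq> {}" "0 \<le> c"
  show "mx I (\<lambda>i. c * f i) \<le> c * mx I f" using I mx_ge[of I _ f]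
    by (auto intro!: mx_le mult_left_mono)
  have "mx I f \<in> f ` I" unfolding mx_def using I by (intro Max_in) auto
  then obtain i where "i \<in> I" "mx I f = f i" by auto
  then show "c * mx I f \<le> mx I (\<lambda>i. c * f i)" using mx_ge[of I i "\<lambda>i. c * f i"] I by simp
qed

lemma mx_measurable [measurable]:
  "finite I \<Longrightarrow> (\<And>i. i \<in> I \<Longrightarrow> f i \<in> borel_measurable M) \<Longrightarrow> (\<lambda>x. mx I (\<lambda>i. f i x)) \<in> borel_measurable M"
  unfolding mx_def by (rule borel_measurable_Max)

lemma mx_abs_le_sum: "finite I \<Longrightarrow> I \<noteq> {} \<Longrightarrow> \<bar>mx I f\<bar> \<le> (\<Sum>i\<in>I. \<bar>f i\<bar>)"
proof -
  assume I: "finite I" "I \<noteq> {}"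
  have "mx I f \<in> f ` I" unfolding mx_def using I by (intro Max_in) auto
  then obtain i where "i \<in> I" "mx I f = f i" by auto
  then show ?thesis using I member_le_sum[of i I "\<lambda>i. \<bar>f i\<bar>"] by simp
qed

lemma mx_integrable:
  assumes "finite I" "I \<noteq> {}" "\<And>i. i \<in> I \<Longrightarrow> integrable M (f i)"
  shows "integrable M (\<lambda>x. mx I (\<lambda>i. f i x))"
proof (rule Bochner_Integration.integrable_bound)
  show "integrable M (\<lambda>x. \<Sum>i\<in>I. \<bar>f i x\<bar>)" using assms by auto
  show "(\<lambda>x. mx I (\<lambda>i. f i x)) \<in> borel_measurable M" using assms by (intro mx_measurable) auto
  show "AE x in M. norm (mx I (\<lambda>i. f i x)) \<le> norm (\<Sum>i\<in>I. \<bar>f i x\<bar>)"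
    using mx_abs_le_sum[OF assms(1,2)] by (auto simp: abs_of_nonneg sum_nonneg)
qed

lemma mx_avg_le: "finite I \<Longrightarrow> I \<noteq> {} \<Longrightarrow> mx I (\<lambda>i. avg A (f i)) \<le> avg A (\<lambda>x. mx I (\<lambda>i. f i x))"
  
proof -
  assume I: "finite I" "I \<noteq> {}"
  show ?thesis
  proof (rule mx_le[OF I])
    fix i assume "i \<in> I"
    then show "avg A (f i) \<le> avg A (\<lambda>x. mx I (\<lambda>i. f i x))"
      by (intro avg_mono) (rule mx_ge[OF I(1), of i "\<lambda>i. f i _"])
  qed
qed

section \<open>The maximal inequality for finite Rademacher sums\<close>

text \<open>On \<open>y >= 0\<close> the function \<open>exp (- y^2 / 2) * cosh y\<close> is
  nonincreasing: its derivative has the sign of \<open>sinh y - y * cosh y\<close>, and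
  \<open>y * cosh y - sinh y\<close> starts at 0 with derivative \<open>y * sinh y\<close>. Evenness
  covers negative arguments.\<close>

lemma cosh_le_exp: "cosh x \<le> exp (x\<^sup>2 / 2)" for x :: real
proof -
  have main: "cosh x \<le> exp (x\<^sup>2 / 2)" if "0 \<le> x" for x :: real
  proof -
    have h: "y * cosh y - sinh y \<ge> 0" if "0 \<le> y" for y :: real
    proof -
      have "(\<lambda>y. y * cosh y - sinh y) 0 \<le> (\<lambda>y. y * cosh y - sinh y) y"
        using that
      proof (rule DERIV_nonneg_imp_nondecreasing)
        fix z :: real assume "0 \<le> z" "z \<le> y"
        then show "\<exists>d. ((\<lambda>y. y * cosh y - sinh y) has_real_derivative d) (at z) \<and> 0 \<le> d"
          by (intro exI[of _ "z * sinh z"]) (auto intro!: derivative_eq_intros)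
      qed
      then show ?thesis by simp
    qed
    have "(\<lambda>y. exp (- y\<^sup>2 / 2) * cosh y) x \<le> (\<lambda>y. exp (- y\<^sup>2 / 2) * cosh y) 0"
      using that
    proof (rule DERIV_nonpos_imp_nonincreasing)
      fix z :: real assume z: "0 \<le> z" "z \<le> x"
      show "\<exists>d. ((\<lambda>y. exp (- y\<^sup>2 / 2) * cosh y) has_real_derivative d) (at z) \<and> d \<le> 0"
        using h[OF z(1)]
        by (intro exI[of _ "- (exp (- z\<^sup>2 / 2) * (z * cosh z - sinh z))"])
           (auto intro!: derivative_eq_intros simp: algebra_simps)
    qed
    then show ?thesis by (simp add: exp_minus field_simps)
  qed
  show ?thesis using main[of "\<bar>x\<bar>"] by (cases "x \<ge> 0") (auto simp: abs_if)
qed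

definition signs :: "nat \<Rightarrow> (nat \<Rightarrow> real) set" where
  "signs m = PiE {..<m} (\<lambda>_. {-1, 1})"

lemma signs_finite [simp]: "finite (signs m)" "signs m \<noteq> {}"
  by (auto simp: signs_def PiE_eq_empty_iff intro!: finite_PiE)

lemma signsD: "e \<in> signs m \<Longrightarrow> r < m \<Longrightarrow> e r = -1 \<or> e r = 1"
  by (auto simp: signs_def PiE_def Pi_def)

text \<open>The subgaussian bound for a Rademacher sum: the signs form a product set, so the
  exponential moment factorizes into values of cosh.\<close>

lemma avg_signs_exp:
  "avg (signs m) (\<lambda>e. exp (\<Sum>r<m. e r * v r)) \<le> exp ((\<Sum>r<m. (v r)\<^sup>2) / 2)"
proof -
  have "avg (signs m) (\<lambda>e. exp (\<Sum>r<m. e r * v r)) = avg (signs m) (\<lambda>e. \<Prod>r<m. exp (e r * v r))"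
    by (simp add: exp_sum)
  also have "\<dots> = (\<Prod>r<m. avg {-1, 1} (\<lambda>s. exp (s * v r)))"
    unfolding signs_def by (rule avg_PiE_prod) auto
  also have "\<dots> = (\<Prod>r<m. cosh (v r))"
    by (intro prod.cong) (auto simp: avg_def cosh_def)
  also have "\<dots> \<le> (\<Prod>r<m. exp ((v r)\<^sup>2 / 2))"
    by (intro prod_mono conjI cosh_le_exp cosh_real_nonneg)
  also have "\<dots> = exp ((\<Sum>r<m. (v r)\<^sup>2) / 2)"
    by (simp add: exp_sum sum_divide_distrib)
  finally show ?thesis .
qed

text \<open>Massart's finite class lemma. The exponential of \<open>t\<close> times the maximum is
  at most the sum over \<open>A\<close> of the exponentials for both signs; Jensen and an optimal
  \<open>t\<close> finish. The 2 inside the logarithm pays for the absolute value.\<close>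

lemma rademacher_max:
  assumes A: "finite A" "A \<noteq> {}" and s: "\<And>a. a \<in> A \<Longrightarrow> (\<Sum>r<m. (v a r)\<^sup>2) \<le> s\<^sup>2" "0 \<le> s"
  shows "avg (signs m) (\<lambda>e. mx A (\<lambda>a. \<bar>\<Sum>r<m. e r * v a r\<bar>)) \<le> s * sqrt (2 * ln (2 * real (card A)))"
\<comment> \<open>The choice of \<open>t\<close> divides by \<open>s\<close>; when
  \<open>s = 0\<close> all coefficients vanish.\<close>
proof (cases "s = 0")
  case True
  have "v a r = 0" if "a \<in> A" "r < m" for a r
    using s(1)[OF that(1)] True that(2) sum_nonneg_eq_0_iff[of "{..<m}" "\<lambda>r. (v a r)\<^sup>2"]
    by (auto simp: antisym_conv sum_nonneg)
  then have "mx A (\<lambda>a. \<bar>\<Sum>r<m. e r * v a r\<bar>) = 0" for e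
    using A by (simp add: mx_def cong: image_cong)
  then show ?thesis using True by simp
next
  case False
  with s have s0: "s > 0" by simp
  define p where "p = real (card A)"
  have p: "p \<ge> 1" using A by (auto simp: p_def Suc_le_eq card_gt_0_iff)
  define L where "L = ln (2 * p)"
  have L: "L > 0" using p by (simp add: L_def)
  \<comment> \<open>The minimizer of \<open>L / t + t * s^2 / 2\<close>, where the minimum is
    \<open>s * sqrt (2 * L)\<close>.\<close>
  define t where "t = sqrt (2 * L) / s"
  have t: "t > 0" using L s0 by (simp add: t_def)
  define X where "X e a = (\<Sum>r<m. e r * v a r)" for e a
  define G where "G e = mx A (\<lambda>a. \<bar>X e a\<bar>)" for e
  have bound: "avg (signs m) (\<lambda>e. exp (u * X e a)) \<le> exp (t\<^sup>2 * s\<^sup>2 / 2)" if "a \<in> A" "u = t \<or> u = -t" for a u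
  proof -
    have "avg (signs m) (\<lambda>e. exp (u * X e a)) = avg (signs m) (\<lambda>e. exp (\<Sum>r<m. e r * (u * v a r)))"
      by (simp add: X_def sum_distrib_left mult_ac)
    also have "\<dots> \<le> exp ((\<Sum>r<m. (u * v a r)\<^sup>2) / 2)" by (rule avg_signs_exp)
    also have "(\<Sum>r<m. (u * v a r)\<^sup>2) = t\<^sup>2 * (\<Sum>r<m. (v a r)\<^sup>2)"
      using that(2) by (auto simp: power_mult_distrib sum_distrib_left)
    also have "\<dots> \<le> t\<^sup>2 * s\<^sup>2" using s(1)[OF that(1)] by (intro mult_left_mono) auto
    finally show ?thesis by simp
  qed
  have "exp (t * avg (signs m) G) = exp (avg (signs m) (\<lambda>e. t * G e))" by (simp add: avg_cmult)
  also have "\<dots> \<le> avg (signs m) (\<lambda>e. exp (t * G e))" by (rule avg_exp_ge) auto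
  also have "\<dots> \<le> avg (signs m) (\<lambda>e. \<Sum>a\<in>A. exp (t * X e a) + exp (-t * X e a))"
  proof (rule avg_mono)
    fix e
    have "G e \<in> (\<lambda>a. \<bar>X e a\<bar>) ` A" unfolding G_def mx_def using A by (intro Max_in) auto
    then obtain a where a: "a \<in> A" "G e = \<bar>X e a\<bar>" by auto
    have "exp (t * G e) \<le> exp (t * X e a) + exp (-t * X e a)"
      unfolding a(2) by (cases "X e a \<ge> 0") (auto simp: abs_if)
    also have "\<dots> \<le> (\<Sum>a\<in>A. exp (t * X e a) + exp (-t * X e a))"
      by (rule member_le_sum) (use a A in \<open>auto simp: add_nonneg_nonneg\<close>)
    finally show "exp (t * G e) \<le> (\<Sum>a\<in>A. exp (t * X e a) + exp (-t * X e a))" .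
  qed
  also have "\<dots> = (\<Sum>a\<in>A. avg (signs m) (\<lambda>e. exp (t * X e a)) + avg (signs m) (\<lambda>e. exp (-t * X e a)))"
    by (simp add: avg_sum avg_add)
  also have "\<dots> \<le> (\<Sum>a\<in>A. exp (t\<^sup>2 * s\<^sup>2 / 2) + exp (t\<^sup>2 * s\<^sup>2 / 2))"
    by (intro sum_mono add_mono bound) auto
  also have "\<dots> = 2 * p * exp (t\<^sup>2 * s\<^sup>2 / 2)" by (simp add: p_def)
  also have "\<dots> = exp (L + t\<^sup>2 * s\<^sup>2 / 2)" using p by (simp add: L_def exp_add)
  finally have "t * avg (signs m) G \<le> L + t\<^sup>2 * s\<^sup>2 / 2" by simp
  also have "t\<^sup>2 * s\<^sup>2 = 2 * L" using s0 L by (simp add: t_def power_divide)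
  finally have "t * avg (signs m) G \<le> 2 * L" by simp
  then have "avg (signs m) G \<le> 2 * L / t" using t by (simp add: field_simps)
  also have "\<dots> = s * sqrt (2 * L)"
  proof -
    define q where "q = sqrt (2 * L)"
    have q: "q > 0" "2 * L = q * q" using L by (auto simp: q_def)
    show ?thesis unfolding t_def q_def[symmetric] unfolding q(2) using q(1) s0 by simp
  qed
  finally show ?thesis unfolding G_def[abs_def] X_def L_def p_def .
qed

section \<open>Uniform entropy and random sums over cells\<close>

definition cS :: "('y \<Rightarrow> real) \<Rightarrow> nat \<times> (nat \<Rightarrow> 'y) \<Rightarrow> real" where
  "cS f z = (\<Sum>l<fst z. f (snd z l))"

text \<open>The Cauchy-Schwarz bound for the squared cell sum. Unlike that square it is additive
  over the units of the cell, each carrying the weight \<open>fst z\<close>, so averages of it over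
  cells are weighted sums of squares.\<close>

definition cQ :: "('y \<Rightarrow> real) \<Rightarrow> nat \<times> (nat \<Rightarrow> 'y) \<Rightarrow> real" where
  "cQ f z = real (fst z) * (\<Sum>l<fst z. (f (snd z l))\<^sup>2)"

definition dif :: "('y \<Rightarrow> real) \<times> ('y \<Rightarrow> real) \<Rightarrow> 'y \<Rightarrow> real" where
  "dif p = (\<lambda>y. fst p y - snd p y)"

lemma cQ_nonneg [simp]: "0 \<le> cQ f z"
  by (simp add: cQ_def sum_nonneg)

lemma cS_dif: "cS (dif p) z = cS (fst p) z - cS (snd p) z"
  by (simp add: cS_def dif_def sum_subtractf)

lemma cS_square_le: "(cS f z)\<^sup>2 \<le> cQ f z"
proof -
  have "(cS f z)\<^sup>2 \<le> (\<Sum>l<fst z. (f (snd z l))\<^sup>2) * (\<Sum>l<fst z. 1\<^sup>2)"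
    using Cauchy_Schwarz_ineq_sum[of "\<lambda>l. f (snd z l)" "\<lambda>_. 1" "{..<fst z}"] by (simp add: cS_def)
  then show ?thesis by (simp add: cQ_def mult.commute)
qed

lemma cQ_mono:
  assumes "\<And>l. \<bar>f (snd z l)\<bar> \<le> \<bar>g (snd z l)\<bar>"
  shows "cQ f z \<le> cQ g z"
  unfolding cQ_def using assms by (intro mult_left_mono sum_mono) (auto simp: abs_le_square_iff)

lemma cQ_cmult: "cQ (\<lambda>y. c * f y) z = c\<^sup>2 * cQ f z"
  by (simp add: cQ_def power_mult_distrib sum_distrib_left mult_ac)

lemma cQ_cross:
  "real (fst z) * (\<Sum>l<fst z. \<bar>f (snd z l)\<bar> * \<bar>g (snd z l)\<bar>) \<le> sqrt (cQ f z) * sqrt (cQ g z)"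
proof -
  have "(\<Sum>l<fst z. \<bar>f (snd z l)\<bar> * \<bar>g (snd z l)\<bar>)
      \<le> sqrt (\<Sum>l<fst z. (f (snd z l))\<^sup>2) * sqrt (\<Sum>l<fst z. (g (snd z l))\<^sup>2)"
    using sum_mult_le_sqrt[where f = "\<lambda>l. \<bar>f (snd z l)\<bar>" and g = "\<lambda>l. \<bar>g (snd z l)\<bar>" and A = "{..<fst z}"]
    by simp
  then have "real (fst z) * (\<Sum>l<fst z. \<bar>f (snd z l)\<bar> * \<bar>g (snd z l)\<bar>)
      \<le> real (fst z) * (sqrt (\<Sum>l<fst z. (f (snd z l))\<^sup>2) * sqrt (\<Sum>l<fst z. (g (snd z l))\<^sup>2))"
    by (rule mult_left_mono) simp
  also have "\<dots> = (sqrt (fst z) * sqrt (fst z)) * (sqrt (\<Sum>l<fst z. (f (snd z l))\<^sup>2) * sqrt (\<Sum>l<fst z. (g (snd z l))\<^sup>2))"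
    by simp
  also have "\<dots> = sqrt (cQ f z) * sqrt (cQ g z)"
    unfolding cQ_def real_sqrt_mult by (simp only: mult_ac)
  finally show ?thesis .
qed

lemma avg_cQ_cross:
  "avg A (\<lambda>r. real (fst (x r)) * (\<Sum>l<fst (x r). \<bar>f (snd (x r) l)\<bar> * \<bar>g (snd (x r) l)\<bar>))
   \<le> sqrt (avg A (\<lambda>r. cQ f (x r))) * sqrt (avg A (\<lambda>r. cQ g (x r)))"
proof -
  have "avg A (\<lambda>r. real (fst (x r)) * (\<Sum>l<fst (x r). \<bar>f (snd (x r) l)\<bar> * \<bar>g (snd (x r) l)\<bar>))
    \<le> avg A (\<lambda>r. sqrt (cQ f (x r)) * sqrt (cQ g (x r)))"
    by (intro avg_mono cQ_cross)
  also have "\<dots> \<le> sqrt (avg A (\<lambda>r. (sqrt (cQ f (x r)))\<^sup>2)) * sqrt (avg A (\<lambda>r. (sqrt (cQ g (x r)))\<^sup>2))"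
    by (rule avg_mult_le_sqrt)
  finally show ?thesis by simp
qed

definition semi :: "nat \<Rightarrow> (nat \<Rightarrow> nat \<times> (nat \<Rightarrow> 'y)) \<Rightarrow> ('y \<Rightarrow> real) \<Rightarrow> real" where
  "semi m x f = sqrt (avg {..<m} (\<lambda>r. cQ f (x r)))"

lemma semi_nonneg [simp]: "0 \<le> semi m x f"
  by (simp add: semi_def avg_nonneg)

text \<open>With rescaled coordinates, one per unit of every cell, \<open>semi\<close> is a
  Euclidean norm; the triangle inequality is inherited from \<open>L2_set\<close>.\<close>

lemma semi_L2: "semi m x f = L2_set (\<lambda>(r, l). sqrt (real (fst (x r)) / real m) * f (snd (x r) l)) 
    (Sigma {..<m} (\<lambda>r. {..<fst (x r)}))"
proof -
  have "avg {..<m} (\<lambda>r. cQ f (x r)) =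
    (\<Sum>(r, l)\<in>Sigma {..<m} (\<lambda>r. {..<fst (x r)}). (sqrt (real (fst (x r)) / real m) * f (snd (x r) l))\<^sup>2)"
    by (subst sum.Sigma [symmetric])
       (auto simp: avg_def cQ_def power_mult_distrib sum_distrib_left sum_divide_distrib)
  then show ?thesis by (simp add: semi_def L2_set_def case_prod_unfold)
qed

lemma semi_add: "semi m x (\<lambda>y. f y + g y) \<le> semi m x f + semi m x g"
  unfolding semi_L2
  by (rule order_trans[OF _ L2_set_triangle_ineq]) (simp add: case_prod_unfold algebra_simps)

lemma semi_swap: "semi m x (dif (f, g)) = semi m x (dif (g, f))"
  by (simp add: semi_def cQ_def dif_def power2_commute)

lemma semi_triangle: "semi m x (dif (f, h)) \<le> semi m x (dif (f, g)) + semi m x (dif (g, h))"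
  using semi_add[of m x "dif (f, g)" "dif (g, h)"] by (simp add: dif_def)

lemma semi_square: "(semi m x f)\<^sup>2 = avg {..<m} (\<lambda>r. cQ f (x r))"
  by (simp add: semi_def avg_nonneg)

text \<open>The form in which the entropy condition is consumed: one number \<open>Nn e\<close> that
  is a valid net size for every finite weighted point set, hence for every sample that data or draws
  can produce. Both sides of \<open>net\<close> are homogeneous in \<open>w\<close>, so the weights
  need not sum to 1. The index type is a pair of cell number and unit number. Summability over
  dyadic scales stands in for the entropy integral.\<close>

locale entropy_class =
  fixes Ysp :: "'y set" and \<F> :: "('y \<Rightarrow> real) set" and Fenv :: "'y \<Rightarrow> real" and Nn :: "real \<Rightarrow> nat"
  assumes nonempty: "\<F> \<noteq> {}"
    and env: "\<And>f y. f \<in> \<F> \<Longrightarrow> y \<in> Ysp \<Longrightarrow> \<bar>f y\<bar> \<le> Fenv y"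
    and Nn_pos: "\<And>e. 1 \<le> Nn e"
    and net: "\<And>e (A :: (nat \<times> nat) set) w p. 0 < e \<Longrightarrow> finite A \<Longrightarrow> (\<And>a. a \<in> A \<Longrightarrow> 0 \<le> w a \<and> p a \<in> Ysp) \<Longrightarrow>
        \<exists>G. finite G \<and> G \<noteq> {} \<and> G \<subseteq> \<F> \<and> card G \<le> Nn e \<and>
          (\<forall>f\<in>\<F>. \<exists>g\<in>G. (\<Sum>a\<in>A. w a * (f (p a) - g (p a))\<^sup>2) \<le> e\<^sup>2 * (\<Sum>a\<in>A. w a * (Fenv (p a))\<^sup>2))"
    and entropy_summable: "summable (\<lambda>s. (1/2)^s * sqrt (ln (real (Nn ((1/2)^s)))))"
begin

definition good :: "nat \<times> (nat \<Rightarrow> 'y) \<Rightarrow> bool" where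
  "good z \<longleftrightarrow> (\<forall>l. snd z l \<in> Ysp)"

lemma net_cells:
  assumes e: "0 < e" and good: "\<And>r. r < m \<Longrightarrow> good (x r)"
  shows "\<exists>G. finite G \<and> G \<noteq> {} \<and> G \<subseteq> \<F> \<and> card G \<le> Nn e \<and>
          (\<forall>f\<in>\<F>. \<exists>g\<in>G. semi m x (dif (f, g)) \<le> e * semi m x Fenv)"
proof -
  define A where "A = Sigma {..<m} (\<lambda>r. {..<fst (x r)})"
  have A: "finite A" by (auto simp: A_def)
  have S: "(\<Sum>a\<in>A. real (fst (x (fst a))) * (f (snd (x (fst a)) (snd a)))\<^sup>2) = real m * (semi m x f)\<^sup>2" for f
  proof -
    have "(\<Sum>a\<in>A. real (fst (x (fst a))) * (f (snd (x (fst a)) (snd a)))\<^sup>2) = (\<Sum>r<m. cQ f (x r))"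
      unfolding A_def cQ_def sum_distrib_left by (subst sum.Sigma) (auto simp: case_prod_unfold)
    then show ?thesis by (simp add: semi_square avg_def)
  qed
  define w where "w a = real (fst (x (fst a)))" for a :: "nat \<times> nat"
  define pt where "pt a = snd (x (fst a)) (snd a)" for a :: "nat \<times> nat"
  define near where "near f g \<longleftrightarrow> (\<Sum>a\<in>A. w a * (f (pt a) - g (pt a))\<^sup>2) \<le> e\<^sup>2 * (\<Sum>a\<in>A. w a * (Fenv (pt a))\<^sup>2)" for f g
  have near: "near f g \<longleftrightarrow> real m * (semi m x (dif (f, g)))\<^sup>2 \<le> e\<^sup>2 * (real m * (semi m x Fenv)\<^sup>2)" for f g
    using S[of "dif (f, g)"] S[of Fenv] by (simp add: near_def w_def pt_def dif_def)
  have pt: "0 \<le> w a \<and> pt a \<in> Ysp" if "a \<in> A" for a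
    using good[of "fst a"] that by (auto simp: w_def pt_def good_def A_def)
  have "\<exists>G. finite G \<and> G \<noteq> {} \<and> G \<subseteq> \<F> \<and> card G \<le> Nn e \<and> (\<forall>f\<in>\<F>. \<exists>g\<in>G. near f g)"
    unfolding near_def by (rule net[where w = w and p = pt, OF e A pt])
  then obtain G where G: "finite G" "G \<noteq> {}" "G \<subseteq> \<F>" "card G \<le> Nn e" and c: "\<forall>f\<in>\<F>. \<exists>g\<in>G. near f g"
    by (elim exE conjE) (rule that)
  have "\<exists>g\<in>G. semi m x (dif (f, g)) \<le> e * semi m x Fenv" if f: "f \<in> \<F>" for f
  proof -
    obtain g where g: "g \<in> G" "near f g" using c f by blast
    have "semi m x (dif (f, g)) \<le> e * semi m x Fenv"
    proof (cases "m = 0")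
      case True then show ?thesis by (simp add: semi_def avg_def)
    next
      case False
      then have "(semi m x (dif (f, g)))\<^sup>2 \<le> (e * semi m x Fenv)\<^sup>2"
        using g(2) by (simp add: near power_mult_distrib mult.left_commute)
      then show ?thesis using e by (auto intro: power2_le_imp_le)
    qed
    then show ?thesis using g by auto
  qed
  then show ?thesis using G by blast
qed

lemma cQ_dif_le: 
  assumes "f \<in> \<F>" "t \<in> \<F>" "good z"
  shows "cQ (dif (f, t)) z \<le> 4 * cQ Fenv z"
proof -
  have "\<bar>f y - t y\<bar> \<le> \<bar>2 * Fenv y\<bar>" if "y \<in> Ysp" for y
    using env[OF assms(1) that] env[OF assms(2) that] by auto
  then have "cQ (dif (f, t)) z \<le> cQ (\<lambda>y. 2 * Fenv y) z"
    using assms(3) by (intro cQ_mono) (simp add: good_def dif_def)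
  then show ?thesis by (simp add: cQ_cmult)
qed

text \<open>Factor \<open>(f - t)^2 - (a - b)^2\<close> into a difference that is small when
  \<open>a\<close>, \<open>b\<close> approximate \<open>f\<close>, \<open>t\<close>, and a sum of
  four terms bounded by the envelope. Thus nets for the class also serve for its squared
  differences.\<close>

lemma cQ_dif_diff:
  assumes F: "f \<in> \<F>" "t \<in> \<F>" "a \<in> \<F>" "b \<in> \<F>" and good: "good z"
  shows "\<bar>cQ (dif (f, t)) z - cQ (dif (a, b)) z\<bar> \<le>
     4 * (real (fst z) * (\<Sum>l<fst z. \<bar>Fenv (snd z l)\<bar> * \<bar>dif (f, a) (snd z l)\<bar>)
        + real (fst z) * (\<Sum>l<fst z. \<bar>Fenv (snd z l)\<bar> * \<bar>dif (t, b) (snd z l)\<bar>))"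
proof -
  have pt: "\<bar>(f y - t y)\<^sup>2 - (a y - b y)\<^sup>2\<bar> \<le> 4 * (\<bar>Fenv y\<bar> * \<bar>f y - a y\<bar> + \<bar>Fenv y\<bar> * \<bar>t y - b y\<bar>)" if y: "y \<in> Ysp" for y
  proof -
    have "(f y - t y)\<^sup>2 - (a y - b y)\<^sup>2 = ((f y - a y) - (t y - b y)) * (f y - t y + a y - b y)"
      by (simp add: power2_eq_square algebra_simps)
    also have "\<bar>\<dots>\<bar> \<le> (\<bar>f y - a y\<bar> + \<bar>t y - b y\<bar>) * (4 * \<bar>Fenv y\<bar>)"
      unfolding abs_mult
      using env[OF F(1) y] env[OF F(2) y] env[OF F(3) y] env[OF F(4) y] by (intro mult_mono) auto
    finally show ?thesis by (simp add: algebra_simps)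
  qed
  have "\<bar>cQ (dif (f, t)) z - cQ (dif (a, b)) z\<bar> = real (fst z) * \<bar>\<Sum>l<fst z. (dif (f, t) (snd z l))\<^sup>2 - (dif (a, b) (snd z l))\<^sup>2\<bar>"
    by (simp add: cQ_def sum_subtractf right_diff_distrib [symmetric] abs_mult)
  also have "\<dots> \<le> real (fst z) * (\<Sum>l<fst z. 4 * (\<bar>Fenv (snd z l)\<bar> * \<bar>dif (f, a) (snd z l)\<bar> + \<bar>Fenv (snd z l)\<bar> * \<bar>dif (t, b) (snd z l)\<bar>))"
    using good pt unfolding dif_def good_def fst_conv snd_conv
    by (intro mult_left_mono order_trans[OF sum_abs] sum_mono) auto
  also have "\<dots> = 4 * (real (fst z) * (\<Sum>l<fst z. \<bar>Fenv (snd z l)\<bar> * \<bar>dif (f, a) (snd z l)\<bar>)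
        + real (fst z) * (\<Sum>l<fst z. \<bar>Fenv (snd z l)\<bar> * \<bar>dif (t, b) (snd z l)\<bar>))"
    by (simp add: sum_distrib_left [symmetric] sum.distrib algebra_simps)
  finally show ?thesis .
qed

definition Htail :: "real \<Rightarrow> nat \<times> (nat \<Rightarrow> 'y) \<Rightarrow> real" where
  "Htail B z = (if cQ Fenv z > B then cQ Fenv z else 0)"

text \<open>What \<open>rademacher_max\<close> gives for at most \<open>(Nn \<eta>)^2\<close> pairs
  whose squares, truncated to at most \<open>4 * B\<close>, are averaged over \<open>m\<close>
  cells.\<close>

definition sq_rate :: "real \<Rightarrow> real \<Rightarrow> nat \<Rightarrow> real" where
  "sq_rate \<eta> B m = 4 * B * sqrt (2 * ln (2 * (real (Nn \<eta>))\<^sup>2) / real m)"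

text \<open>A symmetrized Glivenko-Cantelli bound. Only convergence to 0 is wanted here, without the
  factor \<open>sqrt m\<close>, so a single net at scale \<eta> replaces chaining. The three terms
  are the envelope tail above \<open>B\<close>, the error of passing to the net, and the maximum
  over the finite net.\<close>

lemma rademacher_squares:
  assumes good: "\<And>r. r < m \<Longrightarrow> good (x r)" and pos: "0 < \<eta>" "0 < B" "0 < m"
    and I: "finite I" "I \<noteq> {}" "I \<subseteq> \<F> \<times> \<F>"
  shows "avg (signs m) (\<lambda>e. mx I (\<lambda>p. \<bar>avg {..<m} (\<lambda>r. e r * cQ (dif p) (x r))\<bar>))
    \<le> 4 * avg {..<m} (\<lambda>r. Htail B (x r)) + 8 * \<eta> * avg {..<m} (\<lambda>r. cQ Fenv (x r)) + sq_rate \<eta> B m"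
proof -
  define h where "h = semi m x Fenv"
  obtain G where G: "finite G" "G \<noteq> {}" "G \<subseteq> \<F>" "card G \<le> Nn \<eta>"
    and G': "\<forall>f\<in>\<F>. \<exists>g\<in>G. semi m x (dif (f, g)) \<le> \<eta> * h"
    using net_cells[OF pos(1), of m x] good unfolding h_def by blast
  obtain c where c: "\<And>f. f \<in> \<F> \<Longrightarrow> c f \<in> G \<and> semi m x (dif (f, c f)) \<le> \<eta> * h"
    using G' by metis
  \<comment> \<open>Cells with a large envelope are discarded for all pairs simultaneously; on the
    others the squares are bounded by \<open>4 * B\<close>.\<close>
  define v where "v p r = (if cQ Fenv (x r) > B then 0 else cQ (dif p) (x r)) / real m" for p r
  have v: "(\<Sum>r<m. (v p r)\<^sup>2) \<le> (4 * B / sqrt m)\<^sup>2" if "p \<in> G \<times> G" for p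
  proof -
    have "\<bar>v p r\<bar> \<le> 4 * B / real m" if "r < m" for r
      using cQ_dif_le[of "fst p" "snd p" "x r"] good[OF that] G(3) \<open>p \<in> G \<times> G\<close> pos
      by (auto simp: v_def divide_right_mono subset_iff)
    then have "(\<Sum>r<m. (v p r)\<^sup>2) \<le> (\<Sum>r<m. (4 * B / real m)\<^sup>2)"
      using pos by (intro sum_mono) (auto simp: abs_le_square_iff [symmetric] abs_mult)
    also have "\<dots> = (4 * B / sqrt m)\<^sup>2" using pos by (simp add: power_divide power2_eq_square)
    finally show ?thesis .
  qed
  define K where "K = 8 * \<eta> * h\<^sup>2 + 4 * avg {..<m} (\<lambda>r. Htail B (x r))"
  have pt: "\<bar>avg {..<m} (\<lambda>r. e r * cQ (dif p) (x r))\<bar> \<le> K + mx (G \<times> G) (\<lambda>p. \<bar>\<Sum>r<m. e r * v p r\<bar>)"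
    if e: "e \<in> signs m" and p: "p \<in> I" for e p
  proof -
    obtain f t where ft: "p = (f, t)" "f \<in> \<F>" "t \<in> \<F>" using p I by auto
    define q where "q = (c f, c t)"
    have q: "q \<in> G \<times> G" using c ft by (auto simp: q_def)
    have cF: "c f \<in> \<F>" "c t \<in> \<F>" using c ft G(3) by auto
    have er: "\<bar>e r\<bar> = 1" if "r < m" for r using signsD[OF e that] by auto
    \<comment> \<open>Replace the pair by its net pair, then split the net pair's squares at the
      truncation level. Signs are used only in the last summand.\<close>
    have "avg {..<m} (\<lambda>r. e r * cQ (dif p) (x r)) = avg {..<m} (\<lambda>r. e r * (cQ (dif p) (x r) - cQ (dif q) (x r)))
        + avg {..<m} (\<lambda>r. e r * (if cQ Fenv (x r) > B then cQ (dif q) (x r) else 0)) + (\<Sum>r<m. e r * v q r)"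
    proof -
      have "(\<Sum>r<m. e r * v q r) = avg {..<m} (\<lambda>r. e r * (if cQ Fenv (x r) > B then 0 else cQ (dif q) (x r)))"
        by (simp add: avg_def v_def sum_divide_distrib)
      moreover have "avg {..<m} (\<lambda>r. e r * cQ (dif p) (x r)) = avg {..<m} (\<lambda>r. e r * (cQ (dif p) (x r) - cQ (dif q) (x r))
        + e r * (if cQ Fenv (x r) > B then cQ (dif q) (x r) else 0)
        + e r * (if cQ Fenv (x r) > B then 0 else cQ (dif q) (x r)))"
        by (intro avg_cong) (auto simp: algebra_simps)
      ultimately show ?thesis by (simp only: avg_add)
    qed
    moreover have "\<bar>avg {..<m} (\<lambda>r. e r * (cQ (dif p) (x r) - cQ (dif q) (x r)))\<bar> \<le> 8 * \<eta> * h\<^sup>2"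
    proof -
      have "\<bar>avg {..<m} (\<lambda>r. e r * (cQ (dif p) (x r) - cQ (dif q) (x r)))\<bar>
          \<le> avg {..<m} (\<lambda>r. 4 * (real (fst (x r)) * (\<Sum>l<fst (x r). \<bar>Fenv (snd (x r) l)\<bar> * \<bar>dif (f, c f) (snd (x r) l)\<bar>)
        + real (fst (x r)) * (\<Sum>l<fst (x r). \<bar>Fenv (snd (x r) l)\<bar> * \<bar>dif (t, c t) (snd (x r) l)\<bar>)))"
        using cQ_dif_diff[OF ft(2,3) cF good]
        by (intro order_trans[OF abs_avg_le] avg_mono) (auto simp: abs_mult er ft(1) q_def)
      also have "\<dots> \<le> 4 * (h * semi m x (dif (f, c f)) + h * semi m x (dif (t, c t)))"
        unfolding avg_cmult avg_add h_def semi_def by (intro mult_left_mono add_mono avg_cQ_cross) auto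
      also have "\<dots> \<le> 4 * (h * (\<eta> * h) + h * (\<eta> * h))"
        using c[OF ft(2)] c[OF ft(3)] by (intro mult_left_mono add_mono) (auto simp: h_def)
      finally show ?thesis by (simp add: power2_eq_square algebra_simps)
    qed
    moreover have "\<bar>avg {..<m} (\<lambda>r. e r * (if cQ Fenv (x r) > B then cQ (dif q) (x r) else 0))\<bar>
        \<le> 4 * avg {..<m} (\<lambda>r. Htail B (x r))"
      unfolding avg_cmult [symmetric] using cQ_dif_le[OF cF good]
      by (intro order_trans[OF abs_avg_le] avg_mono) (auto simp: abs_mult er Htail_def q_def)
    moreover have "\<bar>\<Sum>r<m. e r * v q r\<bar> \<le> mx (G \<times> G) (\<lambda>p. \<bar>\<Sum>r<m. e r * v p r\<bar>)"
      by (rule mx_ge[where f = "\<lambda>p. \<bar>\<Sum>r<m. e r * v p r\<bar>"]) (use q G in auto)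
    ultimately show ?thesis unfolding K_def by linarith
  qed
  have "avg (signs m) (\<lambda>e. mx I (\<lambda>p. \<bar>avg {..<m} (\<lambda>r. e r * cQ (dif p) (x r))\<bar>))
     \<le> avg (signs m) (\<lambda>e. K + mx (G \<times> G) (\<lambda>p. \<bar>\<Sum>r<m. e r * v p r\<bar>))"
    by (intro avg_mono mx_le pt I)
  also have "\<dots> = K + avg (signs m) (\<lambda>e. mx (G \<times> G) (\<lambda>p. \<bar>\<Sum>r<m. e r * v p r\<bar>))"
    by (simp add: avg_add)
  also have "\<dots> \<le> K + 4 * B / sqrt m * sqrt (2 * ln (2 * real (card (G \<times> G))))"
    using G pos by (intro add_left_mono rademacher_max v) auto
  also have "\<dots> \<le> K + 4 * B / sqrt m * sqrt (2 * ln (2 * (real (Nn \<eta>))\<^sup>2))"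
  proof -
    have c1: "card G \<ge> 1" using G by (simp add: Suc_le_eq card_gt_0_iff)
    have "real (card (G \<times> G)) \<le> (real (Nn \<eta>))\<^sup>2"
      using G by (simp add: card_cartesian_product power2_eq_square mult_mono)
    moreover have "real (card (G \<times> G)) \<ge> 1" using mult_mono[OF c1 c1] unfolding card_cartesian_product by (metis mult_1 of_nat_1 of_nat_mono zero_le)
    ultimately have "ln (2 * real (card (G \<times> G))) \<le> ln (2 * (real (Nn \<eta>))\<^sup>2)"
      by (intro ln_mono) linarith+
    then show ?thesis using pos by (intro add_left_mono mult_left_mono real_sqrt_le_mono) auto
  qed
  also have "4 * B / sqrt m * sqrt (2 * ln (2 * (real (Nn \<eta>))\<^sup>2)) = sq_rate \<eta> B m"
    by (simp add: sq_rate_def real_sqrt_divide)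
  finally show ?thesis unfolding K_def h_def semi_square by (simp add: algebra_simps)
qed


section \<open>Chaining for Rademacher sums\<close>

definition ell :: "nat \<Rightarrow> real" where
  "ell s = sqrt (2 * ln (2 * real (Nn ((1/2)^s)) * real (Nn ((1/2)^Suc s))))"

definition ell' :: "nat \<Rightarrow> real" where
  "ell' s = sqrt (2 * ln (2 * (real (Nn ((1/2)^s)))\<^sup>2))"

text \<open>The factor 4 is two ends of each pair times links of length at most
  \<open>2 * (1/2)^u\<close>; the last term is the extra distance \<open>2 * (1/2)^s\<close> that
  the base pairs acquire when both ends move into the net.\<close>

definition chain_rate :: "nat \<Rightarrow> real" where
  "chain_rate s = 4 * (\<Sum>u. (1/2)^(u + s) * ell (u + s)) + 2 * (1/2)^s * ell' s"

lemma ell_nonneg [simp]: "0 \<le> ell s" "0 \<le> ell' s"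
proof -
  have a: "1 \<le> real (Nn a)" for a using Nn_pos[of a] by linarith
  have "1 \<le> real (Nn a) * real (Nn b)" for a b using mult_mono[OF a[of a] a[of b]] by simp
  then have "1 \<le> 2 * (real (Nn a) * real (Nn b))" for a b using order_trans[of 1 "real (Nn a) * real (Nn b)"] by simp
  then show "0 \<le> ell s" "0 \<le> ell' s" by (auto simp: ell_def ell'_def power2_eq_square mult.assoc simp del: power_Suc)
qed

lemma sqrt_ln_prod_le:
  assumes "1 \<le> a" "1 \<le> b"
  shows "sqrt (2 * ln (2 * a * b)) \<le> sqrt (2 * ln 2) + sqrt 2 * sqrt (ln a) + sqrt 2 * sqrt (ln b)"
proof -
  have "2 * ln (2 * a * b) = 2 * ln 2 + 2 * ln a + 2 * ln b"
    using assms by (simp add: ln_mult)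
  moreover have "sqrt (2 * ln 2 + 2 * ln a + 2 * ln b) \<le> sqrt (2 * ln 2 + 2 * ln a) + sqrt (2 * ln b)"
    using assms by (intro sqrt_add_le_add_sqrt) (auto simp: add_nonneg_nonneg)
  moreover have "sqrt (2 * ln 2 + 2 * ln a) \<le> sqrt (2 * ln 2) + sqrt (2 * ln a)"
    using assms by (intro sqrt_add_le_add_sqrt) (auto simp: add_nonneg_nonneg)
  ultimately show ?thesis by (simp add: real_sqrt_mult)
qed

lemma ell_summable: "summable (\<lambda>s. (1/2)^s * ell s)"
proof (rule summable_comparison_test')
  let ?t = "\<lambda>s. (1/2)^s * sqrt (ln (real (Nn ((1/2)^s))))"
  \<comment> \<open>The extra factor 2 in front of the shifted term compensates for
    \<open>(1/2)^n = 2 * (1/2)^Suc n\<close>.\<close>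
  show "summable (\<lambda>s. sqrt (2 * ln 2) * (1/2)^s + sqrt 2 * ?t s + 2 * sqrt 2 * ?t (Suc s))"
    using entropy_summable summable_Suc_iff[of ?t] by (intro summable_add summable_mult) auto
  fix n :: nat
  have "(1/2)^n * ell n \<le> (1/2)^n * (sqrt (2 * ln 2) + sqrt 2 * sqrt (ln (real (Nn ((1/2)^n)))) + sqrt 2 * sqrt (ln (real (Nn ((1/2)^Suc n)))))"
    unfolding ell_def using Nn_pos by (intro mult_left_mono sqrt_ln_prod_le) (auto simp del: power_Suc)
  then show "norm ((1/2)^n * ell n) \<le> sqrt (2 * ln 2) * (1/2)^n + sqrt 2 * ?t n + 2 * sqrt 2 * ?t (Suc n)"
    by (simp add: algebra_simps)
qed

lemma chain_rate_tendsto: "chain_rate \<longlonglongrightarrow> 0"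
proof -
  let ?t = "\<lambda>s. (1/2)^s * sqrt (ln (real (Nn ((1/2)^s))))"
  have "(\<lambda>s. (1/2)^s * ell' s) \<longlonglongrightarrow> 0"
  proof (rule tendsto_sandwich)
    show "\<forall>\<^sub>F s in sequentially. 0 \<le> (1/2)^s * ell' s" by simp
    show "\<forall>\<^sub>F s in sequentially. (1/2)^s * ell' s \<le> sqrt (2 * ln 2) * (1/2)^s + sqrt 2 * ?t s + sqrt 2 * ?t s"
    proof (intro always_eventually allI)
      fix s :: nat
      have "(1/2)^s * ell' s \<le> (1/2)^s * (sqrt (2 * ln 2) + sqrt 2 * sqrt (ln (real (Nn ((1/2)^s)))) + sqrt 2 * sqrt (ln (real (Nn ((1/2)^s)))))"
        unfolding ell'_def power2_eq_square mult.assoc [symmetric]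
        using Nn_pos by (intro mult_left_mono sqrt_ln_prod_le) (auto simp del: power_Suc)
      then show "(1/2)^s * ell' s \<le> sqrt (2 * ln 2) * (1/2)^s + sqrt 2 * ?t s + sqrt 2 * ?t s"
        by (simp add: algebra_simps)
    qed
    have "(\<lambda>s. (1/2)^s) \<longlonglongrightarrow> (0::real)" by (rule LIMSEQ_power_zero) simp
    then have "(\<lambda>s. sqrt (2 * ln 2) * (1/2)^s + sqrt 2 * ?t s + sqrt 2 * ?t s) \<longlonglongrightarrow> sqrt (2 * ln 2) * 0 + sqrt 2 * 0 + sqrt 2 * 0"
      using summable_LIMSEQ_zero[OF entropy_summable] by (intro tendsto_add tendsto_mult tendsto_const)
    then show "(\<lambda>s. sqrt (2 * ln 2) * (1/2)^s + sqrt 2 * ?t s + sqrt 2 * ?t s) \<longlonglongrightarrow> 0" by simp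
  qed simp
  moreover have "(\<lambda>s. \<Sum>u. (1/2)^(u + s) * ell (u + s)) \<longlonglongrightarrow> 0"
    using suminf_exist_split2[OF ell_summable] .
  ultimately have "(\<lambda>s. 4 * (\<Sum>u. (1/2)^(u + s) * ell (u + s)) + 2 * ((1/2)^s * ell' s)) \<longlonglongrightarrow> 4 * 0 + 2 * 0"
    by (intro tendsto_add tendsto_mult tendsto_const)
  then show ?thesis by (simp add: chain_rate_def [abs_def] mult.assoc)
qed

text \<open>Dudley's chaining for differences: both ends of a pair are chained down to the net at
  scale \<open>2\<^sup>-\<^sup>s\<close>, where at most \<open>(Nn (2\<^sup>-\<^sup>s))\<^sup>2\<close> pairs remain.\<close>

lemma rademacher_chaining:
  assumes good: "\<And>r. r < m \<Longrightarrow> good (x r)" and m: "0 < m"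
    and I: "finite I" "I \<noteq> {}" "I \<subseteq> \<F> \<times> \<F>"
  shows "avg (signs m) (\<lambda>e. mx I (\<lambda>p. \<bar>\<Sum>r<m. e r * cS (dif p) (x r)\<bar> / sqrt m))
    \<le> chain_rate s * semi m x Fenv + ell' s * mx I (\<lambda>p. semi m x (dif p))"
proof -
  define h where "h = semi m x Fenv"
  have h: "0 \<le> h" by (simp add: h_def)
  have "\<forall>u. \<exists>G. finite G \<and> G \<noteq> {} \<and> G \<subseteq> \<F> \<and> card G \<le> Nn ((1/2)^u) \<and>
          (\<forall>f\<in>\<F>. \<exists>g\<in>G. semi m x (dif (f, g)) \<le> (1/2)^u * h)"
    using net_cells[of "(1/2)^_" m x] good unfolding h_def by simp
  then obtain G where G: "\<And>u. finite (G u)" "\<And>u. G u \<noteq> {}" "\<And>u. G u \<subseteq> \<F>" "\<And>u. card (G u) \<le> Nn ((1/2)^u)"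
    and G': "\<And>u. \<forall>f\<in>\<F>. \<exists>g\<in>G u. semi m x (dif (f, g)) \<le> (1/2)^u * h" by metis
  from G' have "\<forall>u. \<exists>c. \<forall>f\<in>\<F>. c f \<in> G u \<and> semi m x (dif (f, c f)) \<le> (1/2)^u * h" by metis
  then obtain c where c: "\<And>u f. f \<in> \<F> \<Longrightarrow> c u f \<in> G u" "\<And>u f. f \<in> \<F> \<Longrightarrow> semi m x (dif (f, c u f)) \<le> (1/2)^u * h"
    by metis
  have cF: "c u f \<in> \<F>" if "f \<in> \<F>" for u f using c(1)[OF that] G(3) by blast
  define X where "X e f = (\<Sum>r<m. e r * cS f (x r)) / sqrt m" for e f
  have Xdif: "(\<Sum>r<m. e r * cS (dif p) (x r)) / sqrt m = X e (fst p) - X e (snd p)" for e p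
    by (simp add: X_def cS_dif algebra_simps sum_subtractf diff_divide_distrib)
  \<comment> \<open>Only pairs within distance \<open>d\<close> are kept, so that
    \<open>rademacher_max\<close> applies with \<open>s = d\<close>.\<close>
  define close where "close P d = {p \<in> P. semi m x (dif p) \<le> d}" for P d
  have max_bound: "avg (signs m) (\<lambda>e. mx (close (G u \<times> G v) d) (\<lambda>p. \<bar>X e (fst p) - X e (snd p)\<bar>))
       \<le> d * sqrt (2 * ln (2 * (real (Nn ((1/2)^u)) * real (Nn ((1/2)^v)))))"
    if ne: "close (G u \<times> G v) d \<noteq> {}" for u v d
  proof -
    let ?P = "close (G u \<times> G v) d"
    have fin: "finite ?P" using G by (auto simp: close_def)
    obtain p0 where "p0 \<in> ?P" using ne by auto
    then have d: "0 \<le> d" by (auto simp: close_def intro: order_trans[OF semi_nonneg])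
    have sq: "(\<Sum>r<m. (cS (dif p) (x r) / sqrt m)\<^sup>2) \<le> d\<^sup>2" if "p \<in> ?P" for p
    proof -
      have "(\<Sum>r<m. (cS (dif p) (x r) / sqrt m)\<^sup>2) = avg {..<m} (\<lambda>r. (cS (dif p) (x r))\<^sup>2)"
        by (simp add: avg_def power_divide sum_divide_distrib)
      also have "\<dots> \<le> (semi m x (dif p))\<^sup>2" unfolding semi_square by (intro avg_mono cS_square_le)
      also have "\<dots> \<le> d\<^sup>2" using that by (intro power_mono) (auto simp: close_def)
      finally show ?thesis .
    qed
    have "avg (signs m) (\<lambda>e. mx ?P (\<lambda>p. \<bar>X e (fst p) - X e (snd p)\<bar>))
        = avg (signs m) (\<lambda>e. mx ?P (\<lambda>p. \<bar>\<Sum>r<m. e r * (cS (dif p) (x r) / sqrt m)\<bar>))"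
      by (simp add: Xdif [symmetric] sum_divide_distrib)
    also have "\<dots> \<le> d * sqrt (2 * ln (2 * real (card ?P)))"
      by (rule rademacher_max[OF fin ne sq d])
    also have "\<dots> \<le> d * sqrt (2 * ln (2 * (real (Nn ((1/2)^u)) * real (Nn ((1/2)^v)))))"
    proof -
      have "card ?P \<le> card (G u \<times> G v)" using G by (intro card_mono) (auto simp: close_def)
      also have "\<dots> \<le> Nn ((1/2)^u) * Nn ((1/2)^v)"
        unfolding card_cartesian_product using G by (intro mult_mono) auto
      finally have "real (card ?P) \<le> real (Nn ((1/2)^u)) * real (Nn ((1/2)^v))"
        by (metis of_nat_le_iff of_nat_mult)
      moreover have "1 \<le> real (card ?P)" using fin ne by (simp add: Suc_le_eq card_gt_0_iff)
      ultimately show ?thesis using d by (intro mult_left_mono real_sqrt_le_mono) auto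
    qed
    finally show ?thesis .
  qed
  define D where "D = mx I (\<lambda>p. semi m x (dif p))"
  define M where "M u e = mx (close (G u \<times> G (Suc u)) (2 * (1/2)^u * h)) (\<lambda>p. \<bar>X e (fst p) - X e (snd p)\<bar>)" for u e
  define M' where "M' e = mx (close (G s \<times> G s) (2 * (1/2)^s * h + D)) (\<lambda>p. \<bar>X e (fst p) - X e (snd p)\<bar>)" for e
  have link: "(c u f, c (Suc u) f) \<in> close (G u \<times> G (Suc u)) (2 * (1/2)^u * h)" if "f \<in> \<F>" for u f
  proof -
    have "semi m x (dif (c u f, c (Suc u) f)) \<le> (1/2)^u * h + (1/2)^Suc u * h"
      using semi_triangle[of m x "c u f" "c (Suc u) f" f] c(2)[OF that, of u] c(2)[OF that, of "Suc u"]
      by (simp add: semi_swap[of m x f "c u f"] del: power_Suc)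
    also have "\<dots> \<le> 2 * (1/2)^u * h" using h by (simp add: mult_nonneg_nonneg)
    finally show ?thesis using c(1)[OF that] by (auto simp: close_def)
  qed
  have link': "(c s f, c s t) \<in> close (G s \<times> G s) (2 * (1/2)^s * h + D)" if "(f, t) \<in> I" for f t
  proof -
    have F: "f \<in> \<F>" "t \<in> \<F>" using that I by auto
    have "semi m x (dif (c s f, c s t)) \<le> (1/2)^s * h + (semi m x (dif (f, t)) + (1/2)^s * h)"
      using semi_triangle[of m x "c s f" "c s t" f] semi_triangle[of m x f "c s t" t]
        c(2)[OF F(1), of s] c(2)[OF F(2), of s] semi_swap[of m x f "c s f"] by linarith
    moreover have "semi m x (dif (f, t)) \<le> D" unfolding D_def
      by (rule mx_ge[where f = "\<lambda>p. semi m x (dif p)"]) (use I that in auto)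
    ultimately have "semi m x (dif (c s f, c s t)) \<le> 2 * (1/2)^s * h + D" by linarith
    then show ?thesis using c(1)[OF F(1)] c(1)[OF F(2)] by (simp add: close_def)
  qed
  \<comment> \<open>The end of the chain is bounded without any cancellation of signs, at the price
    of the factor \<open>sqrt m\<close>.\<close>
  have rest: "\<bar>X e f - X e (c u f)\<bar> \<le> sqrt m * ((1/2)^u * h)" if e: "e \<in> signs m" and f: "f \<in> \<F>" for e f u
  proof -
    have "\<bar>X e f - X e (c u f)\<bar> = sqrt m * \<bar>avg {..<m} (\<lambda>r. e r * cS (dif (f, c u f)) (x r))\<bar>"
    proof -
      define q where "q = sqrt m"
      have q: "q > 0" "real m = q * q" using m by (auto simp: q_def)
      have "X e f - X e (c u f) = (\<Sum>r<m. e r * cS (dif (f, c u f)) (x r)) / q"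
        using Xdif[of e "(f, c u f)"] by (simp add: q_def)
      then show ?thesis unfolding avg_def q_def [symmetric] using q(1)
        by (simp add: abs_mult q(2))
    qed
    also have "\<dots> \<le> sqrt m * avg {..<m} (\<lambda>r. \<bar>cS (dif (f, c u f)) (x r)\<bar>)"
      using signsD[OF e] by (intro mult_left_mono order_trans[OF abs_avg_le] avg_mono) (fastforce simp: abs_mult)+
    also have "\<dots> \<le> sqrt m * sqrt (avg {..<m} (\<lambda>r. (cS (dif (f, c u f)) (x r))\<^sup>2))"
      by (intro mult_left_mono avg_abs_le_sqrt) auto
    also have "\<dots> \<le> sqrt m * semi m x (dif (f, c u f))"
      unfolding semi_def by (intro mult_left_mono real_sqrt_le_mono avg_mono cS_square_le) auto
    also have "\<dots> \<le> sqrt m * ((1/2)^u * h)" using c(2)[OF f] by (intro mult_left_mono) auto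
    finally show ?thesis .
  qed
  have chain: "\<bar>X e f - X e (c s f)\<bar> \<le> (\<Sum>u<n. M (u + s) e) + sqrt m * ((1/2)^(n + s) * h)"
    if e: "e \<in> signs m" and f: "f \<in> \<F>" for e f n
  proof -
    have "\<bar>X e (c s f) - X e (c (n + s) f)\<bar> \<le> (\<Sum>u<n. M (u + s) e)"
    proof (induction n)
      case (Suc n)
      have "\<bar>X e (c (n + s) f) - X e (c (Suc n + s) f)\<bar> \<le> M (n + s) e"
        unfolding M_def using mx_ge[OF _ link[OF f, of "n + s"], of "\<lambda>p. \<bar>X e (fst p) - X e (snd p)\<bar>"] G
        by (simp add: close_def)
      then show ?case using Suc by simp
    qed simp
    then show ?thesis using rest[OF e f, of "n + s"] by linarith
  qed
  have bound: "avg (signs m) (\<lambda>e. mx I (\<lambda>p. \<bar>X e (fst p) - X e (snd p)\<bar>))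
     \<le> chain_rate s * h + ell' s * D + 2 * (sqrt m * ((1/2)^(n + s) * h))" for n
  proof -
    have "mx I (\<lambda>p. \<bar>X e (fst p) - X e (snd p)\<bar>) \<le> 2 * (\<Sum>u<n. M (u + s) e) + 2 * (sqrt m * ((1/2)^(n + s) * h)) + M' e"
      if e: "e \<in> signs m" for e
    proof (rule mx_le[OF I(1,2)])
      fix p assume p: "p \<in> I"
      then have F: "fst p \<in> \<F>" "snd p \<in> \<F>" using I by auto
      have "\<bar>X e (c s (fst p)) - X e (c s (snd p))\<bar> \<le> M' e"
        unfolding M'_def using mx_ge[OF _ link'[of "fst p" "snd p"], of "\<lambda>p. \<bar>X e (fst p) - X e (snd p)\<bar>"] G p
        by (simp add: close_def)
      then show "\<bar>X e (fst p) - X e (snd p)\<bar> \<le> 2 * (\<Sum>u<n. M (u + s) e) + 2 * (sqrt m * ((1/2)^(n + s) * h)) + M' e"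
        using chain[OF e F(1), of n] chain[OF e F(2), of n] by linarith
    qed
    then have "avg (signs m) (\<lambda>e. mx I (\<lambda>p. \<bar>X e (fst p) - X e (snd p)\<bar>))
      \<le> avg (signs m) (\<lambda>e. 2 * (\<Sum>u<n. M (u + s) e) + 2 * (sqrt m * ((1/2)^(n + s) * h)) + M' e)"
      by (intro avg_mono)
    also have "\<dots> = 2 * (\<Sum>u<n. avg (signs m) (M (u + s))) + 2 * (sqrt m * ((1/2)^(n + s) * h)) + avg (signs m) M'"
      by (simp add: avg_add avg_cmult avg_sum)
    also have "avg (signs m) M' \<le> (2 * (1/2)^s * h + D) * ell' s"
    proof -
      \<comment> \<open>Any member of \<open>I\<close> will do: it shows that the set of close base
        pairs is nonempty, as \<open>max_bound\<close> requires.\<close>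
      obtain f t where "(f, t) \<in> I" using I(2) by auto
      from link'[OF this] show ?thesis using max_bound[of s s "2 * (1/2)^s * h + D"]
        unfolding M'_def[abs_def] ell'_def power2_eq_square by blast
    qed
    also have "(\<Sum>u<n. avg (signs m) (M (u + s))) \<le> (\<Sum>u<n. 2 * (1/2)^(u + s) * h * ell (u + s))"
    proof (rule sum_mono)
      fix u
      obtain f where "f \<in> \<F>" using nonempty by auto
      from link[OF this] show "avg (signs m) (M (u + s)) \<le> 2 * (1/2)^(u + s) * h * ell (u + s)"
        using max_bound[of "u + s" "Suc (u + s)" "2 * (1/2)^(u + s) * h"]
        unfolding M_def[abs_def] ell_def mult.assoc by blast
    qed
    also have "\<dots> = 2 * h * (\<Sum>u<n. (1/2)^(u + s) * ell (u + s))" by (simp add: sum_distrib_left mult_ac)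
    also have "\<dots> \<le> 2 * h * (\<Sum>u. (1/2)^(u + s) * ell (u + s))"
      using h ell_summable by (intro mult_left_mono sum_le_suminf) (use summable_iff_shift[of "\<lambda>s. (1/2)^s * ell s" s] in auto)
    finally show ?thesis by (simp add: chain_rate_def algebra_simps)
  qed
  \<comment> \<open>For fixed \<open>m\<close> the crude remainder with its factor
    \<open>sqrt m\<close> disappears as the chain gets deeper.\<close>
  have "(\<lambda>n. (1/2)^(n + s)) \<longlonglongrightarrow> (0::real)"
    by (rule LIMSEQ_ignore_initial_segment) (rule LIMSEQ_power_zero, simp)
  then have "(\<lambda>n. chain_rate s * h + ell' s * D + 2 * (sqrt m * ((1/2)^(n + s) * h)))
      \<longlonglongrightarrow> chain_rate s * h + ell' s * D + 2 * (sqrt m * (0 * h))"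
    by (intro tendsto_add tendsto_mult tendsto_const)
  then have "avg (signs m) (\<lambda>e. mx I (\<lambda>p. \<bar>X e (fst p) - X e (snd p)\<bar>)) \<le> chain_rate s * h + ell' s * D"
    using bound by (intro LIMSEQ_le_const[where X = "\<lambda>n. chain_rate s * h + ell' s * D + 2 * (sqrt m * ((1/2)^(n + s) * h))"]) auto
  then show ?thesis by (simp add: Xdif [symmetric] D_def h_def)
qed

end

section \<open>Net sizes from the uniform entropy integral\<close>

lemma covering_number_antimono: "a \<le> b \<Longrightarrow> covering_number b \<F> d \<le> covering_number a \<F> d"
  unfolding covering_number_def by (rule INF_superset_mono) (auto, meson order_trans)

lemma sqrt_log_mono: "n \<le> n' \<Longrightarrow> sqrt_log n \<le> sqrt_log n'"
proof (cases "n' = \<top>")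
  case False
  assume le: "n \<le> n'"
  then have "n \<noteq> \<top>" using False by (auto simp: top_unique)
  moreover have "enn2real n \<le> enn2real n'" using le False by (intro enn2real_mono) (auto simp: less_top)
  ultimately show ?thesis using False by (auto simp: sqrt_log_def intro!: ennreal_leI ln_mono)
qed (simp add: sqrt_log_def)

text \<open>An infimum of cardinalities is attained unless there is no finite net at all, and in
  that case the infimum is \<open>\<top>\<close>.\<close>

lemma covering_number_attained:
  assumes "covering_number e \<F> d \<noteq> \<top>"
  shows "\<exists>G. finite G \<and> G \<subseteq> \<F> \<and> (\<forall>f\<in>\<F>. \<exists>g\<in>G. d f g \<le> e) \<and> covering_number e \<F> d = of_nat (card G)"
proof -
  define P where "P G \<longleftrightarrow> finite G \<and> G \<subseteq> \<F> \<and> (\<forall>f\<in>\<F>. \<exists>g\<in>G. d f g \<le> e)" for G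
  have cn: "covering_number e \<F> d = (INF G\<in>{G. P G}. of_nat (card G))"
    by (simp add: covering_number_def P_def)
  have "\<exists>G. P G"
  proof (rule ccontr)
    assume "\<nexists>G. P G"
    then have "{G. P G} = {}" by auto
    then show False using assms unfolding cn by simp
  qed
  then obtain G where G: "P G" "\<And>G'. P G' \<Longrightarrow> card G \<le> card G'"
    using ex_has_least_nat[of P _ card] by metis
  have "covering_number e \<F> d = of_nat (card G)"
    unfolding cn by (rule antisym) (auto intro!: INF_lower INF_greatest G)
  then show ?thesis using G(1) by (auto simp: P_def)
qed

definition entropy_fun :: "'y set \<Rightarrow> ('y \<Rightarrow> real) set \<Rightarrow> ('y \<Rightarrow> real) \<Rightarrow> real \<Rightarrow> ennreal" where
  "entropy_fun Ysp \<F> Fenv e = (SUP q\<in>fin_prob Ysp. sqrt_log (covering_number (e * L2norm q Fenv) \<F>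
                                   (\<lambda>f g. L2norm q (\<lambda>y. f y - g y))))"

lemma L2norm_nonneg: "q \<in> fin_prob Ysp \<Longrightarrow> 0 \<le> L2norm q f"
  by (auto simp: L2norm_def fin_prob_def intro!: sum_nonneg)

lemma entropy_fun_antimono: "a \<le> b \<Longrightarrow> entropy_fun Ysp \<F> Fenv b \<le> entropy_fun Ysp \<F> Fenv a"
  unfolding entropy_fun_def
  by (intro SUP_subset_mono sqrt_log_mono covering_number_antimono mult_right_mono)
     (auto intro: L2norm_nonneg[of _ Ysp])

text \<open>The points \<open>p a\<close> may coincide, so the normalized weights are added up over
  the fibres of \<open>p\<close> to obtain a probability mass function on
  \<open>Ysp\<close>.\<close>

lemma fin_prob_of_weights:
  fixes A :: "'i set" and p :: "'i \<Rightarrow> 'y"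
  assumes A: "finite A" and wp: "\<And>a. a \<in> A \<Longrightarrow> 0 \<le> w a \<and> p a \<in> Ysp" and W: "0 < (\<Sum>a\<in>A. w a)"
  defines "q \<equiv> \<lambda>y. (\<Sum>a\<in>{a\<in>A. p a = y}. w a) / (\<Sum>a\<in>A. w a)"
  shows "q \<in> fin_prob Ysp" and "L2norm q f = sqrt ((\<Sum>a\<in>A. w a * (f (p a))\<^sup>2) / (\<Sum>a\<in>A. w a))"
proof -
  have sub: "{y. q y \<noteq> 0} \<subseteq> p ` A" 
    by (auto simp: q_def image_iff) (metis (mono_tags, lifting) empty_Collect_eq sum.empty)
  have tot: "(\<Sum>y\<in>{y. q y \<noteq> 0}. q y * g y) = (\<Sum>a\<in>A. w a * g (p a)) / (\<Sum>a\<in>A. w a)" for g :: "'y \<Rightarrow> real"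
  proof -
    have "(\<Sum>y\<in>{y. q y \<noteq> 0}. q y * g y) = (\<Sum>y\<in>p ` A. q y * g y)"
      using A sub by (intro sum.mono_neutral_left) auto
    also have "\<dots> = (\<Sum>y\<in>p ` A. \<Sum>a\<in>{a\<in>A. p a = y}. w a * g (p a)) / (\<Sum>a\<in>A. w a)"
      by (simp add: q_def sum_distrib_right sum_divide_distrib)
    also have "(\<Sum>y\<in>p ` A. \<Sum>a\<in>{a\<in>A. p a = y}. w a * g (p a)) = (\<Sum>a\<in>A. w a * g (p a))"
      using sum.image_gen[OF A, of "\<lambda>a. w a * g (p a)" p] by simp
    finally show ?thesis .
  qed
  show "q \<in> fin_prob Ysp"
    unfolding fin_prob_def
  proof (intro CollectI conjI allI)
    show "finite {y. q y \<noteq> 0}" using A sub by (auto intro: finite_subset)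
    show "{y. q y \<noteq> 0} \<subseteq> Ysp" using sub wp by auto
    show "0 \<le> q y" for y using wp W by (auto simp: q_def intro!: divide_nonneg_pos sum_nonneg)
    show "(\<Sum>y\<in>{y. q y \<noteq> 0}. q y) = 1" using tot[of "\<lambda>_. 1"] W by simp
  qed
  show "L2norm q f = sqrt ((\<Sum>a\<in>A. w a * (f (p a))\<^sup>2) / (\<Sum>a\<in>A. w a))"
    unfolding L2norm_def tot ..
qed

text \<open>The entropy integrand is antitone in the scale. Hence a finite integral makes it finite
  at every scale and makes its dyadic sums converge; inverting the square root of the logarithm
  turns its values into net sizes.\<close>

lemma entropy_class_of_uniform_entropy:
  assumes fin: "uniform_entropy_integral Ysp \<F> Fenv < \<infinity>" and ne: "\<F> \<noteq> {}"
    and env: "\<And>f y. f \<in> \<F> \<Longrightarrow> y \<in> Ysp \<Longrightarrow> \<bar>f y\<bar> \<le> Fenv y"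
  shows "\<exists>Nn. entropy_class Ysp \<F> Fenv Nn"
proof -
  define J where "J = entropy_fun Ysp \<F> Fenv"
  define U where "U = uniform_entropy_integral Ysp \<F> Fenv"
  have U: "U = (\<integral>\<^sup>+ e. indicator {0<..} e * J e \<partial>lborel)"
    by (simp add: U_def J_def uniform_entropy_integral_def entropy_fun_def)
  have anti: "a \<le> b \<Longrightarrow> J b \<le> J a" for a b by (simp add: J_def entropy_fun_antimono)
  \<comment> \<open>On the interval from \<open>(1/2)^Suc s\<close> to \<open>(1/2)^s\<close>, of
    length \<open>(1/2)^Suc s\<close>, the antitone integrand is at least its value at the right
    end; these intervals are disjoint.\<close>
  have partial: "(\<Sum>s<n. J ((1/2)^s) * ennreal ((1/2)^Suc s)) \<le> U" for n
  proof -
    let ?A = "\<lambda>s::nat. {(1/2::real)^Suc s<..(1/2)^s}"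
    have "(\<Sum>s<n. J ((1/2)^s) * ennreal ((1/2)^Suc s)) = (\<Sum>s<n. J ((1/2)^s) * emeasure lborel (?A s))"
      by (intro sum.cong refl) (simp add: emeasure_lborel_Ioc)
    also have "\<dots> = (\<Sum>s<n. \<integral>\<^sup>+ e. J ((1/2)^s) * indicator (?A s) e \<partial>lborel)"
      by (intro sum.cong refl nn_integral_cmult_indicator [symmetric]) auto
    also have "\<dots> = (\<integral>\<^sup>+ e. (\<Sum>s<n. J ((1/2)^s) * indicator (?A s) e) \<partial>lborel)"
      by (rule nn_integral_sum [symmetric]) auto
    also have "\<dots> \<le> U"
      unfolding U
    proof (rule nn_integral_mono)
      fix e :: real
      show "(\<Sum>s<n. J ((1/2)^s) * indicator (?A s) e) \<le> indicator {0<..} e * J e"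
      proof (cases "\<exists>s<n. e \<in> ?A s")
        case True
        then obtain s where s: "s < n" "e \<in> ?A s" by auto
        have uniq: "u = s" if "e \<in> ?A u" for u
        proof (rule ccontr)
          assume "u \<noteq> s"
          then consider "Suc u \<le> s" | "Suc s \<le> u" by linarith
          then show False
          proof cases
            case 1
            then have "(1/2::real)^s \<le> (1/2)^Suc u" by (intro power_decreasing) auto
            then show ?thesis using s that by auto
          next
            case 2
            then have "(1/2::real)^u \<le> (1/2)^Suc s" by (intro power_decreasing) auto
            then show ?thesis using s that by auto
          qed
        qed
        have "(\<Sum>u<n. J ((1/2)^u) * indicator (?A u) e) = (\<Sum>u<n. if u = s then J ((1/2)^s) else 0)"
        proof (rule sum.cong)
          fix u
          show "J ((1/2)^u) * indicator (?A u) e = (if u = s then J ((1/2)^s) else 0)"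
          proof (cases "u = s")
            case True
            then show ?thesis using s by (simp del: power_Suc)
          next
            case False
            then have "e \<notin> ?A u" using uniq by blast
            then show ?thesis using False by (simp del: power_Suc)
          qed
        qed simp
        also have "\<dots> = J ((1/2)^s)" using s by simp
        also have "\<dots> \<le> J e" using s by (intro anti) auto
        also have "\<dots> = indicator {0<..} e * J e"
          using s less_trans[of 0 "(1/2)^Suc s" e] by (auto simp: indicator_def simp del: power_Suc)
        finally show ?thesis .
      next
        case False
        then have "(\<Sum>u<n. J ((1/2)^u) * indicator (?A u) e) = (\<Sum>u<n. 0)"
          by (intro sum.cong refl) (auto simp: indicator_def simp del: power_Suc)
        then show ?thesis by simp
      qed
    qed
    finally show ?thesis .
  qed
  \<comment> \<open>By monotonicity the integral over \<open>{0<..e}\<close> alone is at least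
    \<open>J e * e\<close>.\<close>
  have Jfin: "J e < \<top>" if e: "0 < e" for e
  proof -
    have "J e * ennreal e = (\<integral>\<^sup>+ u. J e * indicator {0<..e} u \<partial>lborel)"
      using e by (simp add: nn_integral_cmult_indicator)
    also have "\<dots> \<le> U" unfolding U
      by (intro nn_integral_mono) (auto simp: indicator_def intro: anti)
    also have "\<dots> < \<top>" using fin by (simp add: U_def)
    finally show ?thesis using e by (auto simp: ennreal_mult_less_top)
  qed
  define b where "b e = enn2real (J e)" for e
  have bJ: "J e = ennreal (b e)" if "0 < e" for e using Jfin[OF that] by (simp add: b_def)
  have b0: "0 \<le> b e" for e by (simp add: b_def)
  \<comment> \<open>The largest cardinality whose \<open>sqrt_log\<close> is at most
    \<open>b e\<close>; the floor loses nothing since cardinalities are integers.\<close>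
  define Nn where "Nn e = nat \<lfloor>exp ((b e)\<^sup>2)\<rfloor>" for e
  have Nn1: "1 \<le> Nn e" for e
  proof -
    have "1 \<le> exp ((b e)\<^sup>2)" by simp
    then have "1 \<le> \<lfloor>exp ((b e)\<^sup>2)\<rfloor>" by (simp add: le_floor_iff)
    then show ?thesis unfolding Nn_def by linarith
  qed
  have "summable (\<lambda>s. (1/2)^s * sqrt (ln (real (Nn ((1/2)^s)))))"
  proof (rule summable_comparison_test')
    show "summable (\<lambda>s. (1/2)^s * b ((1/2)^s))"
    proof (rule summableI_nonneg_bounded)
      fix n
      have "ennreal ((\<Sum>s<n. (1/2)^s * b ((1/2)^s)) / 2) = (\<Sum>s<n. J ((1/2)^s) * ennreal ((1/2)^Suc s))"
        by (subst sum_ennreal [symmetric] | simp add: sum_divide_distrib bJ b0 ennreal_mult [symmetric] mult.commute flip: sum_ennreal)+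
      also have "\<dots> \<le> U" by (rule partial)
      also have "U = ennreal (enn2real U)" using fin by (simp add: U_def)
      finally have "(\<Sum>s<n. (1/2)^s * b ((1/2)^s)) / 2 \<le> enn2real U"
        by (subst (asm) ennreal_le_iff) auto
      then show "(\<Sum>s<n. (1/2)^s * b ((1/2)^s)) \<le> 2 * enn2real U" by simp
    qed (simp add: b0)
    fix n :: nat
    have "real (Nn e) \<le> exp ((b e)\<^sup>2)" for e
      unfolding Nn_def by (simp add: of_nat_floor)
    then have "ln (real (Nn e)) \<le> (b e)\<^sup>2" for e
      using Nn1[of e] ln_mono[of "real (Nn e)" "exp ((b e)\<^sup>2)"] by simp
    then have "sqrt (ln (real (Nn e))) \<le> b e" for e
      using b0[of e] real_sqrt_le_mono[of "ln (real (Nn e))" "(b e)\<^sup>2"] by simp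
    moreover have "0 \<le> ln (real (Nn e))" for e using Nn1[of e] by simp
    ultimately show "norm ((1/2)^n * sqrt (ln (real (Nn ((1/2)^n))))) \<le> (1/2)^n * b ((1/2)^n)"
      by (simp add: abs_mult mult_left_mono)
  qed
  moreover have "\<exists>G. finite G \<and> G \<noteq> {} \<and> G \<subseteq> \<F> \<and> card G \<le> Nn e \<and>
          (\<forall>f\<in>\<F>. \<exists>g\<in>G. (\<Sum>a\<in>A. w a * (f (p a) - g (p a))\<^sup>2) \<le> e\<^sup>2 * (\<Sum>a\<in>A. w a * (Fenv (p a))\<^sup>2))"
    if e: "0 < e" and A: "finite A" and wp: "\<And>a. a \<in> A \<Longrightarrow> 0 \<le> w a \<and> p a \<in> Ysp"
    for e and A :: "(nat \<times> nat) set" and w :: "nat \<times> nat \<Rightarrow> real" and p :: "nat \<times> nat \<Rightarrow> 'a"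
  \<comment> \<open>Zero total weight cannot be normalized to a probability, but then both sums
    vanish and any singleton is a net.\<close>
  proof (cases "(\<Sum>a\<in>A. w a) = 0")
    case True
    then have "w a = 0" if "a \<in> A" for a using A wp that by (simp add: sum_nonneg_eq_0_iff)
    then have "(\<Sum>a\<in>A. w a * g a) = 0" for g by simp
    moreover obtain f where "f \<in> \<F>" using ne by auto
    ultimately show ?thesis using Nn1[of e] by (intro exI[of _ "{f}"]) auto
  next
    case False
    then have W: "0 < (\<Sum>a\<in>A. w a)" using wp by (metis order_le_less sum_nonneg)
    define q where "q = (\<lambda>y. (\<Sum>a\<in>{a\<in>A. p a = y}. w a) / (\<Sum>a\<in>A. w a))"
    have q: "q \<in> fin_prob Ysp" unfolding q_def by (rule fin_prob_of_weights(1)[OF A wp W])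
    have q2: "L2norm q k = sqrt ((\<Sum>a\<in>A. w a * (k (p a))\<^sup>2) / (\<Sum>a\<in>A. w a))" for k
      unfolding q_def by (rule fin_prob_of_weights(2)[OF A wp W])
    define C where "C = covering_number (e * L2norm q Fenv) \<F> (\<lambda>f g. L2norm q (\<lambda>y. f y - g y))"
    have "sqrt_log C \<le> J e" unfolding J_def entropy_fun_def C_def by (rule SUP_upper) (rule q)
    then have sC: "sqrt_log C \<le> ennreal (b e)" using bJ[OF e] by simp
    have "C \<noteq> \<top>"
    proof
      assume "C = \<top>"
      then have "\<top> \<le> ennreal (b e)" using sC by (simp add: sqrt_log_def)
      then show False by (simp add: top_unique)
    qed
    then obtain G where G: "finite G" "G \<subseteq> \<F>" "\<forall>f\<in>\<F>. \<exists>g\<in>G. L2norm q (\<lambda>y. f y - g y) \<le> e * L2norm q Fenv"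
      and C: "C = of_nat (card G)"
      using covering_number_attained[of "e * L2norm q Fenv" \<F> "\<lambda>f g. L2norm q (\<lambda>y. f y - g y)"] unfolding C_def by blast
    have Gne: "G \<noteq> {}" using ne G(3) by auto
    then have G1: "1 \<le> real (card G)" using G(1) by (simp add: Suc_le_eq card_gt_0_iff)
    have "sqrt (ln (real (card G))) \<le> b e"
      using sC G1 b0[of e] \<open>C \<noteq> \<top>\<close> by (simp add: C sqrt_log_def max_def split: if_splits)
    then have "ln (real (card G)) \<le> (b e)\<^sup>2"
      using sqrt_le_D by blast
    then have "real (card G) \<le> exp ((b e)\<^sup>2)"
      using G1 by (metis exp_le_cancel_iff exp_ln less_le_trans zero_less_one)
    then have "card G \<le> Nn e" unfolding Nn_def by (simp add: le_nat_floor)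
    moreover have "\<exists>g\<in>G. (\<Sum>a\<in>A. w a * (f (p a) - g (p a))\<^sup>2) \<le> e\<^sup>2 * (\<Sum>a\<in>A. w a * (Fenv (p a))\<^sup>2)" if f: "f \<in> \<F>" for f
    proof -
      obtain g where g: "g \<in> G" "L2norm q (\<lambda>y. f y - g y) \<le> e * L2norm q Fenv" using G(3) f by blast
      have n0: "0 \<le> (\<Sum>a\<in>A. w a * (k a)\<^sup>2)" for k :: "_ \<Rightarrow> real" using wp by (intro sum_nonneg) auto
      have "(L2norm q (\<lambda>y. f y - g y))\<^sup>2 \<le> (e * L2norm q Fenv)\<^sup>2"
        using g(2) L2norm_nonneg[OF q] by (intro power_mono) auto
      then have "(\<Sum>a\<in>A. w a * (f (p a) - g (p a))\<^sup>2) / (\<Sum>a\<in>A. w a) \<le> e\<^sup>2 * ((\<Sum>a\<in>A. w a * (Fenv (p a))\<^sup>2) / (\<Sum>a\<in>A. w a))"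
      proof -
        have "(L2norm q k)\<^sup>2 = (\<Sum>a\<in>A. w a * (k (p a))\<^sup>2) / (\<Sum>a\<in>A. w a)" for k
          unfolding q2 using W n0[of "\<lambda>a. k (p a)"] by simp
        then show ?thesis using \<open>(L2norm q (\<lambda>y. f y - g y))\<^sup>2 \<le> (e * L2norm q Fenv)\<^sup>2\<close>
          unfolding power_mult_distrib by simp
      qed
      then show ?thesis using W g(1) by (intro bexI[of _ g]) (auto simp: divide_le_cancel)
    qed
    ultimately show ?thesis using G Gne by blast
  qed
  ultimately have "entropy_class Ysp \<F> Fenv Nn"
    by unfold_locales (use ne env Nn1 in auto)
  then show ?thesis by blast
qed

section \<open>Averages over boxes and bootstrap draws\<close>

definition ibox :: "('k::finite \<Rightarrow> nat) \<Rightarrow> ('k \<Rightarrow> nat) set" where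
  "ibox C = PiE UNIV (\<lambda>i. {..<C i})"

text \<open>\<open>d i r\<close> is the index obtained at the \<open>r\<close>-th draw in coordinate
  \<open>i\<close>. Keeping the order of the draws, instead of their counts, makes the bootstrap
  distribution uniform on a product set. In \<open>pick\<close>, a point of the box is read as a
  tuple of draw numbers.\<close>

definition draws :: "('k::finite \<Rightarrow> nat) \<Rightarrow> ('k \<Rightarrow> nat \<Rightarrow> nat) set" where
  "draws C = PiE UNIV (\<lambda>i. PiE {..<C i} (\<lambda>_. {..<C i}))"

definition pick :: "('k \<Rightarrow> nat \<Rightarrow> nat) \<Rightarrow> ('k \<Rightarrow> nat) \<Rightarrow> 'k \<Rightarrow> nat" where
  "pick d u = (\<lambda>i. d i (u i))"

lemma mem_ibox: "j \<in> ibox C \<longleftrightarrow> (\<forall>i. j i < C i)"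
  by (auto simp: ibox_def PiE_def Pi_def)

lemma finite_ibox [simp]: "finite (ibox C)"
  by (auto simp: ibox_def intro!: finite_PiE)

lemma finite_draws [simp]: "finite (draws C)"
  by (auto simp: draws_def intro!: finite_PiE)

lemma ibox_nonempty: "(\<And>i. 0 < C i) \<Longrightarrow> ibox C \<noteq> {}"
  using mem_ibox[of "\<lambda>_. 0" C] by blast

lemma mem_draws: "d \<in> draws C \<longleftrightarrow> (\<forall>i. d i \<in> extensional {..<C i} \<and> (\<forall>x<C i. d i x < C i))"
  by (auto simp: draws_def PiE_def Pi_def)

lemma draws_nonempty: "(\<And>i. 0 < C i) \<Longrightarrow> draws C \<noteq> {}"
proof -
  assume "\<And>i. 0 < C i"
  then have "(\<lambda>i. \<lambda>x\<in>{..<C i}. 0) \<in> draws C" by (auto simp: mem_draws)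
  then show ?thesis by blast
qed

lemma pick_ibox: "d \<in> draws C \<Longrightarrow> u \<in> ibox C \<Longrightarrow> pick d u \<in> ibox C"
  by (auto simp: mem_draws mem_ibox pick_def)

lemma card_ibox: "card (ibox C) = (\<Prod>i\<in>UNIV. C i)"
  by (simp add: ibox_def card_PiE)

text \<open>Exchanging coordinate \<open>i\<close> between two box points is an involution of the
  pairs, so coordinate \<open>i\<close> may be averaged separately from the others.\<close>

lemma avg_box_split:
  fixes x :: "('k::finite \<Rightarrow> nat) \<Rightarrow> 'b::real_normed_field"
  assumes pos: "\<And>i. 0 < C i"
  shows "avg (ibox C) x = avg (ibox C) (\<lambda>w. avg (ibox C) (\<lambda>w'. x (w'(i := w i))))"
proof -
  let ?T = "\<lambda>p. (\<lambda>(w, w'). (w'(i := w i), w(i := w' i))) p :: ('k \<Rightarrow> nat) \<times> ('k \<Rightarrow> nat)"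
  have inv: "?T (?T p) = p" for p by (auto simp: fun_eq_iff split: prod.split)
  have "bij_betw ?T (ibox C \<times> ibox C) (ibox C \<times> ibox C)"
    by (rule bij_betw_byWitness[where f' = ?T]) (auto simp: inv mem_ibox)
  then have "avg (ibox C \<times> ibox C) (\<lambda>p. x (fst (?T p))) = avg (ibox C \<times> ibox C) (\<lambda>p. x (fst p))"
    by (rule avg_reindex)
  moreover have "avg (ibox C \<times> ibox C) (\<lambda>p. x (fst (?T p))) = avg (ibox C) (\<lambda>w. avg (ibox C) (\<lambda>w'. x (w'(i := w i))))"
    by (subst avg_Times [symmetric]) (simp add: case_prod_unfold)
  moreover have "avg (ibox C \<times> ibox C) (\<lambda>p. x (fst p)) = avg (ibox C) x"
    using avg_Times[of "ibox C" "ibox C" "\<lambda>w w'. x w"] ibox_nonempty[of C] pos by (simp add: case_prod_unfold)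
  ultimately show ?thesis by simp
qed

text \<open>The entries of \<open>d\<close> at \<open>u\<close> are uniform on the box and
  independent of the remaining entries. The proof exchanges them with a fresh box point, an
  involution of \<open>draws C \<times> ibox C\<close>.\<close>

lemma avg_draws_resample:
  assumes pos: "\<And>i. 0 < C i" and u: "u \<in> ibox C"
  shows "avg (draws C) \<Phi> = avg (draws C) (\<lambda>d. avg (ibox C) (\<lambda>w. \<Phi> (\<lambda>i. (d i)(u i := w i))))"
proof -
  let ?T = "\<lambda>p. (\<lambda>(d, w). (\<lambda>i. (d i)(u i := w i), pick d u)) p"
  have inv: "?T (?T p) = p" for p by (auto simp: fun_eq_iff pick_def split: prod.split)
  have "bij_betw ?T (draws C \<times> ibox C) (draws C \<times> ibox C)"
    by (rule bij_betw_byWitness[where f' = ?T]) (use u in \<open>auto simp: inv mem_ibox mem_draws pick_def extensional_def\<close>)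
  then have "avg (draws C \<times> ibox C) (\<lambda>p. \<Phi> (fst (?T p))) = avg (draws C \<times> ibox C) (\<lambda>p. \<Phi> (fst p))"
    by (rule avg_reindex)
  moreover have "avg (draws C \<times> ibox C) (\<lambda>p. \<Phi> (fst (?T p)))
      = avg (draws C) (\<lambda>d. avg (ibox C) (\<lambda>w. \<Phi> (\<lambda>i. (d i)(u i := w i))))"
    by (subst avg_Times [symmetric]) (simp add: case_prod_unfold)
  moreover have "avg (draws C \<times> ibox C) (\<lambda>p. \<Phi> (fst p)) = avg (draws C) \<Phi>"
    using avg_Times[of "draws C" "ibox C" "\<lambda>d w. \<Phi> d"] ibox_nonempty[of C] pos by (simp add: case_prod_unfold)
  ultimately show ?thesis by simp
qed

lemma avg_draws_app:
  assumes pos: "\<And>i. 0 < C i" and u: "u \<in> ibox C"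
  shows "avg (draws C) (\<lambda>d. v (pick d u)) = avg (ibox C) v"
  using draws_nonempty[of C] pos by (subst avg_draws_resample[OF pos u]) (simp add: pick_def)

text \<open>After resampling at \<open>u\<close>, the cell drawn at \<open>w\<close> reads the same
  fresh value in exactly those coordinates where \<open>w\<close> and \<open>u\<close>
  agree.\<close>

lemma avg_draws_app2:
  assumes pos: "\<And>i. 0 < C i" and u: "u \<in> ibox C"
  shows "avg (draws C) (\<lambda>d. v (pick d u) (pick d w)) =
    avg (draws C) (\<lambda>d. avg (ibox C) (\<lambda>b. v b (\<lambda>i. if w i = u i then b i else d i (w i))))"
  by (subst avg_draws_resample[OF pos u]) (simp add: pick_def fun_upd_def)

section \<open>Second moments of averages over drawn cells\<close>

lemma avg_box_coord:
  assumes pos: "\<And>i. 0 < C i"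
  shows "avg (ibox C) (\<lambda>v. of_bool (v i = c)) \<le> 1 / real (C i)"
proof -
  have "avg (ibox C) (\<lambda>v. of_bool (v i = c)) = avg (ibox C) (\<lambda>v. \<Prod>k\<in>UNIV. (if k = i then of_bool (v k = c) else 1) :: real)"
    by (intro avg_cong refl) simp
  also have "\<dots> = (\<Prod>k\<in>UNIV. avg {..<C k} (\<lambda>a. if k = i then of_bool (a = c) else 1))"
    unfolding ibox_def by (rule avg_PiE_prod) auto
  also have "\<dots> = (\<Prod>k\<in>UNIV. if k = i then avg {..<C i} (\<lambda>a. of_bool (a = c)) else 1)"
    by (intro prod.cong refl) (use pos in \<open>auto simp: lessThan_empty_iff\<close>)
  also have "\<dots> = avg {..<C i} (\<lambda>a. of_bool (a = c))" by simp
  \<comment> \<open>Not an equality in general: \<open>c\<close> may lie outside the range, and then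
    the average is 0.\<close>
  also have "\<dots> \<le> 1 / real (C i)"
    by (auto simp: avg_def of_bool_def sum.If_cases intro!: divide_right_mono)
       (metis (mono_tags) card_0_eq card.empty card_insert_disjoint One_nat_def le_SucI le_refl finite.emptyI insert_absorb insert_not_empty of_nat_le_iff)?
  finally show ?thesis .
qed

lemma avg_box_coord2:
  assumes pos: "\<And>i. 0 < C i" and ij: "i \<noteq> j"
  shows "avg (ibox C) (\<lambda>v. of_bool (v i = c \<and> v j = c')) \<le> 1 / (real (C i) * real (C j))"
proof -
  have "avg (ibox C) (\<lambda>v. of_bool (v i = c \<and> v j = c')) 
     = avg (ibox C) (\<lambda>w. avg (ibox C) (\<lambda>w'. of_bool (w i = c) * of_bool (w' j = c') :: real))"
    using ij by (subst avg_box_split[OF pos, where i = i]) (simp add: of_bool_conj)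
  also have "\<dots> = avg (ibox C) (\<lambda>w. of_bool (w i = c)) * avg (ibox C) (\<lambda>w'. of_bool (w' j = c'))"
    by (simp add: avg_cmult avg_multc)
  also have "\<dots> \<le> 1 / real (C i) * (1 / real (C j))"
    by (intro mult_mono avg_box_coord pos avg_nonneg) auto
  finally show ?thesis by simp
qed

text \<open>Expand the square over pairs \<open>u\<close>, \<open>v\<close>. Pairs outside
  \<open>P\<close> are uncorrelated; each remaining pair contributes at most the mean square, since
  a single drawn cell is uniform on the box. So \<delta>, the proportion of pairs in
  \<open>P\<close>, is the variance factor.\<close>

lemma avg_draws_square_le:
  fixes R :: "('k::finite \<Rightarrow> nat) \<Rightarrow> real"
  assumes pos: "\<And>i. 0 < C i" and \<delta>: "\<And>u. u \<in> ibox C \<Longrightarrow> avg (ibox C) (\<lambda>v. of_bool (P u v)) \<le> \<delta>"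
    and zero: "\<And>u v. u \<in> ibox C \<Longrightarrow> v \<in> ibox C \<Longrightarrow> \<not> P u v \<Longrightarrow> avg (draws C) (\<lambda>d. R (pick d u) * R (pick d v)) = 0"
  shows "avg (draws C) (\<lambda>d. (avg (ibox C) (\<lambda>u. R (pick d u)))\<^sup>2) \<le> \<delta> * avg (ibox C) (\<lambda>u. (R u)\<^sup>2)"
proof -
  let ?S = "avg (ibox C) (\<lambda>u. (R u)\<^sup>2)"
  have S0: "0 \<le> ?S" by (rule avg_nonneg) simp
  have "avg (draws C) (\<lambda>d. (avg (ibox C) (\<lambda>u. R (pick d u)))\<^sup>2) 
      = avg (draws C) (\<lambda>d. avg (ibox C) (\<lambda>u. avg (ibox C) (\<lambda>v. R (pick d u) * R (pick d v))))"
    by (simp add: avg_cmult avg_multc power2_eq_square)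
  also have "\<dots> = avg (ibox C) (\<lambda>u. avg (draws C) (\<lambda>d. avg (ibox C) (\<lambda>v. R (pick d u) * R (pick d v))))"
    by (rule avg_swap)
  also have "\<dots> = avg (ibox C) (\<lambda>u. avg (ibox C) (\<lambda>v. avg (draws C) (\<lambda>d. R (pick d u) * R (pick d v))))"
    by (subst avg_swap[of "draws C" "ibox C"]) simp
  also have "\<dots> \<le> avg (ibox C) (\<lambda>u. avg (ibox C) (\<lambda>v. of_bool (P u v) * ?S))"
  proof (intro avg_mono)
    fix u v assume uv: "u \<in> ibox C" "v \<in> ibox C"
    show "avg (draws C) (\<lambda>d. R (pick d u) * R (pick d v)) \<le> of_bool (P u v) * ?S"
    proof (cases "P u v")
      case True
      have "avg (draws C) (\<lambda>d. R (pick d u) * R (pick d v))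
         \<le> avg (draws C) (\<lambda>d. (R (pick d u))\<^sup>2 / 2 + (R (pick d v))\<^sup>2 / 2)"
      proof (rule avg_mono)
        fix d show "R (pick d u) * R (pick d v) \<le> (R (pick d u))\<^sup>2 / 2 + (R (pick d v))\<^sup>2 / 2"
          using sum_squares_bound[of "R (pick d u)" "R (pick d v)"] by simp
      qed
      also have "\<dots> = ?S"
        using avg_draws_app[where C = C, OF pos uv(1), where v = "\<lambda>u. (R u)\<^sup>2"] avg_draws_app[where C = C, OF pos uv(2), where v = "\<lambda>u. (R u)\<^sup>2"] uv
        by (simp add: avg_add avg_divide)
      finally show ?thesis using True by simp
    qed (simp add: zero uv)
  qed
  also have "\<dots> \<le> avg (ibox C) (\<lambda>u. \<delta> * ?S)"
    unfolding avg_multc using S0 \<delta> by (intro avg_mono mult_right_mono)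
  also have "\<dots> = \<delta> * ?S" using ibox_nonempty[of C] pos by simp
  finally show ?thesis .
qed

lemma avg_draws_square1:
  assumes pos: "\<And>i. 0 < C i" and R: "avg (ibox C) R = 0"
  shows "avg (draws C) (\<lambda>d. (avg (ibox C) (\<lambda>u. R (pick d u)))\<^sup>2) \<le> (\<Sum>i\<in>UNIV. 1 / real (C i)) * avg (ibox C) (\<lambda>u. (R u)\<^sup>2)"
proof (rule avg_draws_square_le[OF pos, where P = "\<lambda>u v. \<exists>i. v i = u i"])
  fix u
  have "avg (ibox C) (\<lambda>v. of_bool (\<exists>i. v i = u i)) \<le> avg (ibox C) (\<lambda>v. \<Sum>i\<in>UNIV. of_bool (v i = u i) :: real)"
  proof (rule avg_mono)
    fix v
    show "(of_bool (\<exists>i. v i = u i) :: real) \<le> (\<Sum>i\<in>UNIV. of_bool (v i = u i))"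
    proof (cases "\<exists>i. v i = u i")
      case True
      then obtain i where "v i = u i" by auto
      then show ?thesis using member_le_sum[of i UNIV "\<lambda>i. of_bool (v i = u i) :: real"] True by simp
    qed (simp add: sum_nonneg)
  qed
  also have "\<dots> \<le> (\<Sum>i\<in>UNIV. 1 / real (C i))"
    unfolding avg_sum by (intro sum_mono avg_box_coord pos)
  finally show "avg (ibox C) (\<lambda>v. of_bool (\<exists>i. v i = u i)) \<le> (\<Sum>i\<in>UNIV. 1 / real (C i))" .
next
  fix u v assume u: "u \<in> ibox C" and "\<not> (\<exists>i. v i = u i)"
  then have "avg (draws C) (\<lambda>d. R (pick d u) * R (pick d v)) = avg (draws C) (\<lambda>d. avg (ibox C) (\<lambda>b. R b * R (\<lambda>i. d i (v i))))"
    by (subst avg_draws_app2[OF pos u]) simp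
  then show "avg (draws C) (\<lambda>d. R (pick d u) * R (pick d v)) = 0"
    by (simp add: avg_multc R)
qed

text \<open>If \<open>R\<close> averages to 0 also when any one coordinate is held fixed, then pairs
  sharing exactly one coordinate are uncorrelated as well. Only pairs sharing two coordinates
  remain, which improves the order of the factor from \<open>1 / Cmin C\<close> to its
  square.\<close>

lemma avg_draws_square2:
  assumes pos: "\<And>i. 0 < C i" and R: "\<And>i a. a < C i \<Longrightarrow> avg (ibox C) (\<lambda>w. R (w(i := a))) = 0"
  shows "avg (draws C) (\<lambda>d. (avg (ibox C) (\<lambda>u. R (pick d u)))\<^sup>2)
    \<le> (\<Sum>i\<in>UNIV. \<Sum>j\<in>UNIV. 1 / (real (C i) * real (C j))) * avg (ibox C) (\<lambda>u. (R u)\<^sup>2)"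
proof (rule avg_draws_square_le[OF pos, where P = "\<lambda>u v. \<exists>i j. i \<noteq> j \<and> v i = u i \<and> v j = u j"])
  fix u
  have "avg (ibox C) (\<lambda>v. of_bool (\<exists>i j. i \<noteq> j \<and> v i = u i \<and> v j = u j))
     \<le> avg (ibox C) (\<lambda>v. \<Sum>i\<in>UNIV. \<Sum>j\<in>UNIV. of_bool (i \<noteq> j) * of_bool (v i = u i \<and> v j = u j) :: real)"
  proof (rule avg_mono)
    fix v
    show "(of_bool (\<exists>i j. i \<noteq> j \<and> v i = u i \<and> v j = u j) :: real) \<le> (\<Sum>i\<in>UNIV. \<Sum>j\<in>UNIV. of_bool (i \<noteq> j) * of_bool (v i = u i \<and> v j = u j))"
    proof (cases "\<exists>i j. i \<noteq> j \<and> v i = u i \<and> v j = u j")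
      case True
      then obtain i j where ij: "i \<noteq> j" "v i = u i" "v j = u j" by auto
      have "1 \<le> (\<Sum>j\<in>UNIV. of_bool (i \<noteq> j) * of_bool (v i = u i \<and> v j = u j) :: real)"
        using member_le_sum[of j UNIV "\<lambda>j. of_bool (i \<noteq> j) * of_bool (v i = u i \<and> v j = u j) :: real"] ij by simp
      also have "\<dots> \<le> (\<Sum>i\<in>UNIV. \<Sum>j\<in>UNIV. of_bool (i \<noteq> j) * of_bool (v i = u i \<and> v j = u j))"
        using member_le_sum[of i UNIV "\<lambda>i. \<Sum>j\<in>UNIV. of_bool (i \<noteq> j) * of_bool (v i = u i \<and> v j = u j) :: real"]
        by (simp add: sum_nonneg)
      finally show ?thesis using True by simp
    next
      case False
      then have "of_bool (\<exists>i j. i \<noteq> j \<and> v i = u i \<and> v j = u j) = (0::real)" by simp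
      then show ?thesis by (simp only:) (intro sum_nonneg, simp)
    qed
  qed
  also have "\<dots> = (\<Sum>i\<in>UNIV. \<Sum>j\<in>UNIV. of_bool (i \<noteq> j) * avg (ibox C) (\<lambda>v. of_bool (v i = u i \<and> v j = u j)))"
    by (simp only: avg_sum avg_cmult)
  also have "\<dots> \<le> (\<Sum>i\<in>UNIV. \<Sum>j\<in>UNIV. 1 / (real (C i) * real (C j)))"
  proof (intro sum_mono)
    fix i j
    show "of_bool (i \<noteq> j) * avg (ibox C) (\<lambda>v. of_bool (v i = u i \<and> v j = u j)) \<le> 1 / (real (C i) * real (C j))"
      using avg_box_coord2[where C = C and i = i and j = j and c = "u i" and c' = "u j", OF pos] by (cases "i = j") auto
  qed
  finally show "avg (ibox C) (\<lambda>v. of_bool (\<exists>i j. i \<noteq> j \<and> v i = u i \<and> v j = u j)) \<le> (\<Sum>i\<in>UNIV. \<Sum>j\<in>UNIV. 1 / (real (C i) * real (C j)))" .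
next
  fix u v assume u: "u \<in> ibox C" and P: "\<not> (\<exists>i j. i \<noteq> j \<and> v i = u i \<and> v j = u j)"
  \<comment> \<open>The only coordinate in which \<open>u\<close> and \<open>v\<close> can agree;
    arbitrary if they agree nowhere.\<close>
  obtain i where i: "\<And>k. k \<noteq> i \<Longrightarrow> v k \<noteq> u k" using P by metis
  have "avg (ibox C) (\<lambda>b. R b * R (\<lambda>k. if v k = u k then b k else d k (v k))) = 0" for d
  proof -
    \<comment> \<open>The second factor sees the resampled point through coordinate \<open>i\<close>
      alone, so averaging over the others first leaves an average of \<open>R\<close> with that
      coordinate fixed.\<close>
    define Q where "Q a = R (\<lambda>k. if v k = u k then a else d k (v k))" for a
    have Q: "R (\<lambda>k. if v k = u k then b k else d k (v k)) = Q (b i)" for b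
      unfolding Q_def using i by (intro arg_cong[of _ _ R]) (metis (mono_tags))
    have "avg (ibox C) (\<lambda>b. R b * Q (b i)) = avg (ibox C) (\<lambda>w. avg (ibox C) (\<lambda>w'. R (w'(i := w i)) * Q (w i)))"
      by (subst avg_box_split[OF pos, where i = i]) simp
    also have "\<dots> = avg (ibox C) (\<lambda>w. 0)"
      by (intro avg_cong refl) (auto simp: avg_multc R mem_ibox)
    finally show ?thesis by (simp add: Q)
  qed
  then show "avg (draws C) (\<lambda>d. R (pick d u) * R (pick d v)) = 0"
    by (subst avg_draws_app2[OF pos u]) simp
qed

section \<open>Cyclic shifts and symmetrization along diagonals\<close>

definition cshift :: "('k \<Rightarrow> nat) \<Rightarrow> ('k \<Rightarrow> nat) \<Rightarrow> nat \<Rightarrow> 'k \<Rightarrow> nat" where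
  "cshift C a r = (\<lambda>i. (r + a i) mod C i)"

lemma mod_add_inj: "(a + r) mod n = (b + r) mod n \<Longrightarrow> a < n \<Longrightarrow> b < n \<Longrightarrow> a = (b::nat)"
proof (induction a b rule: linorder_wlog)
  case (le a b)
  then have "n dvd (b + r) - (a + r)" using mod_eq_dvd_iff_nat[of "a + r" "b + r" n] by simp
  then show ?case using le by (cases "a = b") (auto dest: dvd_imp_le)
qed simp

lemma cshift_ibox: "(\<And>i. 0 < C i) \<Longrightarrow> cshift C a r \<in> ibox C"
  by (simp add: mem_ibox cshift_def)

lemma cshift_inj: "(\<And>i. m \<le> C i) \<Longrightarrow> inj_on (\<lambda>r. cshift C a r i) {..<m}"
proof (rule inj_onI)
  fix r r' assume m: "\<And>i. m \<le> C i" and r: "r \<in> {..<m}" "r' \<in> {..<m}" and "cshift C a r i = cshift C a r' i"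
  moreover have "r < C i" "r' < C i" using m[of i] r by auto
  ultimately show "r = r'" using mod_add_inj[of r "a i" "C i" r'] by (simp add: cshift_def)
qed

lemma avg_box_shift:
  assumes pos: "\<And>i. 0 < C i"
  shows "avg (ibox C) (\<lambda>a. g (cshift C a r)) = avg (ibox C) g"
proof (rule avg_reindex)
  have inj: "inj_on (\<lambda>a. cshift C a r) (ibox C)"
  proof (intro inj_onI ext)
    fix a b i assume "a \<in> ibox C" "b \<in> ibox C" and eq: "cshift C a r = cshift C b r"
    then have "a i < C i" "b i < C i" by (auto simp: mem_ibox)
    moreover have "(a i + r) mod C i = (b i + r) mod C i"
      using fun_cong[OF eq, of i] by (simp add: cshift_def add.commute)
    ultimately show "a i = b i" by (metis mod_add_inj)
  qed
  moreover have "(\<lambda>a. cshift C a r) ` ibox C \<subseteq> ibox C" using pos by (auto simp: cshift_ibox)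
  ultimately show "bij_betw (\<lambda>a. cshift C a r) (ibox C) (ibox C)"
    using endo_inj_surj[OF finite_ibox, where f = "\<lambda>a. cshift C a r"] by (simp add: bij_betw_def)
qed

text \<open>For each fixed \<open>r\<close> the shift permutes the box, so the box average is also
  the average over starting points \<open>a\<close> of the means along the diagonals that begin at
  \<open>a\<close>.\<close>

lemma avg_box_shift_avg:
  assumes pos: "\<And>i. 0 < C i" and m: "0 < m"
  shows "avg (ibox C) g = avg (ibox C) (\<lambda>a. avg {..<m} (\<lambda>r. g (cshift C a r)))"
  using m by (subst avg_swap) (simp add: avg_box_shift[OF pos, where g = g] lessThan_empty_iff)

text \<open>Exchanging the entries \<open>s r\<close> with \<open>e r = -1\<close> between two independent copies of the draws leaves
  their joint law unchanged.\<close>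

lemma avg_draws_swap:
  fixes v :: "'i \<Rightarrow> ('k::finite \<Rightarrow> nat) \<Rightarrow> real"
  assumes e: "e \<in> signs m" and s: "\<And>r. s r \<in> ibox C" "\<And>i. inj_on (\<lambda>r. s r i) {..<m}"
  shows "avg (draws C) (\<lambda>d. avg (draws C) (\<lambda>d'. mx I (\<lambda>\<iota>. \<bar>avg {..<m} (\<lambda>r. v \<iota> (pick d (s r)) - v \<iota> (pick d' (s r)))\<bar>)))
    = avg (draws C) (\<lambda>d. avg (draws C) (\<lambda>d'. mx I (\<lambda>\<iota>. \<bar>avg {..<m} (\<lambda>r. e r * (v \<iota> (pick d (s r)) - v \<iota> (pick d' (s r))))\<bar>)))"
proof -
  define S where "S i x \<longleftrightarrow> (\<exists>r<m. e r = -1 \<and> x = s r i)" for i x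
  let ?T = "\<lambda>p :: ('k \<Rightarrow> nat \<Rightarrow> nat) \<times> ('k \<Rightarrow> nat \<Rightarrow> nat).
    (\<lambda>i x. if S i x then snd p i x else fst p i x, \<lambda>i x. if S i x then fst p i x else snd p i x)"
  define F where "F p = mx I (\<lambda>\<iota>. \<bar>avg {..<m} (\<lambda>r. v \<iota> (pick (fst p) (s r)) - v \<iota> (pick (snd p) (s r)))\<bar>)" for p
  have inv: "?T (?T p) = p" for p by (auto simp: fun_eq_iff prod_eq_iff)
  have "bij_betw ?T (draws C \<times> draws C) (draws C \<times> draws C)"
    by (rule bij_betw_byWitness[where f' = ?T]) (auto simp: inv mem_draws extensional_def)
  then have "avg (draws C \<times> draws C) F = avg (draws C \<times> draws C) (\<lambda>p. F (?T p))"
    using avg_reindex[of ?T _ _ F] by simp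
  moreover have "F (?T p) = mx I (\<lambda>\<iota>. \<bar>avg {..<m} (\<lambda>r. e r * (v \<iota> (pick (fst p) (s r)) - v \<iota> (pick (snd p) (s r))))\<bar>)" for p
  proof -
    have "v \<iota> (pick (fst (?T p)) (s r)) - v \<iota> (pick (snd (?T p)) (s r)) = e r * (v \<iota> (pick (fst p) (s r)) - v \<iota> (pick (snd p) (s r)))"
      if r: "r < m" for r \<iota>
    proof -
      \<comment> \<open>Injectivity of \<open>s\<close> in each coordinate guarantees that an entry
        of the draws belongs to one \<open>r\<close> only, so exchanging it cannot affect another
        cell.\<close>
      have S: "S i (s r i) \<longleftrightarrow> e r = -1" for i
        using r s(2)[of i] by (auto simp: S_def inj_on_def)
      have "pick (fst (?T p)) (s r) = (if e r = -1 then pick (snd p) (s r) else pick (fst p) (s r))"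
        "pick (snd (?T p)) (s r) = (if e r = -1 then pick (fst p) (s r) else pick (snd p) (s r))"
        by (auto simp: pick_def S)
      then show ?thesis using signsD[OF e r] by auto
    qed
    then have "avg {..<m} (\<lambda>r. v \<iota> (pick (fst (?T p)) (s r)) - v \<iota> (pick (snd (?T p)) (s r)))
      = avg {..<m} (\<lambda>r. e r * (v \<iota> (pick (fst p) (s r)) - v \<iota> (pick (snd p) (s r))))" for \<iota>
      by (intro avg_cong) auto
    then show ?thesis unfolding F_def by simp
  qed
  ultimately show ?thesis
    unfolding avg_Times [symmetric] F_def by (simp add: case_prod_unfold)
qed

text \<open>The box mean is the expectation over a second copy \<open>d'\<close> of the draws, and
  Jensen moves that expectation outside the maximum. Every sign vector leaves the result unchanged
  by \<open>avg_draws_swap\<close>, hence so does their average, and the triangle inequality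
  separates the two copies.\<close>

lemma draws_symmetrization:
  fixes v :: "'i \<Rightarrow> ('k::finite \<Rightarrow> nat) \<Rightarrow> real"
  assumes pos: "\<And>i. 0 < C i" and m: "0 < m" and I: "finite I" "I \<noteq> {}"
    and s: "\<And>r. s r \<in> ibox C" "\<And>i. inj_on (\<lambda>r. s r i) {..<m}"
  shows "avg (draws C) (\<lambda>d. mx I (\<lambda>\<iota>. \<bar>avg {..<m} (\<lambda>r. v \<iota> (pick d (s r))) - avg (ibox C) (v \<iota>)\<bar>))
    \<le> 2 * avg (draws C) (\<lambda>d. avg (signs m) (\<lambda>e. mx I (\<lambda>\<iota>. \<bar>avg {..<m} (\<lambda>r. e r * v \<iota> (pick d (s r)))\<bar>)))"
proof -
  have ne: "draws C \<noteq> {}" using draws_nonempty[of C] pos by simp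
  define P where "P e d = mx I (\<lambda>\<iota>. \<bar>avg {..<m} (\<lambda>r. e r * v \<iota> (pick d (s r)))\<bar>)" for e d
  have "avg (draws C) (\<lambda>d. mx I (\<lambda>\<iota>. \<bar>avg {..<m} (\<lambda>r. v \<iota> (pick d (s r))) - avg (ibox C) (v \<iota>)\<bar>))
     \<le> avg (draws C) (\<lambda>d. avg (draws C) (\<lambda>d'. mx I (\<lambda>\<iota>. \<bar>avg {..<m} (\<lambda>r. v \<iota> (pick d (s r)) - v \<iota> (pick d' (s r)))\<bar>)))"
  proof (rule avg_mono)
    fix d
    have "avg {..<m} (\<lambda>r. v \<iota> (pick d (s r))) - avg (ibox C) (v \<iota>)
       = avg (draws C) (\<lambda>d'. avg {..<m} (\<lambda>r. v \<iota> (pick d (s r)) - v \<iota> (pick d' (s r))))" for \<iota>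
    proof -
      have "avg (draws C) (\<lambda>d'. avg {..<m} (\<lambda>r. v \<iota> (pick d' (s r)))) = avg (ibox C) (v \<iota>)"
        using m by (subst avg_swap) (simp add: avg_draws_app[OF pos s(1)] lessThan_empty_iff)
      then show ?thesis using ne by (simp add: avg_diff)
    qed
    then have "mx I (\<lambda>\<iota>. \<bar>avg {..<m} (\<lambda>r. v \<iota> (pick d (s r))) - avg (ibox C) (v \<iota>)\<bar>)
      \<le> mx I (\<lambda>\<iota>. avg (draws C) (\<lambda>d'. \<bar>avg {..<m} (\<lambda>r. v \<iota> (pick d (s r)) - v \<iota> (pick d' (s r)))\<bar>))"
      using I by (intro mx_mono) (simp_all add: abs_avg_le)
    also have "\<dots> \<le> avg (draws C) (\<lambda>d'. mx I (\<lambda>\<iota>. \<bar>avg {..<m} (\<lambda>r. v \<iota> (pick d (s r)) - v \<iota> (pick d' (s r)))\<bar>))"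
      by (rule mx_avg_le[OF I])
    finally show "mx I (\<lambda>\<iota>. \<bar>avg {..<m} (\<lambda>r. v \<iota> (pick d (s r))) - avg (ibox C) (v \<iota>)\<bar>)
      \<le> avg (draws C) (\<lambda>d'. mx I (\<lambda>\<iota>. \<bar>avg {..<m} (\<lambda>r. v \<iota> (pick d (s r)) - v \<iota> (pick d' (s r)))\<bar>))" .
  qed
  also have "\<dots> = avg (signs m) (\<lambda>e. avg (draws C) (\<lambda>d. avg (draws C) (\<lambda>d'.
      mx I (\<lambda>\<iota>. \<bar>avg {..<m} (\<lambda>r. v \<iota> (pick d (s r)) - v \<iota> (pick d' (s r)))\<bar>))))" by simp
  also have "\<dots> = avg (signs m) (\<lambda>e. avg (draws C) (\<lambda>d. avg (draws C) (\<lambda>d'.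
      mx I (\<lambda>\<iota>. \<bar>avg {..<m} (\<lambda>r. e r * (v \<iota> (pick d (s r)) - v \<iota> (pick d' (s r))))\<bar>))))"
    by (intro avg_cong refl avg_draws_swap s)
  also have "\<dots> \<le> avg (signs m) (\<lambda>e. avg (draws C) (\<lambda>d. avg (draws C) (\<lambda>d'. P e d + P e d')))"
  proof (intro avg_mono)
    fix e d d'
    have "mx I (\<lambda>\<iota>. \<bar>avg {..<m} (\<lambda>r. e r * (v \<iota> (pick d (s r)) - v \<iota> (pick d' (s r))))\<bar>)
      \<le> mx I (\<lambda>\<iota>. \<bar>avg {..<m} (\<lambda>r. e r * v \<iota> (pick d (s r)))\<bar> + \<bar>avg {..<m} (\<lambda>r. e r * v \<iota> (pick d' (s r)))\<bar>)"
      using I by (intro mx_mono) (simp_all add: right_diff_distrib avg_diff)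
    also have "\<dots> \<le> P e d + P e d'" unfolding P_def by (rule mx_add[OF I])
    finally show "mx I (\<lambda>\<iota>. \<bar>avg {..<m} (\<lambda>r. e r * (v \<iota> (pick d (s r)) - v \<iota> (pick d' (s r))))\<bar>) \<le> P e d + P e d'" .
  qed
  also have "\<dots> = avg (signs m) (\<lambda>e. 2 * avg (draws C) (P e))"
    using ne by (simp add: avg_add)
  also have "\<dots> = 2 * avg (draws C) (\<lambda>d. avg (signs m) (\<lambda>e. P e d))"
    unfolding avg_cmult by (subst avg_swap) simp
  finally show ?thesis unfolding P_def .
qed

lemma Cmin_le: "Cmin C \<le> C i" for C :: "'k::finite \<Rightarrow> nat"
  unfolding Cmin_def by (intro Min_le) auto

section \<open>Conditional equicontinuity for fixed data\<close>

context entropy_class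
begin

definition boot_sq_rate :: "real \<Rightarrow> real \<Rightarrow> ('k::finite \<Rightarrow> nat) \<Rightarrow> (('k \<Rightarrow> nat) \<Rightarrow> nat \<times> (nat \<Rightarrow> 'y)) \<Rightarrow> real" where
  "boot_sq_rate \<eta> B C z = 2 * (4 * avg (ibox C) (\<lambda>j. Htail B (z j)) + 8 * \<eta> * avg (ibox C) (\<lambda>j. cQ Fenv (z j)) + sq_rate \<eta> B (Cmin C))"

text \<open>Chaining along a drawn diagonal produces the random semimetric of that diagonal. This
  bounds it, uniformly over the pairs, by the semimetric of the observed box plus an error whose
  averages live on the box again, since each drawn cell is uniform there.\<close>

lemma boot_squares:
  fixes C :: "'k::finite \<Rightarrow> nat"
  assumes good: "\<And>j. j \<in> ibox C \<Longrightarrow> good (z j)" and pos: "0 < \<eta>" "0 < B" "0 < Cmin C"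
    and I: "finite I" "I \<noteq> {}" "I \<subseteq> \<F> \<times> \<F>"
    and s: "\<And>r. s r \<in> ibox C" "\<And>i. inj_on (\<lambda>r. s r i) {..<Cmin C}"
  shows "avg (draws C) (\<lambda>d. mx I (\<lambda>p. avg {..<Cmin C} (\<lambda>r. cQ (dif p) (z (pick d (s r))))))
    \<le> mx I (\<lambda>p. avg (ibox C) (\<lambda>j. cQ (dif p) (z j))) + boot_sq_rate \<eta> B C z"
proof -
  define m where "m = Cmin C"
  have C: "0 < C i" for i using pos(3) Cmin_le[of C i] by simp
  have ne: "draws C \<noteq> {}" using draws_nonempty[of C] C by simp
  have m: "{..<m} \<noteq> {}" using pos by (auto simp: m_def lessThan_empty_iff)
  let ?V = "\<lambda>p. avg (ibox C) (\<lambda>j. cQ (dif p) (z j))"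
  have marg: "avg (draws C) (\<lambda>d. avg {..<m} (\<lambda>r. h (z (pick d (s r))))) = avg (ibox C) (\<lambda>j. h (z j))" for h :: "_ \<Rightarrow> real"
    using m by (subst avg_swap) (simp add: avg_draws_app[OF C s(1), where v = "\<lambda>j. h (z j)"])
  have "avg (draws C) (\<lambda>d. mx I (\<lambda>p. avg {..<m} (\<lambda>r. cQ (dif p) (z (pick d (s r))))))
    \<le> avg (draws C) (\<lambda>d. mx I ?V + mx I (\<lambda>p. \<bar>avg {..<m} (\<lambda>r. cQ (dif p) (z (pick d (s r)))) - ?V p\<bar>))"
    by (intro avg_mono order_trans[OF _ mx_add[OF I(1,2)]] mx_mono I) auto
  also have "\<dots> = mx I ?V + avg (draws C) (\<lambda>d. mx I (\<lambda>p. \<bar>avg {..<m} (\<lambda>r. cQ (dif p) (z (pick d (s r)))) - ?V p\<bar>))"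
    using ne by (simp add: avg_add)
  also have "\<dots> \<le> mx I ?V + 2 * avg (draws C) (\<lambda>d. avg (signs m) (\<lambda>e. mx I (\<lambda>p. \<bar>avg {..<m} (\<lambda>r. e r * cQ (dif p) (z (pick d (s r))))\<bar>)))"
    using pos s by (intro add_left_mono draws_symmetrization[where v = "\<lambda>p j. cQ (dif p) (z j)"] C I) (auto simp: m_def)
  also have "\<dots> \<le> mx I ?V + 2 * avg (draws C) (\<lambda>d. 4 * avg {..<m} (\<lambda>r. Htail B (z (pick d (s r))))
      + 8 * \<eta> * avg {..<m} (\<lambda>r. cQ Fenv (z (pick d (s r)))) + sq_rate \<eta> B m)"
    using pos
    by (intro add_left_mono mult_left_mono avg_mono rademacher_squares[where x = "\<lambda>r. z (pick _ (s r))"] I)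
       (auto simp: m_def intro!: good pick_ibox s(1))
  also have "\<dots> = mx I ?V + boot_sq_rate \<eta> B C z"
    using ne by (simp add: avg_add avg_cmult marg boot_sq_rate_def m_def [symmetric])
  finally show ?thesis by (simp add: m_def)
qed

lemma mx_sqrt_le:
  assumes "finite I" "I \<noteq> {}"
  shows "mx I (\<lambda>i. sqrt (f i)) \<le> sqrt (mx I f)"
  using assms by (intro mx_le) (auto intro: mx_ge[where f = f])

text \<open>For one shifted diagonal, symmetrization and chaining apply given the draws; concavity
  of the square root moves the averages over draws inside, where the marginal law and
  \<open>boot_squares\<close> evaluate them. Averaging over all shifts returns to the box, because
  the bound does not depend on the shift.\<close>

lemma boot_equicontinuity:
  fixes C :: "'k::finite \<Rightarrow> nat"
  assumes good: "\<And>j. j \<in> ibox C \<Longrightarrow> good (z j)" and pos: "0 < \<eta>" "0 < B" "0 < Cmin C"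
    and I: "finite I" "I \<noteq> {}" "I \<subseteq> \<F> \<times> \<F>"
  shows "avg (draws C) (\<lambda>d. mx I (\<lambda>p. \<bar>sqrt (real (Cmin C)) *
        (avg (ibox C) (\<lambda>u. cS (dif p) (z (pick d u))) - avg (ibox C) (\<lambda>j. cS (dif p) (z j)))\<bar>))
    \<le> 2 * (chain_rate s * sqrt (avg (ibox C) (\<lambda>j. cQ Fenv (z j))) +
        ell' s * sqrt (mx I (\<lambda>p. avg (ibox C) (\<lambda>j. cQ (dif p) (z j))) + boot_sq_rate \<eta> B C z))"
proof -
  define m where "m = Cmin C"
  have m0: "0 < m" using pos by (simp add: m_def)
  have C: "0 < C i" for i using pos(3) Cmin_le[of C i] by simp
  have mC: "m \<le> C i" for i by (simp add: m_def Cmin_le)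
  have ne: "draws C \<noteq> {}" "ibox C \<noteq> {}" using draws_nonempty[of C] ibox_nonempty[of C] C by simp_all
  have m: "{..<m} \<noteq> {}" using pos by (auto simp: m_def lessThan_empty_iff)
  define K where "K = 2 * (chain_rate s * sqrt (avg (ibox C) (\<lambda>j. cQ Fenv (z j))) +
        ell' s * sqrt (mx I (\<lambda>p. avg (ibox C) (\<lambda>j. cQ (dif p) (z j))) + boot_sq_rate \<eta> B C z))"
  define W where "W a d = mx I (\<lambda>p. \<bar>avg {..<m} (\<lambda>r. cS (dif p) (z (pick d (cshift C a r)))) - avg (ibox C) (\<lambda>j. cS (dif p) (z j))\<bar>)" for a d
  have c0: "0 \<le> chain_rate s"
    unfolding chain_rate_def
    using ell_summable by (intro add_nonneg_nonneg mult_nonneg_nonneg suminf_nonneg)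
      (use summable_iff_shift[of "\<lambda>s. (1/2)^s * ell s" s] in auto)
  \<comment> \<open>Indices never repeat along the diagonal in any coordinate, so the cells drawn
    along it are independent.\<close>
  have bound: "sqrt m * avg (draws C) (W a) \<le> K" for a
  proof -
    let ?x = "\<lambda>d r. z (pick d (cshift C a r))"
    have marg: "avg (draws C) (\<lambda>d. avg {..<m} (\<lambda>r. h (?x d r))) = avg (ibox C) (\<lambda>j. h (z j))" for h :: "_ \<Rightarrow> real"
      using m by (subst avg_swap) (simp add: avg_draws_app[OF C cshift_ibox[OF C], where v = "\<lambda>j. h (z j)"])
    have "sqrt m * avg (draws C) (W a) \<le> sqrt m * (2 * avg (draws C) (\<lambda>d. avg (signs m) (\<lambda>e. mx I (\<lambda>p. \<bar>avg {..<m} (\<lambda>r. e r * cS (dif p) (?x d r))\<bar>))))"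
      unfolding W_def
      by (intro mult_left_mono draws_symmetrization[where v = "\<lambda>p j. cS (dif p) (z j)"] C I m0 cshift_ibox cshift_inj mC) auto
    also have "\<dots> = 2 * avg (draws C) (\<lambda>d. avg (signs m) (\<lambda>e. mx I (\<lambda>p. \<bar>\<Sum>r<m. e r * cS (dif p) (?x d r)\<bar> / sqrt m)))"
    proof -
      define q where "q = sqrt m"
      have q: "q > 0" "real m = q * q" using m0 by (auto simp: q_def)
      have main: "sqrt m * mx I (\<lambda>p. \<bar>avg {..<m} (\<lambda>r. e r * cS (dif p) (?x d r))\<bar>) = mx I (\<lambda>p. \<bar>\<Sum>r<m. e r * cS (dif p) (?x d r)\<bar> / sqrt m)" for d e
      proof (subst mx_cmult[OF I(1,2), symmetric])
        show "0 \<le> sqrt m" by simp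
        show "mx I (\<lambda>p. sqrt m * \<bar>avg {..<m} (\<lambda>r. e r * cS (dif p) (?x d r))\<bar>) = mx I (\<lambda>p. \<bar>\<Sum>r<m. e r * cS (dif p) (?x d r)\<bar> / sqrt m)"
          unfolding avg_def q_def [symmetric] using q(1) by (simp add: abs_mult q(2))
      qed
      show ?thesis unfolding main [symmetric] avg_cmult by simp
    qed
    also have "\<dots> \<le> 2 * avg (draws C) (\<lambda>d. chain_rate s * semi m (?x d) Fenv + ell' s * mx I (\<lambda>p. semi m (?x d) (dif p)))"
    proof (intro mult_left_mono avg_mono)
      fix d assume d: "d \<in> draws C"
      show "avg (signs m) (\<lambda>e. mx I (\<lambda>p. \<bar>\<Sum>r<m. e r * cS (dif p) (?x d r)\<bar> / sqrt m))
         \<le> chain_rate s * semi m (?x d) Fenv + ell' s * mx I (\<lambda>p. semi m (?x d) (dif p))"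
        using good[OF pick_ibox[OF d cshift_ibox[OF C]]] by (intro rademacher_chaining m0 I)
    qed simp
    also have "\<dots> = 2 * (chain_rate s * avg (draws C) (\<lambda>d. semi m (?x d) Fenv) + ell' s * avg (draws C) (\<lambda>d. mx I (\<lambda>p. semi m (?x d) (dif p))))"
      by (simp add: avg_add avg_cmult)
    also have "\<dots> \<le> K"
      unfolding K_def
    proof (intro mult_left_mono add_mono c0 ell_nonneg)
      show "avg (draws C) (\<lambda>d. semi m (?x d) Fenv) \<le> sqrt (avg (ibox C) (\<lambda>j. cQ Fenv (z j)))"
        unfolding semi_def marg[of "cQ Fenv", symmetric] by (intro avg_sqrt_le avg_nonneg) auto
      have "avg (draws C) (\<lambda>d. mx I (\<lambda>p. semi m (?x d) (dif p))) \<le> avg (draws C) (\<lambda>d. sqrt (mx I (\<lambda>p. avg {..<m} (\<lambda>r. cQ (dif p) (?x d r)))))"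
        unfolding semi_def by (intro avg_mono mx_sqrt_le I)
      also have "\<dots> \<le> sqrt (avg (draws C) (\<lambda>d. mx I (\<lambda>p. avg {..<m} (\<lambda>r. cQ (dif p) (?x d r)))))"
        by (intro avg_sqrt_le mx_nonneg avg_nonneg I) auto
      also have "\<dots> \<le> sqrt (mx I (\<lambda>p. avg (ibox C) (\<lambda>j. cQ (dif p) (z j))) + boot_sq_rate \<eta> B C z)"
        unfolding m_def
        by (intro real_sqrt_le_mono boot_squares good pos I cshift_ibox C cshift_inj Cmin_le)
      finally show "avg (draws C) (\<lambda>d. mx I (\<lambda>p. semi m (?x d) (dif p))) \<le> sqrt (mx I (\<lambda>p. avg (ibox C) (\<lambda>j. cQ (dif p) (z j))) + boot_sq_rate \<eta> B C z)" .
    qed auto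
    finally show ?thesis .
  qed
  have "avg (draws C) (\<lambda>d. mx I (\<lambda>p. \<bar>sqrt m * (avg (ibox C) (\<lambda>u. cS (dif p) (z (pick d u))) - avg (ibox C) (\<lambda>j. cS (dif p) (z j)))\<bar>))
    \<le> avg (draws C) (\<lambda>d. sqrt m * avg (ibox C) (\<lambda>a. W a d))"
  proof (rule avg_mono)
    fix d
    have "\<bar>sqrt m * (avg (ibox C) (\<lambda>u. cS (dif p) (z (pick d u))) - avg (ibox C) (\<lambda>j. cS (dif p) (z j)))\<bar>
       \<le> sqrt m * avg (ibox C) (\<lambda>a. W a d)" if p: "p \<in> I" for p
    proof -
      have "avg (ibox C) (\<lambda>u. cS (dif p) (z (pick d u))) - avg (ibox C) (\<lambda>j. cS (dif p) (z j))
        = avg (ibox C) (\<lambda>a. avg {..<m} (\<lambda>r. cS (dif p) (z (pick d (cshift C a r)))) - avg (ibox C) (\<lambda>j. cS (dif p) (z j)))"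
        using ne by (subst avg_box_shift_avg[OF C m0]) (simp add: avg_diff)
      also have "\<bar>\<dots>\<bar> \<le> avg (ibox C) (\<lambda>a. W a d)"
        unfolding W_def
        by (intro order_trans[OF abs_avg_le] avg_mono)
           (rule mx_ge[OF I(1) p, where f = "\<lambda>p. \<bar>avg {..<m} (\<lambda>r. cS (dif p) (z (pick d (cshift C _ r)))) - avg (ibox C) (\<lambda>j. cS (dif p) (z j))\<bar>"])
      finally show ?thesis by (simp add: abs_mult mult_left_mono)
    qed
    then show "mx I (\<lambda>p. \<bar>sqrt m * (avg (ibox C) (\<lambda>u. cS (dif p) (z (pick d u))) - avg (ibox C) (\<lambda>j. cS (dif p) (z j)))\<bar>)
      \<le> sqrt m * avg (ibox C) (\<lambda>a. W a d)" by (intro mx_le I)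
  qed
  also have "\<dots> = avg (ibox C) (\<lambda>a. sqrt m * avg (draws C) (W a))"
    by (simp add: avg_cmult avg_swap[of "draws C"])
  also have "\<dots> \<le> K" using ne bound by (intro avg_le_const) auto
  finally show ?thesis by (simp add: K_def m_def)
qed

end

section \<open>Dissociated separately exchangeable arrays\<close>

text \<open>Exchangeability is stated for permutations of all naturals, but only finitely many
  indices have to be moved to prescribed places. Each further value is corrected by a transposition
  that fixes the earlier ones.\<close>

lemma bij_extending:
  assumes "inj_on f {..<n::nat}"
  shows "\<exists>\<pi>::nat \<Rightarrow> nat. bij \<pi> \<and> (\<forall>r<n. \<pi> r = f r)"
  using assms
proof (induction n)
  case 0
  show ?case using bij_id by blast
next
  case (Suc n)
  then have "inj_on f {..<n}" by (auto simp: inj_on_def)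
  then obtain \<pi> where \<pi>: "bij \<pi>" "\<And>r. r < n \<Longrightarrow> \<pi> r = f r" using Suc.IH by blast
  define \<pi>' where "\<pi>' = Transposition.transpose (\<pi> n) (f n) \<circ> \<pi>"
  have "bij \<pi>'" unfolding \<pi>'_def using \<pi>(1) by (intro bij_comp) auto
  moreover have "\<pi>' r = f r" if "r < Suc n" for r
  proof (cases "r = n")
    case True
    then show ?thesis by (simp add: \<pi>'_def)
  next
    case False
    then have r: "r < n" using that by simp
    have "f r \<noteq> f n" using Suc.prems r by (auto simp: inj_on_def)
    moreover have "\<pi> r \<noteq> \<pi> n" using \<pi>(1) r by (metis bij_def inj_eq less_irrefl)
    ultimately show ?thesis using \<pi>(2)[OF r] by (simp add: \<pi>'_def transpose_apply_other)
  qed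
  ultimately show ?case by blast
qed

lemma integral_avg:
  fixes f :: "'i \<Rightarrow> 'a \<Rightarrow> real"
  assumes "\<And>x. x \<in> A \<Longrightarrow> integrable M (f x)"
  shows "(\<integral>\<omega>. avg A (\<lambda>x. f x \<omega>) \<partial>M) = avg A (\<lambda>x. \<integral>\<omega>. f x \<omega> \<partial>M)"
  using assms by (simp add: avg_def)

lemma integrable_avg:
  fixes f :: "'i \<Rightarrow> 'a \<Rightarrow> real"
  assumes "\<And>x. x \<in> A \<Longrightarrow> integrable M (f x)"
  shows "integrable M (\<lambda>\<omega>. avg A (\<lambda>x. f x \<omega>))"
  using assms by (simp add: avg_def)

lemma avg_measurable [measurable (raw)]:
  fixes f :: "'i \<Rightarrow> 'a \<Rightarrow> real"
  assumes "\<And>x. x \<in> A \<Longrightarrow> f x \<in> borel_measurable M"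
  shows "(\<lambda>\<omega>. avg A (\<lambda>x. f x \<omega>)) \<in> borel_measurable M"
  using assms unfolding avg_def by (intro borel_measurable_divide borel_measurable_sum) auto

definition diag :: "nat \<Rightarrow> 'k \<Rightarrow> nat" where
  "diag r = (\<lambda>_. r)"

locale exch_array = prob_space M for M :: "'a measure" +
  fixes Z :: "'a \<Rightarrow> ('k::finite \<Rightarrow> nat) \<Rightarrow> 'z" and E :: "'z measure"
  assumes cell_measurable [measurable]: "\<And>j. (\<lambda>\<omega>. Z \<omega> j) \<in> M \<rightarrow>\<^sub>M E"
    and exchangeable: "\<And>\<pi> :: 'k \<Rightarrow> nat \<Rightarrow> nat. \<forall>i. bij (\<pi> i) \<Longrightarrow>
        distr M (\<Pi>\<^sub>M j\<in>UNIV. E) Z = distr M (\<Pi>\<^sub>M j\<in>UNIV. E) (\<lambda>\<omega>. Z \<omega> \<circ> (\<lambda>j i. \<pi> i (j i)))"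
    and dissociated: "\<And>c :: 'k \<Rightarrow> nat. indep_var
        (\<Pi>\<^sub>M j\<in>{j. j \<le> c}. E) (\<lambda>\<omega>. restrict (Z \<omega>) {j. j \<le> c})
        (\<Pi>\<^sub>M j\<in>{j. \<forall>i. c i < j i}. E) (\<lambda>\<omega>. restrict (Z \<omega>) {j. \<forall>i. c i < j i})"
begin

lemma array_measurable: "Z \<in> M \<rightarrow>\<^sub>M (\<Pi>\<^sub>M j\<in>UNIV. E)"
  using measurable_PiM_single'[of UNIV "\<lambda>j \<omega>. Z \<omega> j" M "\<lambda>_. E"] measurable_space[OF cell_measurable]
  by (auto simp: PiE_def Pi_def)

lemma transfer_distr:
  assumes \<pi>: "\<And>i. bij (\<pi> i)" and \<Phi>: "\<Phi> \<in> (\<Pi>\<^sub>M j\<in>UNIV. E) \<rightarrow>\<^sub>M N"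
  shows "distr M N (\<lambda>\<omega>. \<Phi> (Z \<omega>)) = distr M N (\<lambda>\<omega>. \<Phi> (\<lambda>j. Z \<omega> (\<lambda>i. \<pi> i (j i))))"
proof -
  have m: "(\<lambda>\<omega>. Z \<omega> \<circ> (\<lambda>j i. \<pi> i (j i))) \<in> M \<rightarrow>\<^sub>M (\<Pi>\<^sub>M j\<in>UNIV. E)"
    unfolding comp_def
    using measurable_PiM_single'[of UNIV "\<lambda>j \<omega>. Z \<omega> (\<lambda>i. \<pi> i (j i))" M "\<lambda>_. E"] measurable_space[OF cell_measurable]
    by (auto simp: PiE_def Pi_def)
  have "distr M N (\<lambda>\<omega>. \<Phi> (Z \<omega>)) = distr (distr M (\<Pi>\<^sub>M j\<in>UNIV. E) Z) N \<Phi>"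
    by (subst distr_distr[OF \<Phi> array_measurable]) (simp add: comp_def)
  also have "\<dots> = distr (distr M (\<Pi>\<^sub>M j\<in>UNIV. E) (\<lambda>\<omega>. Z \<omega> \<circ> (\<lambda>j i. \<pi> i (j i)))) N \<Phi>"
    using exchangeable[of \<pi>] \<pi> by simp
  also have "\<dots> = distr M N (\<lambda>\<omega>. \<Phi> (\<lambda>j. Z \<omega> (\<lambda>i. \<pi> i (j i))))"
    by (subst distr_distr[OF \<Phi> m]) (simp add: comp_def)
  finally show ?thesis .
qed

lemma transfer_integral:
  fixes \<Phi> :: "_ \<Rightarrow> real"
  assumes \<pi>: "\<And>i. bij (\<pi> i)" and \<Phi>: "\<Phi> \<in> borel_measurable (\<Pi>\<^sub>M j\<in>UNIV. E)"
  shows "(\<integral>\<omega>. \<Phi> (Z \<omega>) \<partial>M) = (\<integral>\<omega>. \<Phi> (\<lambda>j. Z \<omega> (\<lambda>i. \<pi> i (j i))) \<partial>M)"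
proof -
  have m: "(\<lambda>\<omega>. \<lambda>j. Z \<omega> (\<lambda>i. \<pi> i (j i))) \<in> M \<rightarrow>\<^sub>M (\<Pi>\<^sub>M j\<in>UNIV. E)"
    using measurable_PiM_single'[of UNIV "\<lambda>j \<omega>. Z \<omega> (\<lambda>i. \<pi> i (j i))" M "\<lambda>_. E"] measurable_space[OF cell_measurable]
    by (auto simp: PiE_def Pi_def)
  have "(\<integral>x. x \<partial>distr M borel (\<lambda>\<omega>. \<Phi> (Z \<omega>))) = (\<integral>\<omega>. \<Phi> (Z \<omega>) \<partial>M)"
    by (rule integral_distr) (use measurable_compose[OF array_measurable \<Phi>] in auto)
  moreover have "(\<integral>x. x \<partial>distr M borel (\<lambda>\<omega>. \<Phi> (\<lambda>j. Z \<omega> (\<lambda>i. \<pi> i (j i))))) = (\<integral>\<omega>. \<Phi> (\<lambda>j. Z \<omega> (\<lambda>i. \<pi> i (j i))) \<partial>M)"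
    by (rule integral_distr) (use measurable_compose[OF m \<Phi>] in auto)
  ultimately show ?thesis using transfer_distr[OF \<pi> \<Phi>] by simp
qed

text \<open>In coordinate \<open>i\<close> the transposition of 0 and \<open>j i\<close> carries the
  first cell to \<open>j\<close>.\<close>

lemma marginal: "distr M E (\<lambda>\<omega>. Z \<omega> j) = distr M E (\<lambda>\<omega>. Z \<omega> cell1)"
  using transfer_distr[of "\<lambda>i. Transposition.transpose 0 (j i)" "\<lambda>z. z cell1" E]
  by (simp add: cell1_def)

lemma marginal_integrable:
  fixes g :: "'z \<Rightarrow> real"
  assumes [measurable]: "g \<in> borel_measurable E"
  shows "integrable M (\<lambda>\<omega>. g (Z \<omega> j)) \<longleftrightarrow> integrable M (\<lambda>\<omega>. g (Z \<omega> cell1))"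
proof -
  have "integrable (distr M E (\<lambda>\<omega>. Z \<omega> j)) g \<longleftrightarrow> integrable (distr M E (\<lambda>\<omega>. Z \<omega> cell1)) g"
    by (simp add: marginal[of j])
  then show ?thesis by (simp add: integrable_distr_eq)
qed

lemma marginal_integral:
  fixes g :: "'z \<Rightarrow> real"
  assumes [measurable]: "g \<in> borel_measurable E"
  shows "(\<integral>\<omega>. g (Z \<omega> j) \<partial>M) = (\<integral>\<omega>. g (Z \<omega> cell1) \<partial>M)"
proof -
  have "integral\<^sup>L (distr M E (\<lambda>\<omega>. Z \<omega> j)) g = integral\<^sup>L (distr M E (\<lambda>\<omega>. Z \<omega> cell1)) g"
    by (simp add: marginal[of j])
  then show ?thesis by (simp add: integral_distr)
qed

text \<open>The variance is an average over quadruples of box points. If the four points differ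
  pairwise in every coordinate, exchangeability moves them to the values 0, 1, 2, 3 and dissociation
  makes the two factors independent, hence the centred product has mean 0. A coincidence in
  coordinate \<open>k\<close> has frequency at most \<open>6 / C k\<close>, one term for each of the
  six pairs, and costs at most \<open>4 * B^2\<close>; this is the constant 24.\<close>

lemma pair_average_lln:
  fixes \<psi> :: "'z \<Rightarrow> 'z \<Rightarrow> real" and i :: 'k and C :: "'k \<Rightarrow> nat"
  assumes \<psi>: "(\<lambda>(x, y). \<psi> x y) \<in> borel_measurable (E \<Otimes>\<^sub>M E)" and B: "\<And>x y. \<bar>\<psi> x y\<bar> \<le> B"
    and pos: "\<And>k. 0 < C k"
  defines "\<kappa> \<equiv> (\<integral>\<omega>. \<psi> (Z \<omega> cell1) (Z \<omega> (cell2 i)) \<partial>M)"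
  shows "(\<integral>\<omega>. (avg (ibox C) (\<lambda>u. avg (ibox C) (\<lambda>v. \<psi> (Z \<omega> u) (Z \<omega> (v(i := u i))))) - \<kappa>)\<^sup>2 \<partial>M)
    \<le> 24 * B\<^sup>2 * (\<Sum>k\<in>UNIV. 1 / real (C k))"
proof -
  define y where "y u v \<omega> = \<psi> (Z \<omega> u) (Z \<omega> (v(i := u i))) - \<kappa>" for u v \<omega>
  have \<psi>m [measurable]: "(\<lambda>\<omega>. \<psi> (f \<omega>) (g \<omega>)) \<in> borel_measurable N" if "f \<in> N \<rightarrow>\<^sub>M E" "g \<in> N \<rightarrow>\<^sub>M E" for f g and N :: "'n measure"
    using measurable_compose[OF measurable_Pair[OF that] \<psi>] by simp
  have \<psi>M [measurable]: "(\<lambda>\<omega>. \<psi> (Z \<omega> u) (Z \<omega> v)) \<in> borel_measurable M" for u v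
    using measurable_compose[OF measurable_Pair[OF cell_measurable cell_measurable] \<psi>] by simp
  have \<psi>I: "integrable M (\<lambda>\<omega>. \<psi> (Z \<omega> u) (Z \<omega> v))" for u v
    by (rule integrable_const_bound[where B = B]) (auto simp: B)
  have ym [measurable]: "y u v \<in> borel_measurable M" for u v unfolding y_def by measurable
  have B0: "0 \<le> B" by (rule order_trans[OF abs_ge_zero B])
  have \<kappa>B: "\<bar>\<kappa>\<bar> \<le> B"
  proof -
    have "\<bar>\<kappa>\<bar> \<le> (\<integral>\<omega>. \<bar>\<psi> (Z \<omega> cell1) (Z \<omega> (cell2 i))\<bar> \<partial>M)" unfolding \<kappa>_def by (rule integral_abs_bound)
    also have "\<dots> \<le> (\<integral>\<omega>. B \<partial>M)"
      by (intro integral_mono integrable_const_bound[where B = B]) (auto simp: B B0)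
    finally show ?thesis by (simp add: prob_space)
  qed
  have yB: "\<bar>y u v \<omega>\<bar> \<le> 2 * B" for u v \<omega> using B[of "Z \<omega> u" "Z \<omega> (v(i := u i))"] \<kappa>B by (auto simp: y_def)
  have yyB: "\<bar>y u v \<omega> * y u' v' \<omega>\<bar> \<le> 4 * B\<^sup>2" for u v u' v' \<omega>
    using mult_mono[OF yB[of u v \<omega>] yB[of u' v' \<omega>]] B0 by (simp add: abs_mult power2_eq_square)
  have yyI: "integrable M (\<lambda>\<omega>. y u v \<omega> * y u' v' \<omega>)" for u v u' v'
    by (rule integrable_const_bound[where B = "4 * B\<^sup>2"]) (auto intro: yyB)
  define bad where "bad u v u' v' \<longleftrightarrow> (\<exists>k. u k = v k \<or> u k = u' k \<or> u k = v' k \<or> v k = u' k \<or> v k = v' k \<or> u' k = v' k)"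
    for u v u' v' :: "'k \<Rightarrow> nat"
  have zero: "(\<integral>\<omega>. y u v \<omega> * y u' v' \<omega> \<partial>M) = 0" if nb: "\<not> bad u v u' v'" for u v u' v'
  proof -
    have "\<exists>\<pi>::nat \<Rightarrow> nat. bij \<pi> \<and> \<pi> 0 = u k \<and> \<pi> 1 = v k \<and> \<pi> 2 = u' k \<and> \<pi> 3 = v' k" for k
    proof -
      define f where "f = (\<lambda>r::nat. if r = 0 then u k else if r = 1 then v k else if r = 2 then u' k else v' k)"
      have S: "{..<4::nat} = {0, 1, 2, 3}" by auto
      have ne: "u k \<noteq> v k" "u k \<noteq> u' k" "u k \<noteq> v' k" "v k \<noteq> u' k" "v k \<noteq> v' k" "u' k \<noteq> v' k"
        using nb unfolding bad_def by blast+
      have "inj_on f {..<4}" unfolding S using ne ne[symmetric] by (simp add: f_def)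
      then obtain \<pi> where "bij \<pi>" "\<And>r. r < 4 \<Longrightarrow> \<pi> r = f r" using bij_extending by blast
      then show ?thesis by (intro exI[of _ \<pi>]) (auto simp: f_def)
    qed
    then obtain \<pi> :: "'k \<Rightarrow> nat \<Rightarrow> nat" where \<pi>: "\<And>k. bij (\<pi> k)" "\<And>k. \<pi> k 0 = u k" "\<And>k. \<pi> k 1 = v k" "\<And>k. \<pi> k 2 = u' k" "\<And>k. \<pi> k 3 = v' k"
      by metis
    \<comment> \<open>The cells \<open>cell1\<close> and \<open>cell2 i\<close> translated by 2 in
      all coordinates.\<close>
    define c3 c4 where "c3 = (\<lambda>k::'k. 2::nat)" and "c4 = (\<lambda>k. if k = i then 2 else 3::nat)"
    define \<Phi> where "\<Phi> z = (\<psi> (z cell1) (z (cell2 i)) - \<kappa>) * (\<psi> (z c3) (z c4) - \<kappa>)" for z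
    have [measurable]: "\<Phi> \<in> borel_measurable (\<Pi>\<^sub>M j\<in>UNIV. E)"
      unfolding \<Phi>_def by (intro borel_measurable_times borel_measurable_diff \<psi>m) auto
    have c: "(\<lambda>k. \<pi> k (cell1 k)) = u" "(\<lambda>k. \<pi> k (cell2 i k)) = v(i := u i)"
      "(\<lambda>k. \<pi> k (c3 k)) = u'" "(\<lambda>k. \<pi> k (c4 k)) = v'(i := u' i)"
      using \<pi> by (auto simp: cell1_def cell2_def c3_def c4_def fun_eq_iff)
    have "(\<integral>\<omega>. y u v \<omega> * y u' v' \<omega> \<partial>M) = (\<integral>\<omega>. \<Phi> (\<lambda>j. Z \<omega> (\<lambda>k. \<pi> k (j k))) \<partial>M)"
      by (simp add: \<Phi>_def c y_def)
    also have "\<dots> = (\<integral>\<omega>. \<Phi> (Z \<omega>) \<partial>M)" using \<pi>(1) by (intro transfer_integral [symmetric]) auto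
    also have "\<dots> = (\<integral>\<omega>. (\<psi> (Z \<omega> cell1) (Z \<omega> (cell2 i)) - \<kappa>) \<partial>M) * (\<integral>\<omega>. (\<psi> (Z \<omega> c3) (Z \<omega> c4) - \<kappa>) \<partial>M)"
      unfolding \<Phi>_def
    proof (rule indep_var_lebesgue_integral)
      \<comment> \<open>The first pair of cells uses the values 0 and 1, the second 2 and 3, so
        dissociation at the threshold 1 separates them.\<close>
      let ?L = "{j::'k \<Rightarrow> nat. j \<le> diag 1}" and ?U = "{j::'k \<Rightarrow> nat. \<forall>k. diag 1 k < j k}"
      have mem: "cell1 \<in> ?L" "cell2 i \<in> ?L" "c3 \<in> ?U" "c4 \<in> ?U"
        by (auto simp: cell1_def cell2_def c3_def c4_def diag_def le_fun_def)
      have "indep_var borel ((\<lambda>z. \<psi> (z cell1) (z (cell2 i)) - \<kappa>) \<circ> (\<lambda>\<omega>. restrict (Z \<omega>) ?L))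
          borel ((\<lambda>z. \<psi> (z c3) (z c4) - \<kappa>) \<circ> (\<lambda>\<omega>. restrict (Z \<omega>) ?U))"
        using mem by (intro indep_var_compose[OF dissociated] borel_measurable_diff \<psi>m measurable_component_singleton) auto
      then show "indep_var borel (\<lambda>\<omega>. \<psi> (Z \<omega> cell1) (Z \<omega> (cell2 i)) - \<kappa>) borel (\<lambda>\<omega>. \<psi> (Z \<omega> c3) (Z \<omega> c4) - \<kappa>)"
        using mem by (simp add: comp_def)
    qed (auto intro!: Bochner_Integration.integrable_diff \<psi>I)
    also have "(\<integral>\<omega>. (\<psi> (Z \<omega> cell1) (Z \<omega> (cell2 i)) - \<kappa>) \<partial>M) = 0"
      by (subst Bochner_Integration.integral_diff) (auto intro!: \<psi>I simp: \<kappa>_def prob_space)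
    finally show ?thesis by simp
  qed
  have bound: "(\<integral>\<omega>. y u v \<omega> * y u' v' \<omega> \<partial>M) \<le> 4 * B\<^sup>2 * of_bool (bad u v u' v')" for u v u' v'
  proof (cases "bad u v u' v'")
    case True
    have "(\<integral>\<omega>. y u v \<omega> * y u' v' \<omega> \<partial>M) \<le> (\<integral>\<omega>. 4 * B\<^sup>2 \<partial>M)"
      using yyB by (intro integral_mono yyI) (auto simp: abs_le_iff)
    then show ?thesis using True by (simp add: prob_space)
  qed (simp add: zero)
  define ob where "ob u v k = (of_bool (v k = u k) :: real)" for u v :: "'k \<Rightarrow> nat" and k
  have ob: "avg (ibox C) (\<lambda>v. ob u v k) \<le> 1 / real (C k)" for u k
    unfolding ob_def by (rule avg_box_coord[OF pos])
  have ne: "ibox C \<noteq> {}" using ibox_nonempty[of C] pos by simp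
  let ?A = "\<lambda>f. avg (ibox C) f"
  have "(\<integral>\<omega>. (?A (\<lambda>u. ?A (\<lambda>v. \<psi> (Z \<omega> u) (Z \<omega> (v(i := u i))))) - \<kappa>)\<^sup>2 \<partial>M)
      = (\<integral>\<omega>. ?A (\<lambda>u. ?A (\<lambda>v. ?A (\<lambda>u'. ?A (\<lambda>v'. y u v \<omega> * y u' v' \<omega>)))) \<partial>M)"
    using ne by (simp add: y_def avg_diff avg_cmult avg_multc power2_eq_square)
  also have "\<dots> = ?A (\<lambda>u. ?A (\<lambda>v. ?A (\<lambda>u'. ?A (\<lambda>v'. \<integral>\<omega>. y u v \<omega> * y u' v' \<omega> \<partial>M))))"
    by (subst integral_avg; intro integrable_avg yyI avg_cong refl)+
  also have "\<dots> \<le> ?A (\<lambda>u. ?A (\<lambda>v. ?A (\<lambda>u'. ?A (\<lambda>v'. 4 * B\<^sup>2 * (\<Sum>k\<in>UNIV. ob u v k + ob u u' k + ob v u' k + (ob u v' k + ob v v' k + ob u' v' k))))))"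
  proof (intro avg_mono order_trans[OF bound] mult_left_mono)
    fix u v u' v'
    show "of_bool (bad u v u' v') \<le> (\<Sum>k\<in>UNIV. ob u v k + ob u u' k + ob v u' k + (ob u v' k + ob v v' k + ob u' v' k))"
      (is "_ \<le> sum ?f UNIV")
    proof (cases "bad u v u' v'")
      case True
      then obtain k where "u k = v k \<or> u k = u' k \<or> u k = v' k \<or> v k = u' k \<or> v k = v' k \<or> u' k = v' k"
        unfolding bad_def by blast
      then have "1 \<le> ?f k" by (elim disjE) (simp_all add: ob_def)
      also have "?f k \<le> sum ?f UNIV" by (rule member_le_sum) (auto simp: ob_def)
      finally show ?thesis using True by simp
    next
      case False
      have "0 \<le> sum ?f UNIV" by (intro sum_nonneg) (auto simp: ob_def)
      then show ?thesis using False by simp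
    qed
  qed auto
  also have "\<dots> \<le> ?A (\<lambda>u. ?A (\<lambda>v. ?A (\<lambda>u'. 4 * B\<^sup>2 * (\<Sum>k\<in>UNIV. ob u v k + ob u u' k + ob v u' k + 3 / C k))))"
  proof (intro avg_mono)
    fix u v u'
    have "?A (\<lambda>v'. ob u v' k + ob v v' k + ob u' v' k) \<le> 3 / C k" for k
      using ob[of u k] ob[of v k] ob[of u' k] by (simp add: avg_add)
    then show "?A (\<lambda>v'. 4 * B\<^sup>2 * (\<Sum>k\<in>UNIV. ob u v k + ob u u' k + ob v u' k + (ob u v' k + ob v v' k + ob u' v' k)))
      \<le> 4 * B\<^sup>2 * (\<Sum>k\<in>UNIV. ob u v k + ob u u' k + ob v u' k + 3 / C k)"
      using ne unfolding avg_cmult avg_sum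
      by (intro mult_left_mono sum_mono) (auto simp: avg_add)
  qed
  also have "\<dots> \<le> ?A (\<lambda>u. ?A (\<lambda>v. 4 * B\<^sup>2 * (\<Sum>k\<in>UNIV. ob u v k + 5 / C k)))"
  proof (intro avg_mono)
    fix u v
    have "?A (\<lambda>u'. ob u v k + ob u u' k + ob v u' k + 3 / C k) \<le> ob u v k + 5 / C k" for k
      using ob[of u k] ob[of v k] ne by (simp add: avg_add)
    then show "?A (\<lambda>u'. 4 * B\<^sup>2 * (\<Sum>k\<in>UNIV. ob u v k + ob u u' k + ob v u' k + 3 / C k)) \<le> 4 * B\<^sup>2 * (\<Sum>k\<in>UNIV. ob u v k + 5 / C k)"
      unfolding avg_cmult avg_sum by (intro mult_left_mono sum_mono) auto
  qed
  also have "\<dots> \<le> ?A (\<lambda>u. 4 * B\<^sup>2 * (\<Sum>k\<in>UNIV. 6 / C k))"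
  proof (intro avg_mono)
    fix u
    have "?A (\<lambda>v. ob u v k + 5 / C k) \<le> 6 / C k" for k
      using ob[of u k] ne by (simp add: avg_add)
    then show "?A (\<lambda>v. 4 * B\<^sup>2 * (\<Sum>k\<in>UNIV. ob u v k + 5 / C k)) \<le> 4 * B\<^sup>2 * (\<Sum>k\<in>UNIV. 6 / C k)"
      unfolding avg_cmult avg_sum by (intro mult_left_mono sum_mono) auto
  qed
  also have "\<dots> = 24 * B\<^sup>2 * (\<Sum>k\<in>UNIV. 1 / real (C k))"
    using ne by (simp add: sum_distrib_left)
  finally show ?thesis .
qed

text \<open>The ghost sample is the continuation of the diagonal, cells \<open>m\<close> to
  \<open>2 * m - 1\<close>. Dissociation makes it independent of the first \<open>m\<close> cells,
  and exchangeability allows \<open>r\<close> and \<open>m + r\<close> to be exchanged in all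
  coordinates at once, which inserts the signs.\<close>

lemma diag_symmetrization:
  fixes g :: "'i \<Rightarrow> 'z \<Rightarrow> real"
  assumes I: "finite I" "I \<noteq> {}" and m: "0 < m"
    and gm: "\<And>\<iota>. \<iota> \<in> I \<Longrightarrow> g \<iota> \<in> borel_measurable E"
    and gi: "\<And>\<iota>. \<iota> \<in> I \<Longrightarrow> integrable M (\<lambda>\<omega>. g \<iota> (Z \<omega> cell1))"
  defines "\<mu> \<equiv> \<lambda>\<iota>. \<integral>\<omega>. g \<iota> (Z \<omega> cell1) \<partial>M"
  shows "(\<integral>\<omega>. mx I (\<lambda>\<iota>. \<bar>avg {..<m} (\<lambda>r. g \<iota> (Z \<omega> (diag r))) - \<mu> \<iota>\<bar>) \<partial>M)
    \<le> 2 * (\<integral>\<omega>. avg (signs m) (\<lambda>e. mx I (\<lambda>\<iota>. \<bar>avg {..<m} (\<lambda>r. e r * g \<iota> (Z \<omega> (diag r)))\<bar>)) \<partial>M)"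
proof -
  have mne: "{..<m} \<noteq> {}" using m by (auto simp: lessThan_empty_iff)
  have gI: "integrable M (\<lambda>\<omega>. g \<iota> (Z \<omega> j))" if "\<iota> \<in> I" for \<iota> j
    using marginal_integrable[OF gm[OF that], of j] gi[OF that] by simp
  have g\<mu>: "(\<integral>\<omega>. g \<iota> (Z \<omega> j) \<partial>M) = \<mu> \<iota>" if "\<iota> \<in> I" for \<iota> j
    using marginal_integral[OF gm[OF that], of j] by (simp add: \<mu>_def)
  define K where "K e x = mx I (\<lambda>\<iota>. \<bar>avg {..<m} (\<lambda>r. e r * (g \<iota> (x (diag r)) - g \<iota> (x (diag (m + r)))))\<bar>)"
    for e :: "nat \<Rightarrow> real" and x :: "('k \<Rightarrow> nat) \<Rightarrow> 'z"
  define R where "R e \<omega> = mx I (\<lambda>\<iota>. \<bar>avg {..<m} (\<lambda>r. e r * g \<iota> (Z \<omega> (diag r)))\<bar>)" for e \<omega>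
  define R' where "R' e \<omega> = mx I (\<lambda>\<iota>. \<bar>avg {..<m} (\<lambda>r. e r * g \<iota> (Z \<omega> (diag (m + r))))\<bar>)" for e \<omega>
  have gP: "(\<lambda>x. g \<iota> (x j)) \<in> borel_measurable (\<Pi>\<^sub>M j\<in>UNIV. E)" if "\<iota> \<in> I" for \<iota> j
    using gm[OF that] by (intro measurable_compose[OF measurable_component_singleton]) auto
  have Km: "K e \<in> borel_measurable (\<Pi>\<^sub>M j\<in>UNIV. E)" for e
    unfolding K_def by (intro mx_measurable I borel_measurable_abs avg_measurable borel_measurable_times borel_measurable_diff gP) auto
  have KI: "integrable M (\<lambda>\<omega>. K e (Z \<omega>))" for e
    unfolding K_def by (intro mx_integrable I integrable_abs integrable_avg integrable_mult_right Bochner_Integration.integrable_diff gI)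
  have RI: "integrable M (R e)" "integrable M (R' e)" for e
    unfolding R_def [abs_def] R'_def [abs_def]
    by (intro mx_integrable I integrable_abs integrable_avg integrable_mult_right gI; assumption)+
  have ghost: "(\<integral>\<omega>. mx I (\<lambda>\<iota>. \<bar>avg {..<m} (\<lambda>r. g \<iota> (Z \<omega> (diag r))) - \<mu> \<iota>\<bar>) \<partial>M) \<le> (\<integral>\<omega>. K (\<lambda>_. 1) (Z \<omega>) \<partial>M)"
  proof -
    \<comment> \<open>With threshold \<open>m - 1\<close> the first \<open>m\<close> diagonal cells
      lie in \<open>L\<close> and, as \<open>m\<close> is positive, all later ones in
      \<open>U\<close>.\<close>
    define L where "L = {j::'k \<Rightarrow> nat. j \<le> diag (m - 1)}"
    define U where "U = {j::'k \<Rightarrow> nat. \<forall>i. diag (m - 1) i < j i}"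
    define PL PU where "PL = (\<Pi>\<^sub>M j\<in>L. E)" and "PU = (\<Pi>\<^sub>M j\<in>U. E)"
    have memL: "diag r \<in> L" if "r < m" for r using that by (auto simp: L_def diag_def le_fun_def)
    have memU: "diag (m + r) \<in> U" for r using m by (auto simp: U_def diag_def)
    have ind: "indep_var PL (\<lambda>\<omega>. restrict (Z \<omega>) L) PU (\<lambda>\<omega>. restrict (Z \<omega>) U)"
      unfolding PL_def PU_def L_def U_def by (rule dissociated)
    have rvL [measurable]: "(\<lambda>\<omega>. restrict (Z \<omega>) L) \<in> M \<rightarrow>\<^sub>M PL" using indep_var_rv1[OF ind] .
    have rvU [measurable]: "(\<lambda>\<omega>. restrict (Z \<omega>) U) \<in> M \<rightarrow>\<^sub>M PU" using indep_var_rv2[OF ind] .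
    define DL DU where "DL = distr M PL (\<lambda>\<omega>. restrict (Z \<omega>) L)" and "DU = distr M PU (\<lambda>\<omega>. restrict (Z \<omega>) U)"
    interpret L: prob_space DL unfolding DL_def by (rule prob_space_distr) measurable
    interpret U: prob_space DU unfolding DU_def by (rule prob_space_distr) measurable
    interpret LU: pair_sigma_finite DL DU ..
    have joint: "DL \<Otimes>\<^sub>M DU = distr M (PL \<Otimes>\<^sub>M PU) (\<lambda>\<omega>. (restrict (Z \<omega>) L, restrict (Z \<omega>) U))"
      using ind unfolding indep_var_distribution_eq DL_def DU_def by simp
    define a where "a \<iota> x = avg {..<m} (\<lambda>r. g \<iota> (x (diag r)))" for \<iota> and x :: "('k \<Rightarrow> nat) \<Rightarrow> 'z"
    define b where "b \<iota> x = avg {..<m} (\<lambda>r. g \<iota> (x (diag (m + r))))" for \<iota> and x :: "('k \<Rightarrow> nat) \<Rightarrow> 'z"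
    have am [measurable]: "a \<iota> \<in> borel_measurable PL" if "\<iota> \<in> I" for \<iota>
      unfolding a_def PL_def using gm[OF that] memL
      by (intro avg_measurable measurable_compose[OF measurable_component_singleton]) auto
    have bm [measurable]: "b \<iota> \<in> borel_measurable PU" if "\<iota> \<in> I" for \<iota>
      unfolding b_def PU_def using gm[OF that] memU
      by (intro avg_measurable measurable_compose[OF measurable_component_singleton]) auto
    have aZ: "a \<iota> (restrict (Z \<omega>) L) = avg {..<m} (\<lambda>r. g \<iota> (Z \<omega> (diag r)))" for \<iota> \<omega>
      unfolding a_def by (intro avg_cong refl) (simp add: memL)
    have bZ: "b \<iota> (restrict (Z \<omega>) U) = avg {..<m} (\<lambda>r. g \<iota> (Z \<omega> (diag (m + r))))" for \<iota> \<omega>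
      unfolding b_def by (intro avg_cong refl) (simp add: memU)
    have bI: "integrable DU (b \<iota>)" if "\<iota> \<in> I" for \<iota>
      unfolding DU_def using bm[OF that] gI[OF that] by (subst integrable_distr_eq) (auto simp: bZ intro!: integrable_avg)
    have b\<mu>: "(\<integral>x. b \<iota> x \<partial>DU) = \<mu> \<iota>" if "\<iota> \<in> I" for \<iota>
      unfolding DU_def using bm[OF that] gI[OF that] m by (subst integral_distr) (auto simp: bZ integral_avg g\<mu>[OF that] lessThan_empty_iff)
    define T where "T p = mx I (\<lambda>\<iota>. \<bar>a \<iota> (fst p) - b \<iota> (snd p)\<bar>)" for p
    have Tm: "T \<in> borel_measurable (PL \<Otimes>\<^sub>M PU)"
      unfolding T_def by (intro mx_measurable I borel_measurable_abs borel_measurable_diff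
          measurable_compose[OF measurable_fst am] measurable_compose[OF measurable_snd bm])
    have TZ: "T (restrict (Z \<omega>) L, restrict (Z \<omega>) U) = K (\<lambda>_. 1) (Z \<omega>)" for \<omega>
      by (simp add: T_def K_def aZ bZ avg_diff)
    have TI: "integrable (DL \<Otimes>\<^sub>M DU) T"
      unfolding joint using Tm KI[of "\<lambda>_. 1"] by (subst integrable_distr_eq) (auto simp: TZ)
    have "(\<integral>\<omega>. mx I (\<lambda>\<iota>. \<bar>avg {..<m} (\<lambda>r. g \<iota> (Z \<omega> (diag r))) - \<mu> \<iota>\<bar>) \<partial>M)
        = (\<integral>x. mx I (\<lambda>\<iota>. \<bar>a \<iota> x - \<mu> \<iota>\<bar>) \<partial>DL)"
      unfolding DL_def by (subst integral_distr) (auto simp: aZ intro!: mx_measurable I borel_measurable_abs borel_measurable_diff am)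
    also have "\<dots> \<le> (\<integral>x. (\<integral>x'. T (x, x') \<partial>DU) \<partial>DL)"
    proof (rule integral_mono)
      have aI: "integrable DL (a \<iota>)" if "\<iota> \<in> I" for \<iota>
        unfolding DL_def using am[OF that] gI[OF that] by (subst integrable_distr_eq) (auto simp: aZ intro!: integrable_avg)
      show "integrable DL (\<lambda>x. mx I (\<lambda>\<iota>. \<bar>a \<iota> x - \<mu> \<iota>\<bar>))"
        by (intro mx_integrable I integrable_abs Bochner_Integration.integrable_diff aI) auto
      show "integrable DL (\<lambda>x. \<integral>x'. T (x, x') \<partial>DU)" using LU.integrable_fst'[OF TI] .
      fix x assume "x \<in> space DL"
      have TxI: "integrable DU (\<lambda>x'. T (x, x'))"
        unfolding T_def fst_conv snd_conv by (intro mx_integrable I integrable_abs Bochner_Integration.integrable_diff bI) auto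
      show "mx I (\<lambda>\<iota>. \<bar>a \<iota> x - \<mu> \<iota>\<bar>) \<le> (\<integral>x'. T (x, x') \<partial>DU)"
      proof (rule mx_le[OF I])
        fix \<iota> assume \<iota>: "\<iota> \<in> I"
        have "a \<iota> x - \<mu> \<iota> = (\<integral>x'. a \<iota> x - b \<iota> x' \<partial>DU)"
          using bI[OF \<iota>] by (simp add: b\<mu>[OF \<iota>] U.prob_space)
        also have "\<bar>\<dots>\<bar> \<le> (\<integral>x'. \<bar>a \<iota> x - b \<iota> x'\<bar> \<partial>DU)" by (rule integral_abs_bound)
        also have "\<dots> \<le> (\<integral>x'. T (x, x') \<partial>DU)"
          using bI[OF \<iota>] TxI by (intro integral_mono) (auto simp: T_def intro!: mx_ge[OF I(1) \<iota>, where f = "\<lambda>\<iota>. \<bar>a \<iota> x - b \<iota> _\<bar>"])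
        finally show "\<bar>a \<iota> x - \<mu> \<iota>\<bar> \<le> (\<integral>x'. T (x, x') \<partial>DU)" .
      qed
    qed
    also have "\<dots> = (\<integral>p. T p \<partial>(DL \<Otimes>\<^sub>M DU))" by (rule LU.integral_fst'[OF TI])
    also have "\<dots> = (\<integral>\<omega>. K (\<lambda>_. 1) (Z \<omega>) \<partial>M)"
      unfolding joint using Tm by (subst integral_distr) (auto simp: TZ)
    finally show ?thesis .
  qed
  have swap: "(\<integral>\<omega>. K (\<lambda>_. 1) (Z \<omega>) \<partial>M) = (\<integral>\<omega>. K e (Z \<omega>) \<partial>M)" if e: "e \<in> signs m" for e
  proof -
    \<comment> \<open>Exchanges \<open>x\<close> and \<open>m + x\<close> exactly where the sign is
      -1.\<close>
    define \<pi> where "\<pi> x = (if x < m then (if e x = -1 then m + x else x) else if x < 2 * m then (if e (x - m) = -1 then x - m else x) else x)" for x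
    have "\<pi> (\<pi> x) = x" for x by (auto simp: \<pi>_def)
    then have bij: "bij \<pi>" by (rule involuntory_imp_bij)
    have "(\<integral>\<omega>. K (\<lambda>_. 1) (Z \<omega>) \<partial>M) = (\<integral>\<omega>. K (\<lambda>_. 1) (\<lambda>j. Z \<omega> (\<lambda>i. \<pi> (j i))) \<partial>M)"
      by (rule transfer_integral[of "\<lambda>_. \<pi>", OF bij Km])
    moreover have "K (\<lambda>_. 1) (\<lambda>j. Z \<omega> (\<lambda>i. \<pi> (j i))) = K e (Z \<omega>)" for \<omega>
    proof -
      have "g \<iota> (Z \<omega> (\<lambda>i. \<pi> (diag r i))) - g \<iota> (Z \<omega> (\<lambda>i. \<pi> (diag (m + r) i))) = e r * (g \<iota> (Z \<omega> (diag r)) - g \<iota> (Z \<omega> (diag (m + r))))"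
        if "r < m" for r \<iota>
        using signsD[OF e that] that by (auto simp: diag_def \<pi>_def)
      then have "avg {..<m} (\<lambda>r. g \<iota> (Z \<omega> (\<lambda>i. \<pi> (diag r i))) - g \<iota> (Z \<omega> (\<lambda>i. \<pi> (diag (m + r) i))))
          = avg {..<m} (\<lambda>r. e r * (g \<iota> (Z \<omega> (diag r)) - g \<iota> (Z \<omega> (diag (m + r)))))" for \<iota>
        by (intro avg_cong) auto
      then show ?thesis by (simp add: K_def)
    qed
    ultimately show ?thesis by simp
  qed
  have RR': "(\<integral>\<omega>. R' e \<omega> \<partial>M) = (\<integral>\<omega>. R e \<omega> \<partial>M)" for e
  proof -
    define \<pi> where "\<pi> x = (if x < m then m + x else if x < 2 * m then x - m else x)" for x
    have "\<pi> (\<pi> x) = x" for x by (auto simp: \<pi>_def)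
    then have bij: "bij \<pi>" by (rule involuntory_imp_bij)
    have m': "(\<lambda>x. mx I (\<lambda>\<iota>. \<bar>avg {..<m} (\<lambda>r. e r * g \<iota> (x (diag r)))\<bar>)) \<in> borel_measurable (\<Pi>\<^sub>M j\<in>UNIV. E)"
      by (intro mx_measurable I borel_measurable_abs avg_measurable borel_measurable_times gP) auto
    have "(\<integral>\<omega>. R e \<omega> \<partial>M) = (\<integral>\<omega>. mx I (\<lambda>\<iota>. \<bar>avg {..<m} (\<lambda>r. e r * g \<iota> (Z \<omega> (\<lambda>i. \<pi> (diag r i))))\<bar>) \<partial>M)"
      unfolding R_def by (rule transfer_integral[of "\<lambda>_. \<pi>", OF bij m'])
    also have "\<dots> = (\<integral>\<omega>. R' e \<omega> \<partial>M)"
      unfolding R'_def by (intro Bochner_Integration.integral_cong refl mx_cong arg_cong[of _ _ abs] avg_cong) (simp add: \<pi>_def diag_def)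
    finally show ?thesis by simp
  qed
  have tri: "(\<integral>\<omega>. K e (Z \<omega>) \<partial>M) \<le> 2 * (\<integral>\<omega>. R e \<omega> \<partial>M)" for e
  proof -
    have "(\<integral>\<omega>. K e (Z \<omega>) \<partial>M) \<le> (\<integral>\<omega>. R e \<omega> + R' e \<omega> \<partial>M)"
    proof (rule integral_mono)
      fix \<omega>
      have "K e (Z \<omega>) \<le> mx I (\<lambda>\<iota>. \<bar>avg {..<m} (\<lambda>r. e r * g \<iota> (Z \<omega> (diag r)))\<bar> + \<bar>avg {..<m} (\<lambda>r. e r * g \<iota> (Z \<omega> (diag (m + r))))\<bar>)"
        unfolding K_def using I by (intro mx_mono) (simp_all add: right_diff_distrib avg_diff)
      also have "\<dots> \<le> R e \<omega> + R' e \<omega>" unfolding R_def R'_def by (rule mx_add[OF I])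
      finally show "K e (Z \<omega>) \<le> R e \<omega> + R' e \<omega>" .
    qed (auto intro: KI RI)
    then show ?thesis using RR'[of e] RI[of e] by simp
  qed
  have "(\<integral>\<omega>. K (\<lambda>_. 1) (Z \<omega>) \<partial>M) = avg (signs m) (\<lambda>e. \<integral>\<omega>. K (\<lambda>_. 1) (Z \<omega>) \<partial>M)" by simp
  also have "\<dots> = avg (signs m) (\<lambda>e. \<integral>\<omega>. K e (Z \<omega>) \<partial>M)" by (intro avg_cong refl swap)
  also have "\<dots> \<le> avg (signs m) (\<lambda>e. 2 * (\<integral>\<omega>. R e \<omega> \<partial>M))" by (intro avg_mono tri)
  also have "\<dots> = 2 * (\<integral>\<omega>. avg (signs m) (\<lambda>e. R e \<omega>) \<partial>M)"
    unfolding avg_cmult by (subst integral_avg) (auto intro: RI)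
  finally show ?thesis using ghost unfolding R_def by linarith
qed

text \<open>The box mean is an average of means over shifted diagonals, and each of these has the
  law of the main diagonal: in coordinate \<open>i\<close> some permutation extends the injective
  map sending \<open>r\<close> to \<open>cshift C a r i\<close>.\<close>

lemma box_symmetrization:
  fixes g :: "'i \<Rightarrow> 'z \<Rightarrow> real" and C :: "'k \<Rightarrow> nat"
  assumes I: "finite I" "I \<noteq> {}" and m: "0 < Cmin C"
    and gm: "\<And>\<iota>. \<iota> \<in> I \<Longrightarrow> g \<iota> \<in> borel_measurable E"
    and gi: "\<And>\<iota>. \<iota> \<in> I \<Longrightarrow> integrable M (\<lambda>\<omega>. g \<iota> (Z \<omega> cell1))"
  defines "\<mu> \<equiv> \<lambda>\<iota>. \<integral>\<omega>. g \<iota> (Z \<omega> cell1) \<partial>M"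
  shows "(\<integral>\<omega>. mx I (\<lambda>\<iota>. \<bar>avg (ibox C) (\<lambda>j. g \<iota> (Z \<omega> j)) - \<mu> \<iota>\<bar>) \<partial>M)
    \<le> 2 * (\<integral>\<omega>. avg (signs (Cmin C)) (\<lambda>e. mx I (\<lambda>\<iota>. \<bar>avg {..<Cmin C} (\<lambda>r. e r * g \<iota> (Z \<omega> (diag r)))\<bar>)) \<partial>M)"
proof -
  define m where "m = Cmin C"
  have m0: "0 < m" using m by (simp add: m_def)
  have C: "0 < C i" for i using m Cmin_le[of C i] by simp
  have ne: "ibox C \<noteq> {}" using ibox_nonempty[of C] C by simp
  have gI: "integrable M (\<lambda>\<omega>. g \<iota> (Z \<omega> j))" if "\<iota> \<in> I" for \<iota> j
    using marginal_integrable[OF gm[OF that], of j] gi[OF that] by simp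
  have gP: "(\<lambda>x. g \<iota> (x j)) \<in> borel_measurable (\<Pi>\<^sub>M j\<in>UNIV. E)" if "\<iota> \<in> I" for \<iota> j
    using gm[OF that] by (intro measurable_compose[OF measurable_component_singleton]) auto
  define D where "D s \<omega> = mx I (\<lambda>\<iota>. \<bar>avg {..<m} (\<lambda>r. g \<iota> (Z \<omega> (s r))) - \<mu> \<iota>\<bar>)" for s \<omega>
  have DI: "integrable M (D s)" for s
    unfolding D_def [abs_def] by (intro mx_integrable I integrable_abs integrable_avg Bochner_Integration.integrable_diff gI) auto
  have "(\<integral>\<omega>. mx I (\<lambda>\<iota>. \<bar>avg (ibox C) (\<lambda>j. g \<iota> (Z \<omega> j)) - \<mu> \<iota>\<bar>) \<partial>M) \<le> (\<integral>\<omega>. avg (ibox C) (\<lambda>a. D (cshift C a) \<omega>) \<partial>M)"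
  proof (rule integral_mono)
    show "integrable M (\<lambda>\<omega>. mx I (\<lambda>\<iota>. \<bar>avg (ibox C) (\<lambda>j. g \<iota> (Z \<omega> j)) - \<mu> \<iota>\<bar>))"
      by (intro mx_integrable I integrable_abs integrable_avg Bochner_Integration.integrable_diff gI) auto
    show "integrable M (\<lambda>\<omega>. avg (ibox C) (\<lambda>a. D (cshift C a) \<omega>))" by (intro integrable_avg DI)
    fix \<omega>
    have "avg (ibox C) (\<lambda>j. g \<iota> (Z \<omega> j)) - \<mu> \<iota> = avg (ibox C) (\<lambda>a. avg {..<m} (\<lambda>r. g \<iota> (Z \<omega> (cshift C a r))) - \<mu> \<iota>)" for \<iota>
      using ne by (subst avg_box_shift_avg[OF C m0]) (simp add: avg_diff)
    then have "mx I (\<lambda>\<iota>. \<bar>avg (ibox C) (\<lambda>j. g \<iota> (Z \<omega> j)) - \<mu> \<iota>\<bar>)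
       \<le> mx I (\<lambda>\<iota>. avg (ibox C) (\<lambda>a. \<bar>avg {..<m} (\<lambda>r. g \<iota> (Z \<omega> (cshift C a r))) - \<mu> \<iota>\<bar>))"
      using I by (intro mx_mono) (simp_all add: abs_avg_le)
    also have "\<dots> \<le> avg (ibox C) (\<lambda>a. D (cshift C a) \<omega>)" unfolding D_def by (rule mx_avg_le[OF I])
    finally show "mx I (\<lambda>\<iota>. \<bar>avg (ibox C) (\<lambda>j. g \<iota> (Z \<omega> j)) - \<mu> \<iota>\<bar>) \<le> avg (ibox C) (\<lambda>a. D (cshift C a) \<omega>)" .
  qed
  also have "\<dots> = avg (ibox C) (\<lambda>a. \<integral>\<omega>. D (cshift C a) \<omega> \<partial>M)" by (intro integral_avg DI)
  also have "\<dots> = avg (ibox C) (\<lambda>a. \<integral>\<omega>. D diag \<omega> \<partial>M)"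
  proof (intro avg_cong refl)
    fix a
    have "\<exists>\<pi>. bij \<pi> \<and> (\<forall>r<m. \<pi> r = cshift C a r i)" for i
      unfolding m_def by (rule bij_extending[OF cshift_inj]) (rule Cmin_le)
    then obtain \<pi> where \<pi>: "\<And>i. bij (\<pi> i)" "\<And>i r. r < m \<Longrightarrow> \<pi> i r = cshift C a r i" by metis
    have m': "(\<lambda>x. mx I (\<lambda>\<iota>. \<bar>avg {..<m} (\<lambda>r. g \<iota> (x (diag r))) - \<mu> \<iota>\<bar>)) \<in> borel_measurable (\<Pi>\<^sub>M j\<in>UNIV. E)"
      by (intro mx_measurable I borel_measurable_abs avg_measurable borel_measurable_diff gP) auto
    have "(\<integral>\<omega>. D diag \<omega> \<partial>M) = (\<integral>\<omega>. mx I (\<lambda>\<iota>. \<bar>avg {..<m} (\<lambda>r. g \<iota> (Z \<omega> (\<lambda>i. \<pi> i (diag r i)))) - \<mu> \<iota>\<bar>) \<partial>M)"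
      unfolding D_def by (rule transfer_integral[OF \<pi>(1) m'])
    also have "\<dots> = (\<integral>\<omega>. D (cshift C a) \<omega> \<partial>M)"
      unfolding D_def by (intro Bochner_Integration.integral_cong refl mx_cong arg_cong[of _ _ abs] arg_cong2[of _ _ _ _ minus] avg_cong)
         (simp add: \<pi>(2) diag_def)
    finally show "(\<integral>\<omega>. D (cshift C a) \<omega> \<partial>M) = (\<integral>\<omega>. D diag \<omega> \<partial>M)" by simp
  qed
  also have "\<dots> = (\<integral>\<omega>. D diag \<omega> \<partial>M)" using ne by simp
  also have "\<dots> \<le> 2 * (\<integral>\<omega>. avg (signs m) (\<lambda>e. mx I (\<lambda>\<iota>. \<bar>avg {..<m} (\<lambda>r. e r * g \<iota> (Z \<omega> (diag r)))\<bar>)) \<partial>M)"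
    unfolding D_def \<mu>_def by (rule diag_symmetrization[OF I m0 gm gi])
  finally show ?thesis by (simp add: m_def)
qed

end

section \<open>The conditional central limit theorem\<close>

text \<open>The bootstrap process at one function, for cell sums \<open>x\<close> and draws
  \<open>d\<close>; \<open>boot_process_counts\<close> makes the identification with the weighted
  sum.\<close>

definition boot_val :: "('k::finite \<Rightarrow> nat) \<Rightarrow> (('k \<Rightarrow> nat) \<Rightarrow> real) \<Rightarrow> ('k \<Rightarrow> nat \<Rightarrow> nat) \<Rightarrow> real" where
  "boot_val C x d = sqrt (real (Cmin C)) * (avg (ibox C) (\<lambda>u. x (pick d u)) - avg (ibox C) x)"

lemma boot_val_diff: "boot_val C (\<lambda>j. x j - y j) d = boot_val C x d - boot_val C y d"
  by (simp add: boot_val_def avg_diff algebra_simps)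

lemma Cmin_inverse_sum:
  fixes C :: "'k::finite \<Rightarrow> nat"
  assumes "0 < Cmin C"
  shows "(\<Sum>i\<in>UNIV. 1 / real (C i)) \<le> real CARD('k) / real (Cmin C)"
proof -
  have "(\<Sum>i\<in>UNIV. 1 / real (C i)) \<le> (\<Sum>i\<in>(UNIV::'k set). 1 / real (Cmin C))"
    using assms Cmin_le[of C] by (intro sum_mono divide_left_mono) (auto intro!: mult_pos_pos less_le_trans[OF assms])
  then show ?thesis by simp
qed

text \<open>Centring \<open>x\<close> at its box mean does not change \<open>boot_val\<close>, and
  \<open>avg_draws_square1\<close> then applies; the factor \<open>Cmin C\<close> cancels against
  the sum of the \<open>1 / C i\<close>. Being uniform in \<open>C\<close>, the bound is what later
  permits truncation.\<close>

lemma boot_val_second_moment: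
  fixes C :: "'k::finite \<Rightarrow> nat"
  assumes m: "0 < Cmin C"
  shows "avg (draws C) (\<lambda>d. (boot_val C x d)\<^sup>2) \<le> real CARD('k) * avg (ibox C) (\<lambda>j. (x j)\<^sup>2)"
proof -
  have pos: "0 < C i" for i using m Cmin_le[of C i] by simp
  have ne: "ibox C \<noteq> {}" using ibox_nonempty[of C] pos by simp
  define c where "c = avg (ibox C) x"
  define R where "R j = x j - c" for j
  have R0: "avg (ibox C) R = 0" using ne by (simp add: R_def[abs_def] c_def avg_diff)
  have S: "avg (ibox C) (\<lambda>j. (R j)\<^sup>2) \<le> avg (ibox C) (\<lambda>j. (x j)\<^sup>2)"
  proof -
    have "avg (ibox C) (\<lambda>j. (R j)\<^sup>2) = avg (ibox C) (\<lambda>j. (x j)\<^sup>2 - 2 * c * x j + c\<^sup>2)"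
      by (simp add: R_def power2_eq_square algebra_simps)
    also have "\<dots> = avg (ibox C) (\<lambda>j. (x j)\<^sup>2) - c\<^sup>2"
      using ne by (simp add: avg_add avg_diff avg_cmult c_def[symmetric] power2_eq_square)
    finally show ?thesis by simp
  qed
  have "boot_val C x d = sqrt (Cmin C) * avg (ibox C) (\<lambda>u. R (pick d u))" for d
    using ne by (simp add: boot_val_def R_def avg_diff c_def)
  then have "avg (draws C) (\<lambda>d. (boot_val C x d)\<^sup>2) = Cmin C * avg (draws C) (\<lambda>d. (avg (ibox C) (\<lambda>u. R (pick d u)))\<^sup>2)"
    by (simp add: power_mult_distrib avg_cmult)
  also have "\<dots> \<le> Cmin C * ((\<Sum>i\<in>UNIV. 1 / real (C i)) * avg (ibox C) (\<lambda>j. (R j)\<^sup>2))"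
    by (intro mult_left_mono avg_draws_square1 pos R0) auto
  also have "\<dots> \<le> Cmin C * ((real CARD('k) / real (Cmin C)) * avg (ibox C) (\<lambda>j. (x j)\<^sup>2))"
    by (intro mult_left_mono mult_mono Cmin_inverse_sum m S avg_nonneg) auto
  also have "\<dots> = real CARD('k) * avg (ibox C) (\<lambda>j. (x j)\<^sup>2)" using m by simp
  finally show ?thesis .
qed

section \<open>Projection onto single coordinates\<close>

lemma avg_box_proj:
  fixes f :: "nat \<Rightarrow> 'b::real_normed_field"
  assumes pos: "\<And>i. 0 < C i"
  shows "avg (ibox C) (\<lambda>v. f (v i)) = avg {..<C i} f"
proof -
  have "avg (ibox C) (\<lambda>v. f (v i)) = avg (ibox C) (\<lambda>v. \<Prod>k\<in>UNIV. (if k = i then f (v k) else 1))"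
    by (intro avg_cong refl) simp
  also have "\<dots> = (\<Prod>k\<in>UNIV. avg {..<C k} (\<lambda>a. if k = i then f a else 1))"
    unfolding ibox_def by (rule avg_PiE_prod) auto
  also have "\<dots> = (\<Prod>k\<in>UNIV. if k = i then avg {..<C i} f else 1)"
  proof (intro prod.cong refl)
    fix k show "avg {..<C k} (\<lambda>a. if k = i then f a else 1) = (if k = i then avg {..<C i} f else 1)"
      using pos[of k] by (cases "k = i") (auto simp: lessThan_empty_iff)
  qed
  finally show ?thesis by simp
qed

text \<open>The first-order component of the Hoeffding decomposition of \<open>x\<close> over the
  box, in coordinate \<open>i\<close> at the value \<open>a\<close>.\<close>

definition slice :: "('k::finite \<Rightarrow> nat) \<Rightarrow> (('k \<Rightarrow> nat) \<Rightarrow> real) \<Rightarrow> 'k \<Rightarrow> nat \<Rightarrow> real" where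
  "slice C x i a = avg (ibox C) (\<lambda>w. x (w(i := a))) - avg (ibox C) x"

definition boot_linear :: "('k::finite \<Rightarrow> nat) \<Rightarrow> (('k \<Rightarrow> nat) \<Rightarrow> real) \<Rightarrow> ('k \<Rightarrow> nat \<Rightarrow> nat) \<Rightarrow> real" where
  "boot_linear C x d = sqrt (real (Cmin C)) * (\<Sum>i\<in>UNIV. avg {..<C i} (\<lambda>r. slice C x i (d i r)))"

definition slice_var :: "('k::finite \<Rightarrow> nat) \<Rightarrow> (('k \<Rightarrow> nat) \<Rightarrow> real) \<Rightarrow> 'k \<Rightarrow> real" where
  "slice_var C x i = avg {..<C i} (\<lambda>a. (slice C x i a)\<^sup>2)"

lemma abs_avg_le_const:
  fixes f :: "'a \<Rightarrow> real"
  assumes "0 \<le> B" "\<And>x. \<bar>f x\<bar> \<le> B" 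
  shows "\<bar>avg A f\<bar> \<le> B"
proof (cases "finite A \<and> A \<noteq> {}")
  case True
  then show ?thesis using order_trans[OF abs_avg_le avg_le_const[of A "\<lambda>x. \<bar>f x\<bar>" B]] assms by auto
next
  case False
  then show ?thesis using assms by (auto simp: avg_def)
qed

lemma slice_bound:
  assumes "0 \<le> B" "\<And>j. \<bar>x j\<bar> \<le> B" shows "\<bar>slice C x i a\<bar> \<le> 2 * B"
  using abs_avg_le_const[of B x "ibox C"] abs_avg_le_const[of B "\<lambda>w. x (w(i := a))" "ibox C"] assms
  by (auto simp: slice_def)

lemma slice_mean:
  assumes pos: "\<And>i. 0 < C i"
  shows "avg {..<C i} (slice C x i) = 0"
proof -
  have "avg {..<C i} (slice C x i) = avg (ibox C) (\<lambda>v. slice C x i (v i))"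
    by (rule avg_box_proj[OF pos, symmetric])
  also have "\<dots> = 0"
    using ibox_nonempty[of C] pos unfolding slice_def avg_diff
    by (subst avg_box_split[where C = C and x = x and i = i, OF pos]) simp
  finally show ?thesis .
qed

text \<open>Writes the slice variance as an average over pairs of cells sharing coordinate
  \<open>i\<close>, which is the shape required by \<open>pair_average_lln\<close>.\<close>

lemma slice_var_eq:
  assumes pos: "\<And>i. 0 < C i"
  shows "slice_var C x i = avg (ibox C) (\<lambda>u. avg (ibox C) (\<lambda>v. x u * x (v(i := u i)))) - (avg (ibox C) x)\<^sup>2"
proof -
  define c where "c = avg (ibox C) x"
  define S where "S a = avg (ibox C) (\<lambda>w. x (w(i := a)))" for a
  have S1: "avg {..<C i} S = c"
    using slice_mean[where C = C and x = x and i = i, OF pos] pos[of i] by (simp add: slice_def[abs_def] S_def[symmetric] avg_diff c_def lessThan_empty_iff)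
  have "slice_var C x i = avg {..<C i} (\<lambda>a. (S a)\<^sup>2 - 2 * c * S a + c\<^sup>2)"
    by (simp add: slice_var_def slice_def S_def c_def power2_eq_square algebra_simps)
  also have "\<dots> = avg {..<C i} (\<lambda>a. (S a)\<^sup>2) - c\<^sup>2"
    using pos[of i] by (simp add: avg_add avg_diff avg_cmult S1 power2_eq_square lessThan_empty_iff)
  also have "avg {..<C i} (\<lambda>a. (S a)\<^sup>2) = avg (ibox C) (\<lambda>v. S (v i) * S (v i))"
    unfolding power2_eq_square by (rule avg_box_proj[OF pos, symmetric])
  also have "\<dots> = avg (ibox C) (\<lambda>w. avg (ibox C) (\<lambda>w'. x (w'(i := w i)) * S (w i)))"
    unfolding avg_multc by (simp add: S_def)
  also have "\<dots> = avg (ibox C) (\<lambda>u. x u * S (u i))"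
    by (subst avg_box_split[where C = C and x = "\<lambda>u. x u * S (u i)" and i = i, OF pos]) simp
  also have "\<dots> = avg (ibox C) (\<lambda>u. avg (ibox C) (\<lambda>v. x u * x (v(i := u i))))"
    unfolding avg_cmult by (simp add: S_def)
  finally show ?thesis by (simp add: c_def)
qed

text \<open>The remainder of the Hajek projection has vanishing coordinate averages, so only pairs of
  index vectors sharing two coordinates contribute to its second moment.\<close>

lemma hajek_projection:
  fixes C :: "'k::finite \<Rightarrow> nat"
  assumes m: "0 < Cmin C" and B: "0 \<le> B" "\<And>j. \<bar>x j\<bar> \<le> B"
  shows "avg (draws C) (\<lambda>d. \<bar>boot_val C x d - boot_linear C x d\<bar>) \<le> 2 * B * real (CARD('k) * (1 + CARD('k))) / sqrt (Cmin C)"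
proof -
  let ?k = "real CARD('k)"
  have pos: "0 < C i" for i using m Cmin_le[of C i] by simp
  have ne: "ibox C \<noteq> {}" using ibox_nonempty[of C] pos by simp
  define R where "R j = x j - avg (ibox C) x - (\<Sum>i\<in>UNIV. slice C x i (j i))" for j
  have Rb: "\<bar>R j\<bar> \<le> 2 * B * (1 + ?k)" for j
  proof -
    have "\<bar>\<Sum>i\<in>UNIV. slice C x i (j i)\<bar> \<le> (\<Sum>i\<in>(UNIV::'k set). 2 * B)"
      by (intro order_trans[OF sum_abs] sum_mono slice_bound B)
    moreover have "\<bar>avg (ibox C) x\<bar> \<le> B" by (rule abs_avg_le_const[OF B])
    ultimately have "\<bar>R j\<bar> \<le> B + B + ?k * (2 * B)" using B(2)[of j] unfolding R_def by simp
    then show ?thesis by (simp add: algebra_simps)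
  qed
  \<comment> \<open>With coordinate \<open>i\<close> fixed at \<open>a\<close>, the slices of the
    other coordinates average to 0 and the slice of coordinate \<open>i\<close> cancels the mean of
    \<open>x\<close>.\<close>
  have R0: "avg (ibox C) (\<lambda>w. R (w(i := a))) = 0" if a: "a < C i" for i a
  proof -
    have sl: "avg (ibox C) (\<lambda>w. slice C x k ((w(i := a)) k)) = (if k = i then slice C x i a else 0)" for k
      using ne by (cases "k = i") (simp_all add: avg_box_proj[where C = C and f = "slice C x k" and i = k, OF pos] slice_mean[where C = C and x = x and i = k, OF pos])
    have "avg (ibox C) (\<lambda>w. R (w(i := a))) = slice C x i a - (\<Sum>k\<in>UNIV. avg (ibox C) (\<lambda>w. slice C x k ((w(i := a)) k)))"
      unfolding R_def avg_diff avg_sum using ne by (simp add: slice_def)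
    then show ?thesis unfolding sl by simp
  qed
  have eq: "boot_val C x d - boot_linear C x d = sqrt (Cmin C) * avg (ibox C) (\<lambda>u. R (pick d u))" for d
  proof -
    have "avg (ibox C) (\<lambda>u. slice C x i (pick d u i)) = avg {..<C i} (\<lambda>r. slice C x i (d i r))" for i
      unfolding pick_def by (rule avg_box_proj[OF pos, where f = "\<lambda>r. slice C x i (d i r)"])
    then have aR: "avg (ibox C) (\<lambda>u. R (pick d u)) = avg (ibox C) (\<lambda>u. x (pick d u)) - avg (ibox C) x - (\<Sum>i\<in>UNIV. avg {..<C i} (\<lambda>r. slice C x i (d i r)))"
      unfolding R_def avg_diff avg_sum using ne by simp
    show ?thesis by (simp only: boot_val_def boot_linear_def aR right_diff_distrib)
  qed
  have "avg (draws C) (\<lambda>d. \<bar>boot_val C x d - boot_linear C x d\<bar>) \<le> sqrt (avg (draws C) (\<lambda>d. (boot_val C x d - boot_linear C x d)\<^sup>2))"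
    by (rule avg_abs_le_sqrt)
  also have "\<dots> \<le> sqrt ((2 * B * (?k * (1 + ?k)) / sqrt (Cmin C))\<^sup>2)"
  proof (rule real_sqrt_le_mono)
    have "avg (draws C) (\<lambda>d. (boot_val C x d - boot_linear C x d)\<^sup>2) = Cmin C * avg (draws C) (\<lambda>d. (avg (ibox C) (\<lambda>u. R (pick d u)))\<^sup>2)"
      by (simp add: eq power_mult_distrib avg_cmult)
    also have "\<dots> \<le> Cmin C * ((\<Sum>i\<in>UNIV. \<Sum>j\<in>UNIV. 1 / (real (C i) * real (C j))) * avg (ibox C) (\<lambda>u. (R u)\<^sup>2))"
      by (intro mult_left_mono avg_draws_square2 pos R0) auto
    also have "\<dots> \<le> Cmin C * ((?k / real (Cmin C))\<^sup>2 * (2 * B * (1 + ?k))\<^sup>2)"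
    proof (intro mult_left_mono mult_mono)
      have "(\<Sum>i\<in>UNIV. \<Sum>j\<in>UNIV. 1 / (real (C i) * real (C j))) = (\<Sum>i\<in>UNIV. 1 / real (C i))\<^sup>2"
        by (simp add: power2_eq_square sum_product)
      also have "\<dots> \<le> (?k / real (Cmin C))\<^sup>2"
        by (intro power_mono Cmin_inverse_sum m sum_nonneg) auto
      finally show "(\<Sum>i\<in>UNIV. \<Sum>j\<in>UNIV. 1 / (real (C i) * real (C j))) \<le> (?k / real (Cmin C))\<^sup>2" .
      show "avg (ibox C) (\<lambda>u. (R u)\<^sup>2) \<le> (2 * B * (1 + ?k))\<^sup>2"
        using ne Rb B(1) by (intro avg_le_const) (auto simp: abs_le_square_iff[symmetric] abs_mult)
    qed (auto intro: avg_nonneg)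
    also have "\<dots> = (2 * B * (?k * (1 + ?k)) / sqrt (Cmin C))\<^sup>2"
      using m by (simp add: power_divide power_mult_distrib power2_eq_square)
    finally show "avg (draws C) (\<lambda>d. (boot_val C x d - boot_linear C x d)\<^sup>2) \<le> (2 * B * (?k * (1 + ?k)) / sqrt (Cmin C))\<^sup>2" .
  qed
  also have "\<dots> = 2 * B * (?k * (1 + ?k)) / sqrt (Cmin C)"
    using B(1) by (simp add: mult_nonneg_nonneg)
  finally show ?thesis by (simp add: algebra_simps)
qed

section \<open>Characteristic functions of the linear part\<close>

lemma exp_neg_taylor: "0 \<le> x \<Longrightarrow> \<bar>exp (- x) - (1 - x)\<bar> \<le> x\<^sup>2 / 2" for x :: real
proof -
  assume x: "0 \<le> x"
  have "(\<lambda>x. 1 - x + x\<^sup>2 / 2 - exp (- x)) 0 \<le> (\<lambda>x. 1 - x + x\<^sup>2 / 2 - exp (- x)) x"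
    using x
  proof (rule DERIV_nonneg_imp_nondecreasing)
    fix z :: real
    show "\<exists>d. ((\<lambda>x. 1 - x + x\<^sup>2 / 2 - exp (- x)) has_real_derivative d) (at z) \<and> 0 \<le> d"
      using exp_ge_add_one_self[of "- z"]
      by (intro exI[of _ "- 1 + z + exp (- z)"]) (auto intro!: derivative_eq_intros)
  qed
  then show ?thesis using exp_ge_add_one_self[of "- x"] by simp
qed

lemma exp_neg_lipschitz: "0 \<le> a \<Longrightarrow> 0 \<le> b \<Longrightarrow> \<bar>exp (- a) - exp (- b)\<bar> \<le> \<bar>a - b\<bar>" for a b :: real
proof (induction a b rule: linorder_wlog)
  case (le a b)
  have "exp (- a) - exp (- b) = exp (- a) * (1 - exp (- (b - a)))"
    by (simp add: algebra_simps exp_add [symmetric])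
  also have "\<dots> \<le> 1 * (b - a)"
  proof (rule mult_mono)
    show "1 - exp (- (b - a)) \<le> b - a" using exp_ge_add_one_self[of "- (b - a)"] by linarith
  qed (use le in auto)
  finally show ?case using le by simp
next
  case (sym a b) then show ?case by (simp add: abs_minus_commute)
qed

lemma iexp_lipschitz: "cmod (iexp a - iexp b) \<le> \<bar>a - b\<bar>" for a b :: real
proof -
  have "iexp a - iexp b = iexp b * (iexp (a - b) - 1)"
    by (simp add: algebra_simps exp_add [symmetric])
  then have "cmod (iexp a - iexp b) = cmod (iexp (a - b) - 1)"
    by (simp add: norm_mult)
  also have "\<dots> \<le> \<bar>a - b\<bar>" using iexp_approx1[of "a - b" 0] by simp
  finally show ?thesis .
qed

text \<open>A central limit theorem with explicit error for \<open>n\<close> uniform draws from the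
  values \<open>y\<close>: the empirical characteristic function is compared with
  \<open>1 - s^2 * v / 2\<close> to third order, this in turn with its exponential, and in the unit
  disc the distance of \<open>n\<close>-th powers is at most \<open>n\<close> times the distance of
  the bases.\<close>

lemma char_average_power:
  fixes y :: "nat \<Rightarrow> real"
  assumes n: "0 < n" and mean: "avg {..<n} y = 0" and y: "\<And>a. \<bar>y a\<bar> \<le> b" and s: "0 \<le> s"
  shows "cmod ((avg {..<n} (\<lambda>a. iexp (s * y a)))^n - complex_of_real (exp (- (n * s\<^sup>2 * avg {..<n} (\<lambda>a. (y a)\<^sup>2) / 2))))
    \<le> n * ((s * b)^3 / 6 + (s * b)^4 / 8)"
proof -
  define v where "v = avg {..<n} (\<lambda>a. (y a)\<^sup>2)"
  have ne: "{..<n} \<noteq> {}" using n by (auto simp: lessThan_empty_iff)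
  have b: "0 \<le> b" using order_trans[OF abs_ge_zero y] .
  have v: "0 \<le> v" "v \<le> b\<^sup>2"
    unfolding v_def using ne y b by (auto intro!: avg_nonneg avg_le_const simp: abs_le_square_iff[symmetric])
  let ?\<phi> = "avg {..<n} (\<lambda>a. iexp (s * y a))"
  let ?e = "complex_of_real (exp (- (s\<^sup>2 * v / 2)))"
  have "?\<phi> - complex_of_real (1 - s\<^sup>2 * v / 2) = avg {..<n} (\<lambda>a. iexp (s * y a) - (1 + \<i> * (s * y a) - (s * y a)\<^sup>2 / 2))"
  proof -
    have ofr: "avg {..<n} (\<lambda>a. complex_of_real (f a)) = complex_of_real (avg {..<n} f)" for f
      by (simp add: avg_def)
    have "avg {..<n} (\<lambda>a. \<i> * complex_of_real (s * y a)) = \<i> * complex_of_real (s * avg {..<n} y)"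
      by (simp add: avg_cmult ofr)
    moreover have "avg {..<n} (\<lambda>a. complex_of_real ((s * y a)\<^sup>2 / 2)) = complex_of_real (s\<^sup>2 * v / 2)"
      unfolding ofr v_def power_mult_distrib avg_divide avg_cmult ..
    ultimately show ?thesis
      using ne mean by (simp add: avg_diff avg_add)
  qed
  also have "cmod \<dots> \<le> avg {..<n} (\<lambda>a. cmod (iexp (s * y a) - (1 + \<i> * (s * y a) - (s * y a)\<^sup>2 / 2)))"
    by (rule norm_avg_le)
  also have "\<dots> \<le> avg {..<n} (\<lambda>a. (s * b)^3 / 6)"
  proof (rule avg_mono)
    fix a
    have "cmod (iexp (s * y a) - (\<Sum>k\<le>2. (\<i> * (s * y a))^k / fact k)) \<le> \<bar>s * y a\<bar>^Suc 2 / fact (Suc 2)"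
      by (rule iexp_approx1)
    also have "(\<Sum>k\<le>2. (\<i> * complex_of_real (s * y a))^k / fact k) = 1 + \<i> * (s * y a) - (s * y a)\<^sup>2 / 2"
    proof -
      have "{..2::nat} = {0, 1, 2}" by auto
      then show ?thesis by (simp add: power_mult_distrib)
    qed
    also have "\<bar>s * y a\<bar>^Suc 2 / fact (Suc 2) \<le> (s * b)^3 / 6"
      using y[of a] s by (simp add: fact_numeral numeral_3_eq_3 abs_mult del: power_Suc) (intro power_mono mult_left_mono, auto)
    finally show "cmod (iexp (s * y a) - (1 + \<i> * (s * y a) - (s * y a)\<^sup>2 / 2)) \<le> (s * b)^3 / 6" .
  qed
  also have "\<dots> = (s * b)^3 / 6" using ne by simp
  finally have 1: "cmod (?\<phi> - complex_of_real (1 - s\<^sup>2 * v / 2)) \<le> (s * b)^3 / 6" .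
  have "\<bar>exp (- (s\<^sup>2 * v / 2)) - (1 - s\<^sup>2 * v / 2)\<bar> \<le> (s\<^sup>2 * v / 2)\<^sup>2 / 2"
    using v by (intro exp_neg_taylor) auto
  also have "\<dots> \<le> (s\<^sup>2 * b\<^sup>2 / 2)\<^sup>2 / 2"
    using v by (intro divide_right_mono power_mono mult_left_mono) auto
  also have "\<dots> = (s * b)^4 / 8"
    by (simp add: power_mult_distrib power_divide power2_eq_square power4_eq_xxxx)
  finally have 2: "cmod (?e - complex_of_real (1 - s\<^sup>2 * v / 2)) \<le> (s * b)^4 / 8"
    unfolding of_real_diff [symmetric] norm_of_real .
  have "cmod (?\<phi> - ?e) \<le> (s * b)^3 / 6 + (s * b)^4 / 8"
    using norm_triangle_ineq4[of "?\<phi> - complex_of_real (1 - s\<^sup>2 * v / 2)" "?e - complex_of_real (1 - s\<^sup>2 * v / 2)"] 1 2 by simp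
  moreover have "cmod ?\<phi> \<le> 1"
    using ne order_trans[OF norm_avg_le avg_le_const[of "{..<n}" "\<lambda>a. cmod (iexp (s * y a))" 1]] by simp
  moreover have "cmod ?e \<le> 1" using v by simp
  ultimately have "cmod (?\<phi>^n - ?e^n) \<le> n * ((s * b)^3 / 6 + (s * b)^4 / 8)"
    using norm_power_diff[of ?\<phi> ?e n] by (meson mult_left_mono of_nat_0_le_iff order_trans)
  moreover have "?e^n = complex_of_real (exp (- (n * s\<^sup>2 * v / 2)))"
    by (simp add: exp_of_nat_mult [symmetric] of_real_power [symmetric] mult.assoc del: of_real_power)
  ultimately show ?thesis by (simp add: v_def)
qed

text \<open>Draws are independent across coordinates and within each coordinate, so the average over
  draws factorizes completely and leaves a \<open>C i\<close>-th power for coordinate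
  \<open>i\<close>.\<close>

lemma boot_linear_char:
  fixes C :: "'k::finite \<Rightarrow> nat"
  assumes m: "0 < Cmin C" and B: "0 \<le> B" "\<And>j. \<bar>x j\<bar> \<le> B"
  shows "cmod (avg (draws C) (\<lambda>d. iexp (boot_linear C x d))
      - complex_of_real (exp (- ((\<Sum>i\<in>UNIV. real (Cmin C) / real (C i) * slice_var C x i) / 2))))
    \<le> real CARD('k) * ((2 * B)^3 / 6 + (2 * B)^4 / 8) / sqrt (Cmin C)"
proof -
  define M where "M = real (Cmin C)"
  have M: "0 < M" using m by (simp add: M_def)
  have MC: "M \<le> real (C i)" for i by (simp add: M_def Cmin_le)
  have pos: "0 < C i" for i using m Cmin_le[of C i] by simp
  define s where "s i = sqrt M / real (C i)" for i
  have s0: "0 \<le> s i" for i by (simp add: s_def M_def)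
  define \<phi> where "\<phi> i = (avg {..<C i} (\<lambda>a. iexp (s i * slice C x i a)))^C i" for i
  define e where "e i = complex_of_real (exp (- (M / real (C i) * slice_var C x i / 2)))" for i
  have "avg (draws C) (\<lambda>d. iexp (boot_linear C x d)) = avg (draws C) (\<lambda>d. \<Prod>i\<in>UNIV. \<Prod>r<C i. iexp (s i * slice C x i (d i r)))"
  proof (intro avg_cong refl)
    fix d
    have "boot_linear C x d = (\<Sum>i\<in>UNIV. \<Sum>r<C i. s i * slice C x i (d i r))"
      by (simp add: boot_linear_def s_def M_def avg_def sum_distrib_left sum_divide_distrib)
    then show "iexp (boot_linear C x d) = (\<Prod>i\<in>UNIV. \<Prod>r<C i. iexp (s i * slice C x i (d i r)))"
      by (simp add: exp_sum sum_distrib_left)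
  qed
  also have "\<dots> = (\<Prod>i\<in>UNIV. avg (PiE {..<C i} (\<lambda>_. {..<C i})) (\<lambda>\<delta>. \<Prod>r<C i. iexp (s i * slice C x i (\<delta> r))))"
    unfolding draws_def
    by (rule avg_PiE_prod[where f = "\<lambda>i \<delta>. \<Prod>r<C i. iexp (s i * slice C x i (\<delta> r))"]) (auto intro!: finite_PiE)
  also have "\<dots> = (\<Prod>i\<in>UNIV. \<phi> i)"
  proof (intro prod.cong refl)
    fix i
    have "avg (PiE {..<C i} (\<lambda>_. {..<C i})) (\<lambda>\<delta>. \<Prod>r<C i. iexp (s i * slice C x i (\<delta> r)))
       = (\<Prod>r<C i. avg {..<C i} (\<lambda>a. iexp (s i * slice C x i a)))"
      by (rule avg_PiE_prod[where f = "\<lambda>r a. iexp (s i * slice C x i a)"]) auto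
    then show "avg (PiE {..<C i} (\<lambda>_. {..<C i})) (\<lambda>\<delta>. \<Prod>r<C i. iexp (s i * slice C x i (\<delta> r))) = \<phi> i"
      by (simp add: \<phi>_def)
  qed
  finally have 1: "avg (draws C) (\<lambda>d. iexp (boot_linear C x d)) = (\<Prod>i\<in>UNIV. \<phi> i)" .
  have 2: "complex_of_real (exp (- ((\<Sum>i\<in>UNIV. M / real (C i) * slice_var C x i) / 2))) = (\<Prod>i\<in>UNIV. e i)"
    by (simp add: e_def exp_sum [symmetric] sum_negf sum_divide_distrib of_real_prod [symmetric] del: of_real_prod)
  have \<phi>1: "cmod (\<phi> i) \<le> 1" for i
  proof -
    have "cmod (avg {..<C i} (\<lambda>a. iexp (s i * slice C x i a))) \<le> 1"
      using pos[of i] order_trans[OF norm_avg_le avg_le_const[of "{..<C i}" "\<lambda>a. cmod (iexp (s i * slice C x i a))" 1]]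
      by (simp add: lessThan_empty_iff)
    then show ?thesis by (simp add: \<phi>_def norm_power power_le_one)
  qed
  have sv: "0 \<le> slice_var C x i" for i unfolding slice_var_def by (rule avg_nonneg) simp
  have e1: "cmod (e i) \<le> 1" for i using sv[of i] M by (simp add: e_def)
  have diff: "cmod (\<phi> i - e i) \<le> ((2 * B)^3 / 6 + (2 * B)^4 / 8) / sqrt M" for i
  proof -
    define n where "n = real (C i)"
    have n: "0 < n" "M \<le> n" "1 \<le> n" using MC[of i] M pos[of i] by (auto simp: n_def)
    have ns2: "n * (s i)\<^sup>2 = M / n" using M n by (simp add: s_def n_def power_divide power2_eq_square)
    \<comment> \<open>Since \<open>n * (s i)^2 <= 1\<close> and \<open>s i <= 1 / sqrt M\<close>,
      the cubic and the quartic remainder, each multiplied by \<open>n\<close>, are both of order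
      \<open>1 / sqrt M\<close>.\<close>
    have b1: "n * (s i)\<^sup>2 \<le> 1" using n M by (simp add: ns2)
    have b2: "s i \<le> 1 / sqrt M"
    proof -
      define q where "q = sqrt M"
      have q: "q > 0" "M = q * q" using M by (auto simp: q_def)
      have "s i = M / n / sqrt M" unfolding s_def n_def q_def [symmetric] using q by simp
      also have "\<dots> \<le> 1 / sqrt M" using n M by (intro divide_right_mono) auto
      finally show ?thesis .
    qed
    have M1: "1 \<le> M" using m by (simp add: M_def Suc_le_eq)
    have b3: "s i \<le> 1" using b2 M1 by (meson divide_le_eq_1_pos order_trans real_sqrt_ge_one zero_less_one less_le_trans)
    have "cmod (\<phi> i - e i) \<le> C i * ((s i * (2 * B))^3 / 6 + (s i * (2 * B))^4 / 8)"
      using char_average_power[where n = "C i" and y = "slice C x i" and b = "2 * B" and s = "s i", OF pos slice_mean[where C = C and x = x and i = i, OF pos] slice_bound[OF B] s0]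
      unfolding \<phi>_def e_def slice_var_def [symmetric] ns2[unfolded n_def] .
    also have "\<dots> = (n * (s i)\<^sup>2) * s i * ((2 * B)^3 / 6) + (n * (s i)\<^sup>2) * s i * s i * ((2 * B)^4 / 8)"
      by (simp add: n_def power_mult_distrib algebra_simps power2_eq_square power3_eq_cube power4_eq_xxxx)
    also have "\<dots> \<le> 1 * (1 / sqrt M) * ((2 * B)^3 / 6) + 1 * (1 / sqrt M) * 1 * ((2 * B)^4 / 8)"
      using b1 b2 b3 s0[of i] B(1) M n by (intro add_mono mult_mono) auto
    finally show ?thesis by (simp add: add_divide_distrib)
  qed
  have "cmod ((\<Prod>i\<in>UNIV. \<phi> i) - (\<Prod>i\<in>UNIV. e i)) \<le> (\<Sum>i\<in>UNIV. cmod (\<phi> i - e i))"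
    by (rule norm_prod_diff) (auto simp: \<phi>1 e1)
  also have "\<dots> \<le> (\<Sum>i\<in>(UNIV::'k set). ((2 * B)^3 / 6 + (2 * B)^4 / 8) / sqrt M)"
    by (intro sum_mono diff)
  finally show ?thesis unfolding 1 2[unfolded M_def] by (simp add: M_def)
qed

definition clt_rate :: "nat \<Rightarrow> real \<Rightarrow> real" where
  "clt_rate k B = 2 * B * real (k * (1 + k)) + real k * ((2 * B)^3 / 6 + (2 * B)^4 / 8)"

text \<open>The intended limit variance \<open>V\<close> is not yet known to be nonnegative. The sum
  of slice variances is, so replacing \<open>V\<close> by \<open>max 0 V\<close> does not increase
  the distance between them.\<close>

lemma boot_char_bounded:
  fixes C :: "'k::finite \<Rightarrow> nat"
  assumes m: "0 < Cmin C" and B: "0 \<le> B" "\<And>j. \<bar>x j\<bar> \<le> B"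
  shows "cmod (avg (draws C) (\<lambda>d. iexp (boot_val C x d)) - complex_of_real (exp (- (max 0 V / 2))))
    \<le> clt_rate CARD('k) B / sqrt (Cmin C) + \<bar>(\<Sum>i\<in>UNIV. real (Cmin C) / real (C i) * slice_var C x i) - V\<bar>"
proof -
  define S where "S = (\<Sum>i\<in>UNIV. real (Cmin C) / real (C i) * slice_var C x i)"
  have S0: "0 \<le> S" unfolding S_def slice_var_def by (intro sum_nonneg mult_nonneg_nonneg avg_nonneg) auto
  have "cmod (avg (draws C) (\<lambda>d. iexp (boot_val C x d)) - avg (draws C) (\<lambda>d. iexp (boot_linear C x d)))
      \<le> avg (draws C) (\<lambda>d. \<bar>boot_val C x d - boot_linear C x d\<bar>)"
    unfolding avg_diff [symmetric] by (intro order_trans[OF norm_avg_le] avg_mono iexp_lipschitz)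
  also note hajek_projection[OF m B]
  finally have 1: "cmod (avg (draws C) (\<lambda>d. iexp (boot_val C x d)) - avg (draws C) (\<lambda>d. iexp (boot_linear C x d)))
      \<le> 2 * B * real (CARD('k) * (1 + CARD('k))) / sqrt (Cmin C)" by blast
  have 2: "cmod (avg (draws C) (\<lambda>d. iexp (boot_linear C x d)) - complex_of_real (exp (- (S / 2))))
    \<le> real CARD('k) * ((2 * B)^3 / 6 + (2 * B)^4 / 8) / sqrt (Cmin C)"
    unfolding S_def by (rule boot_linear_char[OF m B])
  have "\<bar>exp (- (S / 2)) - exp (- (max 0 V / 2))\<bar> \<le> \<bar>S / 2 - max 0 V / 2\<bar>"
    using S0 by (intro exp_neg_lipschitz) auto
  also have "\<dots> \<le> \<bar>S - V\<bar>" using S0 by (auto simp: max_def)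
  finally have 3: "cmod (complex_of_real (exp (- (S / 2))) - complex_of_real (exp (- (max 0 V / 2)))) \<le> \<bar>S - V\<bar>"
    unfolding of_real_diff [symmetric] norm_of_real .
  show ?thesis
    unfolding S_def [symmetric] clt_rate_def add_divide_distrib
    using norm_diff_triangle_le[OF norm_diff_triangle_le[OF 1 2] 3] by simp
qed

section \<open>Trigonometric approximation of bounded Lipschitz functions\<close>

text \<open>Indexing by naturals keeps an additional type variable out of the predicate;
  \<open>trig_polyI\<close> admits any finite index set.\<close>

definition trig_poly :: "'t set \<Rightarrow> (('t \<Rightarrow> real) \<Rightarrow> complex) \<Rightarrow> bool" where
  "trig_poly T g \<longleftrightarrow> (\<exists>(I :: nat set) c l. finite I \<and> g = (\<lambda>x. \<Sum>n\<in>I. c n * iexp (\<Sum>t\<in>T. l n t * x t)))"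

lemma trig_polyI:
  fixes c :: "'i \<Rightarrow> complex" and l :: "'i \<Rightarrow> 't \<Rightarrow> real"
  assumes "finite I" "\<And>x. g x = (\<Sum>n\<in>I. c n * iexp (\<Sum>t\<in>T. l n t * x t))"
  shows "trig_poly T g"
proof -
  obtain f :: "nat \<Rightarrow> 'i" where f: "bij_betw f {..<card I} I"
    using ex_bij_betw_nat_finite[OF assms(1)] by (auto simp: atLeast0LessThan)
  have "g = (\<lambda>x. \<Sum>n\<in>{..<card I}. c (f n) * iexp (\<Sum>t\<in>T. l (f n) t * x t))"
  proof
    fix x
    show "g x = (\<Sum>n\<in>{..<card I}. c (f n) * iexp (\<Sum>t\<in>T. l (f n) t * x t))"
      using sum.reindex_bij_betw[OF f, of "\<lambda>n. c n * iexp (\<Sum>t\<in>T. l n t * x t)"] assms(2)[of x] by simp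
  qed
  then show ?thesis unfolding trig_poly_def
    by (intro exI[of _ "{..<card I}"] exI[of _ "\<lambda>n. c (f n)"] exI[of _ "\<lambda>n. l (f n)"]) auto
qed

lemma trig_poly_const: "trig_poly T (\<lambda>x. c)"
  by (rule trig_polyI[of "{()}" _ "\<lambda>_. c" "\<lambda>_ _. 0"]) auto

lemma trig_poly_mult:
  assumes "trig_poly T f" "trig_poly T g" shows "trig_poly T (\<lambda>x. f x * g x)"
proof -
  obtain I :: "nat set" and c l where f: "finite I" "f = (\<lambda>x. \<Sum>n\<in>I. c n * iexp (\<Sum>t\<in>T. l n t * x t))"
    using assms(1) unfolding trig_poly_def by blast
  obtain J :: "nat set" and c' l' where g: "finite J" "g = (\<lambda>x. \<Sum>n\<in>J. c' n * iexp (\<Sum>t\<in>T. l' n t * x t))"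
    using assms(2) unfolding trig_poly_def by blast
  show ?thesis
  proof (rule trig_polyI[of "I \<times> J" _ "\<lambda>p. c (fst p) * c' (snd p)" "\<lambda>p t. l (fst p) t + l' (snd p) t"])
    fix x
    have "f x * g x = (\<Sum>p\<in>I \<times> J. (c (fst p) * iexp (\<Sum>t\<in>T. l (fst p) t * x t)) * (c' (snd p) * iexp (\<Sum>t\<in>T. l' (snd p) t * x t)))"
      unfolding f g by (simp add: sum_product sum.cartesian_product case_prod_unfold)
    also have "\<dots> = (\<Sum>p\<in>I \<times> J. c (fst p) * c' (snd p) * iexp (\<Sum>t\<in>T. (l (fst p) t + l' (snd p) t) * x t))"
      by (intro sum.cong refl) (simp add: distrib_right sum.distrib exp_add [symmetric] distrib_left)
    finally show "f x * g x = (\<Sum>p\<in>I \<times> J. c (fst p) * c' (snd p) * iexp (\<Sum>t\<in>T. (l (fst p) t + l' (snd p) t) * x t))" .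
  qed (use f g in auto)
qed

lemma trig_poly_add:
  assumes "trig_poly T f" "trig_poly T g" shows "trig_poly T (\<lambda>x. f x + g x)"
proof -
  obtain I :: "nat set" and c l where f: "finite I" "f = (\<lambda>x. \<Sum>n\<in>I. c n * iexp (\<Sum>t\<in>T. l n t * x t))"
    using assms(1) unfolding trig_poly_def by blast
  obtain J :: "nat set" and c' l' where g: "finite J" "g = (\<lambda>x. \<Sum>n\<in>J. c' n * iexp (\<Sum>t\<in>T. l' n t * x t))"
    using assms(2) unfolding trig_poly_def by blast
  show ?thesis
    by (rule trig_polyI[of "I <+> J" _ "case_sum c c'" "case_sum l l'"]) (use f g in \<open>auto simp: sum.Plus\<close>)
qed

lemma trig_poly_power: "trig_poly T f \<Longrightarrow> trig_poly T (\<lambda>x. f x ^ n)"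
  by (induction n) (auto intro: trig_poly_const trig_poly_mult)

lemma trig_poly_prod: "finite S \<Longrightarrow> (\<And>s. s \<in> S \<Longrightarrow> trig_poly T (f s)) \<Longrightarrow> trig_poly T (\<lambda>x. \<Prod>s\<in>S. f s x)"
  by (induction S rule: finite_induct) (auto intro: trig_poly_const trig_poly_mult)

lemma trig_poly_cos:
  assumes "finite T" "t \<in> T" shows "trig_poly T (\<lambda>x. complex_of_real (cos (b * x t - a)))"
proof (rule trig_polyI[of "{False, True}" _ "\<lambda>p. (if p then iexp (- a) else iexp a) / 2" "\<lambda>p t'. if t' = t then (if p then b else - b) else 0"])
  fix x
  have S: "(\<Sum>t'\<in>T. (if t' = t then c else 0) * x t') = c * x t" for c :: real
    using assms by (simp add: if_distrib[of "\<lambda>c. c * _"] cong: if_cong)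
  have "\<i> * complex_of_real a + \<i> * complex_of_real (- b * x t) = \<i> * complex_of_real (- (b * x t - a))"
    by (simp add: algebra_simps)
  then have e1: "iexp a / 2 * iexp (- b * x t) = iexp (- (b * x t - a)) / 2"
    by (simp only: times_divide_eq_left exp_add [symmetric])
  have "\<i> * complex_of_real (- a) + \<i> * complex_of_real (b * x t) = \<i> * complex_of_real (b * x t - a)"
    by (simp add: algebra_simps)
  then have e2: "iexp (- a) / 2 * iexp (b * x t) = iexp (b * x t - a) / 2"
    by (simp only: times_divide_eq_left exp_add [symmetric])
  have "complex_of_real (cos (b * x t - a)) = (iexp (b * x t - a) + iexp (- (b * x t - a))) / 2"
    unfolding cos_of_real [symmetric] cos_exp_eq by (simp add: algebra_simps)
  also have "\<dots> = iexp a / 2 * iexp (- b * x t) + iexp (- a) / 2 * iexp (b * x t)"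
    unfolding e1 e2 by (simp add: add_divide_distrib)
  also have "\<dots> = (\<Sum>n\<in>{False, True}. (if n then iexp (- a) else iexp a) / 2 * iexp (\<Sum>t'\<in>T. (if t' = t then if n then b else - b else 0) * x t'))"
    unfolding S by simp
  finally show "complex_of_real (cos (b * x t - a)) = (\<Sum>n\<in>{False, True}. (if n then iexp (- a) else iexp a) / 2 * iexp (\<Sum>t'\<in>T. (if t' = t then if n then b else - b else 0) * x t'))" .
qed auto

text \<open>The de la Vallee Poussin kernel \<open>((1 + cos u) / 2)\<^sup>N\<close>: its sum over a grid of
  \<open>L > N\<close> equidistant angles does not depend on the offset \<open>u\<close>.\<close>

definition vp_grid :: "nat \<Rightarrow> nat \<Rightarrow> real" where
  "vp_grid L a = 2 * pi * real a / real L - pi"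

lemma sum_roots_of_unity:
  assumes L: "0 < L" and k: "\<bar>k\<bar> < int L" "k \<noteq> 0"
  shows "(\<Sum>a<L. iexp (of_int k * (vp_grid L a))) = 0"
proof -
  define z where "z = cis (2 * pi * of_int k / L)"
  have z1: "z \<noteq> 1"
  proof
    assume "z = 1"
    then have "cos (2 * pi * of_int k / L) = 1" by (simp add: z_def complex_eq_iff)
    then obtain n :: int where "2 * pi * of_int k / L = of_int n * 2 * pi" unfolding cos_one_2pi_int by blast
    then have "real_of_int k = of_int n * real L" using L by (simp add: field_simps)
    then have "real_of_int k = real_of_int (n * int L)" by simp
    then have kn: "k = n * int L" by (simp only: of_int_eq_iff)
    then have "n \<noteq> 0" using k(2) by auto
    then have "1 * int L \<le> \<bar>n\<bar> * int L" by (intro mult_right_mono) auto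
    then show False using k(1) kn by (simp add: abs_mult)
  qed
  have zL: "z ^ L = 1"
  proof -
    have "z ^ L = cis (real L * (2 * pi * of_int k / L))" unfolding z_def by (rule Complex.DeMoivre)
    also have "real L * (2 * pi * of_int k / L) = 2 * pi * of_int k" using L by simp
    finally show ?thesis by simp
  qed
  have "(\<Sum>a<L. iexp (of_int k * (vp_grid L a))) = (\<Sum>a<L. cis (- (of_int k * pi)) * z ^ a)"
  proof (intro sum.cong refl)
    fix a
    have za: "z ^ a = cis (real a * (2 * pi * of_int k / L))" unfolding z_def by (rule Complex.DeMoivre)
    have eq: "of_int k * vp_grid L a = - (of_int k * pi) + real a * (2 * pi * of_int k / L)"
      by (simp add: vp_grid_def algebra_simps)
    show "iexp (of_int k * (vp_grid L a)) = cis (- (of_int k * pi)) * z ^ a"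
      unfolding eq za cis_mult by (rule cis_conv_exp [symmetric])
  qed
  also have "\<dots> = cis (- (of_int k * pi)) * (\<Sum>a<L. z ^ a)" by (simp add: sum_distrib_left)
  also have "(\<Sum>a<L. z ^ a) = 0" using z1 zL by (simp add: geometric_sum)
  finally show ?thesis by simp
qed

definition vp :: "nat \<Rightarrow> real \<Rightarrow> real" where
  "vp N u = ((1 + cos u) / 2)^N"

text \<open>\<open>L\<close> times the constant Fourier coefficient of \<open>vp N\<close>.\<close>

definition vp_const :: "nat \<Rightarrow> nat \<Rightarrow> real" where
  "vp_const N L = real L * real ((2 * N) choose N) / 4^N"

lemma vp_nonneg [simp]: "0 \<le> vp N u"
proof -
  have "0 \<le> 1 + cos u" unfolding real_0_le_add_iff by (rule cos_ge_minus_one)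
  then show ?thesis by (simp add: vp_def)
qed

text \<open>With \<open>w = iexp (u / 2)\<close> one has
  \<open>(1 + cos u) / 2 = ((w + inverse w) / 2)^2\<close>, so the binomial theorem yields all
  Fourier coefficients.\<close>

lemma vp_expand: "complex_of_real (vp N u) = (\<Sum>b\<le>2 * N. of_nat ((2 * N) choose b) / 4^N * iexp ((of_int (int b - int N)) * u))"
proof -
  define w where "w = iexp (u / 2)"
  have w: "w \<noteq> 0" by (simp add: w_def)
  have sq: "complex_of_real ((1 + cos u) / 2) = ((w + inverse w) / 2)\<^sup>2"
  proof -
    have "complex_of_real ((1 + cos u) / 2) = (complex_of_real (cos (u / 2)))\<^sup>2"
      using cos_double_cos[of "u / 2"] by (simp flip: of_real_power)
    moreover have "complex_of_real (cos (u / 2)) = (w + inverse w) / 2"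
      unfolding cos_of_real [symmetric] cos_exp_eq by (simp add: w_def exp_minus)
    ultimately show ?thesis by simp
  qed
  have "complex_of_real (vp N u) = ((w + inverse w) / 2)^(2 * N)"
    unfolding vp_def of_real_power sq power_mult ..
  also have "\<dots> = (w + inverse w)^(2 * N) / 4^N" by (simp add: power_divide power_mult)
  also have "(w + inverse w)^(2 * N) = (\<Sum>b\<le>2 * N. of_nat ((2 * N) choose b) * w^b * (inverse w)^(2 * N - b))"
    by (rule binomial_ring)
  also have "\<dots> = (\<Sum>b\<le>2 * N. of_nat ((2 * N) choose b) * iexp ((of_int (int b - int N)) * u))"
  proof (intro sum.cong refl)
    fix b assume b: "b \<in> {..2 * N}"
    have "w^b * (inverse w)^(2 * N - b) = exp (of_nat b * (\<i> * (u / 2))) * exp (of_nat (2 * N - b) * (- (\<i> * (u / 2))))"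
      unfolding w_def exp_minus [symmetric] exp_of_nat_mult [symmetric] ..
    also have "\<dots> = iexp ((of_int (int b - int N)) * u)"
      using b by (simp add: exp_add [symmetric] of_nat_diff algebra_simps)
    finally show "of_nat ((2 * N) choose b) * w^b * (inverse w)^(2 * N - b) = of_nat ((2 * N) choose b) * iexp ((of_int (int b - int N)) * u)"
      by (simp add: mult.assoc)
  qed
  finally show ?thesis by (simp add: sum_divide_distrib)
qed

text \<open>Only frequencies of absolute value at most \<open>N\<close> occur; since
  \<open>N < L\<close>, all of them except 0 cancel over the grid.\<close>

lemma vp_grid_sum:
  assumes L: "N < L" shows "(\<Sum>a<L. vp N (u - vp_grid L a)) = vp_const N L"
proof -
  have "complex_of_real (\<Sum>a<L. vp N (u - vp_grid L a))
    = (\<Sum>a<L. \<Sum>b\<le>2 * N. of_nat ((2 * N) choose b) / 4^N * iexp ((of_int (int b - int N)) * u) * iexp (of_int (int N - int b) * vp_grid L a))"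
    unfolding of_real_sum vp_expand
    by (intro sum.cong refl) (simp add: mult.assoc exp_add [symmetric] algebra_simps)
  also have "\<dots> = (\<Sum>b\<le>2 * N. of_nat ((2 * N) choose b) / 4^N * iexp ((of_int (int b - int N)) * u) * (\<Sum>a<L. iexp (of_int (int N - int b) * vp_grid L a)))"
    by (subst sum.swap) (simp add: sum_distrib_left)
  also have "\<dots> = (\<Sum>b\<le>2 * N. if b = N then of_nat ((2 * N) choose N) / 4^N * of_nat L else 0)"
  proof (intro sum.cong refl)
    fix b assume b: "b \<in> {..2 * N}"
    show "of_nat ((2 * N) choose b) / 4^N * iexp ((of_int (int b - int N)) * u) * (\<Sum>a<L. iexp (of_int (int N - int b) * vp_grid L a))
      = (if b = N then of_nat ((2 * N) choose N) / 4^N * of_nat L else 0)"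
    proof (cases "b = N")
      case False
      then have "(\<Sum>a<L. iexp (of_int (int N - int b) * vp_grid L a)) = 0"
        using b L by (intro sum_roots_of_unity) auto
      then show ?thesis using False by simp
    qed simp
  qed
  also have "\<dots> = complex_of_real (vp_const N L)" by (simp add: vp_const_def)
  finally show ?thesis by (simp only: of_real_eq_iff)
qed

lemma vp_const_pos: "0 < L \<Longrightarrow> 0 < vp_const N L"
  by (simp add: vp_const_def)

lemma vp_const_Suc: "vp_const (Suc N) L = vp_const N L * (2 * real N + 1) / (2 * real N + 2)"
proof -
  define a b c n where "a = real (Suc (Suc (2 * N)) choose Suc N)" and "b = real (Suc (2 * N) choose N)"
    and "c = real ((2 * N) choose N)" and "n = real N + 1"
  have n: "0 < n" by (simp add: n_def)
  have "n * a = (2 * n) * b"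
    using arg_cong[OF Suc_times_binomial[of N "Suc (2 * N)"], of real] unfolding of_nat_mult a_def b_def n_def
    by (simp add: algebra_simps del: binomial_Suc_Suc)
  then have a: "a = 2 * b" using n by simp
  have "Suc (2 * N) choose N = Suc (2 * N) choose Suc N"
    using binomial_symmetric[of N "Suc (2 * N)"] by (simp add: Suc_diff_le)
  then have "n * b = (2 * real N + 1) * c"
    using arg_cong[OF Suc_times_binomial[of N "2 * N"], of real] unfolding of_nat_mult b_def c_def n_def
    by (simp add: algebra_simps del: binomial_Suc_Suc)
  then have b: "b = (2 * real N + 1) * c / n" using n by (simp add: field_simps)
  have "vp_const (Suc N) L = real L * a / (4 * 4^N)" by (simp add: vp_const_def a_def)
  also have "\<dots> = real L * c / 4^N * (2 * real N + 1) / (2 * n)" using n by (simp add: a b field_simps)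
  finally show ?thesis by (simp add: vp_const_def c_def n_def)
qed

text \<open>Because \<open>vp N w * (1 - cos w) = 2 * (vp N w - vp (Suc N) w)\<close>, the spread of
  the kernel is a difference of two grid sums, and the ratio of central binomial coefficients
  evaluates it exactly.\<close>

lemma vp_grid_variance:
  assumes L: "Suc N < L"
  shows "(\<Sum>a<L. vp N (u - vp_grid L a) / vp_const N L * (1 - cos (u - vp_grid L a))) = 1 / (real N + 1)"
proof -
  have pos: "vp_const N L > 0" using L by (intro vp_const_pos) simp
  have "vp N w * (1 - cos w) = 2 * (vp N w - vp (Suc N) w)" for w
    by (simp add: vp_def algebra_simps)
  then have "(\<Sum>a<L. vp N (u - vp_grid L a) / vp_const N L * (1 - cos (u - vp_grid L a)))
     = (\<Sum>a<L. 2 * (vp N (u - vp_grid L a) - vp (Suc N) (u - vp_grid L a)) / vp_const N L)"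
    by simp
  also have "\<dots> = 2 * ((\<Sum>a<L. vp N (u - vp_grid L a)) - (\<Sum>a<L. vp (Suc N) (u - vp_grid L a))) / vp_const N L"
    by (simp add: sum_divide_distrib [symmetric] sum_distrib_left [symmetric] sum_subtractf)
  also have "\<dots> = 2 * (vp_const N L - vp_const (Suc N) L) / vp_const N L"
    using L by (simp add: vp_grid_sum)
  also have "\<dots> = 1 / (real N + 1)"
  proof -
    define c n where "c = vp_const N L" and "n = real N + 1"
    have cn: "0 < c" "0 < n" using pos by (auto simp: c_def n_def)
    have "vp_const (Suc N) L = c * (2 * n - 1) / (2 * n)"
      unfolding vp_const_Suc c_def n_def by (simp add: algebra_simps)
    then show ?thesis using cn unfolding c_def [symmetric] n_def [symmetric] by (simp add: field_simps)
  qed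
  finally show ?thesis .
qed

lemma sin_ge_fifth:
  assumes v: "0 \<le> v" "v \<le> 3 * pi / 4"
  shows "v / 5 \<le> sin v"
proof (cases "v \<le> pi / 4")
  case True
  have "(\<lambda>v. sin v - v / 5) 0 \<le> (\<lambda>v. sin v - v / 5) v"
    using v(1)
  proof (rule DERIV_nonneg_imp_nondecreasing)
    fix z assume z: "0 \<le> z" "z \<le> v"
    have "cos (pi / 3) \<le> cos z" using z True by (intro cos_monotone_0_pi_le) auto
    then have "1 / 5 \<le> cos z" by (simp add: cos_60)
    then show "\<exists>d. ((\<lambda>v. sin v - v / 5) has_real_derivative d) (at z) \<and> 0 \<le> d"
      by (intro exI[of _ "cos z - 1 / 5"]) (auto intro!: derivative_eq_intros)
  qed
  then show ?thesis by simp
next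
  case False
  have "sin v = cos \<bar>v - pi / 2\<bar>" using sin_cos_eq[of v] by (simp add: abs_if cos_diff)
  moreover have "cos (pi / 4) \<le> cos \<bar>v - pi / 2\<bar>"
    using v False by (intro cos_monotone_0_pi_le) (auto simp: abs_if)
  moreover have "3 / 5 \<le> cos (pi / 4)"
  proof -
    have "6 / 5 \<le> sqrt 2" by (rule real_le_rsqrt) (simp add: power2_eq_square)
    then show ?thesis by (simp add: cos_45)
  qed
  moreover have "v / 5 \<le> 3 / 5" using v(2) pi_less_4 by simp
  ultimately show ?thesis by linarith
qed

text \<open>The range is the one that occurs below: an angle of size at most \<open>pi / 2\<close>
  minus a grid angle of size at most \<open>pi\<close>. From
  \<open>1 - cos w = 2 * (sin (w / 2))^2\<close> and slope \<open>1/5\<close> for the sine comes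
  \<open>2 / 10^2 = 1 / 50\<close>.\<close>

lemma one_minus_cos_ge:
  assumes "\<bar>w\<bar> \<le> 3 * pi / 2"
  shows "w\<^sup>2 / 50 \<le> 1 - cos w"
proof -
  define v where "v = \<bar>w\<bar> / 2"
  have v: "0 \<le> v" "v \<le> 3 * pi / 4" using assms by (auto simp: v_def)
  have "1 - cos \<bar>w\<bar> = 2 * (sin v)\<^sup>2" using cos_double_sin[of v] by (simp add: v_def)
  moreover have "(v / 5)\<^sup>2 \<le> (sin v)\<^sup>2" using sin_ge_fifth[OF v] v by (intro power_mono) auto
  ultimately show ?thesis by (simp add: v_def power_divide)
qed

text \<open>Evaluating a \<open>1\<close>-Lipschitz function at a grid of period \<open>4 R\<close> in each coordinate and
  interpolating with products of kernels: the error is controlled by the kernel variance inside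
  \<open>[-R, R]\<close> and by a second moment outside.\<close>

lemma vp_partition:
  assumes R: "0 < R" and \<kappa>: "0 < \<kappa>"
  shows "\<exists>L (\<psi> :: nat \<Rightarrow> real \<Rightarrow> real) (p :: nat \<Rightarrow> real). 
      (\<forall>a u. 0 \<le> \<psi> a u) \<and> (\<forall>u. (\<Sum>a<L. \<psi> a u) = 1) \<and>
      (\<forall>u. (\<Sum>a<L. \<psi> a u * min 2 \<bar>p a - u\<bar>) \<le> \<kappa> + 2 * u\<^sup>2 / R\<^sup>2) \<and>
      (\<forall>(T :: 't set) t a. finite T \<longrightarrow> t \<in> T \<longrightarrow> trig_poly T (\<lambda>x. complex_of_real (\<psi> a (x t))))"
proof -
  \<comment> \<open>Scales \<open>[-R, R]\<close> to angles in \<open>[-pi/2, pi/2]\<close>, well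
    inside one period.\<close>
  define s where "s = pi / (2 * R)"
  have s: "0 < s" using R by (simp add: s_def)
  \<comment> \<open>Makes the variance bound \<open>50 / (s^2 * (N + 1))\<close> at most the square
    of \<kappa>.\<close>
  obtain N :: nat where N: "50 / (\<kappa> * s)\<^sup>2 < real N" using reals_Archimedean2 by blast
  define L where "L = N + 2"
  have L: "Suc N < L" "0 < L" by (auto simp: L_def)
  define \<psi> where "\<psi> a u = vp N (s * u - vp_grid L a) / vp_const N L" for a u
  define p where "p a = vp_grid L a / s" for a
  have c: "0 < vp_const N L" using L by (intro vp_const_pos)
  have nn: "0 \<le> \<psi> a u" for a u using c by (simp add: \<psi>_def)
  have one: "(\<Sum>a<L. \<psi> a u) = 1" for u
    using vp_grid_sum[of N L "s * u"] L c by (simp add: \<psi>_def sum_divide_distrib [symmetric])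
  have near: "(\<Sum>a<L. \<psi> a u * \<bar>p a - u\<bar>) \<le> \<kappa>" if u: "\<bar>u\<bar> \<le> R" for u
  proof -
    have "(\<Sum>a<L. \<psi> a u * \<bar>p a - u\<bar>) = (\<Sum>a<L. sqrt (\<psi> a u) * (sqrt (\<psi> a u) * \<bar>p a - u\<bar>))"
      by (simp add: nn mult.assoc [symmetric])
    also have "\<dots> \<le> sqrt (\<Sum>a<L. (sqrt (\<psi> a u))\<^sup>2) * sqrt (\<Sum>a<L. (sqrt (\<psi> a u) * \<bar>p a - u\<bar>)\<^sup>2)"
      by (rule sum_mult_le_sqrt)
    also have "\<dots> = sqrt (\<Sum>a<L. \<psi> a u * (p a - u)\<^sup>2)"
      by (simp add: nn one power_mult_distrib)
    also have "(\<Sum>a<L. \<psi> a u * (p a - u)\<^sup>2) \<le> (\<Sum>a<L. 50 / s\<^sup>2 * (\<psi> a u * (1 - cos (s * u - vp_grid L a))))"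
    proof (rule sum_mono)
      fix a assume a: "a \<in> {..<L}"
      have "vp_grid L a \<le> pi" "- pi \<le> vp_grid L a"
        using a L by (auto simp: vp_grid_def field_simps)
      moreover have "\<bar>s * u\<bar> \<le> pi / 2"
        using mult_left_mono[OF u, of s] s R by (simp add: s_def abs_mult)
      ultimately have "(s * u - vp_grid L a)\<^sup>2 / 50 \<le> 1 - cos (s * u - vp_grid L a)"
        by (intro one_minus_cos_ge) (unfold abs_le_iff, linarith)
      moreover have "(s * u - vp_grid L a)\<^sup>2 = s\<^sup>2 * (p a - u)\<^sup>2"
      proof -
        have "vp_grid L a = s * p a" using s by (simp add: p_def)
        then show ?thesis by (simp add: power2_eq_square algebra_simps)
      qed
      ultimately have "(p a - u)\<^sup>2 \<le> 50 / s\<^sup>2 * (1 - cos (s * u - vp_grid L a))"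
        using s by (simp add: field_simps)
      then have "\<psi> a u * (p a - u)\<^sup>2 \<le> \<psi> a u * (50 / s\<^sup>2 * (1 - cos (s * u - vp_grid L a)))"
        by (rule mult_left_mono) (rule nn)
      then show "\<psi> a u * (p a - u)\<^sup>2 \<le> 50 / s\<^sup>2 * (\<psi> a u * (1 - cos (s * u - vp_grid L a)))"
        by (simp add: mult.left_commute)
    qed
    also have "\<dots> = 50 / s\<^sup>2 * (1 / (real N + 1))"
      unfolding sum_distrib_left [symmetric] \<psi>_def using vp_grid_variance[OF L(1), of "s * u"] by simp
    also have "\<dots> \<le> \<kappa>\<^sup>2"
    proof -
      have "50 < real N * (\<kappa> * s)\<^sup>2" using N s \<kappa> by (simp add: divide_less_eq)
      also have "\<dots> \<le> (real N + 1) * (\<kappa> * s)\<^sup>2" by (intro mult_right_mono) auto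
      finally have "50 \<le> \<kappa>\<^sup>2 * (s\<^sup>2 * (real N + 1))" by (simp add: power_mult_distrib mult_ac)
      then have "50 / (s\<^sup>2 * (real N + 1)) \<le> \<kappa>\<^sup>2" using s by (subst pos_divide_le_eq) auto
      then show ?thesis by simp
    qed
    finally show ?thesis using \<kappa> by simp
  qed
  \<comment> \<open>The cap 2 is the largest possible increment of a function bounded by 1. Outside
    \<open>[-R, R]\<close> interpolation at a periodic grid says nothing, and there 2 is at most
    \<open>2 * u^2 / R^2\<close>.\<close>
  have "(\<Sum>a<L. \<psi> a u * min 2 \<bar>p a - u\<bar>) \<le> \<kappa> + 2 * u\<^sup>2 / R\<^sup>2" for u
  proof (cases "\<bar>u\<bar> \<le> R")
    case True
    have "(\<Sum>a<L. \<psi> a u * min 2 \<bar>p a - u\<bar>) \<le> (\<Sum>a<L. \<psi> a u * \<bar>p a - u\<bar>)"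
      by (intro sum_mono mult_left_mono nn) auto
    moreover have "0 \<le> 2 * u\<^sup>2 / R\<^sup>2" by simp
    ultimately show ?thesis using near[OF True] by linarith
  next
    case False
    have "(\<Sum>a<L. \<psi> a u * min 2 \<bar>p a - u\<bar>) \<le> (\<Sum>a<L. \<psi> a u * 2)"
      by (intro sum_mono mult_left_mono nn) auto
    also have "\<dots> = 2" by (simp add: sum_distrib_right [symmetric] one)
    also have "2 \<le> 2 * u\<^sup>2 / R\<^sup>2"
    proof -
      have "R\<^sup>2 \<le> u\<^sup>2" using False R by (simp add: abs_le_square_iff [symmetric])
      then show ?thesis using R by (simp add: field_simps)
    qed
    finally show ?thesis using \<kappa> by linarith
  qed
  moreover have "trig_poly T (\<lambda>x. complex_of_real (\<psi> a (x t)))" if "finite T" "t \<in> T" for T :: "'t set" and t a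
  proof -
    have "complex_of_real (\<psi> a (x t)) = ((1 / 2 + 1 / 2 * complex_of_real (cos (s * x t - vp_grid L a)))^N) * complex_of_real (1 / vp_const N L)" for x :: "'t \<Rightarrow> real"
      by (simp add: \<psi>_def vp_def add_divide_distrib)
    then show ?thesis
      using that by (simp only:) (intro trig_poly_mult trig_poly_power trig_poly_add trig_poly_const trig_poly_cos)
  qed
  ultimately show ?thesis using nn one by blast
qed

text \<open>The functions \<open>\<Psi> a\<close> do not depend on \<open>H\<close>, which enters
  only through its values at the nodes \<open>q a\<close>, bounded by 1. Convergence of finitely
  many characteristic functions therefore suffices for all \<open>H\<close> simultaneously.\<close>

lemma lipschitz_trig_approximation:
  fixes T :: "'t set"
  assumes T: "finite T" and R: "0 < R" and \<kappa>: "0 < \<kappa>"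
  shows "\<exists>(A :: ('t \<Rightarrow> nat) set) \<Psi> q. finite A \<and> (\<forall>a\<in>A. trig_poly T (\<lambda>x. complex_of_real (\<Psi> a x))) \<and>
      (\<forall>H x. (\<forall>x. \<bar>H x\<bar> \<le> 1) \<longrightarrow> (\<forall>x z. \<bar>H x - H z\<bar> \<le> (\<Sum>t\<in>T. \<bar>x t - z t\<bar>)) \<longrightarrow>
        \<bar>H x - (\<Sum>a\<in>A. H (q a) * \<Psi> a x)\<bar> \<le> (\<Sum>t\<in>T. \<kappa> + 2 * (x t)\<^sup>2 / R\<^sup>2))"
proof -
  obtain L :: nat and \<psi> :: "nat \<Rightarrow> real \<Rightarrow> real" and p :: "nat \<Rightarrow> real" where P: "(\<forall>a u. 0 \<le> \<psi> a u) \<and> (\<forall>u. (\<Sum>a<L. \<psi> a u) = 1) \<and>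
      (\<forall>u. (\<Sum>a<L. \<psi> a u * min 2 \<bar>p a - u\<bar>) \<le> \<kappa> + 2 * u\<^sup>2 / R\<^sup>2) \<and>
      (\<forall>(T :: 't set) t a. finite T \<longrightarrow> t \<in> T \<longrightarrow> trig_poly T (\<lambda>x. complex_of_real (\<psi> a (x t))))"
    using vp_partition[OF R \<kappa>, where 't = 't] by (elim exE) (rule that)
  have nn: "0 \<le> \<psi> a u" and one: "(\<Sum>a<L. \<psi> a u) = 1"
    and w: "(\<Sum>a<L. \<psi> a u * min 2 \<bar>p a - u\<bar>) \<le> \<kappa> + 2 * u\<^sup>2 / R\<^sup>2"
    and tp: "finite T' \<Longrightarrow> t \<in> T' \<Longrightarrow> trig_poly T' (\<lambda>x. complex_of_real (\<psi> a (x t)))" for a u and T' :: "'t set" and t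
    using P by auto
  define A where "A = PiE T (\<lambda>_. {..<L})"
  define \<Psi> where "\<Psi> a x = (\<Prod>t\<in>T. \<psi> (a t) (x t))" for a and x :: "'t \<Rightarrow> real"
  define q where "q a t = p (a t)" for a and t :: 't
  have A: "finite A" using T by (auto simp: A_def intro!: finite_PiE)
  have \<Psi>1: "(\<Sum>a\<in>A. \<Psi> a x) = 1" for x
    unfolding A_def \<Psi>_def using prod_sum_PiE[where f = "\<lambda>t a. \<psi> a (x t)" and A = T and B = "\<lambda>_. {..<L}"] T by (simp add: one)
  have \<Psi>0: "0 \<le> \<Psi> a x" for a x unfolding \<Psi>_def by (intro prod_nonneg) (auto intro: nn)
  have marg: "(\<Sum>a\<in>A. \<Psi> a x * g (a t)) = (\<Sum>b<L. \<psi> b (x t) * g b)" if t: "t \<in> T" for g x t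
  proof -
    have "(\<Sum>a\<in>A. \<Psi> a x * g (a t)) = (\<Sum>a\<in>A. \<Prod>s\<in>T. \<psi> (a s) (x s) * (if s = t then g (a s) else 1))"
      using t T by (intro sum.cong refl) (simp add: \<Psi>_def prod.distrib)
    also have "\<dots> = (\<Prod>s\<in>T. \<Sum>b<L. \<psi> b (x s) * (if s = t then g b else 1))"
      unfolding A_def using prod_sum_PiE[where f = "\<lambda>s b. \<psi> b (x s) * (if s = t then g b else 1)" and A = T and B = "\<lambda>_. {..<L}"] T by simp
    also have "\<dots> = (\<Prod>s\<in>T. if s = t then (\<Sum>b<L. \<psi> b (x t) * g b) else 1)"
      by (intro prod.cong refl) (auto simp: one)
    finally show ?thesis using t T by simp
  qed
  have "\<bar>H x - (\<Sum>a\<in>A. H (q a) * \<Psi> a x)\<bar> \<le> (\<Sum>t\<in>T. \<kappa> + 2 * (x t)\<^sup>2 / R\<^sup>2)"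
    if H1: "\<forall>x. \<bar>H x\<bar> \<le> 1" and Hl: "\<forall>x z. \<bar>H x - H z\<bar> \<le> (\<Sum>t\<in>T. \<bar>x t - z t\<bar>)" for H x
  proof -
    have "(\<Sum>a\<in>A. \<Psi> a x * H x) = H x" unfolding sum_distrib_right [symmetric] \<Psi>1 by simp
    then have "H x - (\<Sum>a\<in>A. H (q a) * \<Psi> a x) = (\<Sum>a\<in>A. \<Psi> a x * (H x - H (q a)))"
      by (simp only: right_diff_distrib sum_subtractf mult.commute[of "H (q _)"])
    also have "\<bar>\<dots>\<bar> \<le> (\<Sum>a\<in>A. \<Psi> a x * \<bar>H x - H (q a)\<bar>)"
      by (rule order_trans[OF sum_abs]) (simp add: abs_mult \<Psi>0)
    also have "\<dots> \<le> (\<Sum>a\<in>A. \<Psi> a x * (\<Sum>t\<in>T. min 2 \<bar>p (a t) - x t\<bar>))"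
    proof (intro sum_mono mult_left_mono \<Psi>0)
      fix a
      show "\<bar>H x - H (q a)\<bar> \<le> (\<Sum>t\<in>T. min 2 \<bar>p (a t) - x t\<bar>)"
      proof (cases "\<exists>t\<in>T. 2 \<le> \<bar>p (a t) - x t\<bar>")
        case True
        then obtain t where t: "t \<in> T" "2 \<le> \<bar>p (a t) - x t\<bar>" by auto
        have "\<bar>H x - H (q a)\<bar> \<le> 2" using H1[rule_format, of x] H1[rule_format, of "q a"] by linarith
        also have "2 = min 2 \<bar>p (a t) - x t\<bar>" using t by simp
        also have "\<dots> \<le> (\<Sum>t\<in>T. min 2 \<bar>p (a t) - x t\<bar>)" using t T by (intro member_le_sum) auto
        finally show ?thesis .
      next
        case False
        then have "(\<Sum>t\<in>T. min 2 \<bar>p (a t) - x t\<bar>) = (\<Sum>t\<in>T. \<bar>x t - q a t\<bar>)"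
          by (intro sum.cong refl) (force simp: q_def abs_minus_commute)
        then show ?thesis using Hl by simp
      qed
    qed
    also have "\<dots> = (\<Sum>t\<in>T. \<Sum>a\<in>A. \<Psi> a x * min 2 \<bar>p (a t) - x t\<bar>)"
      by (simp add: sum_distrib_left sum.swap[of _ T A])
    also have "\<dots> = (\<Sum>t\<in>T. \<Sum>b<L. \<psi> b (x t) * min 2 \<bar>p b - x t\<bar>)"
      by (intro sum.cong refl) (rule marg[where g = "\<lambda>b. min 2 \<bar>p b - x _\<bar>"])
    also have "\<dots> \<le> (\<Sum>t\<in>T. \<kappa> + 2 * (x t)\<^sup>2 / R\<^sup>2)" by (intro sum_mono w)
    finally show ?thesis .
  qed
  moreover have "trig_poly T (\<lambda>x. complex_of_real (\<Psi> a x))" for a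
    unfolding \<Psi>_def of_real_prod using T by (intro trig_poly_prod tp)
  ultimately show ?thesis using A by blast
qed

lemma (in prob_space) integral_abs_le_sqrt:
  fixes f :: "'a \<Rightarrow> real"
  assumes f2: "integrable M (\<lambda>x. (f x)\<^sup>2)" and f: "f \<in> borel_measurable M"
  shows "integrable M f" "(\<integral>x. \<bar>f x\<bar> \<partial>M) \<le> sqrt (\<integral>x. (f x)\<^sup>2 \<partial>M)"
proof -
  show fi: "integrable M f" by (rule square_integrable_imp_integrable[OF f f2])
  define c where "c = (\<integral>x. \<bar>f x\<bar> \<partial>M)"
  have "0 \<le> (\<integral>x. (\<bar>f x\<bar> - c)\<^sup>2 \<partial>M)" by (rule integral_nonneg_AE) simp
  also have "(\<integral>x. (\<bar>f x\<bar> - c)\<^sup>2 \<partial>M) = (\<integral>x. (f x)\<^sup>2 - 2 * c * \<bar>f x\<bar> + c\<^sup>2 \<partial>M)"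
    by (intro Bochner_Integration.integral_cong refl) (simp add: power2_eq_square algebra_simps)
  also have "\<dots> = (\<integral>x. (f x)\<^sup>2 \<partial>M) - 2 * c * c + c\<^sup>2"
    using fi f2 by (simp add: prob_space c_def)
  finally have "c\<^sup>2 \<le> (\<integral>x. (f x)\<^sup>2 \<partial>M)" by (simp add: power2_eq_square)
  then show "(\<integral>x. \<bar>f x\<bar> \<partial>M) \<le> sqrt (\<integral>x. (f x)\<^sup>2 \<partial>M)" unfolding c_def by (rule real_le_rsqrt)
qed

lemma abs_mult_le_squares: "\<bar>x * y\<bar> \<le> x\<^sup>2 + y\<^sup>2" for x y :: real
proof -
  have "2 * (\<bar>x\<bar> * \<bar>y\<bar>) \<le> x\<^sup>2 + y\<^sup>2" using sum_squares_bound[of "\<bar>x\<bar>" "\<bar>y\<bar>"] by (simp add: mult.assoc)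
  moreover have "0 \<le> \<bar>x\<bar> * \<bar>y\<bar>" by simp
  ultimately show ?thesis unfolding abs_mult by linarith
qed

lemma boot_val_measurable [measurable (raw)]:
  assumes "\<And>j. x j \<in> borel_measurable M"
  shows "(\<lambda>\<omega>. boot_val C (\<lambda>j. x j \<omega>) d) \<in> borel_measurable M"
  unfolding boot_val_def using assms by (intro borel_measurable_times borel_measurable_diff avg_measurable) auto

lemma boot_val_sum: "boot_val C (\<lambda>j. \<Sum>t\<in>T. l t * x t j) d = (\<Sum>t\<in>T. l t * boot_val C (x t) d)"
  by (simp add: boot_val_def avg_sum avg_cmult right_diff_distrib sum_subtractf sum_distrib_left mult.left_commute)

lemma avg_complex_measurable:
  fixes f :: "'i \<Rightarrow> 'a \<Rightarrow> complex"
  assumes "\<And>x. x \<in> A \<Longrightarrow> f x \<in> borel_measurable M"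
  shows "(\<lambda>\<omega>. avg A (\<lambda>x. f x \<omega>)) \<in> borel_measurable M"
  using assms unfolding avg_def by (intro borel_measurable_divide borel_measurable_sum) auto

section \<open>Conditional characteristic functions over the exchangeable array\<close>

context exch_array
begin

text \<open>The variance of the Gaussian limit at a single function; both cells have the same
  marginal law, hence the square of one mean. \<open>kernel_sum\<close> identifies it with the
  quadratic form of the kernel.\<close>

definition cov_limit :: "('k \<Rightarrow> real) \<Rightarrow> ('z \<Rightarrow> real) \<Rightarrow> real" where
  "cov_limit lam \<phi> = (\<Sum>i\<in>UNIV. lam i * ((\<integral>\<omega>. \<phi> (Z \<omega> cell1) * \<phi> (Z \<omega> (cell2 i)) \<partial>M) - (\<integral>\<omega>. \<phi> (Z \<omega> cell1) \<partial>M)\<^sup>2))"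

definition char_error :: "('k \<Rightarrow> nat) \<Rightarrow> ('k \<Rightarrow> real) \<Rightarrow> ('z \<Rightarrow> real) \<Rightarrow> 'a \<Rightarrow> real" where
  "char_error C lam \<phi> \<omega> = cmod (avg (draws C) (\<lambda>d. iexp (boot_val C (\<lambda>j. \<phi> (Z \<omega> j)) d)) - complex_of_real (exp (- (max 0 (cov_limit lam \<phi>) / 2))))"

lemma char_error_measurable [measurable]:
  assumes [measurable]: "\<phi> \<in> borel_measurable E"
  shows "char_error C lam \<phi> \<in> borel_measurable M"
proof -
  have "(\<lambda>\<omega>. avg (draws C) (\<lambda>d. iexp (boot_val C (\<lambda>j. \<phi> (Z \<omega> j)) d))) \<in> borel_measurable M"
    by (intro avg_complex_measurable) measurable
  then show ?thesis unfolding char_error_def [abs_def] by simp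
qed

lemma char_error_bound: "char_error C lam \<phi> \<omega> \<le> 2"
proof -
  have "cmod (avg (draws C) (\<lambda>d. iexp (boot_val C (\<lambda>j. \<phi> (Z \<omega> j)) d))) \<le> 1"
  proof (cases "draws C = {}")
    case False
    then show ?thesis by (intro order_trans[OF norm_avg_le] avg_le_const) auto
  qed (simp add: avg_def)
  moreover have "cmod (complex_of_real (exp (- (max 0 (cov_limit lam \<phi>) / 2)))) \<le> 1" by simp
  ultimately show ?thesis unfolding char_error_def
    by (intro order_trans[OF norm_triangle_ineq4]) linarith
qed

lemma char_error_integrable:
  assumes "\<phi> \<in> borel_measurable E"
  shows "integrable M (char_error C lam \<phi>)"
  using char_error_measurable[OF assms] char_error_bound
  by (intro integrable_const_bound[where B = 2]) (auto simp: char_error_def)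

lemma slice_var_error:
  fixes C :: "'k \<Rightarrow> nat" and i :: 'k
  assumes \<phi> [measurable]: "\<phi> \<in> borel_measurable E" and B: "\<And>z. \<bar>\<phi> z\<bar> \<le> B" and m: "0 < Cmin C"
  defines "c \<equiv> (\<integral>\<omega>. \<phi> (Z \<omega> cell1) * \<phi> (Z \<omega> (cell2 i)) \<partial>M) - (\<integral>\<omega>. \<phi> (Z \<omega> cell1) \<partial>M)\<^sup>2"
  shows "integrable M (\<lambda>\<omega>. \<bar>slice_var C (\<lambda>j. \<phi> (Z \<omega> j)) i - c\<bar>)"
    "(\<integral>\<omega>. \<bar>slice_var C (\<lambda>j. \<phi> (Z \<omega> j)) i - c\<bar> \<partial>M) \<le> 3 * B\<^sup>2 * sqrt (24 * real CARD('k) / real (Cmin C))"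
proof -
  let ?\<kappa> = "\<integral>\<omega>. \<phi> (Z \<omega> cell1) * \<phi> (Z \<omega> (cell2 i)) \<partial>M" and ?\<mu> = "\<integral>\<omega>. \<phi> (Z \<omega> cell1) \<partial>M"
  have pos: "0 < C k" for k using m Cmin_le[of C k] by simp
  have B0: "0 \<le> B" by (rule order_trans[OF abs_ge_zero B])
  define a where "a \<omega> = avg (ibox C) (\<lambda>u. avg (ibox C) (\<lambda>v. \<phi> (Z \<omega> u) * \<phi> (Z \<omega> (v(i := u i)))))" for \<omega>
  define b where "b \<omega> = avg (ibox C) (\<lambda>u. \<phi> (Z \<omega> u))" for \<omega>
  have am [measurable]: "a \<in> borel_measurable M" unfolding a_def by (intro avg_measurable) measurable
  have bm [measurable]: "b \<in> borel_measurable M" unfolding b_def by (intro avg_measurable) measurable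
  have \<phi>\<phi>: "\<bar>\<phi> x * \<phi> y\<bar> \<le> B\<^sup>2" for x y
    using mult_mono[OF B B B0] by (simp add: abs_mult power2_eq_square)
  have aB: "\<bar>a \<omega>\<bar> \<le> B\<^sup>2" for \<omega> unfolding a_def by (intro abs_avg_le_const \<phi>\<phi>) auto
  have bB: "\<bar>b \<omega>\<bar> \<le> B" for \<omega> unfolding b_def by (intro abs_avg_le_const B B0)
  have \<mu>B: "\<bar>?\<mu>\<bar> \<le> B"
  proof -
    have "\<bar>?\<mu>\<bar> \<le> (\<integral>\<omega>. \<bar>\<phi> (Z \<omega> cell1)\<bar> \<partial>M)" by (rule integral_abs_bound)
    also have "\<dots> \<le> (\<integral>\<omega>. B \<partial>M)" by (intro integral_mono integrable_const_bound[where B = B]) (auto simp: B B0)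
    finally show ?thesis by (simp add: prob_space)
  qed
  define S where "S = (\<Sum>k\<in>UNIV. 1 / real (C k))"
  have S: "S \<le> real CARD('k) / real (Cmin C)" unfolding S_def by (rule Cmin_inverse_sum[OF m])
  have S0: "0 \<le> S" unfolding S_def by (intro sum_nonneg) auto
  have la: "(\<integral>\<omega>. (a \<omega> - ?\<kappa>)\<^sup>2 \<partial>M) \<le> 24 * (B\<^sup>2)\<^sup>2 * S"
    unfolding a_def S_def
    by (rule pair_average_lln[of "\<lambda>x y. \<phi> x * \<phi> y" "B\<^sup>2" C i]) (auto simp: \<phi>\<phi> pos case_prod_unfold)
  have lb: "(\<integral>\<omega>. (b \<omega> - ?\<mu>)\<^sup>2 \<partial>M) \<le> 24 * B\<^sup>2 * S"
  proof -
    \<comment> \<open>The plain mean is a pair average of a function that ignores its second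
      argument.\<close>
    have "(\<integral>\<omega>. (avg (ibox C) (\<lambda>u. avg (ibox C) (\<lambda>v. \<phi> (Z \<omega> u))) - ?\<mu>)\<^sup>2 \<partial>M) \<le> 24 * B\<^sup>2 * S"
      unfolding S_def by (rule pair_average_lln[of "\<lambda>x y. \<phi> x" B C i]) (auto simp: B pos case_prod_unfold)
    then show ?thesis using ibox_nonempty[of C] pos by (simp add: b_def)
  qed
  have ai: "integrable M (\<lambda>\<omega>. (a \<omega> - ?\<kappa>)\<^sup>2)"
  proof (rule integrable_const_bound[where B = "(B\<^sup>2 + \<bar>?\<kappa>\<bar>)\<^sup>2"])
    show "AE \<omega> in M. norm ((a \<omega> - ?\<kappa>)\<^sup>2) \<le> (B\<^sup>2 + \<bar>?\<kappa>\<bar>)\<^sup>2"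
    proof (rule AE_I2)
      fix \<omega>
      have "\<bar>a \<omega> - ?\<kappa>\<bar> \<le> \<bar>B\<^sup>2 + \<bar>?\<kappa>\<bar>\<bar>" using aB[of \<omega>] by linarith
      then show "norm ((a \<omega> - ?\<kappa>)\<^sup>2) \<le> (B\<^sup>2 + \<bar>?\<kappa>\<bar>)\<^sup>2" unfolding abs_le_square_iff by simp
    qed
  qed measurable
  have bi: "integrable M (\<lambda>\<omega>. (b \<omega> - ?\<mu>)\<^sup>2)"
  proof (rule integrable_const_bound[where B = "(2 * B)\<^sup>2"])
    show "AE \<omega> in M. norm ((b \<omega> - ?\<mu>)\<^sup>2) \<le> (2 * B)\<^sup>2"
    proof (rule AE_I2)
      fix \<omega>
      have "\<bar>b \<omega> - ?\<mu>\<bar> \<le> \<bar>2 * B\<bar>" using bB[of \<omega>] \<mu>B by linarith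
      then show "norm ((b \<omega> - ?\<mu>)\<^sup>2) \<le> (2 * B)\<^sup>2" unfolding abs_le_square_iff by simp
    qed
  qed measurable
  note La = integral_abs_le_sqrt[OF ai] and Lb = integral_abs_le_sqrt[OF bi]
  have eq: "slice_var C (\<lambda>j. \<phi> (Z \<omega> j)) i - c = (a \<omega> - ?\<kappa>) - (b \<omega> + ?\<mu>) * (b \<omega> - ?\<mu>)" for \<omega>
    unfolding slice_var_eq[where C = C, OF pos] a_def b_def c_def by (simp add: power2_eq_square algebra_simps)
  have bd: "\<bar>slice_var C (\<lambda>j. \<phi> (Z \<omega> j)) i - c\<bar> \<le> \<bar>a \<omega> - ?\<kappa>\<bar> + 2 * B * \<bar>b \<omega> - ?\<mu>\<bar>" for \<omega>
  proof -
    have "\<bar>(b \<omega> + ?\<mu>) * (b \<omega> - ?\<mu>)\<bar> \<le> 2 * B * \<bar>b \<omega> - ?\<mu>\<bar>"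
      unfolding abs_mult using bB[of \<omega>] \<mu>B by (intro mult_right_mono) auto
    then show ?thesis unfolding eq by linarith
  qed
  have dom: "integrable M (\<lambda>\<omega>. \<bar>a \<omega> - ?\<kappa>\<bar> + 2 * B * \<bar>b \<omega> - ?\<mu>\<bar>)"
    using La(1) Lb(1) by (intro Bochner_Integration.integrable_add integrable_mult_right integrable_abs) auto
  show int: "integrable M (\<lambda>\<omega>. \<bar>slice_var C (\<lambda>j. \<phi> (Z \<omega> j)) i - c\<bar>)"
    by (rule Bochner_Integration.integrable_bound[OF dom]) (use bd B0 in \<open>auto simp: eq\<close>)
  have "(\<integral>\<omega>. \<bar>slice_var C (\<lambda>j. \<phi> (Z \<omega> j)) i - c\<bar> \<partial>M) \<le> (\<integral>\<omega>. \<bar>a \<omega> - ?\<kappa>\<bar> + 2 * B * \<bar>b \<omega> - ?\<mu>\<bar> \<partial>M)"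
    by (rule integral_mono[OF int dom bd])
  also have "\<dots> = (\<integral>\<omega>. \<bar>a \<omega> - ?\<kappa>\<bar> \<partial>M) + 2 * B * (\<integral>\<omega>. \<bar>b \<omega> - ?\<mu>\<bar> \<partial>M)"
    using La(1) Lb(1) by (subst Bochner_Integration.integral_add) auto
  also have "\<dots> \<le> sqrt (24 * (B\<^sup>2)\<^sup>2 * S) + 2 * B * sqrt (24 * B\<^sup>2 * S)"
    using La(2) Lb(2) la lb B0
    by (intro add_mono mult_left_mono) (auto intro: order_trans[OF _ real_sqrt_le_mono])
  also have "\<dots> = 3 * B\<^sup>2 * sqrt (24 * S)"
  proof -
    have "sqrt (24 * (B\<^sup>2)\<^sup>2 * S) = B\<^sup>2 * sqrt (24 * S)" "sqrt (24 * B\<^sup>2 * S) = B * sqrt (24 * S)"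
    proof -
      have "sqrt (24 * (B\<^sup>2)\<^sup>2 * S) = sqrt ((B\<^sup>2)\<^sup>2) * sqrt (24 * S)" "sqrt (24 * B\<^sup>2 * S) = sqrt (B\<^sup>2) * sqrt (24 * S)"
        by (simp_all only: real_sqrt_mult mult_ac)
      then show "sqrt (24 * (B\<^sup>2)\<^sup>2 * S) = B\<^sup>2 * sqrt (24 * S)" "sqrt (24 * B\<^sup>2 * S) = B * sqrt (24 * S)"
        using B0 by (simp_all only: real_sqrt_abs abs_of_nonneg zero_le_power2)
    qed
    then show ?thesis by (simp add: power2_eq_square)
  qed
  also have "\<dots> \<le> 3 * B\<^sup>2 * sqrt (24 * real CARD('k) / real (Cmin C))"
    using S by (intro mult_left_mono real_sqrt_le_mono) auto
  finally show "(\<integral>\<omega>. \<bar>slice_var C (\<lambda>j. \<phi> (Z \<omega> j)) i - c\<bar> \<partial>M) \<le> 3 * B\<^sup>2 * sqrt (24 * real CARD('k) / real (Cmin C))" .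
qed

lemma conditional_clt_bounded:
  fixes Cs :: "nat \<Rightarrow> 'k \<Rightarrow> nat"
  assumes \<phi> [measurable]: "\<phi> \<in> borel_measurable E" and B: "\<And>z. \<bar>\<phi> z\<bar> \<le> B"
    and Cs: "filterlim (\<lambda>n. Cmin (Cs n)) at_top sequentially"
    and lam: "\<And>i. (\<lambda>n. real (Cmin (Cs n)) / real (Cs n i)) \<longlonglongrightarrow> lam i"
  shows "(\<lambda>n. \<integral>\<omega>. char_error (Cs n) lam \<phi> \<omega> \<partial>M) \<longlonglongrightarrow> 0"
proof -
  have B0: "0 \<le> B" by (rule order_trans[OF abs_ge_zero B])
  define c where "c i = (\<integral>\<omega>. \<phi> (Z \<omega> cell1) * \<phi> (Z \<omega> (cell2 i)) \<partial>M) - (\<integral>\<omega>. \<phi> (Z \<omega> cell1) \<partial>M)\<^sup>2" for i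
  define m where "m n = real (Cmin (Cs n))" for n
  have mlim: "filterlim m at_top sequentially"
    unfolding m_def by (rule filterlim_compose[OF filterlim_real_sequentially Cs])
  let ?e = "\<lambda>n. clt_rate CARD('k) B / sqrt (m n) + (\<Sum>i\<in>(UNIV::'k set). 3 * B\<^sup>2 * sqrt (24 * real CARD('k) / m n) + \<bar>m n / real (Cs n i) - lam i\<bar> * \<bar>c i\<bar>)"
  have ev: "\<forall>\<^sub>F n in sequentially. (\<integral>\<omega>. char_error (Cs n) lam \<phi> \<omega> \<partial>M) \<le> ?e n"
    using filterlim_at_top[THEN iffD1, OF Cs, rule_format, of 1]
  proof eventually_elim
    case (elim n)
    define C where "C = Cs n"
    have m0: "0 < Cmin C" using elim by (simp add: C_def)
    define sv where "sv i \<omega> = \<bar>slice_var C (\<lambda>j. \<phi> (Z \<omega> j)) i - c i\<bar>" for i \<omega>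
    have svI: "integrable M (sv i)" and svb: "(\<integral>\<omega>. sv i \<omega> \<partial>M) \<le> 3 * B\<^sup>2 * sqrt (24 * real CARD('k) / m n)" for i
      using slice_var_error[OF \<phi> B m0, of i] unfolding sv_def [abs_def] c_def m_def C_def by auto
    have pt: "char_error C lam \<phi> \<omega> \<le> clt_rate CARD('k) B / sqrt (m n) + (\<Sum>i\<in>UNIV. sv i \<omega> + \<bar>m n / real (Cs n i) - lam i\<bar> * \<bar>c i\<bar>)" for \<omega>
    proof -
      have "char_error C lam \<phi> \<omega> \<le> clt_rate CARD('k) B / sqrt (Cmin C)
          + \<bar>(\<Sum>i\<in>UNIV. real (Cmin C) / real (C i) * slice_var C (\<lambda>j. \<phi> (Z \<omega> j)) i) - cov_limit lam \<phi>\<bar>"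
        unfolding char_error_def by (rule boot_char_bounded[OF m0 B0 B])
      also have "(\<Sum>i\<in>UNIV. real (Cmin C) / real (C i) * slice_var C (\<lambda>j. \<phi> (Z \<omega> j)) i) - cov_limit lam \<phi>
          = (\<Sum>i\<in>UNIV. m n / real (C i) * (slice_var C (\<lambda>j. \<phi> (Z \<omega> j)) i - c i) + (m n / real (C i) - lam i) * c i)"
        unfolding cov_limit_def c_def [symmetric] sum_subtractf [symmetric]
        by (intro sum.cong refl) (simp add: m_def C_def algebra_simps)
      also have "\<bar>\<dots>\<bar> \<le> (\<Sum>i\<in>UNIV. sv i \<omega> + \<bar>m n / real (Cs n i) - lam i\<bar> * \<bar>c i\<bar>)"
      proof (rule order_trans[OF sum_abs], rule sum_mono)
        fix i
        have "m n / real (C i) \<le> 1" using Cmin_le[of C i] m0 by (simp add: m_def C_def[symmetric] divide_le_eq_1)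
        then have "\<bar>m n / real (C i) * (slice_var C (\<lambda>j. \<phi> (Z \<omega> j)) i - c i)\<bar> \<le> 1 * sv i \<omega>"
          unfolding abs_mult sv_def by (intro mult_right_mono) (auto simp: m_def)
        then show "\<bar>m n / real (C i) * (slice_var C (\<lambda>j. \<phi> (Z \<omega> j)) i - c i) + (m n / real (C i) - lam i) * c i\<bar> \<le> sv i \<omega> + \<bar>m n / real (Cs n i) - lam i\<bar> * \<bar>c i\<bar>"
          by (intro order_trans[OF abs_triangle_ineq] add_mono) (auto simp: abs_mult C_def)
      qed
      finally show ?thesis by (simp add: m_def C_def)
    qed
    have "(\<integral>\<omega>. char_error C lam \<phi> \<omega> \<partial>M) \<le> (\<integral>\<omega>. clt_rate CARD('k) B / sqrt (m n) + (\<Sum>i\<in>UNIV. sv i \<omega> + \<bar>m n / real (Cs n i) - lam i\<bar> * \<bar>c i\<bar>) \<partial>M)"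
      by (intro integral_mono pt char_error_integrable \<phi> Bochner_Integration.integrable_add Bochner_Integration.integrable_sum svI) auto
    also have "\<dots> = clt_rate CARD('k) B / sqrt (m n) + (\<Sum>i\<in>UNIV. (\<integral>\<omega>. sv i \<omega> \<partial>M) + \<bar>m n / real (Cs n i) - lam i\<bar> * \<bar>c i\<bar>)"
      using svI by (simp add: prob_space)
    also have "\<dots> \<le> ?e n" by (intro add_left_mono sum_mono add_right_mono svb)
    finally show ?case by (simp add: C_def)
  qed
  have lim1: "((\<lambda>n. clt_rate CARD('k) B / sqrt (m n)) \<longlongrightarrow> 0) sequentially"
    by (intro real_tendsto_divide_at_top[OF tendsto_const] filterlim_compose[OF sqrt_at_top mlim])
  have lim2: "(\<lambda>n. 3 * B\<^sup>2 * sqrt (24 * real CARD('k) / m n) + \<bar>m n / real (Cs n i) - lam i\<bar> * \<bar>c i\<bar>) \<longlonglongrightarrow> 3 * B\<^sup>2 * sqrt 0 + \<bar>lam i - lam i\<bar> * \<bar>c i\<bar>" for i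
    using lam[of i] unfolding m_def [symmetric]
    by (intro tendsto_add tendsto_mult tendsto_const tendsto_real_sqrt tendsto_rabs tendsto_diff real_tendsto_divide_at_top[OF tendsto_const mlim])
  have "?e \<longlonglongrightarrow> 0 + (\<Sum>i\<in>(UNIV::'k set). 3 * B\<^sup>2 * sqrt 0 + \<bar>lam i - lam i\<bar> * \<bar>c i\<bar>)"
    by (rule tendsto_add[OF lim1 tendsto_sum[OF lim2]])
  then have lim: "?e \<longlonglongrightarrow> 0" by simp
  show ?thesis
    by (rule tendsto_sandwich[OF _ ev tendsto_const lim]) (auto simp: char_error_def intro!: always_eventually integral_nonneg_AE)
qed

lemma boot_val_L1:
  fixes C :: "'k \<Rightarrow> nat"
  assumes \<phi> [measurable]: "\<phi> \<in> borel_measurable E" and \<phi>2: "integrable M (\<lambda>\<omega>. (\<phi> (Z \<omega> cell1))\<^sup>2)" and m: "0 < Cmin C"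
  shows "integrable M (\<lambda>\<omega>. avg (draws C) (\<lambda>d. (boot_val C (\<lambda>j. \<phi> (Z \<omega> j)) d)\<^sup>2))"
    "(\<integral>\<omega>. avg (draws C) (\<lambda>d. (boot_val C (\<lambda>j. \<phi> (Z \<omega> j)) d)\<^sup>2) \<partial>M) \<le> real CARD('k) * (\<integral>\<omega>. (\<phi> (Z \<omega> cell1))\<^sup>2 \<partial>M)"
    "integrable M (\<lambda>\<omega>. avg (draws C) (\<lambda>d. \<bar>boot_val C (\<lambda>j. \<phi> (Z \<omega> j)) d\<bar>))"
    "(\<integral>\<omega>. avg (draws C) (\<lambda>d. \<bar>boot_val C (\<lambda>j. \<phi> (Z \<omega> j)) d\<bar>) \<partial>M) \<le> sqrt (real CARD('k) * (\<integral>\<omega>. (\<phi> (Z \<omega> cell1))\<^sup>2 \<partial>M))"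
proof -
  have pos: "0 < C k" for k using m Cmin_le[of C k] by simp
  have ne: "ibox C \<noteq> {}" using ibox_nonempty[of C] pos by simp
  have I: "integrable M (\<lambda>\<omega>. (\<phi> (Z \<omega> j))\<^sup>2)" for j
    using marginal_integrable[of "\<lambda>z. (\<phi> z)\<^sup>2" j] \<phi>2 by simp
  have E: "(\<integral>\<omega>. (\<phi> (Z \<omega> j))\<^sup>2 \<partial>M) = (\<integral>\<omega>. (\<phi> (Z \<omega> cell1))\<^sup>2 \<partial>M)" for j
    using marginal_integral[of "\<lambda>z. (\<phi> z)\<^sup>2" j] by simp
  define q where "q \<omega> = avg (draws C) (\<lambda>d. (boot_val C (\<lambda>j. \<phi> (Z \<omega> j)) d)\<^sup>2)" for \<omega>
  define l where "l \<omega> = avg (draws C) (\<lambda>d. \<bar>boot_val C (\<lambda>j. \<phi> (Z \<omega> j)) d\<bar>)" for \<omega>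
  have qm [measurable]: "q \<in> borel_measurable M" unfolding q_def by (intro avg_measurable) measurable
  have lm [measurable]: "l \<in> borel_measurable M" unfolding l_def by (intro avg_measurable) measurable
  have q0: "0 \<le> q \<omega>" for \<omega> unfolding q_def by (rule avg_nonneg) simp
  have l0: "0 \<le> l \<omega>" for \<omega> unfolding l_def by (rule avg_nonneg) simp
  have qb: "q \<omega> \<le> real CARD('k) * avg (ibox C) (\<lambda>j. (\<phi> (Z \<omega> j))\<^sup>2)" for \<omega>
    unfolding q_def by (rule boot_val_second_moment[OF m])
  have dI: "integrable M (\<lambda>\<omega>. real CARD('k) * avg (ibox C) (\<lambda>j. (\<phi> (Z \<omega> j))\<^sup>2))"
    by (intro integrable_mult_right integrable_avg I)
  have qI: "integrable M q"
    by (rule Bochner_Integration.integrable_bound[OF dI]) (use qb q0 in \<open>auto intro!: AE_I2 order_trans[OF qb]\<close>)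
  have qE: "(\<integral>\<omega>. q \<omega> \<partial>M) \<le> real CARD('k) * (\<integral>\<omega>. (\<phi> (Z \<omega> cell1))\<^sup>2 \<partial>M)"
  proof -
    have "(\<integral>\<omega>. q \<omega> \<partial>M) \<le> (\<integral>\<omega>. real CARD('k) * avg (ibox C) (\<lambda>j. (\<phi> (Z \<omega> j))\<^sup>2) \<partial>M)"
      by (rule integral_mono[OF qI dI qb])
    also have "\<dots> = real CARD('k) * avg (ibox C) (\<lambda>j. \<integral>\<omega>. (\<phi> (Z \<omega> j))\<^sup>2 \<partial>M)"
      by (subst integral_mult_right_zero) (subst integral_avg, auto intro: I)
    also have "\<dots> = real CARD('k) * avg (ibox C) (\<lambda>j. \<integral>\<omega>. (\<phi> (Z \<omega> cell1))\<^sup>2 \<partial>M)"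
      by (intro arg_cong2[where f = "(*)"] refl avg_cong E)
    finally show ?thesis using ne by simp
  qed
  have lq: "l \<omega> \<le> sqrt (q \<omega>)" for \<omega> unfolding l_def q_def by (rule avg_abs_le_sqrt)
  have sI: "integrable M (\<lambda>\<omega>. (sqrt (q \<omega>))\<^sup>2)" using qI q0 by simp
  note sq = integral_abs_le_sqrt[OF sI]
  have lI: "integrable M l"
    by (rule Bochner_Integration.integrable_bound[OF sq(1)]) (use lq l0 q0 in \<open>auto intro!: AE_I2\<close>)
  have "(\<integral>\<omega>. l \<omega> \<partial>M) \<le> (\<integral>\<omega>. \<bar>sqrt (q \<omega>)\<bar> \<partial>M)"
    using lq q0 sq(1) by (intro integral_mono lI) auto
  also have "\<dots> \<le> sqrt (\<integral>\<omega>. q \<omega> \<partial>M)" using sq(2) q0 by simp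
  also have "\<dots> \<le> sqrt (real CARD('k) * (\<integral>\<omega>. (\<phi> (Z \<omega> cell1))\<^sup>2 \<partial>M))" using qE by (rule real_sqrt_le_mono)
  finally show "integrable M (\<lambda>\<omega>. avg (draws C) (\<lambda>d. (boot_val C (\<lambda>j. \<phi> (Z \<omega> j)) d)\<^sup>2))"
    "(\<integral>\<omega>. avg (draws C) (\<lambda>d. (boot_val C (\<lambda>j. \<phi> (Z \<omega> j)) d)\<^sup>2) \<partial>M) \<le> real CARD('k) * (\<integral>\<omega>. (\<phi> (Z \<omega> cell1))\<^sup>2 \<partial>M)"
    "integrable M (\<lambda>\<omega>. avg (draws C) (\<lambda>d. \<bar>boot_val C (\<lambda>j. \<phi> (Z \<omega> j)) d\<bar>))"
    "(\<integral>\<omega>. avg (draws C) (\<lambda>d. \<bar>boot_val C (\<lambda>j. \<phi> (Z \<omega> j)) d\<bar>) \<partial>M) \<le> sqrt (real CARD('k) * (\<integral>\<omega>. (\<phi> (Z \<omega> cell1))\<^sup>2 \<partial>M))"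
    using qI qE lI unfolding q_def [abs_def] l_def [abs_def] by auto
qed

text \<open>Truncation reduces to bounded functions. The discarded part contributes at most the root
  of its second moment, uniformly in the box, by \<open>boot_val_L1\<close>, and the limit variances
  converge by dominated convergence.\<close>

theorem conditional_clt:
  fixes Cs :: "nat \<Rightarrow> 'k \<Rightarrow> nat"
  assumes \<phi> [measurable]: "\<phi> \<in> borel_measurable E" and \<phi>2: "integrable M (\<lambda>\<omega>. (\<phi> (Z \<omega> cell1))\<^sup>2)"
    and Cs: "filterlim (\<lambda>n. Cmin (Cs n)) at_top sequentially"
    and lam: "\<And>i. (\<lambda>n. real (Cmin (Cs n)) / real (Cs n i)) \<longlonglongrightarrow> lam i"
  shows "(\<lambda>n. \<integral>\<omega>. char_error (Cs n) lam \<phi> \<omega> \<partial>M) \<longlonglongrightarrow> 0"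
proof -
  \<comment> \<open>Large values are set to 0, so the truncated function and the discarded part are
    both dominated by the original.\<close>
  define \<phi>' where "\<phi>' b z = (if \<bar>\<phi> z\<bar> \<le> real b then \<phi> z else 0)" for b :: nat and z
  have \<phi>'m [measurable]: "\<phi>' b \<in> borel_measurable E" for b unfolding \<phi>'_def by measurable
  have \<phi>'lim: "(\<lambda>b. \<phi>' b z) \<longlonglongrightarrow> \<phi> z" for z
  proof (rule tendsto_eventually)
    obtain b0 :: nat where "\<bar>\<phi> z\<bar> \<le> real b0" using real_arch_simple by blast
    then have "\<phi>' b z = \<phi> z" if "b0 \<le> b" for b using that by (auto simp: \<phi>'_def)
    then show "\<forall>\<^sub>F b in sequentially. \<phi>' b z = \<phi> z" by (auto simp: eventually_sequentially)
  qed
  have \<phi>'le: "\<bar>\<phi>' b z\<bar> \<le> \<bar>\<phi> z\<bar>" for b z by (simp add: \<phi>'_def)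
  have I2: "integrable M (\<lambda>\<omega>. (\<phi> (Z \<omega> j))\<^sup>2)" for j
    using marginal_integrable[of "\<lambda>z. (\<phi> z)\<^sup>2" j] \<phi>2 by simp
  have I1: "integrable M (\<lambda>\<omega>. \<phi> (Z \<omega> j))" for j
    by (rule integral_abs_le_sqrt(1)[OF I2]) measurable
  define \<delta> where "\<delta> b = (\<integral>\<omega>. (\<phi> (Z \<omega> cell1) - \<phi>' b (Z \<omega> cell1))\<^sup>2 \<partial>M)" for b
  have dl: "((x::real) - y)\<^sup>2 \<le> x\<^sup>2" if "y = x \<or> y = 0" for x y using that by auto
  have \<delta>le: "(\<phi> z - \<phi>' b z)\<^sup>2 \<le> (\<phi> z)\<^sup>2" for z b by (rule dl) (auto simp: \<phi>'_def)
  have dI: "integrable M (\<lambda>\<omega>. (\<phi> (Z \<omega> cell1) - \<phi>' b (Z \<omega> cell1))\<^sup>2)" for b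
    by (rule Bochner_Integration.integrable_bound[OF I2[of cell1]]) (auto simp: \<delta>le)
  have \<delta>lim: "\<delta> \<longlonglongrightarrow> 0"
  proof -
    have "\<delta> \<longlonglongrightarrow> (\<integral>\<omega>. 0 \<partial>M)"
      unfolding \<delta>_def
    proof (rule integral_dominated_convergence[OF _ _ I2[of cell1]])
      show "AE \<omega> in M. (\<lambda>b. (\<phi> (Z \<omega> cell1) - \<phi>' b (Z \<omega> cell1))\<^sup>2) \<longlonglongrightarrow> 0"
      proof (rule AE_I2)
        fix \<omega>
        have "(\<lambda>b. (\<phi> (Z \<omega> cell1) - \<phi>' b (Z \<omega> cell1))\<^sup>2) \<longlonglongrightarrow> (\<phi> (Z \<omega> cell1) - \<phi> (Z \<omega> cell1))\<^sup>2"
          by (intro tendsto_power tendsto_diff tendsto_const \<phi>'lim)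
        then show "(\<lambda>b. (\<phi> (Z \<omega> cell1) - \<phi>' b (Z \<omega> cell1))\<^sup>2) \<longlonglongrightarrow> 0" by simp
      qed
    qed (auto simp: \<delta>le)
    then show ?thesis by simp
  qed
  have Vlim: "(\<lambda>b. cov_limit lam (\<phi>' b)) \<longlonglongrightarrow> cov_limit lam \<phi>"
    unfolding cov_limit_def
  proof (intro tendsto_sum tendsto_mult tendsto_const tendsto_diff tendsto_power)
    fix i
    show "(\<lambda>b. \<integral>\<omega>. \<phi>' b (Z \<omega> cell1) * \<phi>' b (Z \<omega> (cell2 i)) \<partial>M) \<longlonglongrightarrow> (\<integral>\<omega>. \<phi> (Z \<omega> cell1) * \<phi> (Z \<omega> (cell2 i)) \<partial>M)"
    proof (rule integral_dominated_convergence[where w = "\<lambda>\<omega>. (\<phi> (Z \<omega> cell1))\<^sup>2 + (\<phi> (Z \<omega> (cell2 i)))\<^sup>2"])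
      show "AE \<omega> in M. norm (\<phi>' b (Z \<omega> cell1) * \<phi>' b (Z \<omega> (cell2 i))) \<le> (\<phi> (Z \<omega> cell1))\<^sup>2 + (\<phi> (Z \<omega> (cell2 i)))\<^sup>2" for b
      proof (rule AE_I2)
        fix \<omega>
        have "\<bar>\<phi>' b (Z \<omega> cell1)\<bar> * \<bar>\<phi>' b (Z \<omega> (cell2 i))\<bar> \<le> \<bar>\<phi> (Z \<omega> cell1)\<bar> * \<bar>\<phi> (Z \<omega> (cell2 i))\<bar>"
          by (intro mult_mono \<phi>'le) auto
        also have "\<dots> \<le> (\<phi> (Z \<omega> cell1))\<^sup>2 + (\<phi> (Z \<omega> (cell2 i)))\<^sup>2"
          unfolding abs_mult [symmetric] by (rule abs_mult_le_squares)
        finally show "norm (\<phi>' b (Z \<omega> cell1) * \<phi>' b (Z \<omega> (cell2 i))) \<le> (\<phi> (Z \<omega> cell1))\<^sup>2 + (\<phi> (Z \<omega> (cell2 i)))\<^sup>2"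
          by (simp add: abs_mult)
      qed
    qed (auto intro!: Bochner_Integration.integrable_add I2 tendsto_mult \<phi>'lim)
    show "(\<lambda>b. \<integral>\<omega>. \<phi>' b (Z \<omega> cell1) \<partial>M) \<longlonglongrightarrow> (\<integral>\<omega>. \<phi> (Z \<omega> cell1) \<partial>M)"
      by (rule integral_dominated_convergence[where w = "\<lambda>\<omega>. \<bar>\<phi> (Z \<omega> cell1)\<bar>"]) (auto simp: \<phi>'le \<phi>'lim I1)
  qed
  have step: "(\<integral>\<omega>. char_error (Cs n) lam \<phi> \<omega> \<partial>M) \<le> sqrt (real CARD('k) * \<delta> b) + (\<integral>\<omega>. char_error (Cs n) lam (\<phi>' b) \<omega> \<partial>M) + \<bar>cov_limit lam (\<phi>' b) - cov_limit lam \<phi>\<bar>"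
    if n: "1 \<le> Cmin (Cs n)" for n b
  proof -
    define C where "C = Cs n"
    have m: "0 < Cmin C" using n by (simp add: C_def)
    have dm: "(\<lambda>z. \<phi> z - \<phi>' b z) \<in> borel_measurable E" by measurable
    note bl = boot_val_L1(3,4)[OF dm dI m]
    have pt: "char_error C lam \<phi> \<omega> \<le> avg (draws C) (\<lambda>d. \<bar>boot_val C (\<lambda>j. \<phi> (Z \<omega> j) - \<phi>' b (Z \<omega> j)) d\<bar>) + char_error C lam (\<phi>' b) \<omega> + \<bar>cov_limit lam (\<phi>' b) - cov_limit lam \<phi>\<bar>" for \<omega>
    proof -
      let ?A = "\<lambda>\<phi>. avg (draws C) (\<lambda>d. iexp (boot_val C (\<lambda>j. \<phi> (Z \<omega> j)) d))"
      let ?e = "\<lambda>V. complex_of_real (exp (- (max 0 V / 2)))"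
      have 1: "cmod (?A \<phi> - ?A (\<phi>' b)) \<le> avg (draws C) (\<lambda>d. \<bar>boot_val C (\<lambda>j. \<phi> (Z \<omega> j) - \<phi>' b (Z \<omega> j)) d\<bar>)"
        unfolding avg_diff [symmetric] boot_val_diff by (intro order_trans[OF norm_avg_le] avg_mono iexp_lipschitz)
      have "\<bar>exp (- (max 0 V / 2)) - exp (- (max 0 W / 2))\<bar> \<le> \<bar>max 0 V / 2 - max 0 W / 2\<bar>" for V W :: real
        by (intro exp_neg_lipschitz) auto
      moreover have "\<bar>max 0 V / 2 - max 0 W / 2\<bar> \<le> \<bar>V - W\<bar>" for V W :: real by (auto simp: max_def)
      ultimately have "\<bar>exp (- (max 0 V / 2)) - exp (- (max 0 W / 2))\<bar> \<le> \<bar>V - W\<bar>" for V W :: real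
        using order_trans by blast
      then have 2: "cmod (?e (cov_limit lam (\<phi>' b)) - ?e (cov_limit lam \<phi>)) \<le> \<bar>cov_limit lam (\<phi>' b) - cov_limit lam \<phi>\<bar>"
        unfolding of_real_diff [symmetric] norm_of_real .
      show ?thesis unfolding char_error_def
        by (rule norm_diff_triangle_le[OF norm_diff_triangle_le[OF 1 order_refl] 2])
    qed
    have "(\<integral>\<omega>. char_error C lam \<phi> \<omega> \<partial>M) \<le> (\<integral>\<omega>. avg (draws C) (\<lambda>d. \<bar>boot_val C (\<lambda>j. \<phi> (Z \<omega> j) - \<phi>' b (Z \<omega> j)) d\<bar>) + char_error C lam (\<phi>' b) \<omega> + \<bar>cov_limit lam (\<phi>' b) - cov_limit lam \<phi>\<bar> \<partial>M)"
      by (intro integral_mono pt char_error_integrable Bochner_Integration.integrable_add bl \<phi> \<phi>'m) auto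
    also have "\<dots> = (\<integral>\<omega>. avg (draws C) (\<lambda>d. \<bar>boot_val C (\<lambda>j. \<phi> (Z \<omega> j) - \<phi>' b (Z \<omega> j)) d\<bar>) \<partial>M) + (\<integral>\<omega>. char_error C lam (\<phi>' b) \<omega> \<partial>M) + \<bar>cov_limit lam (\<phi>' b) - cov_limit lam \<phi>\<bar>"
      using bl(1) char_error_integrable[OF \<phi>'m[of b], of C lam] by (simp add: prob_space)
    finally show ?thesis using bl(2) unfolding C_def \<delta>_def by linarith
  qed
  show ?thesis
  proof (rule LIMSEQ_I)
    fix r :: real assume r: "0 < r"
    have "(\<lambda>b. sqrt (real CARD('k) * \<delta> b) + \<bar>cov_limit lam (\<phi>' b) - cov_limit lam \<phi>\<bar>) \<longlonglongrightarrow> sqrt (real CARD('k) * 0) + \<bar>cov_limit lam \<phi> - cov_limit lam \<phi>\<bar>"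
      by (intro tendsto_add tendsto_real_sqrt tendsto_mult tendsto_const \<delta>lim tendsto_rabs tendsto_diff Vlim)
    then have "(\<lambda>b. sqrt (real CARD('k) * \<delta> b) + \<bar>cov_limit lam (\<phi>' b) - cov_limit lam \<phi>\<bar>) \<longlonglongrightarrow> 0" by simp
    then have "\<forall>\<^sub>F b in sequentially. sqrt (real CARD('k) * \<delta> b) + \<bar>cov_limit lam (\<phi>' b) - cov_limit lam \<phi>\<bar> < r / 2"
      using r by (intro order_tendstoD) auto
    then obtain b where b: "sqrt (real CARD('k) * \<delta> b) + \<bar>cov_limit lam (\<phi>' b) - cov_limit lam \<phi>\<bar> < r / 2"
      using eventually_happens by fastforce
    have "(\<lambda>n. \<integral>\<omega>. char_error (Cs n) lam (\<phi>' b) \<omega> \<partial>M) \<longlonglongrightarrow> 0"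
      by (rule conditional_clt_bounded[where B = "real b", OF \<phi>'m _ Cs lam]) (simp add: \<phi>'_def)
    then have "\<forall>\<^sub>F n in sequentially. (\<integral>\<omega>. char_error (Cs n) lam (\<phi>' b) \<omega> \<partial>M) < r / 2"
      using r by (intro order_tendstoD) auto
    then have "\<forall>\<^sub>F n in sequentially. norm ((\<integral>\<omega>. char_error (Cs n) lam \<phi> \<omega> \<partial>M) - 0) < r"
      using filterlim_at_top[THEN iffD1, OF Cs, rule_format, of 1]
    proof eventually_elim
      case (elim n)
      have "0 \<le> (\<integral>\<omega>. char_error (Cs n) lam \<phi> \<omega> \<partial>M)" by (rule integral_nonneg_AE) (simp add: char_error_def)
      then show ?case using step[OF elim(2), of b] elim(1) b by simp
    qed
    then show "\<exists>no. \<forall>n\<ge>no. norm ((\<integral>\<omega>. char_error (Cs n) lam \<phi> \<omega> \<partial>M) - 0) < r"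
      by (simp add: eventually_sequentially)
  qed
qed

text \<open>Finite-dimensional convergence, uniformly over bounded Lipschitz functions; \<open>G\<close> enters only
  through its characteristic functions and second moments.\<close>

lemma boot_findim:
  fixes Cs :: "nat \<Rightarrow> 'k \<Rightarrow> nat" and \<phi> :: "'t \<Rightarrow> 'z \<Rightarrow> real" and G :: "'w \<Rightarrow> 't \<Rightarrow> real"
  assumes T: "finite T" and \<phi>: "\<And>t. t \<in> T \<Longrightarrow> \<phi> t \<in> borel_measurable E"
    and \<phi>2: "\<And>t. t \<in> T \<Longrightarrow> integrable M (\<lambda>\<omega>. (\<phi> t (Z \<omega> cell1))\<^sup>2)"
    and Cs: "filterlim (\<lambda>n. Cmin (Cs n)) at_top sequentially"
    and lam: "\<And>i. (\<lambda>n. real (Cmin (Cs n)) / real (Cs n i)) \<longlonglongrightarrow> lam i"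
    and Q: "prob_space Q" and Gm: "\<And>t. t \<in> T \<Longrightarrow> (\<lambda>w. G w t) \<in> borel_measurable Q"
    and G2: "\<And>t. t \<in> T \<Longrightarrow> integrable Q (\<lambda>w. (G w t)\<^sup>2)"
    and Gchar: "\<And>l. (\<integral>w. iexp (\<Sum>t\<in>T. l t * G w t) \<partial>Q) = complex_of_real (exp (- (max 0 (cov_limit lam (\<lambda>z. \<Sum>t\<in>T. l t * \<phi> t z)) / 2)))"
    and \<epsilon>: "0 < \<epsilon>"
  shows "\<forall>\<^sub>F n in sequentially. \<exists>U. integrable M U \<and> (\<integral>\<omega>. U \<omega> \<partial>M) \<le> \<epsilon> \<and>
     (\<forall>\<omega> H. (\<forall>x. \<bar>H x\<bar> \<le> 1) \<longrightarrow> (\<forall>x z. \<bar>H x - H z\<bar> \<le> (\<Sum>t\<in>T. \<bar>x t - z t\<bar>)) \<longrightarrow> (\<lambda>w. H (G w)) \<in> borel_measurable Q \<longrightarrow>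
       \<bar>avg (draws (Cs n)) (\<lambda>d. H (\<lambda>t. boot_val (Cs n) (\<lambda>j. \<phi> t (Z \<omega> j)) d)) - (\<integral>w. H (G w) \<partial>Q)\<bar> \<le> U \<omega>)"
proof -
  interpret Q: prob_space Q by (rule Q)
  define S where "S = real CARD('k) * (\<Sum>t\<in>T. \<integral>\<omega>. (\<phi> t (Z \<omega> cell1))\<^sup>2 \<partial>M) + (\<Sum>t\<in>T. \<integral>w. (G w t)\<^sup>2 \<partial>Q)"
  have S0: "0 \<le> S" unfolding S_def by (intro add_nonneg_nonneg mult_nonneg_nonneg sum_nonneg integral_nonneg_AE) auto
  \<comment> \<open>With these choices \<open>2 * card T * \<kappa>\<close> and
    \<open>2 * S / R^2\<close> are each at most a quarter of \<epsilon>; a further quarter goes to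
    the characteristic functions. The added 1 covers an empty \<open>T\<close> here and
    \<open>S = 0\<close> in \<open>R\<close>.\<close>
  define \<kappa> where "\<kappa> = \<epsilon> / (8 * (real (card T) + 1))"
  define R where "R = sqrt (8 * (S + 1) / \<epsilon>)"
  have \<kappa>: "0 < \<kappa>" using \<epsilon> by (simp add: \<kappa>_def)
  have R: "0 < R" using \<epsilon> S0 by (simp add: R_def)
  obtain A :: "('t \<Rightarrow> nat) set" and \<Psi> q where A: "finite A" and tp: "\<forall>a\<in>A. trig_poly T (\<lambda>x. complex_of_real (\<Psi> a x))"
    and app: "\<forall>H x. (\<forall>x. \<bar>H x\<bar> \<le> 1) \<longrightarrow> (\<forall>x z. \<bar>H x - H z\<bar> \<le> (\<Sum>t\<in>T. \<bar>x t - z t\<bar>)) \<longrightarrow>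
        \<bar>H x - (\<Sum>a\<in>A. H (q a) * \<Psi> a x)\<bar> \<le> (\<Sum>t\<in>T. \<kappa> + 2 * (x t)\<^sup>2 / R\<^sup>2)"
    using lipschitz_trig_approximation[OF T R \<kappa>] by (elim exE conjE) (rule that)
  define b where "b n \<omega> d t = boot_val (Cs n) (\<lambda>j. \<phi> t (Z \<omega> j)) d" for n \<omega> d t
  define err where "err n a \<omega> = cmod (avg (draws (Cs n)) (\<lambda>d. complex_of_real (\<Psi> a (b n \<omega> d))) - (\<integral>w. complex_of_real (\<Psi> a (G w)) \<partial>Q))" for n a \<omega>
  have iexp_m: "(\<lambda>x. iexp x) \<in> borel_measurable borel" by measurable
  have expm: "(\<lambda>w. iexp (\<Sum>t\<in>T. l t * G w t)) \<in> borel_measurable Q" for l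
    by (rule measurable_compose[OF _ iexp_m]) (intro borel_measurable_sum borel_measurable_times borel_measurable_const Gm)
  have expI: "integrable Q (\<lambda>w. iexp (\<Sum>t\<in>T. l t * G w t))" for l
    by (rule Q.integrable_const_bound[where B = 1, OF _ expm]) simp
  \<comment> \<open>The Cramer-Wold device: a linear combination of bootstrap values is the
    bootstrap value of the linear combination, so every exponential in \<open>\<Psi> a\<close> is
    covered by \<open>conditional_clt\<close>.\<close>
  have trig: "\<exists>(I :: nat set) c l. finite I \<and> (\<forall>n \<omega>. err n a \<omega> \<le> (\<Sum>i\<in>I. cmod (c i) * char_error (Cs n) lam (\<lambda>z. \<Sum>t\<in>T. l i t * \<phi> t z) \<omega>)) \<and> 
      integrable Q (\<lambda>w. \<Psi> a (G w)) \<and> (\<forall>n. (err n a) \<in> borel_measurable M)" if a: "a \<in> A" for a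
  proof -
    obtain I :: "nat set" and c l where I: "finite I" and tr: "(\<lambda>x. complex_of_real (\<Psi> a x)) = (\<lambda>x. \<Sum>i\<in>I. c i * iexp (\<Sum>t\<in>T. l i t * x t))"
      using tp a unfolding trig_poly_def by blast
    have tr': "complex_of_real (\<Psi> a x) = (\<Sum>i\<in>I. c i * iexp (\<Sum>t\<in>T. l i t * x t))" for x using fun_cong[OF tr] .
    have cI: "integrable Q (\<lambda>w. complex_of_real (\<Psi> a (G w)))"
      unfolding tr' by (intro Bochner_Integration.integrable_sum integrable_mult_right expI)
    have EG: "(\<integral>w. complex_of_real (\<Psi> a (G w)) \<partial>Q) = (\<Sum>i\<in>I. c i * complex_of_real (exp (- (max 0 (cov_limit lam (\<lambda>z. \<Sum>t\<in>T. l i t * \<phi> t z)) / 2))))"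
    proof -
      have "(\<integral>w. complex_of_real (\<Psi> a (G w)) \<partial>Q) = (\<Sum>i\<in>I. \<integral>w. c i * iexp (\<Sum>t\<in>T. l i t * G w t) \<partial>Q)"
        unfolding tr' by (rule Bochner_Integration.integral_sum) (intro integrable_mult_right expI)
      also have "\<dots> = (\<Sum>i\<in>I. c i * (\<integral>w. iexp (\<Sum>t\<in>T. l i t * G w t) \<partial>Q))"
        by (intro sum.cong refl integral_mult_right_zero)
      finally show ?thesis unfolding Gchar .
    qed
    have lin: "(\<Sum>t\<in>T. l i t * b n \<omega> d t) = boot_val (Cs n) (\<lambda>j. \<Sum>t\<in>T. l i t * \<phi> t (Z \<omega> j)) d" for i n \<omega> d
      unfolding b_def by (rule boot_val_sum[symmetric])
    have "err n a \<omega> \<le> (\<Sum>i\<in>I. cmod (c i) * char_error (Cs n) lam (\<lambda>z. \<Sum>t\<in>T. l i t * \<phi> t z) \<omega>)" for n \<omega>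
    proof -
      have "avg (draws (Cs n)) (\<lambda>d. complex_of_real (\<Psi> a (b n \<omega> d))) - (\<integral>w. complex_of_real (\<Psi> a (G w)) \<partial>Q)
         = (\<Sum>i\<in>I. c i * (avg (draws (Cs n)) (\<lambda>d. iexp (boot_val (Cs n) (\<lambda>j. \<Sum>t\<in>T. l i t * \<phi> t (Z \<omega> j)) d)) - complex_of_real (exp (- (max 0 (cov_limit lam (\<lambda>z. \<Sum>t\<in>T. l i t * \<phi> t z)) / 2)))))"
        unfolding EG unfolding tr' lin avg_sum avg_cmult by (simp only: right_diff_distrib sum_subtractf)
      then show ?thesis unfolding err_def char_error_def
        by (simp only:) (intro order_trans[OF norm_sum] sum_mono, simp add: norm_mult)
    qed
    moreover have "integrable Q (\<lambda>w. \<Psi> a (G w))" using cI by (simp only: complex_of_real_integrable_eq)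
    moreover have "err n a \<in> borel_measurable M" for n
    proof -
      have "(\<lambda>\<omega>. avg (draws (Cs n)) (\<lambda>d. complex_of_real (\<Psi> a (b n \<omega> d)))) \<in> borel_measurable M"
        unfolding tr' lin
      proof (intro avg_complex_measurable borel_measurable_sum borel_measurable_times borel_measurable_const)
        fix d i
        have "(\<lambda>\<omega>. boot_val (Cs n) (\<lambda>j. \<Sum>t\<in>T. l i t * \<phi> t (Z \<omega> j)) d) \<in> borel_measurable M"
          by (intro boot_val_measurable borel_measurable_sum borel_measurable_times borel_measurable_const measurable_compose[OF cell_measurable \<phi>])
        then show "(\<lambda>\<omega>. iexp (boot_val (Cs n) (\<lambda>j. \<Sum>t\<in>T. l i t * \<phi> t (Z \<omega> j)) d)) \<in> borel_measurable M"
          by (rule measurable_compose[OF _ iexp_m])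
      qed
      then show ?thesis unfolding err_def [abs_def] by simp
    qed
    ultimately show ?thesis using I by (intro exI[of _ I] exI[of _ c] exI[of _ l]) auto
  qed
  have errI: "integrable M (err n a)" and errlim: "(\<lambda>n. \<integral>\<omega>. err n a \<omega> \<partial>M) \<longlonglongrightarrow> 0" and \<Psi>I: "integrable Q (\<lambda>w. \<Psi> a (G w))" if a: "a \<in> A" for n a
  proof -
    obtain I :: "nat set" and c l where I: "finite I" and le: "\<And>n \<omega>. err n a \<omega> \<le> (\<Sum>i\<in>I. cmod (c i) * char_error (Cs n) lam (\<lambda>z. \<Sum>t\<in>T. l i t * \<phi> t z) \<omega>)"
      and QI: "integrable Q (\<lambda>w. \<Psi> a (G w))" and em: "\<And>n. err n a \<in> borel_measurable M"
      using trig[OF a] by blast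
    have lm: "(\<lambda>z. \<Sum>t\<in>T. l i t * \<phi> t z) \<in> borel_measurable E" for i
      using \<phi> by (intro borel_measurable_sum borel_measurable_times borel_measurable_const)
    have prod_I: "integrable M (\<lambda>\<omega>. \<phi> s (Z \<omega> cell1) * \<phi> t (Z \<omega> cell1))" if "s \<in> T" "t \<in> T" for s t
    proof (rule Bochner_Integration.integrable_bound[OF Bochner_Integration.integrable_add[OF \<phi>2[OF that(1)] \<phi>2[OF that(2)]]])
      show "AE \<omega> in M. norm (\<phi> s (Z \<omega> cell1) * \<phi> t (Z \<omega> cell1)) \<le> norm ((\<phi> s (Z \<omega> cell1))\<^sup>2 + (\<phi> t (Z \<omega> cell1))\<^sup>2)"
      proof (rule AE_I2)
        fix \<omega>
        show "norm (\<phi> s (Z \<omega> cell1) * \<phi> t (Z \<omega> cell1)) \<le> norm ((\<phi> s (Z \<omega> cell1))\<^sup>2 + (\<phi> t (Z \<omega> cell1))\<^sup>2)"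
          using abs_mult_le_squares[of "\<phi> s (Z \<omega> cell1)" "\<phi> t (Z \<omega> cell1)"] by simp
      qed
    qed (intro borel_measurable_times measurable_compose[OF cell_measurable \<phi>] that)
    have l2: "integrable M (\<lambda>\<omega>. (\<Sum>t\<in>T. l i t * \<phi> t (Z \<omega> cell1))\<^sup>2)" for i
    proof -
      have "(\<lambda>\<omega>. (\<Sum>t\<in>T. l i t * \<phi> t (Z \<omega> cell1))\<^sup>2) = (\<lambda>\<omega>. \<Sum>s\<in>T. \<Sum>t\<in>T. (l i s * l i t) * (\<phi> s (Z \<omega> cell1) * \<phi> t (Z \<omega> cell1)))"
        by (simp add: power2_eq_square sum_product mult_ac)
      then show ?thesis
        by (simp only:) (intro Bochner_Integration.integrable_sum integrable_mult_right prod_I)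
    qed
    have e0: "0 \<le> err n a \<omega>" for n \<omega> by (simp add: err_def)
    have dI: "integrable M (\<lambda>\<omega>. \<Sum>i\<in>I. cmod (c i) * char_error (Cs n) lam (\<lambda>z. \<Sum>t\<in>T. l i t * \<phi> t z) \<omega>)" for n
      by (intro Bochner_Integration.integrable_sum integrable_mult_right char_error_integrable lm)
    have eI: "integrable M (err n a)" for n
      by (rule Bochner_Integration.integrable_bound[OF dI[of n] em]) (use le[of n] e0[of n] in \<open>auto intro!: AE_I2 order_trans[OF le abs_ge_self]\<close>)
    show "integrable M (err n a)" by (rule eI)
    show "integrable Q (\<lambda>w. \<Psi> a (G w))" by (rule QI)
    have "(\<lambda>n. \<Sum>i\<in>I. cmod (c i) * (\<integral>\<omega>. char_error (Cs n) lam (\<lambda>z. \<Sum>t\<in>T. l i t * \<phi> t z) \<omega> \<partial>M)) \<longlonglongrightarrow> (\<Sum>i\<in>I. cmod (c i) * 0)"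
      by (intro tendsto_sum tendsto_mult tendsto_const conditional_clt lm l2 Cs lam)
    then have lim0: "(\<lambda>n. \<Sum>i\<in>I. cmod (c i) * (\<integral>\<omega>. char_error (Cs n) lam (\<lambda>z. \<Sum>t\<in>T. l i t * \<phi> t z) \<omega> \<partial>M)) \<longlonglongrightarrow> 0" by simp
    have up: "(\<integral>\<omega>. err n a \<omega> \<partial>M) \<le> (\<Sum>i\<in>I. cmod (c i) * (\<integral>\<omega>. char_error (Cs n) lam (\<lambda>z. \<Sum>t\<in>T. l i t * \<phi> t z) \<omega> \<partial>M))" for n
    proof -
      have "(\<integral>\<omega>. err n a \<omega> \<partial>M) \<le> (\<integral>\<omega>. (\<Sum>i\<in>I. cmod (c i) * char_error (Cs n) lam (\<lambda>z. \<Sum>t\<in>T. l i t * \<phi> t z) \<omega>) \<partial>M)"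
        by (rule integral_mono[OF eI dI le])
      also have "\<dots> = (\<Sum>i\<in>I. cmod (c i) * (\<integral>\<omega>. char_error (Cs n) lam (\<lambda>z. \<Sum>t\<in>T. l i t * \<phi> t z) \<omega> \<partial>M))"
        by (subst Bochner_Integration.integral_sum) (auto intro!: integrable_mult_right char_error_integrable lm)
      finally show ?thesis .
    qed
    show "(\<lambda>n. \<integral>\<omega>. err n a \<omega> \<partial>M) \<longlonglongrightarrow> 0"
      by (rule tendsto_sandwich[OF _ _ tendsto_const lim0]) (auto intro!: always_eventually integral_nonneg_AE e0 up)
  qed
  have "(\<lambda>n. \<Sum>a\<in>A. \<integral>\<omega>. err n a \<omega> \<partial>M) \<longlonglongrightarrow> (\<Sum>a\<in>A. 0)" by (intro tendsto_sum errlim)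
  then have "\<forall>\<^sub>F n in sequentially. (\<Sum>a\<in>A. \<integral>\<omega>. err n a \<omega> \<partial>M) < \<epsilon> / 4"
    using \<epsilon> by (intro order_tendstoD) auto
  then show ?thesis
    using filterlim_at_top[THEN iffD1, OF Cs, rule_format, of 1]
  proof eventually_elim
    case (elim n)
    have m: "0 < Cmin (Cs n)" using elim(2) by simp
    define b2 where "b2 t \<omega> = avg (draws (Cs n)) (\<lambda>d. (b n \<omega> d t)\<^sup>2)" for t \<omega>
    have b2I: "integrable M (b2 t)" and b2E: "(\<integral>\<omega>. b2 t \<omega> \<partial>M) \<le> real CARD('k) * (\<integral>\<omega>. (\<phi> t (Z \<omega> cell1))\<^sup>2 \<partial>M)" if "t \<in> T" for t
      using boot_val_L1(1,2)[OF \<phi>[OF that] \<phi>2[OF that] m] unfolding b2_def [abs_def] b_def by auto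
    \<comment> \<open>Approximation error at the bootstrap process, the same at \<open>G\<close>,
      and the errors of the finitely many \<open>\<Psi> a\<close>; none of them involves
      \<open>H\<close>.\<close>
    define U where "U \<omega> = (\<Sum>t\<in>T. \<kappa> + 2 / R\<^sup>2 * b2 t \<omega>) + (\<Sum>t\<in>T. \<kappa> + 2 / R\<^sup>2 * (\<integral>w. (G w t)\<^sup>2 \<partial>Q)) + (\<Sum>a\<in>A. err n a \<omega>)" for \<omega>
    have UI: "integrable M U"
      unfolding U_def [abs_def]
      by (intro Bochner_Integration.integrable_add Bochner_Integration.integrable_sum integrable_mult_right b2I errI) auto
    have "(\<integral>\<omega>. U \<omega> \<partial>M) = (\<Sum>t\<in>T. \<kappa> + 2 / R\<^sup>2 * (\<integral>\<omega>. b2 t \<omega> \<partial>M)) + (\<Sum>t\<in>T. \<kappa> + 2 / R\<^sup>2 * (\<integral>w. (G w t)\<^sup>2 \<partial>Q)) + (\<Sum>a\<in>A. \<integral>\<omega>. err n a \<omega> \<partial>M)"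
    proof -
      have "(\<integral>\<omega>. (\<Sum>t\<in>T. \<kappa> + 2 / R\<^sup>2 * b2 t \<omega>) \<partial>M) = (\<Sum>t\<in>T. \<kappa> + 2 / R\<^sup>2 * (\<integral>\<omega>. b2 t \<omega> \<partial>M))"
        using b2I by (subst Bochner_Integration.integral_sum) (auto simp: prob_space)
      moreover have "(\<integral>\<omega>. (\<Sum>a\<in>A. err n a \<omega>) \<partial>M) = (\<Sum>a\<in>A. \<integral>\<omega>. err n a \<omega> \<partial>M)"
        by (rule Bochner_Integration.integral_sum) (rule errI)
      moreover have "integrable M (\<lambda>\<omega>. \<Sum>t\<in>T. \<kappa> + 2 / R\<^sup>2 * b2 t \<omega>)" "integrable M (\<lambda>\<omega>. \<Sum>a\<in>A. err n a \<omega>)"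
        by (intro Bochner_Integration.integrable_sum Bochner_Integration.integrable_add integrable_mult_right b2I errI; simp)+
      ultimately show ?thesis unfolding U_def by (simp add: prob_space)
    qed
    also have "\<dots> \<le> (\<Sum>t\<in>T. \<kappa> + 2 / R\<^sup>2 * (real CARD('k) * (\<integral>\<omega>. (\<phi> t (Z \<omega> cell1))\<^sup>2 \<partial>M))) + (\<Sum>t\<in>T. \<kappa> + 2 / R\<^sup>2 * (\<integral>w. (G w t)\<^sup>2 \<partial>Q)) + \<epsilon> / 4"
      using elim(1) by (intro add_mono sum_mono mult_left_mono b2E) auto
    also have "\<dots> = 2 * (real (card T) * \<kappa>) + 2 / R\<^sup>2 * S + \<epsilon> / 4"
      by (simp add: S_def sum.distrib sum_distrib_left algebra_simps)
    also have "\<dots> \<le> \<epsilon>"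
    proof -
      have "real (card T) * \<kappa> \<le> \<epsilon> / 8" using \<epsilon> by (simp add: \<kappa>_def field_simps)
      moreover have "2 / R\<^sup>2 * S \<le> \<epsilon> / 4"
        using \<epsilon> S0 by (simp add: R_def field_simps)
      ultimately show ?thesis using \<epsilon> by linarith
    qed
    finally have UE: "(\<integral>\<omega>. U \<omega> \<partial>M) \<le> \<epsilon>" .
    have pos: "0 < Cs n k" for k using m Cmin_le[of "Cs n" k] by simp
    have ne: "draws (Cs n) \<noteq> {}" using draws_nonempty[of "Cs n"] pos by simp
    have main: "\<bar>avg (draws (Cs n)) (\<lambda>d. H (b n \<omega> d)) - (\<integral>w. H (G w) \<partial>Q)\<bar> \<le> U \<omega>"
      if H1: "\<forall>x. \<bar>H x\<bar> \<le> 1" and Hl: "\<forall>x z. \<bar>H x - H z\<bar> \<le> (\<Sum>t\<in>T. \<bar>x t - z t\<bar>)" and Hm: "(\<lambda>w. H (G w)) \<in> borel_measurable Q" for \<omega> H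
    proof -
      have ap: "\<bar>H x - (\<Sum>a\<in>A. H (q a) * \<Psi> a x)\<bar> \<le> (\<Sum>t\<in>T. \<kappa> + 2 / R\<^sup>2 * (x t)\<^sup>2)" for x
        using app[rule_format, OF H1[rule_format] Hl[rule_format], of x] by simp
      have 1: "\<bar>avg (draws (Cs n)) (\<lambda>d. H (b n \<omega> d)) - avg (draws (Cs n)) (\<lambda>d. \<Sum>a\<in>A. H (q a) * \<Psi> a (b n \<omega> d))\<bar> \<le> (\<Sum>t\<in>T. \<kappa> + 2 / R\<^sup>2 * b2 t \<omega>)"
      proof -
        have "\<bar>avg (draws (Cs n)) (\<lambda>d. H (b n \<omega> d)) - avg (draws (Cs n)) (\<lambda>d. \<Sum>a\<in>A. H (q a) * \<Psi> a (b n \<omega> d))\<bar>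
          \<le> avg (draws (Cs n)) (\<lambda>d. \<Sum>t\<in>T. \<kappa> + 2 / R\<^sup>2 * (b n \<omega> d t)\<^sup>2)"
          unfolding avg_diff [symmetric] by (intro order_trans[OF abs_avg_le] avg_mono ap)
        also have "\<dots> = (\<Sum>t\<in>T. \<kappa> + 2 / R\<^sup>2 * b2 t \<omega>)"
          unfolding avg_sum avg_add avg_cmult b2_def using ne by simp
        finally show ?thesis .
      qed
      have HI: "integrable Q (\<lambda>w. H (G w))" using H1 Hm by (intro Q.integrable_const_bound[where B = 1]) auto
      have sI: "integrable Q (\<lambda>w. \<Sum>a\<in>A. H (q a) * \<Psi> a (G w))"
        by (intro Bochner_Integration.integrable_sum integrable_mult_right \<Psi>I)
      have gI: "integrable Q (\<lambda>w. \<Sum>t\<in>T. \<kappa> + 2 / R\<^sup>2 * (G w t)\<^sup>2)"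
        by (intro Bochner_Integration.integrable_sum Bochner_Integration.integrable_add integrable_mult_right G2) auto
      have 2: "\<bar>(\<integral>w. (\<Sum>a\<in>A. H (q a) * \<Psi> a (G w)) \<partial>Q) - (\<integral>w. H (G w) \<partial>Q)\<bar> \<le> (\<Sum>t\<in>T. \<kappa> + 2 / R\<^sup>2 * (\<integral>w. (G w t)\<^sup>2 \<partial>Q))"
      proof -
        have "\<bar>(\<integral>w. (\<Sum>a\<in>A. H (q a) * \<Psi> a (G w)) \<partial>Q) - (\<integral>w. H (G w) \<partial>Q)\<bar> = \<bar>\<integral>w. (\<Sum>a\<in>A. H (q a) * \<Psi> a (G w)) - H (G w) \<partial>Q\<bar>"
          by (subst Bochner_Integration.integral_diff[OF sI HI]) simp
        also have "\<dots> \<le> (\<integral>w. \<bar>(\<Sum>a\<in>A. H (q a) * \<Psi> a (G w)) - H (G w)\<bar> \<partial>Q)" by (rule integral_abs_bound)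
        also have "\<dots> \<le> (\<integral>w. (\<Sum>t\<in>T. \<kappa> + 2 / R\<^sup>2 * (G w t)\<^sup>2) \<partial>Q)"
          using ap by (intro integral_mono integrable_abs Bochner_Integration.integrable_diff sI HI gI) (simp add: abs_minus_commute)
        also have "\<dots> = (\<Sum>t\<in>T. \<kappa> + 2 / R\<^sup>2 * (\<integral>w. (G w t)\<^sup>2 \<partial>Q))"
          using G2 by (subst Bochner_Integration.integral_sum) (auto simp: Q.prob_space)
        finally show ?thesis .
      qed
      have 3: "\<bar>avg (draws (Cs n)) (\<lambda>d. \<Sum>a\<in>A. H (q a) * \<Psi> a (b n \<omega> d)) - (\<integral>w. (\<Sum>a\<in>A. H (q a) * \<Psi> a (G w)) \<partial>Q)\<bar> \<le> (\<Sum>a\<in>A. err n a \<omega>)"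
      proof -
        have "(\<integral>w. (\<Sum>a\<in>A. H (q a) * \<Psi> a (G w)) \<partial>Q) = (\<Sum>a\<in>A. H (q a) * (\<integral>w. \<Psi> a (G w) \<partial>Q))"
          by (subst Bochner_Integration.integral_sum) (auto intro!: integrable_mult_right \<Psi>I)
        then have "avg (draws (Cs n)) (\<lambda>d. \<Sum>a\<in>A. H (q a) * \<Psi> a (b n \<omega> d)) - (\<integral>w. (\<Sum>a\<in>A. H (q a) * \<Psi> a (G w)) \<partial>Q)
          = (\<Sum>a\<in>A. H (q a) * (avg (draws (Cs n)) (\<lambda>d. \<Psi> a (b n \<omega> d)) - (\<integral>w. \<Psi> a (G w) \<partial>Q)))"
          by (simp only: avg_sum avg_cmult right_diff_distrib sum_subtractf)
        also have "\<bar>\<dots>\<bar> \<le> (\<Sum>a\<in>A. err n a \<omega>)"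
        proof (rule order_trans[OF sum_abs], rule sum_mono)
          fix a
          have "avg (draws (Cs n)) (\<lambda>d. complex_of_real (\<Psi> a (b n \<omega> d))) - (\<integral>w. complex_of_real (\<Psi> a (G w)) \<partial>Q)
            = complex_of_real (avg (draws (Cs n)) (\<lambda>d. \<Psi> a (b n \<omega> d)) - (\<integral>w. \<Psi> a (G w) \<partial>Q))"
            by (simp add: avg_def)
          then have e: "err n a \<omega> = \<bar>avg (draws (Cs n)) (\<lambda>d. \<Psi> a (b n \<omega> d)) - (\<integral>w. \<Psi> a (G w) \<partial>Q)\<bar>"
            unfolding err_def by (simp only: norm_of_real)
          show "\<bar>H (q a) * (avg (draws (Cs n)) (\<lambda>d. \<Psi> a (b n \<omega> d)) - (\<integral>w. \<Psi> a (G w) \<partial>Q))\<bar> \<le> err n a \<omega>"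
            unfolding e abs_mult using H1 by (intro mult_left_le_one_le) auto
        qed
        finally show ?thesis .
      qed
      show ?thesis using 1 2 3 unfolding U_def by linarith
    qed
    show ?case
    proof (intro exI[of _ U] conjI UI UE allI impI)
      fix \<omega> H
      assume "\<forall>x. \<bar>H x\<bar> \<le> (1::real)" "\<forall>x z. \<bar>H x - H z\<bar> \<le> (\<Sum>t\<in>T. \<bar>x t - z t\<bar>)" "(\<lambda>w. H (G w)) \<in> borel_measurable Q"
      from main[OF this, of \<omega>]
      show "\<bar>avg (draws (Cs n)) (\<lambda>d. H (\<lambda>t. boot_val (Cs n) (\<lambda>j. \<phi> t (Z \<omega> j)) d)) - (\<integral>w. H (G w) \<partial>Q)\<bar> \<le> U \<omega>"
        unfolding b_def [abs_def] .
    qed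
  qed
qed

end

section \<open>Asymptotic equicontinuity\<close>

lemma (in prob_space) integral_sqrt_le:
  assumes "integrable M f" "\<And>x. 0 \<le> f x"
  shows "integrable M (\<lambda>x. sqrt (f x))" "(\<integral>x. sqrt (f x) \<partial>M) \<le> sqrt (\<integral>x. f x \<partial>M)"
proof -
  have f2: "integrable M (\<lambda>x. (sqrt (f x))\<^sup>2)" using assms by simp
  have fm: "(\<lambda>x. sqrt (f x)) \<in> borel_measurable M" using assms(1) by measurable
  show "integrable M (\<lambda>x. sqrt (f x))" "(\<integral>x. sqrt (f x) \<partial>M) \<le> sqrt (\<integral>x. f x \<partial>M)"
    using integral_abs_le_sqrt[OF f2 fm] assms(2) by simp_all
qed

text \<open>Functions of the class are measurable only on \<open>Ysp\<close>, so \<open>cQ\<close>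
  of them need not be measurable on the whole cell space. The measurability assumptions therefore
  ask only for a measurable \<open>g\<close> that agrees with it on all data cells.\<close>

locale boot_class = exch_array M Z E + entropy_class Ysp \<F> Fenv Nn
  for M :: "'a measure" and Z :: "'a \<Rightarrow> ('k::finite \<Rightarrow> nat) \<Rightarrow> nat \<times> (nat \<Rightarrow> 'y)" and E
    and Ysp :: "'y set" and \<F> :: "('y \<Rightarrow> real) set" and Fenv Nn +
  assumes goodZ: "\<And>\<omega> j. \<omega> \<in> space M \<Longrightarrow> good (Z \<omega> j)"
    and sq_meas: "\<And>p. p \<in> \<F> \<times> \<F> \<Longrightarrow> \<exists>g\<in>borel_measurable E. \<forall>\<omega>\<in>space M. \<forall>j. g (Z \<omega> j) = cQ (dif p) (Z \<omega> j)"
    and env_meas: "\<exists>g\<in>borel_measurable E. \<forall>\<omega>\<in>space M. \<forall>j. g (Z \<omega> j) = cQ Fenv (Z \<omega> j)"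
    and env_int: "integrable M (\<lambda>\<omega>. cQ Fenv (Z \<omega> cell1))"
begin

section \<open>Uniform laws of large numbers and total boundedness in mean square\<close>

definition pdist :: "('y \<Rightarrow> real) \<times> ('y \<Rightarrow> real) \<Rightarrow> real" where
  "pdist p = (\<integral>\<omega>. cQ (dif p) (Z \<omega> cell1) \<partial>M)"

definition Hmean :: real where
  "Hmean = (\<integral>\<omega>. cQ Fenv (Z \<omega> cell1) \<partial>M)"

definition Htail_mean :: "real \<Rightarrow> real" where
  "Htail_mean B = (\<integral>\<omega>. Htail B (Z \<omega> cell1) \<partial>M)"

definition gc_rate :: "real \<Rightarrow> real \<Rightarrow> nat \<Rightarrow> real" where
  "gc_rate \<eta> B m = 2 * (4 * Htail_mean B + 8 * \<eta> * Hmean + sq_rate \<eta> B m)"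

lemma Htail_nonneg [simp]: "0 \<le> Htail B z"
  by (simp add: Htail_def)

lemma represented_integral:
  fixes f :: "nat \<times> (nat \<Rightarrow> 'y) \<Rightarrow> real"
  assumes g: "g \<in> borel_measurable E" "\<And>\<omega> j. \<omega> \<in> space M \<Longrightarrow> g (Z \<omega> j) = f (Z \<omega> j)"
    and f: "integrable M (\<lambda>\<omega>. f (Z \<omega> cell1))"
  shows "integrable M (\<lambda>\<omega>. f (Z \<omega> j))" "(\<integral>\<omega>. f (Z \<omega> j) \<partial>M) = (\<integral>\<omega>. f (Z \<omega> cell1) \<partial>M)"
proof -
  have I: "integrable M (\<lambda>\<omega>. f (Z \<omega> j)) \<longleftrightarrow> integrable M (\<lambda>\<omega>. g (Z \<omega> j))" for j
    by (rule Bochner_Integration.integrable_cong) (simp_all add: g(2))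
  have E: "(\<integral>\<omega>. f (Z \<omega> j) \<partial>M) = (\<integral>\<omega>. g (Z \<omega> j) \<partial>M)" for j
    by (rule Bochner_Integration.integral_cong) (simp_all add: g(2))
  show "integrable M (\<lambda>\<omega>. f (Z \<omega> j))" using f unfolding I marginal_integrable[OF g(1), of j] .
  show "(\<integral>\<omega>. f (Z \<omega> j) \<partial>M) = (\<integral>\<omega>. f (Z \<omega> cell1) \<partial>M)" unfolding E by (rule marginal_integral[OF g(1)])
qed

lemma env_integral: "integrable M (\<lambda>\<omega>. cQ Fenv (Z \<omega> j))" "(\<integral>\<omega>. cQ Fenv (Z \<omega> j) \<partial>M) = Hmean"
proof -
  obtain g where g: "g \<in> borel_measurable E" "\<forall>\<omega>\<in>space M. \<forall>j. g (Z \<omega> j) = cQ Fenv (Z \<omega> j)" using env_meas by blast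
  then have g': "\<And>\<omega> j. \<omega> \<in> space M \<Longrightarrow> g (Z \<omega> j) = cQ Fenv (Z \<omega> j)" by blast
  show "integrable M (\<lambda>\<omega>. cQ Fenv (Z \<omega> j))" "(\<integral>\<omega>. cQ Fenv (Z \<omega> j) \<partial>M) = Hmean"
    unfolding Hmean_def by (rule represented_integral[where f = "cQ Fenv", OF g(1) g' env_int]; assumption)+
qed

lemma tail_integral: "integrable M (\<lambda>\<omega>. Htail B (Z \<omega> j))" "(\<integral>\<omega>. Htail B (Z \<omega> j) \<partial>M) = Htail_mean B"
proof -
  obtain g where g: "g \<in> borel_measurable E" "\<forall>\<omega>\<in>space M. \<forall>j. g (Z \<omega> j) = cQ Fenv (Z \<omega> j)" using env_meas by blast
  define g' where "g' z = (if g z > B then g z else 0)" for z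
  have gm: "g' \<in> borel_measurable E" unfolding g'_def using g(1) by measurable
  have ge: "g' (Z \<omega> j) = Htail B (Z \<omega> j)" if "\<omega> \<in> space M" for \<omega> j
    using g(2) that by (simp add: g'_def Htail_def)
  have "integrable M (\<lambda>\<omega>. g' (Z \<omega> cell1))"
  proof (rule Bochner_Integration.integrable_bound[OF env_int])
    show "(\<lambda>\<omega>. g' (Z \<omega> cell1)) \<in> borel_measurable M" by (rule measurable_compose[OF cell_measurable gm])
    show "AE \<omega> in M. norm (g' (Z \<omega> cell1)) \<le> norm (cQ Fenv (Z \<omega> cell1))"
      by (rule AE_I2) (simp add: ge Htail_def)
  qed
  then have "integrable M (\<lambda>\<omega>. Htail B (Z \<omega> cell1))"
    by (subst Bochner_Integration.integrable_cong[OF refl, of M _ "\<lambda>\<omega>. g' (Z \<omega> cell1)"]) (simp_all add: ge)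
  note r = represented_integral[where f = "Htail B", OF gm ge this]
  show "integrable M (\<lambda>\<omega>. Htail B (Z \<omega> j))" "(\<integral>\<omega>. Htail B (Z \<omega> j) \<partial>M) = Htail_mean B"
    unfolding Htail_mean_def by (rule r; assumption)+
qed

lemma sq_representation:
  assumes p: "p \<in> \<F> \<times> \<F>"
  shows "\<exists>g. g \<in> borel_measurable E \<and> (\<forall>\<omega>\<in>space M. \<forall>j. g (Z \<omega> j) = cQ (dif p) (Z \<omega> j)) \<and> integrable M (\<lambda>\<omega>. g (Z \<omega> cell1))"
proof -
  obtain g where g: "g \<in> borel_measurable E" "\<forall>\<omega>\<in>space M. \<forall>j. g (Z \<omega> j) = cQ (dif p) (Z \<omega> j)" using sq_meas[OF p] by blast
  have "integrable M (\<lambda>\<omega>. g (Z \<omega> cell1))"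
  proof (rule Bochner_Integration.integrable_bound)
    show "integrable M (\<lambda>\<omega>. 4 * cQ Fenv (Z \<omega> cell1))" by (intro integrable_mult_right env_int)
    show "(\<lambda>\<omega>. g (Z \<omega> cell1)) \<in> borel_measurable M" by (rule measurable_compose[OF cell_measurable g(1)])
    show "AE \<omega> in M. norm (g (Z \<omega> cell1)) \<le> norm (4 * cQ Fenv (Z \<omega> cell1))"
      using p g(2) by (intro AE_I2) (auto intro!: cQ_dif_le goodZ)
  qed
  then show ?thesis using g by blast
qed

lemma sq_integral:
  assumes p: "p \<in> \<F> \<times> \<F>"
  shows "integrable M (\<lambda>\<omega>. cQ (dif p) (Z \<omega> j))" "(\<integral>\<omega>. cQ (dif p) (Z \<omega> j) \<partial>M) = pdist p"
proof -
  obtain g where g: "g \<in> borel_measurable E" "\<forall>\<omega>\<in>space M. \<forall>j. g (Z \<omega> j) = cQ (dif p) (Z \<omega> j)" "integrable M (\<lambda>\<omega>. g (Z \<omega> cell1))"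
    using sq_representation[OF p] by blast
  then have ge: "\<And>\<omega> j. \<omega> \<in> space M \<Longrightarrow> g (Z \<omega> j) = cQ (dif p) (Z \<omega> j)" by blast
  have "integrable M (\<lambda>\<omega>. cQ (dif p) (Z \<omega> cell1))"
    using g(3) by (subst Bochner_Integration.integrable_cong[OF refl, of M _ "\<lambda>\<omega>. g (Z \<omega> cell1)"]) (simp_all add: ge)
  note r = represented_integral[where f = "cQ (dif p)", OF g(1) ge this]
  show "integrable M (\<lambda>\<omega>. cQ (dif p) (Z \<omega> j))" "(\<integral>\<omega>. cQ (dif p) (Z \<omega> j) \<partial>M) = pdist p"
    unfolding pdist_def by (rule r; assumption)+
qed

lemma Hmean_nonneg: "0 \<le> Hmean" "0 \<le> Htail_mean B"
  unfolding Hmean_def Htail_mean_def by (intro integral_nonneg_AE; simp)+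

text \<open>Both bounds come from \<open>rademacher_squares\<close> through symmetrization. The
  diagonal version serves total boundedness, where any sample size is available; the box version
  serves equicontinuity.\<close>

lemma glivenko_cantelli:
  fixes C :: "'k \<Rightarrow> nat"
  assumes I: "finite I" "I \<noteq> {}" "I \<subseteq> \<F> \<times> \<F>" and pos: "0 < \<eta>" "0 < B"
  shows "0 < m \<Longrightarrow> (\<integral>\<omega>. mx I (\<lambda>p. \<bar>avg {..<m} (\<lambda>r. cQ (dif p) (Z \<omega> (diag r))) - pdist p\<bar>) \<partial>M) \<le> gc_rate \<eta> B m" (is "_ \<Longrightarrow> ?D")
    and "0 < Cmin C \<Longrightarrow> (\<integral>\<omega>. mx I (\<lambda>p. \<bar>avg (ibox C) (\<lambda>j. cQ (dif p) (Z \<omega> j)) - pdist p\<bar>) \<partial>M) \<le> gc_rate \<eta> B (Cmin C)" (is "_ \<Longrightarrow> ?B")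
proof -
  have "\<forall>p\<in>I. \<exists>g. g \<in> borel_measurable E \<and> (\<forall>\<omega>\<in>space M. \<forall>j. g (Z \<omega> j) = cQ (dif p) (Z \<omega> j)) \<and> integrable M (\<lambda>\<omega>. g (Z \<omega> cell1))"
    using sq_representation I(3) by blast
  from bchoice[OF this] obtain g where g: "\<forall>p\<in>I. g p \<in> borel_measurable E \<and> (\<forall>\<omega>\<in>space M. \<forall>j. g p (Z \<omega> j) = cQ (dif p) (Z \<omega> j)) \<and> integrable M (\<lambda>\<omega>. g p (Z \<omega> cell1))"
    by blast
  have gm: "g p \<in> borel_measurable E" and gi: "integrable M (\<lambda>\<omega>. g p (Z \<omega> cell1))" if "p \<in> I" for p using g that by auto
  have ge: "g p (Z \<omega> j) = cQ (dif p) (Z \<omega> j)" if "p \<in> I" "\<omega> \<in> space M" for p \<omega> j using g that by blast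
  have g\<mu>: "(\<integral>\<omega>. g p (Z \<omega> cell1) \<partial>M) = pdist p" if "p \<in> I" for p
    unfolding pdist_def by (rule Bochner_Integration.integral_cong) (simp_all add: ge that)
  have rad: "2 * (\<integral>\<omega>. avg (signs m) (\<lambda>e. mx I (\<lambda>p. \<bar>avg {..<m} (\<lambda>r. e r * g p (Z \<omega> (diag r)))\<bar>)) \<partial>M) \<le> gc_rate \<eta> B m" if m: "0 < m" for m
  proof -
    have mne: "{..<m} \<noteq> {}" using m by (auto simp: lessThan_empty_iff)
    let ?b = "\<lambda>\<omega>. 4 * avg {..<m} (\<lambda>r. Htail B (Z \<omega> (diag r))) + 8 * \<eta> * avg {..<m} (\<lambda>r. cQ Fenv (Z \<omega> (diag r))) + sq_rate \<eta> B m"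
    have gI: "integrable M (\<lambda>\<omega>. g p (Z \<omega> j))" if "p \<in> I" for p j
      using marginal_integrable[OF gm[OF that], of j] gi[OF that] by simp
    have bI: "integrable M ?b"
      by (intro Bochner_Integration.integrable_add integrable_mult_right integrable_avg tail_integral env_integral) auto
    have "(\<integral>\<omega>. avg (signs m) (\<lambda>e. mx I (\<lambda>p. \<bar>avg {..<m} (\<lambda>r. e r * g p (Z \<omega> (diag r)))\<bar>)) \<partial>M) \<le> (\<integral>\<omega>. ?b \<omega> \<partial>M)"
    proof (rule integral_mono)
      show "integrable M (\<lambda>\<omega>. avg (signs m) (\<lambda>e. mx I (\<lambda>p. \<bar>avg {..<m} (\<lambda>r. e r * g p (Z \<omega> (diag r)))\<bar>)))"
        by (intro integrable_avg mx_integrable I integrable_abs integrable_mult_right gI)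
      fix \<omega> assume \<omega>: "\<omega> \<in> space M"
      have "avg (signs m) (\<lambda>e. mx I (\<lambda>p. \<bar>avg {..<m} (\<lambda>r. e r * g p (Z \<omega> (diag r)))\<bar>))
         = avg (signs m) (\<lambda>e. mx I (\<lambda>p. \<bar>avg {..<m} (\<lambda>r. e r * cQ (dif p) (Z \<omega> (diag r)))\<bar>))"
        by (intro avg_cong refl mx_cong) (simp add: ge \<omega>)
      also have "\<dots> \<le> ?b \<omega>"
        by (rule rademacher_squares[where x = "\<lambda>r. Z \<omega> (diag r)"]) (use goodZ[OF \<omega>] pos m I in auto)
      finally show "avg (signs m) (\<lambda>e. mx I (\<lambda>p. \<bar>avg {..<m} (\<lambda>r. e r * g p (Z \<omega> (diag r)))\<bar>)) \<le> ?b \<omega>" .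
    qed (rule bI)
    also have "(\<integral>\<omega>. ?b \<omega> \<partial>M) = 4 * (\<integral>\<omega>. avg {..<m} (\<lambda>r. Htail B (Z \<omega> (diag r))) \<partial>M) + 8 * \<eta> * (\<integral>\<omega>. avg {..<m} (\<lambda>r. cQ Fenv (Z \<omega> (diag r))) \<partial>M) + sq_rate \<eta> B m"
      using integrable_avg[of "{..<m}" M "\<lambda>r \<omega>. Htail B (Z \<omega> (diag r))"] integrable_avg[of "{..<m}" M "\<lambda>r \<omega>. cQ Fenv (Z \<omega> (diag r))"]
      by (simp add: tail_integral env_integral prob_space)
    also have "\<dots> = 4 * Htail_mean B + 8 * \<eta> * Hmean + sq_rate \<eta> B m"
      using mne by (simp add: integral_avg tail_integral env_integral)
    finally show ?thesis by (simp add: gc_rate_def)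
  qed
  show ?D if m: "0 < m"
  proof -
    have "(\<integral>\<omega>. mx I (\<lambda>p. \<bar>avg {..<m} (\<lambda>r. cQ (dif p) (Z \<omega> (diag r))) - pdist p\<bar>) \<partial>M)
       = (\<integral>\<omega>. mx I (\<lambda>p. \<bar>avg {..<m} (\<lambda>r. g p (Z \<omega> (diag r))) - (\<integral>\<omega>. g p (Z \<omega> cell1) \<partial>M)\<bar>) \<partial>M)"
      by (intro Bochner_Integration.integral_cong refl mx_cong) (simp add: ge g\<mu>)
    also have "\<dots> \<le> 2 * (\<integral>\<omega>. avg (signs m) (\<lambda>e. mx I (\<lambda>p. \<bar>avg {..<m} (\<lambda>r. e r * g p (Z \<omega> (diag r)))\<bar>)) \<partial>M)"
      by (rule diag_symmetrization[OF I(1,2) m gm gi])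
    finally show ?thesis using rad[OF m] by linarith
  qed
  show ?B if m: "0 < Cmin C"
  proof -
    have "(\<integral>\<omega>. mx I (\<lambda>p. \<bar>avg (ibox C) (\<lambda>j. cQ (dif p) (Z \<omega> j)) - pdist p\<bar>) \<partial>M)
       = (\<integral>\<omega>. mx I (\<lambda>p. \<bar>avg (ibox C) (\<lambda>j. g p (Z \<omega> j)) - (\<integral>\<omega>. g p (Z \<omega> cell1) \<partial>M)\<bar>) \<partial>M)"
      by (intro Bochner_Integration.integral_cong refl mx_cong) (simp add: ge g\<mu>)
    also have "\<dots> \<le> 2 * (\<integral>\<omega>. avg (signs (Cmin C)) (\<lambda>e. mx I (\<lambda>p. \<bar>avg {..<Cmin C} (\<lambda>r. e r * g p (Z \<omega> (diag r)))\<bar>)) \<partial>M)"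
      by (rule box_symmetrization[OF I(1,2) m gm gi])
    finally show ?thesis using rad[OF m] by linarith
  qed
qed

lemma Htail_mean_tendsto: "(\<lambda>b. Htail_mean (real b)) \<longlonglongrightarrow> 0"
proof -
  have "(\<lambda>b. Htail_mean (real b)) \<longlonglongrightarrow> (\<integral>\<omega>. 0 \<partial>M)"
    unfolding Htail_mean_def
  proof (rule integral_dominated_convergence[OF _ _ env_int])
    show "AE \<omega> in M. (\<lambda>b. Htail (real b) (Z \<omega> cell1)) \<longlonglongrightarrow> 0"
    proof (intro AE_I2 tendsto_eventually)
      fix \<omega>
      obtain b0 :: nat where "cQ Fenv (Z \<omega> cell1) \<le> real b0" using real_arch_simple by blast
      then have "Htail (real b) (Z \<omega> cell1) = 0" if "b0 \<le> b" for b using that by (auto simp: Htail_def)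
      then show "\<forall>\<^sub>F b in sequentially. Htail (real b) (Z \<omega> cell1) = 0" by (auto simp: eventually_sequentially)
    qed
    show "(\<lambda>\<omega>. Htail (real b) (Z \<omega> cell1)) \<in> borel_measurable M" for b
      using tail_integral(1) by (rule borel_measurable_integrable)
  qed (auto simp: Htail_def)
  then show ?thesis by simp
qed

text \<open>First \<open>B\<close> makes the envelope tail small, then \<eta> makes the net error
  small; with both fixed, \<open>sq_rate\<close> tends to 0 in \<open>m\<close>.\<close>

lemma gc_rate_small:
  assumes \<delta>: "0 < \<delta>"
  shows "\<exists>\<eta> B. 0 < \<eta> \<and> 0 < B \<and> (\<forall>\<^sub>F m in sequentially. gc_rate \<eta> B m < \<delta>)"
proof -
  have "\<forall>\<^sub>F b in sequentially. Htail_mean (real b) < \<delta> / 32"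
    using \<delta> by (intro order_tendstoD[OF Htail_mean_tendsto]) auto
  then have "\<forall>\<^sub>F b in sequentially. Htail_mean (real b) < \<delta> / 32 \<and> 1 \<le> b"
    using eventually_ge_at_top[of 1] by eventually_elim auto
  then obtain b :: nat where b: "Htail_mean (real b) < \<delta> / 32" "1 \<le> b"
    using eventually_happens by fastforce
  define \<eta> where "\<eta> = \<delta> / (64 * (Hmean + 1))"
  have \<eta>: "0 < \<eta>" using \<delta> Hmean_nonneg(1) by (simp add: \<eta>_def)
  have \<eta>H: "\<eta> * Hmean \<le> \<delta> / 64" using \<delta> Hmean_nonneg(1) by (simp add: \<eta>_def field_simps)
  have "(\<lambda>m. sq_rate \<eta> (real b) m) \<longlonglongrightarrow> 4 * real b * sqrt 0"
    unfolding sq_rate_def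
    by (intro tendsto_mult tendsto_const tendsto_real_sqrt real_tendsto_divide_at_top[OF tendsto_const filterlim_real_sequentially])
  then have "\<forall>\<^sub>F m in sequentially. sq_rate \<eta> (real b) m < \<delta> / 8"
    using \<delta> by (intro order_tendstoD[where y = "4 * real b * sqrt 0"]) auto
  then have "\<forall>\<^sub>F m in sequentially. gc_rate \<eta> (real b) m < \<delta>"
  proof eventually_elim
    case (elim m)
    have "2 * (4 * x + 8 * y + z) < \<delta>" if "x < \<delta> / 32" "y \<le> \<delta> / 64" "z < \<delta> / 8" for x y z
      using that \<delta> by (simp add: field_simps)
    from this[OF b(1) \<eta>H elim] show ?case by (simp add: gc_rate_def mult.assoc)
  qed
  then show ?thesis using \<eta> b(2) by (intro exI[of _ \<eta>] exI[of _ "real b"]) auto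
qed

text \<open>A separated set is also separated in the empirical distance for some outcome, so its
  cardinality is bounded by a uniform covering number.\<close>

lemma separated_card_le:
  assumes \<delta>: "0 < \<delta>"
  shows "\<exists>N. \<forall>S. finite S \<longrightarrow> S \<subseteq> \<F> \<longrightarrow> (\<forall>f\<in>S. \<forall>g\<in>S. f \<noteq> g \<longrightarrow> \<delta> \<le> pdist (f, g)) \<longrightarrow> card S \<le> N"
proof -
  \<comment> \<open>Chosen so that, by Markov, the empirical envelope exceeds \<open>h\<close> with
    probability at most one half.\<close>
  define h where "h = 2 * Hmean + 1"
  have h: "0 < h" "Hmean / h \<le> 1 / 2" using Hmean_nonneg(1) by (auto simp: h_def field_simps)
  \<comment> \<open>Two functions with the same net centre are then at squared empirical distance at
    most \<open>4 * \<theta>^2 * h\<close>, a quarter of \<delta>.\<close>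
  define \<theta> where "\<theta> = sqrt (\<delta> / (16 * h))"
  have \<theta>: "0 < \<theta>" "\<theta>\<^sup>2 = \<delta> / (16 * h)" using \<delta> h by (auto simp: \<theta>_def)
  have "card S \<le> Nn \<theta>" if S: "finite S" "S \<subseteq> \<F>" and sep: "\<forall>f\<in>S. \<forall>g\<in>S. f \<noteq> g \<longrightarrow> \<delta> \<le> pdist (f, g)" for S
  proof (rule ccontr)
    assume "\<not> card S \<le> Nn \<theta>"
    then have big: "Nn \<theta> < card S" by simp
    define I where "I = {p \<in> S \<times> S. fst p \<noteq> snd p}"
    have I: "finite I" "I \<subseteq> \<F> \<times> \<F>" using S by (auto simp: I_def)
    have Ine: "I \<noteq> {}"
    proof
      assume "I = {}"
      then have "\<forall>f\<in>S. \<forall>g\<in>S. f = g" unfolding I_def by fastforce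
      then have "card S \<le> 1" using S(1) by (auto simp: card_le_Suc0_iff_eq)
      then show False using big Nn_pos[of \<theta>] by simp
    qed
    obtain \<eta> B where \<eta>B: "0 < \<eta>" "0 < B" "\<forall>\<^sub>F m in sequentially. gc_rate \<eta> B m < \<delta> / 8" using gc_rate_small[of "\<delta> / 8"] \<delta> by auto
    have "\<forall>\<^sub>F m in sequentially. gc_rate \<eta> B m < \<delta> / 8 \<and> 1 \<le> m"
      using \<eta>B(3) eventually_ge_at_top[of 1] by eventually_elim auto
    then obtain m :: nat where m: "gc_rate \<eta> B m < \<delta> / 8" "0 < m" using eventually_happens by fastforce
    have mne: "{..<m} \<noteq> {}" using m by (auto simp: lessThan_empty_iff)
    define X where "X \<omega> = mx I (\<lambda>p. \<bar>avg {..<m} (\<lambda>r. cQ (dif p) (Z \<omega> (diag r))) - pdist p\<bar>)" for \<omega>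
    define Y where "Y \<omega> = avg {..<m} (\<lambda>r. cQ Fenv (Z \<omega> (diag r)))" for \<omega>
    have XI: "integrable M X" unfolding X_def [abs_def]
      using I by (intro mx_integrable Ine integrable_abs Bochner_Integration.integrable_diff integrable_avg sq_integral) auto
    have YI: "integrable M Y" unfolding Y_def [abs_def] by (intro integrable_avg env_integral)
    have EX: "(\<integral>\<omega>. X \<omega> \<partial>M) < \<delta> / 8"
      unfolding X_def using glivenko_cantelli(1)[OF I(1) Ine I(2) \<eta>B(1,2) m(2)] m(1) by linarith
    have EY: "(\<integral>\<omega>. Y \<omega> \<partial>M) = Hmean" unfolding Y_def using mne by (simp add: integral_avg env_integral)
    \<comment> \<open>Otherwise \<open>2 * X / \<delta> + Y / h\<close> would be at least 1
      everywhere, while its mean is at most \<open>1/4 + 1/2\<close>.\<close>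
    have "\<exists>\<omega>\<in>space M. X \<omega> < \<delta> / 2 \<and> Y \<omega> \<le> h"
    proof (rule ccontr)
      assume no: "\<not> (\<exists>\<omega>\<in>space M. X \<omega> < \<delta> / 2 \<and> Y \<omega> \<le> h)"
      have X0: "0 \<le> X \<omega>" for \<omega> unfolding X_def by (intro mx_nonneg I Ine) auto
      have Y0: "0 \<le> Y \<omega>" for \<omega> unfolding Y_def by (intro avg_nonneg) auto
      have "(\<integral>\<omega>. 1 \<partial>M) \<le> (\<integral>\<omega>. X \<omega> * (2 / \<delta>) + Y \<omega> * (1 / h) \<partial>M)"
      proof (rule integral_mono)
        show "integrable M (\<lambda>\<omega>. X \<omega> * (2 / \<delta>) + Y \<omega> * (1 / h))"
          by (intro Bochner_Integration.integrable_add integrable_mult_left XI YI)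
        fix \<omega> assume "\<omega> \<in> space M"
        then consider "\<delta> / 2 \<le> X \<omega>" | "h \<le> Y \<omega>" using no by force
        then show "1 \<le> X \<omega> * (2 / \<delta>) + Y \<omega> * (1 / h)"
        proof cases
          case 1
          then have "1 \<le> X \<omega> * (2 / \<delta>)" using \<delta> by (simp add: field_simps)
          moreover have "0 \<le> Y \<omega> * (1 / h)" using Y0[of \<omega>] h by simp
          ultimately show ?thesis by linarith
        next
          case 2
          then have "1 \<le> Y \<omega> * (1 / h)" using h by (simp add: field_simps)
          moreover have "0 \<le> X \<omega> * (2 / \<delta>)" using X0[of \<omega>] \<delta> by simp
          ultimately show ?thesis by linarith
        qed
      qed simp
      also have "\<dots> = (\<integral>\<omega>. X \<omega> \<partial>M) * (2 / \<delta>) + Hmean * (1 / h)"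
        using XI YI by (simp add: EY)
      also have "(\<integral>\<omega>. X \<omega> \<partial>M) * (2 / \<delta>) \<le> (\<delta> / 8) * (2 / \<delta>)"
        using EX \<delta> by (intro mult_right_mono) auto
      also have "(\<delta> / 8) * (2 / \<delta>) = 1 / 4" using \<delta> by simp
      finally show False using h(2) by (simp add: prob_space)
    qed
    then obtain \<omega> where \<omega>: "\<omega> \<in> space M" "X \<omega> < \<delta> / 2" "Y \<omega> \<le> h" by blast
    define x where "x r = Z \<omega> (diag r)" for r :: nat
    have gx: "good (x r)" for r using goodZ[OF \<omega>(1)] by (simp add: x_def)
    have sF: "(semi m x Fenv)\<^sup>2 = Y \<omega>" unfolding semi_square x_def Y_def ..
    obtain G where G: "finite G" "G \<noteq> {}" "card G \<le> Nn \<theta>" "\<forall>f\<in>\<F>. \<exists>g\<in>G. semi m x (dif (f, g)) \<le> \<theta> * semi m x Fenv"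
      using net_cells[OF \<theta>(1), of m x] gx by blast
    obtain c where c: "\<forall>f\<in>\<F>. c f \<in> G \<and> semi m x (dif (f, c f)) \<le> \<theta> * semi m x Fenv" using G(4) by metis
    \<comment> \<open>By pigeonhole two separated functions share a centre; they are empirically
      close, contradicting \<open>X < \<delta> / 2\<close>.\<close>
    have "\<not> inj_on c S"
    proof
      assume "inj_on c S"
      then have "card S \<le> card G" using c S G(1) by (intro card_inj_on_le[of c]) auto
      then show False using G(3) big by simp
    qed
    then obtain f g where fg: "f \<in> S" "g \<in> S" "f \<noteq> g" "c f = c g" by (auto simp: inj_on_def)
    have fgF: "f \<in> \<F>" "g \<in> \<F>" using fg S by auto
    have "semi m x (dif (f, g)) \<le> semi m x (dif (f, c f)) + semi m x (dif (g, c g))"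
      using semi_triangle[of m x f g "c f"] semi_swap[of m x "c g" g] fg(4) by simp
    also have "\<dots> \<le> 2 * \<theta> * semi m x Fenv"
    proof -
      have "semi m x (dif (f, c f)) \<le> \<theta> * semi m x Fenv" "semi m x (dif (g, c g)) \<le> \<theta> * semi m x Fenv"
        using c fgF by blast+
      moreover have "2 * \<theta> * semi m x Fenv = \<theta> * semi m x Fenv + \<theta> * semi m x Fenv" by simp
      ultimately show ?thesis by linarith
    qed
    finally have "(semi m x (dif (f, g)))\<^sup>2 \<le> (2 * \<theta> * semi m x Fenv)\<^sup>2" by (intro power_mono) auto
    also have "\<dots> = 4 * \<theta>\<^sup>2 * Y \<omega>" by (simp add: power_mult_distrib sF)
    also have "\<dots> \<le> 4 * \<theta>\<^sup>2 * h" using \<omega>(3) by (intro mult_left_mono) auto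
    also have "\<dots> = \<delta> / 4" using h \<theta>(2) by simp
    finally have small: "avg {..<m} (\<lambda>r. cQ (dif (f, g)) (Z \<omega> (diag r))) \<le> \<delta> / 4" unfolding semi_square x_def .
    have "(f, g) \<in> I" using fg by (auto simp: I_def)
    then have "\<bar>avg {..<m} (\<lambda>r. cQ (dif (f, g)) (Z \<omega> (diag r))) - pdist (f, g)\<bar> \<le> X \<omega>"
      unfolding X_def by (rule mx_ge[OF I(1), where f = "\<lambda>p. \<bar>avg {..<m} (\<lambda>r. cQ (dif p) (Z \<omega> (diag r))) - pdist p\<bar>"])
    moreover have "\<delta> \<le> pdist (f, g)" using sep fg by blast
    ultimately show False using small \<omega>(2) \<delta> by linarith
  qed
  then show ?thesis by blast
qed

text \<open>A separated set of maximal cardinality is a net: a function far from all its points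
  could be added.\<close>

lemma totally_bounded:
  assumes \<delta>: "0 < \<delta>"
  shows "\<exists>T. finite T \<and> T \<subseteq> \<F> \<and> (\<forall>f\<in>\<F>. \<exists>t\<in>T. pdist (f, t) < \<delta>)"
proof -
  define P where "P S \<longleftrightarrow> finite S \<and> S \<subseteq> \<F> \<and> (\<forall>f\<in>S. \<forall>g\<in>S. f \<noteq> g \<longrightarrow> \<delta> \<le> pdist (f, g))" for S
  obtain N where N: "\<forall>S. P S \<longrightarrow> card S \<le> N" using separated_card_le[OF \<delta>] unfolding P_def by metis
  have P0: "P {}" by (simp add: P_def)
  have "\<forall>S. P S \<longrightarrow> card S < Suc N" using N by (simp only: less_Suc_eq_le)
  from ex_has_greatest_nat[OF P0 this] obtain T where T: "P T" "\<forall>S. P S \<longrightarrow> card S \<le> card T" by blast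
  have TF: "finite T" "T \<subseteq> \<F>" "f \<in> T \<Longrightarrow> g \<in> T \<Longrightarrow> f \<noteq> g \<Longrightarrow> \<delta> \<le> pdist (f, g)" for f g
    using T(1) unfolding P_def by blast+
  have sym: "pdist (f, g) = pdist (g, f)" for f g
  proof -
    have "(dif (f, g) y)\<^sup>2 = (dif (g, f) y)\<^sup>2" for y unfolding dif_def fst_conv snd_conv by (rule power2_commute)
    then show ?thesis unfolding pdist_def cQ_def by simp
  qed
  have self: "pdist (f, f) = 0" for f unfolding pdist_def cQ_def dif_def by simp
  have "\<exists>t\<in>T. pdist (f, t) < \<delta>" if f: "f \<in> \<F>" for f
  proof (rule ccontr)
    assume "\<not> (\<exists>t\<in>T. pdist (f, t) < \<delta>)"
    then have no: "\<delta> \<le> pdist (f, t)" "\<delta> \<le> pdist (t, f)" if "t \<in> T" for t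
      using that unfolding sym[of t f] by (meson not_less)+
    have fT: "f \<notin> T" using no(1)[of f] \<delta> unfolding self by linarith
    have "P (insert f T)" unfolding P_def using TF no f by (intro conjI ballI impI) (simp, simp, metis insert_iff)
    then have "card (insert f T) \<le> card T" using T(2) by blast
    then show False using fT TF(1) by simp
  qed
  then show ?thesis using TF by blast
qed

text \<open>Maxima over initial segments of an enumeration increase to the supremum, so the uniform
  bound on finite maxima survives by dominated convergence. Countability is what makes the supremum
  measurable.\<close>

lemma countable_sup_bound:
  fixes v :: "'i \<Rightarrow> 'a \<Rightarrow> real"
  assumes P: "countable P" and vm: "\<And>p. p \<in> P \<Longrightarrow> integrable M (v p)" and v0: "\<And>p \<omega>. 0 \<le> v p \<omega>"
    and dom: "\<And>p \<omega>. p \<in> P \<Longrightarrow> \<omega> \<in> space M \<Longrightarrow> v p \<omega> \<le> w \<omega>" and wI: "integrable M w"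
    and K: "0 \<le> K" "\<And>I. finite I \<Longrightarrow> I \<noteq> {} \<Longrightarrow> I \<subseteq> P \<Longrightarrow> (\<integral>\<omega>. mx I (\<lambda>p. v p \<omega>) \<partial>M) \<le> K"
  shows "\<exists>V. integrable M V \<and> (\<forall>\<omega>. 0 \<le> V \<omega>) \<and> (\<integral>\<omega>. V \<omega> \<partial>M) \<le> K \<and> (\<forall>p\<in>P. \<forall>\<omega>\<in>space M. v p \<omega> \<le> V \<omega>)"
proof (cases "P = {}")
  case True
  then show ?thesis using K(1) by (intro exI[of _ "\<lambda>_. 0"]) auto
next
  case False
  define a where "a = from_nat_into P"
  have aP: "a i \<in> P" for i using from_nat_into[OF False] by (simp add: a_def)
  have aS: "\<exists>i. p = a i" if "p \<in> P" for p using from_nat_into_surj[OF P that] by (auto simp: a_def)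
  define u where "u n \<omega> = mx (a ` {..n}) (\<lambda>p. v p \<omega>)" for n \<omega>
  have uI: "integrable M (u n)" for n unfolding u_def [abs_def] by (intro mx_integrable vm) (use aP in auto)
  have mono: "u n \<omega> \<le> u n' \<omega>" if "n \<le> n'" for n n' \<omega>
    unfolding u_def using that by (intro mx_le) (auto intro!: mx_ge[where f = "\<lambda>p. v p \<omega>"])
  have ub: "u n \<omega> \<le> w \<omega>" if "\<omega> \<in> space M" for n \<omega>
    unfolding u_def by (intro mx_le) (use dom aP that in auto)
  have u0: "0 \<le> u n \<omega>" for n \<omega> unfolding u_def by (intro mx_nonneg v0) auto
  \<comment> \<open>The value 0 is only for arguments outside \<open>space M\<close>; inside,
    \<open>w\<close> bounds the maxima.\<close>
  define V where "V \<omega> = (if bdd_above (range (\<lambda>n. u n \<omega>)) then (SUP n. u n \<omega>) else 0)" for \<omega>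
  have bdd: "bdd_above (range (\<lambda>n. u n \<omega>))" if "\<omega> \<in> space M" for \<omega> using ub[OF that] by (intro bdd_aboveI[of _ "w \<omega>"]) auto
  have lim: "(\<lambda>n. u n \<omega>) \<longlonglongrightarrow> V \<omega>" if "\<omega> \<in> space M" for \<omega>
    using LIMSEQ_incseq_SUP[OF bdd[OF that]] mono bdd[OF that] by (auto simp: V_def incseq_def)
  have Vm: "V \<in> borel_measurable M"
    by (rule borel_measurable_LIMSEQ_real[OF lim]) (use uI in auto)
  have VI: "integrable M V" and Vlim: "(\<lambda>n. \<integral>\<omega>. u n \<omega> \<partial>M) \<longlonglongrightarrow> (\<integral>\<omega>. V \<omega> \<partial>M)"
  proof -
    have "AE \<omega> in M. norm (u n \<omega>) \<le> w \<omega>" for n using ub u0 by (intro AE_I2) auto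
    moreover have "AE \<omega> in M. (\<lambda>n. u n \<omega>) \<longlonglongrightarrow> V \<omega>" using lim by (intro AE_I2)
    ultimately show "integrable M V" "(\<lambda>n. \<integral>\<omega>. u n \<omega> \<partial>M) \<longlonglongrightarrow> (\<integral>\<omega>. V \<omega> \<partial>M)"
      using integrable_dominated_convergence[OF Vm _ wI, of u] integral_dominated_convergence[OF Vm _ wI, of u] uI by auto
  qed
  have "(\<integral>\<omega>. u n \<omega> \<partial>M) \<le> K" for n unfolding u_def by (rule K(2)) (use aP in auto)
  then have "(\<integral>\<omega>. V \<omega> \<partial>M) \<le> K" using Vlim by (intro LIMSEQ_le_const2[OF Vlim]) auto
  moreover have "0 \<le> V \<omega>" for \<omega>
  proof (cases "bdd_above (range (\<lambda>n. u n \<omega>))")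
    case True
    then have "u 0 \<omega> \<le> V \<omega>" unfolding V_def using cSUP_upper[OF UNIV_I True, of 0] by simp
    then show ?thesis using u0[of 0 \<omega>] by linarith
  qed (simp add: V_def)
  moreover have "v p \<omega> \<le> V \<omega>" if pw: "p \<in> P" "\<omega> \<in> space M" for p \<omega>
  proof -
    obtain i where "p = a i" using aS[OF pw(1)] by blast
    then have "v p \<omega> \<le> u i \<omega>" unfolding u_def by (intro mx_ge[where f = "\<lambda>p. v p \<omega>"]) auto
    also have "\<dots> \<le> V \<omega>" using bdd[OF pw(2)] cSUP_upper[OF UNIV_I bdd[OF pw(2)], of i] by (simp add: V_def)
    finally show ?thesis .
  qed
  ultimately show ?thesis using VI by blast
qed

text \<open>Pointwise limits on \<open>Ysp\<close> are also limits in the empirical and in the mean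
  squared distance, with the envelope as dominating function. This carries bounds from the countable
  subclass to all of \<open>\<F>\<close>.\<close>

lemma pdist_tendsto:
  assumes s: "\<And>n. s n \<in> \<F>" and f: "f \<in> \<F>" and t: "t \<in> \<F>" and lim: "\<And>y. y \<in> Ysp \<Longrightarrow> (\<lambda>n. s n y) \<longlonglongrightarrow> f y"
  shows "\<omega> \<in> space M \<Longrightarrow> (\<lambda>n. cQ (dif (s n, t)) (Z \<omega> j)) \<longlonglongrightarrow> cQ (dif (f, t)) (Z \<omega> j)"
    and "(\<lambda>n. pdist (s n, t)) \<longlonglongrightarrow> pdist (f, t)"
proof -
  show pt: "(\<lambda>n. cQ (dif (s n, t)) (Z \<omega> j)) \<longlonglongrightarrow> cQ (dif (f, t)) (Z \<omega> j)" if "\<omega> \<in> space M" for \<omega> j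
    unfolding cQ_def dif_def fst_conv snd_conv using goodZ[OF that, of j]
    by (intro tendsto_intros lim) (simp add: good_def)
  show "(\<lambda>n. pdist (s n, t)) \<longlonglongrightarrow> pdist (f, t)"
    unfolding pdist_def
  proof (rule integral_dominated_convergence[where w = "\<lambda>\<omega>. 4 * cQ Fenv (Z \<omega> cell1)"])
    show "integrable M (\<lambda>\<omega>. 4 * cQ Fenv (Z \<omega> cell1))" by (intro integrable_mult_right env_int)
    show "AE \<omega> in M. (\<lambda>n. cQ (dif (s n, t)) (Z \<omega> cell1)) \<longlonglongrightarrow> cQ (dif (f, t)) (Z \<omega> cell1)" using pt by (intro AE_I2)
    show "AE \<omega> in M. norm (cQ (dif (s n, t)) (Z \<omega> cell1)) \<le> 4 * cQ Fenv (Z \<omega> cell1)" for n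
      by (intro AE_I2) (auto intro!: cQ_dif_le s t goodZ)
  qed (use sq_integral(1) s f t in \<open>auto intro!: borel_measurable_integrable\<close>)
qed

text \<open>The order of quantifiers matters: \<delta> comes before the finite set \<open>T\<close>,
  since \<open>T\<close> will be a \<delta>-net, and \<open>U\<close> before the finite set
  \<open>I\<close> of pairs, since \<open>I\<close> will depend on the outcome and on
  \<open>h\<close>.\<close>

lemma asymptotic_equicontinuity:
  fixes Cs :: "nat \<Rightarrow> 'k \<Rightarrow> nat"
  assumes pm: "pointwise_measurable Ysp \<F>" and Cs: "filterlim (\<lambda>n. Cmin (Cs n)) at_top sequentially" and \<kappa>: "0 < \<kappa>"
  shows "\<exists>\<delta>>0. \<forall>T. finite T \<longrightarrow> T \<subseteq> \<F> \<longrightarrow> (\<forall>\<^sub>F n in sequentially. \<exists>U. integrable M U \<and> (\<integral>\<omega>. U \<omega> \<partial>M) \<le> \<kappa> \<and>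
     (\<forall>\<omega>\<in>space M. \<forall>I. finite I \<longrightarrow> I \<noteq> {} \<longrightarrow> I \<subseteq> \<F> \<times> T \<longrightarrow> (\<forall>p\<in>I. pdist p < \<delta>) \<longrightarrow>
        avg (draws (Cs n)) (\<lambda>d. mx I (\<lambda>p. \<bar>boot_val (Cs n) (\<lambda>j. cS (dif p) (Z \<omega> j)) d\<bar>)) \<le> U \<omega>))"
proof -
  have "(\<lambda>s. chain_rate s * sqrt Hmean) \<longlonglongrightarrow> 0 * sqrt Hmean" by (intro tendsto_mult tendsto_const chain_rate_tendsto)
  then have "\<forall>\<^sub>F s in sequentially. chain_rate s * sqrt Hmean < \<kappa> / 4" using \<kappa> by (intro order_tendstoD) auto
  then obtain s where s: "chain_rate s * sqrt Hmean < \<kappa> / 4" using eventually_happens by fastforce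
  \<comment> \<open>Solves \<open>ell' s * sqrt (4 * \<delta>) <= \<kappa> / 4\<close>; adding 1 to
    \<open>ell' s\<close> keeps the divisor positive.\<close>
  define \<delta> where "\<delta> = (\<kappa> / (8 * (ell' s + 1)))\<^sup>2"
  have l: "0 < ell' s + 1" using ell_nonneg(2)[of s] by linarith
  have \<delta>: "0 < \<delta>" using \<kappa> l by (simp add: \<delta>_def)
  have sq\<delta>: "ell' s * sqrt (4 * \<delta>) \<le> \<kappa> / 4"
  proof -
    define L where "L = ell' s + 1"
    have L: "0 < L" using l by (simp add: L_def)
    have "sqrt (4 * \<delta>) = 2 * (\<kappa> / (8 * L))" unfolding \<delta>_def real_sqrt_mult L_def using \<kappa> l by simp
    then have "ell' s * sqrt (4 * \<delta>) = \<kappa> / 4 * (ell' s / L)" using L by (simp add: field_simps)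
    also have "\<dots> \<le> \<kappa> / 4 * 1" using \<kappa> L by (intro mult_left_mono) (auto simp: L_def)
    finally show ?thesis by simp
  qed
  \<comment> \<open>The budget \<open>4 * \<delta>\<close> under the root is \<delta> for the mean
    distance plus \<open>3 * \<delta> / 2\<close> twice: once for the deviation of the box from the
    mean, once for the drawn diagonal from the box.\<close>
  obtain \<eta> B where \<eta>B: "0 < \<eta>" "0 < B" "\<forall>\<^sub>F m in sequentially. gc_rate \<eta> B m < 3 * \<delta> / 2" using gc_rate_small[of "3 * \<delta> / 2"] \<delta> by auto
  obtain \<G> where \<G>: "\<G> \<subseteq> \<F>" "countable \<G>" "\<forall>f\<in>\<F>. \<exists>s. (\<forall>n. s n \<in> \<G>) \<and> (\<forall>y\<in>Ysp. (\<lambda>n. s n y) \<longlonglongrightarrow> f y)"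
    using pm unfolding pointwise_measurable_def by blast
  have main: "\<forall>\<^sub>F n in sequentially. \<exists>U. integrable M U \<and> (\<integral>\<omega>. U \<omega> \<partial>M) \<le> \<kappa> \<and>
     (\<forall>\<omega>\<in>space M. \<forall>I. finite I \<longrightarrow> I \<noteq> {} \<longrightarrow> I \<subseteq> \<F> \<times> T \<longrightarrow> (\<forall>p\<in>I. pdist p < \<delta>) \<longrightarrow>
        avg (draws (Cs n)) (\<lambda>d. mx I (\<lambda>p. \<bar>boot_val (Cs n) (\<lambda>j. cS (dif p) (Z \<omega> j)) d\<bar>)) \<le> U \<omega>)"
    if T: "finite T" "T \<subseteq> \<F>" for T
    using filterlim_at_top[THEN iffD1, OF Cs, rule_format, of 1] eventually_compose_filterlim[OF \<eta>B(3) Cs]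
  proof eventually_elim
    case (elim n)
    define C where "C = Cs n"
    have m: "0 < Cmin C" using elim(1) by (simp add: C_def)
    have rate: "gc_rate \<eta> B (Cmin C) < 3 * \<delta> / 2" using elim(2) by (simp add: C_def)
    have pos: "0 < C k" for k using m Cmin_le[of C k] by simp
    have ne: "ibox C \<noteq> {}" using ibox_nonempty[of C] pos by simp
    \<comment> \<open>First ends from the countable subclass, second ends from the finite
      \<open>T\<close>: a countable set, so the largest box distance has a measurable
      majorant.\<close>
    define P where "P = {p \<in> \<G> \<times> T. pdist p < \<delta>}"
    have P: "countable P" unfolding P_def using \<G>(2) T(1) by (intro countable_Collect countable_SIGMA) (auto intro: countable_finite)
    have PF: "P \<subseteq> \<F> \<times> \<F>" using \<G>(1) T(2) by (auto simp: P_def)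
    define v where "v p \<omega> = avg (ibox C) (\<lambda>j. cQ (dif p) (Z \<omega> j))" for p \<omega>
    define w where "w \<omega> = avg (ibox C) (\<lambda>j. cQ Fenv (Z \<omega> j))" for \<omega>
    have wI: "integrable M w" unfolding w_def [abs_def] by (intro integrable_avg env_integral)
    have Ew: "(\<integral>\<omega>. w \<omega> \<partial>M) = Hmean" unfolding w_def using ne by (simp add: integral_avg env_integral)
    have w0: "0 \<le> w \<omega>" for \<omega> unfolding w_def by (intro avg_nonneg) auto
    have vI: "integrable M (v p)" if "p \<in> P" for p
      unfolding v_def [abs_def] using that PF by (intro integrable_avg sq_integral) auto
    have vK: "(\<integral>\<omega>. mx I (\<lambda>p. v p \<omega>) \<partial>M) \<le> \<delta> + 3 * \<delta> / 2" if I: "finite I" "I \<noteq> {}" "I \<subseteq> P" for I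
    proof -
      have IF: "I \<subseteq> \<F> \<times> \<F>" using I PF by auto
      have DI: "integrable M (\<lambda>\<omega>. mx I (\<lambda>p. \<bar>v p \<omega> - pdist p\<bar>))"
        using I vI by (intro mx_integrable integrable_abs Bochner_Integration.integrable_diff) auto
      have "(\<integral>\<omega>. mx I (\<lambda>p. v p \<omega>) \<partial>M) \<le> (\<integral>\<omega>. \<delta> + mx I (\<lambda>p. \<bar>v p \<omega> - pdist p\<bar>) \<partial>M)"
      proof (rule integral_mono)
        show "integrable M (\<lambda>\<omega>. mx I (\<lambda>p. v p \<omega>))" using I vI by (intro mx_integrable) auto
        show "integrable M (\<lambda>\<omega>. \<delta> + mx I (\<lambda>p. \<bar>v p \<omega> - pdist p\<bar>))" using DI by simp
        fix \<omega>
        show "mx I (\<lambda>p. v p \<omega>) \<le> \<delta> + mx I (\<lambda>p. \<bar>v p \<omega> - pdist p\<bar>)"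
        proof (rule mx_le[OF I(1,2)])
          fix p assume p: "p \<in> I"
          have "\<bar>v p \<omega> - pdist p\<bar> \<le> mx I (\<lambda>p. \<bar>v p \<omega> - pdist p\<bar>)" by (rule mx_ge[OF I(1) p, where f = "\<lambda>p. \<bar>v p \<omega> - pdist p\<bar>"])
          moreover have "pdist p < \<delta>" using p I(3) by (auto simp: P_def)
          ultimately show "v p \<omega> \<le> \<delta> + mx I (\<lambda>p. \<bar>v p \<omega> - pdist p\<bar>)" by linarith
        qed
      qed
      also have "\<dots> = \<delta> + (\<integral>\<omega>. mx I (\<lambda>p. \<bar>v p \<omega> - pdist p\<bar>) \<partial>M)" using DI by (simp add: prob_space)
      also have "\<dots> \<le> \<delta> + 3 * \<delta> / 2"
        using glivenko_cantelli(2)[OF I(1,2) IF \<eta>B(1,2) m] rate unfolding v_def by linarith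
      finally show ?thesis .
    qed
    have "\<exists>V. integrable M V \<and> (\<forall>\<omega>. 0 \<le> V \<omega>) \<and> (\<integral>\<omega>. V \<omega> \<partial>M) \<le> \<delta> + 3 * \<delta> / 2 \<and> (\<forall>p\<in>P. \<forall>\<omega>\<in>space M. v p \<omega> \<le> V \<omega>)"
    proof (rule countable_sup_bound[OF P vI])
      show "0 \<le> v p \<omega>" for p \<omega> unfolding v_def by (intro avg_nonneg) auto
      show "integrable M (\<lambda>\<omega>. 4 * w \<omega>)" using wI by simp
      fix p \<omega> assume "p \<in> P" "\<omega> \<in> space M"
      then show "v p \<omega> \<le> 4 * w \<omega>"
        unfolding v_def w_def avg_cmult [symmetric] using PF goodZ by (intro avg_mono) (auto intro!: cQ_dif_le)
    qed (use \<delta> vK in auto)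
    then obtain V where V: "integrable M V" "\<And>\<omega>. 0 \<le> V \<omega>" "(\<integral>\<omega>. V \<omega> \<partial>M) \<le> \<delta> + 3 * \<delta> / 2" "\<And>p \<omega>. p \<in> P \<Longrightarrow> \<omega> \<in> space M \<Longrightarrow> v p \<omega> \<le> V \<omega>"
      by blast
    define b where "b \<omega> = boot_sq_rate \<eta> B C (Z \<omega>)" for \<omega>
    have bI: "integrable M b" unfolding b_def [abs_def] boot_sq_rate_def
      by (intro integrable_mult_right Bochner_Integration.integrable_add integrable_avg tail_integral env_integral) auto
    have sr0: "0 \<le> sq_rate \<eta> B (Cmin C)"
    proof -
      have "1 \<le> real (Nn \<eta>)" using Nn_pos[of \<eta>] by simp
      then have "1 \<le> (real (Nn \<eta>))\<^sup>2" by (simp add: one_le_power)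
      then have "0 \<le> ln (2 * (real (Nn \<eta>))\<^sup>2)" by (intro ln_ge_zero) linarith
      then show ?thesis using \<eta>B(2) unfolding sq_rate_def by (intro mult_nonneg_nonneg real_sqrt_ge_zero divide_nonneg_nonneg) auto
    qed
    have b0: "0 \<le> b \<omega>" for \<omega> unfolding b_def boot_sq_rate_def
      using sr0 \<eta>B(1) by (intro mult_nonneg_nonneg add_nonneg_nonneg avg_nonneg) auto
    have Eb: "(\<integral>\<omega>. b \<omega> \<partial>M) = gc_rate \<eta> B (Cmin C)"
    proof -
      have i1: "integrable M (\<lambda>\<omega>. avg (ibox C) (\<lambda>j. Htail B (Z \<omega> j)))" by (intro integrable_avg tail_integral)
      have "(\<integral>\<omega>. b \<omega> \<partial>M) = 2 * (4 * (\<integral>\<omega>. avg (ibox C) (\<lambda>j. Htail B (Z \<omega> j)) \<partial>M) + 8 * \<eta> * (\<integral>\<omega>. w \<omega> \<partial>M) + sq_rate \<eta> B (Cmin C))"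
        unfolding b_def boot_sq_rate_def w_def [symmetric] using i1 wI by (simp add: prob_space)
      also have "(\<integral>\<omega>. avg (ibox C) (\<lambda>j. Htail B (Z \<omega> j)) \<partial>M) = Htail_mean B" using ne by (simp add: integral_avg tail_integral)
      finally show ?thesis by (simp add: Ew gc_rate_def)
    qed
    have Vb: "integrable M (\<lambda>\<omega>. V \<omega> + b \<omega>)" "\<And>\<omega>. 0 \<le> V \<omega> + b \<omega>" using V bI b0 by (auto simp: add_nonneg_nonneg)
    define U where "U \<omega> = 2 * (chain_rate s * sqrt (w \<omega>) + ell' s * sqrt (V \<omega> + b \<omega>))" for \<omega>
    note sw = integral_sqrt_le[OF wI w0] and sV = integral_sqrt_le[OF Vb]
    have c0: "0 \<le> chain_rate s"
      unfolding chain_rate_def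
      using ell_summable by (intro add_nonneg_nonneg mult_nonneg_nonneg suminf_nonneg)
        (use summable_iff_shift[of "\<lambda>s. (1/2)^s * ell s" s] in auto)
    have UI: "integrable M U" unfolding U_def [abs_def]
      by (intro integrable_mult_right Bochner_Integration.integrable_add sw(1) sV(1))
    have "(\<integral>\<omega>. U \<omega> \<partial>M) = 2 * (chain_rate s * (\<integral>\<omega>. sqrt (w \<omega>) \<partial>M) + ell' s * (\<integral>\<omega>. sqrt (V \<omega> + b \<omega>) \<partial>M))"
      unfolding U_def using sw(1) sV(1) by simp
    also have "\<dots> \<le> 2 * (chain_rate s * sqrt Hmean + ell' s * sqrt (4 * \<delta>))"
    proof (intro mult_left_mono add_mono c0 ell_nonneg)
      show "(\<integral>\<omega>. sqrt (w \<omega>) \<partial>M) \<le> sqrt Hmean" using sw(2) by (simp add: Ew)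
      have "(\<integral>\<omega>. V \<omega> + b \<omega> \<partial>M) \<le> 4 * \<delta>" using V bI rate by (simp add: Eb)
      then show "(\<integral>\<omega>. sqrt (V \<omega> + b \<omega>) \<partial>M) \<le> sqrt (4 * \<delta>)" using sV(2) by (meson order_trans real_sqrt_le_mono)
    qed auto
    also have "\<dots> \<le> \<kappa>"
    proof -
      have "2 * (x + y) \<le> \<kappa>" if "x < \<kappa> / 4" "y \<le> \<kappa> / 4" for x y
        using that by argo
      then show ?thesis using s sq\<delta> by blast
    qed
    finally have UE: "(\<integral>\<omega>. U \<omega> \<partial>M) \<le> \<kappa>" .
    have bound: "avg (draws C) (\<lambda>d. mx I (\<lambda>p. \<bar>boot_val C (\<lambda>j. cS (dif p) (Z \<omega> j)) d\<bar>)) \<le> U \<omega>"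
      if \<omega>: "\<omega> \<in> space M" and I: "finite I" "I \<noteq> {}" "I \<subseteq> \<F> \<times> T" "\<forall>p\<in>I. pdist p < \<delta>" for \<omega> I
    proof -
      have IF: "I \<subseteq> \<F> \<times> \<F>" using I(3) T(2) by auto
      \<comment> \<open>Approximate \<open>f\<close> by the countable subclass. The strict
        inequality \<open>pdist p < \<delta>\<close> persists along the sequence, and the bound by
        \<open>V\<close> passes to the limit.\<close>
      have vV: "v p \<omega> \<le> V \<omega>" if p: "p \<in> I" for p
      proof -
        obtain f t where ft: "p = (f, t)" "f \<in> \<F>" "t \<in> T" using p I(3) by auto
        have tF: "t \<in> \<F>" using ft T by auto
        obtain sq where sq: "\<And>n. sq n \<in> \<G>" "\<And>y. y \<in> Ysp \<Longrightarrow> (\<lambda>n. sq n y) \<longlonglongrightarrow> f y" using \<G>(3) ft(2) by blast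
        have sqF: "sq n \<in> \<F>" for n using sq(1) \<G>(1) by blast
        have lim1: "(\<lambda>n. cQ (dif (sq n, t)) (Z \<omega> j)) \<longlonglongrightarrow> cQ (dif (f, t)) (Z \<omega> j)" for j
          by (rule pdist_tendsto(1)[where s = sq and f = f and t = t]) (fact sqF ft(2) tF sq(2) \<omega>)+
        have lim2: "(\<lambda>n. pdist (sq n, t)) \<longlonglongrightarrow> pdist (f, t)"
          by (rule pdist_tendsto(2)[where s = sq and f = f and t = t]) (fact sqF ft(2) tF sq(2))+
        have "pdist (f, t) < \<delta>" using I(4) p ft(1) by blast
        then have "\<forall>\<^sub>F n in sequentially. pdist (sq n, t) < \<delta>" by (intro order_tendstoD[OF lim2])
        then have "\<forall>\<^sub>F n in sequentially. v (sq n, t) \<omega> \<le> V \<omega>"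
        proof eventually_elim
          case (elim n)
          then show ?case using sq(1) ft(3) by (intro V(4) \<omega>) (auto simp: P_def)
        qed
        moreover have "(\<lambda>n. v (sq n, t) \<omega>) \<longlonglongrightarrow> v (f, t) \<omega>"
          unfolding v_def avg_def using ne by (intro tendsto_divide tendsto_sum tendsto_const lim1) auto
        ultimately show ?thesis unfolding ft(1) by (intro tendsto_upperbound[where F = sequentially]) auto
      qed
      have "avg (draws C) (\<lambda>d. mx I (\<lambda>p. \<bar>boot_val C (\<lambda>j. cS (dif p) (Z \<omega> j)) d\<bar>))
        \<le> 2 * (chain_rate s * sqrt (w \<omega>) + ell' s * sqrt (mx I (\<lambda>p. v p \<omega>) + b \<omega>))"
        unfolding boot_val_def w_def v_def b_def
        by (rule boot_equicontinuity[where z = "Z \<omega>"]) (use goodZ[OF \<omega>] \<eta>B m I(1,2) IF in auto)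
      also have "\<dots> \<le> U \<omega>"
        unfolding U_def using vV I(1,2) by (intro mult_left_mono add_left_mono real_sqrt_le_mono add_right_mono mx_le) auto
      finally show ?thesis .
    qed
    show ?case
      by (rule exI[of _ U]) (use UI UE bound in \<open>auto simp: C_def\<close>)
  qed
  show ?thesis by (rule exI[of _ \<delta>]) (use \<delta> main in blast)
qed

end

section \<open>The pigeonhole bootstrap of a class of functions\<close>

text \<open>Each sublevel set of \<open>f\<close> is the trace on \<open>S\<close> of a Borel set
  \<open>B q\<close>. The infimum of the rationals \<open>q\<close> with \<open>y\<close> in
  \<open>B q\<close> is Borel and equals \<open>f y\<close> on \<open>S\<close>; off
  \<open>S\<close> it may be infinite, hence the detour through extended reals.\<close>

lemma borel_extension_exists:
  fixes f :: "'y::topological_space \<Rightarrow> real"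
  assumes "f \<in> borel_measurable (restrict_space borel S)"
  shows "\<exists>g\<in>borel_measurable borel. \<forall>y\<in>S. g y = f y"
proof -
  have "\<exists>B\<in>sets borel. {y\<in>S. f y < q} = S \<inter> B" for q
  proof -
    have "{y \<in> space (restrict_space borel S). f y < q} \<in> sets (restrict_space borel S)"
      using assms by measurable
    then show ?thesis by (auto simp: sets_restrict_space space_restrict_space)
  qed
  then obtain B where B: "\<And>q. B q \<in> sets borel" "\<And>q. {y\<in>S. f y < q} = S \<inter> B q" by metis
  define u where "u y = (INF q\<in>\<rat>. if y \<in> B q then ereal q else \<infinity>)" for y
  have m: "(\<lambda>y. if y \<in> B q then ereal q else \<infinity>) \<in> borel_measurable borel" for q
    using B(1)[of q] by (intro measurable_If_set) auto
  have um: "u \<in> borel_measurable borel"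
    unfolding u_def by (intro borel_measurable_INF countable_rat m)
  have "u y = ereal (f y)" if y: "y \<in> S" for y
  proof (rule antisym)
    have mem: "y \<in> B q \<longleftrightarrow> f y < q" for q using B(2)[of q] y by blast
    show "ereal (f y) \<le> u y"
      unfolding u_def by (intro INF_greatest) (auto simp: mem)
    show "u y \<le> ereal (f y)"
    proof (rule ereal_le_epsilon2)
      fix e :: real assume "0 < e"
      then obtain q where q: "q \<in> \<rat>" "f y < q" "q < f y + e" using Rats_dense_in_real[of "f y" "f y + e"] by auto
      have "u y \<le> (if y \<in> B q then ereal q else \<infinity>)" unfolding u_def by (rule INF_lower[OF q(1)])
      also have "\<dots> \<le> ereal (f y) + ereal e" using q by (simp add: mem)
      finally show "u y \<le> ereal (f y) + ereal e" .
    qed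
  qed
  then show ?thesis using um by (intro bexI[of _ "\<lambda>y. real_of_ereal (u y)"]) auto
qed

definition borel_ext :: "'y::topological_space set \<Rightarrow> ('y \<Rightarrow> real) \<Rightarrow> 'y \<Rightarrow> real" where
  "borel_ext S f = (SOME g. g \<in> borel_measurable borel \<and> (\<forall>y\<in>S. g y = f y))"

lemma borel_ext:
  assumes "f \<in> borel_measurable (restrict_space borel S)"
  shows "borel_ext S f \<in> borel_measurable borel" "\<And>y. y \<in> S \<Longrightarrow> borel_ext S f y = f y"
  using someI_ex[OF borel_extension_exists[OF assms, unfolded Bex_def]] unfolding borel_ext_def by blast+

lemma cS_measurable:
  fixes f :: "'y::topological_space \<Rightarrow> real"
  assumes f: "f \<in> borel_measurable borel"
  shows "cS f \<in> borel_measurable cellspace"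
proof -
  have "(\<lambda>z. snd z l) \<in> cellspace \<rightarrow>\<^sub>M (borel :: 'y measure)" for l :: nat
    unfolding cellspace_def by (rule measurable_compose[OF measurable_snd measurable_component_singleton]) simp
  then have m: "(\<lambda>z. f (snd z l)) \<in> borel_measurable cellspace" for l :: nat by (rule measurable_compose[OF _ f])
  have "(\<lambda>z. \<Sum>l<fst z. f (snd z l)) \<in> borel_measurable cellspace"
  proof (rule measurable_compose_countable[where f = "\<lambda>n z. \<Sum>l<n. f (snd z l)" and g = fst])
    show "fst \<in> cellspace \<rightarrow>\<^sub>M count_space UNIV" unfolding cellspace_def by (rule measurable_fst)
  qed (use m in auto)
  then show ?thesis by (simp add: cS_def [abs_def])
qed

lemma cQ_eq_cS: "cQ f z = real (fst z) * cS (\<lambda>y. (f y)\<^sup>2) z"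
  by (simp add: cQ_def cS_def)

lemma cQ_measurable:
  fixes f :: "'y::topological_space \<Rightarrow> real"
  assumes f: "f \<in> borel_measurable borel"
  shows "cQ f \<in> borel_measurable cellspace"
proof -
  have "(\<lambda>z. real (fst z)) \<in> borel_measurable (cellspace :: (nat \<times> (nat \<Rightarrow> 'y)) measure)"
    unfolding cellspace_def by (rule measurable_compose[OF measurable_fst]) simp
  moreover have "cS (\<lambda>y. (f y)\<^sup>2) \<in> borel_measurable cellspace" using f by (intro cS_measurable) measurable
  ultimately show ?thesis unfolding cQ_eq_cS [abs_def] by (rule borel_measurable_times)
qed

lemma cS_data: "cS f (data N Y \<omega> j) = cellsum N Y f j \<omega>"
  by (simp add: cS_def data_def cellsum_def)

lemma cQ_data: "cQ f (data N Y \<omega> j) = real (N \<omega> j) * cellsum N Y (\<lambda>y. (f y)\<^sup>2) j \<omega>"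
  by (simp add: cQ_def data_def cellsum_def)

lemma exch_array_data:
  fixes N :: "'a \<Rightarrow> ('k::finite \<Rightarrow> nat) \<Rightarrow> nat" and Y :: "'a \<Rightarrow> ('k \<Rightarrow> nat) \<Rightarrow> nat \<Rightarrow> 'y::topological_space"
  assumes "prob_space M" "A1 M N Y"
  shows "exch_array M (data N Y) cellspace"
proof -
  interpret prob_space M by fact
  have Nm: "(\<lambda>\<omega>. N \<omega> j) \<in> measurable M (count_space UNIV)" and Ym: "(\<lambda>\<omega>. Y \<omega> j l) \<in> borel_measurable M" for j l
    using assms(2) by (auto simp: A1_def)
  show ?thesis
  proof
    fix j
    have "(\<lambda>\<omega> l. Y \<omega> j l) \<in> M \<rightarrow>\<^sub>M (\<Pi>\<^sub>M l\<in>UNIV. borel)"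
      by (rule measurable_PiM_single') (use Ym in \<open>auto simp: PiE_def\<close>)
    then show "(\<lambda>\<omega>. data N Y \<omega> j) \<in> M \<rightarrow>\<^sub>M cellspace"
      unfolding data_def cellspace_def using Nm by (intro measurable_Pair)
  qed (use assms(2) in \<open>auto simp: A1_def\<close>)
qed

section \<open>Bootstrap weights as multiplicities of uniform draws\<close>

definition counts :: "('k \<Rightarrow> nat) \<Rightarrow> ('k \<Rightarrow> nat \<Rightarrow> nat) \<Rightarrow> 'k \<Rightarrow> nat \<Rightarrow> nat" where
  "counts C d i j = card {m\<in>{..<C i}. d i m = j}"

text \<open>The weights are the image of a uniform distribution under counting.
  \<open>Pi_pmf\<close> uses functions that are 0 outside the index range, \<open>draws\<close>
  extensional ones; restriction is a bijection between the two that preserves the counts.\<close>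

lemma boot_expectation:
  fixes C :: "'k::finite \<Rightarrow> nat" and \<Phi> :: "_ \<Rightarrow> real"
  assumes pos: "\<And>i. 0 < C i"
  shows "measure_pmf.expectation (boot_weights C) \<Phi> = avg (draws C) (\<lambda>d. \<Phi> (counts C d))"
proof -
  define D where "D i = PiE_dflt {..<C i} (0::nat) (\<lambda>_. {..<C i})" for i
  define P where "P = PiE_dflt UNIV (\<lambda>_. 0::nat) D"
  define cnt where "cnt i d j = card {m\<in>{..<C i}. d m = j}" for i and d :: "nat \<Rightarrow> nat" and j
  have ne: "{..<C i} \<noteq> {}" for i using pos[of i] by auto
  have D: "Pi_pmf {..<C i} 0 (\<lambda>_. pmf_of_set {..<C i}) = pmf_of_set (D i)" for i
    unfolding D_def by (rule Pi_pmf_of_set) (use ne in auto)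
  have Df: "finite (D i)" "D i \<noteq> {}" for i
    unfolding D_def using pos[of i] by (auto intro!: finite_PiE_dflt simp: PiE_dflt_empty_iff)
  have Pf: "finite P" "P \<noteq> {}"
    unfolding P_def using Df by (auto intro!: finite_PiE_dflt simp: PiE_dflt_empty_iff)
  have "boot_weights C = Pi_pmf UNIV (\<lambda>_. 0) (\<lambda>i. bind_pmf (pmf_of_set (D i)) (\<lambda>d. return_pmf (cnt i d)))"
    unfolding boot_weights_def D map_pmf_def cnt_def ..
  also have "\<dots> = bind_pmf (Pi_pmf UNIV (\<lambda>_. 0) (\<lambda>i. pmf_of_set (D i))) (\<lambda>f. return_pmf (\<lambda>i. cnt i (f i)))"
    by (subst Pi_pmf_bind[where d' = "\<lambda>_. 0"]) simp_all
  also have "\<dots> = map_pmf (\<lambda>f i. cnt i (f i)) (pmf_of_set P)"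
    unfolding map_pmf_def P_def by (subst Pi_pmf_of_set) (use Df in auto)
  finally have "measure_pmf.expectation (boot_weights C) \<Phi> = avg P (\<lambda>f. \<Phi> (\<lambda>i. cnt i (f i)))"
    by (simp add: integral_pmf_of_set[OF Pf(2,1)] avg_def)
  also have "\<dots> = avg P (\<lambda>f. \<Phi> (counts C (\<lambda>i. restrict (f i) {..<C i})))"
  proof (intro avg_cong refl)
    fix f assume "f \<in> P"
    have "cnt i (f i) = counts C (\<lambda>i. restrict (f i) {..<C i}) i" for i
      unfolding cnt_def counts_def by (intro ext arg_cong[where f = card]) auto
    then show "\<Phi> (\<lambda>i. cnt i (f i)) = \<Phi> (counts C (\<lambda>i. restrict (f i) {..<C i}))" by presburger
  qed
  also have "\<dots> = avg (draws C) (\<lambda>d. \<Phi> (counts C d))"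
  proof (rule avg_reindex, rule bij_betw_byWitness[where f' = "\<lambda>d i m. if m < C i then d i m else 0"])
    show "\<forall>f\<in>P. (\<lambda>i m. if m < C i then restrict (f i) {..<C i} m else 0) = f"
      by (auto simp: P_def D_def PiE_dflt_def fun_eq_iff)
    show "\<forall>d\<in>draws C. (\<lambda>i. restrict (\<lambda>m. if m < C i then d i m else 0) {..<C i}) = d"
      by (auto simp: mem_draws fun_eq_iff extensional_def restrict_def)
    show "(\<lambda>f i. restrict (f i) {..<C i}) ` P \<subseteq> draws C"
      by (auto simp: P_def D_def PiE_dflt_def mem_draws)
    show "(\<lambda>d i m. if m < C i then d i m else 0) ` draws C \<subseteq> P"
      by (auto simp: P_def D_def PiE_dflt_def mem_draws)
  qed
  finally show ?thesis .
qed

text \<open>The product of the counts at \<open>j\<close> is the number of box points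
  \<open>u\<close> with \<open>pick d u = j\<close>, since these form a product set; grouping the
  box by the drawn cell turns the weighted sum into a sum over draws.\<close>

lemma boot_process_counts:
  fixes C :: "'k::finite \<Rightarrow> nat"
  assumes d: "d \<in> draws C"
  shows "boot_process C N Y \<omega> (counts C d) f = boot_val C (\<lambda>j. cellsum N Y f j \<omega>) d"
proof -
  define x where "x j = cellsum N Y f j \<omega>" for j
  have I: "{j. \<forall>i. j i < C i} = ibox C" by (auto simp: mem_ibox)
  have c: "(\<Prod>i\<in>UNIV. counts C d i (j i)) = card {u\<in>ibox C. pick d u = j}" for j
  proof -
    have "{u\<in>ibox C. pick d u = j} = PiE UNIV (\<lambda>i. {m\<in>{..<C i}. d i m = j i})"
      by (auto simp: mem_ibox pick_def fun_eq_iff PiE_iff)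
    then show ?thesis by (simp add: card_PiE counts_def)
  qed
  have "(\<Sum>j\<in>ibox C. real (\<Prod>i\<in>UNIV. counts C d i (j i)) * x j) = (\<Sum>j\<in>ibox C. \<Sum>u\<in>{u\<in>ibox C. pick d u = j}. x (pick d u))"
    unfolding c by (intro sum.cong refl) simp
  also have "\<dots> = (\<Sum>u\<in>ibox C. x (pick d u))"
    by (rule sum.group) (use pick_ibox[OF d] in auto)
  finally have "(\<Sum>j\<in>ibox C. (real (\<Prod>i\<in>UNIV. counts C d i (j i)) - 1) * x j) = (\<Sum>u\<in>ibox C. x (pick d u)) - (\<Sum>j\<in>ibox C. x j)"
    by (simp add: left_diff_distrib sum_subtractf)
  then show ?thesis
    unfolding boot_process_def I boot_val_def avg_def x_def [symmetric] card_ibox by (simp add: diff_divide_distrib right_diff_distrib)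
qed

lemma normal_char:
  fixes X :: "'w \<Rightarrow> real"
  assumes Q: "prob_space Q" and X: "distributed Q lborel X (normal_density 0 (sqrt v))" and v: "0 < v"
  shows "(\<integral>w. iexp (X w) \<partial>Q) = complex_of_real (exp (- (v / 2)))"
    and "integrable Q (\<lambda>w. (X w)\<^sup>2)"
proof -
  interpret Q: prob_space Q by (rule Q)
  define S where "S w = X w / sqrt v" for w
  have s: "0 < sqrt v" using v by simp
  have S: "distributed Q lborel S std_normal_density"
    using Q.normal_standard_normal_convert[OF s, of X 0] X unfolding S_def by simp
  have Sm: "S \<in> borel_measurable Q" using distributed_measurable[OF S] by simp
  have "distr Q borel S = distr Q lborel S" by (rule distr_cong) simp_all
  then have law: "distr Q borel S = std_normal_distribution"
    using distributed_distr_eq_density[OF S] by simp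
  have "(\<integral>w. iexp (sqrt v * S w) \<partial>Q) = char (distr Q borel S) (sqrt v)"
    unfolding char_def by (rule integral_distr[OF Sm, symmetric]) simp
  also have "\<dots> = char std_normal_distribution (sqrt v)" by (simp only: law)
  also have "\<dots> = complex_of_real (exp (- (v / 2)))" using v by (simp add: char_std_normal_distribution)
  finally show "(\<integral>w. iexp (X w) \<partial>Q) = complex_of_real (exp (- (v / 2)))" using s by (simp add: S_def)
  have "integrable lborel (\<lambda>x. normal_density 0 (sqrt v) x * x\<^sup>2)"
    using integrable_normal_moment[OF s, of 0 2] by simp
  then show "integrable Q (\<lambda>w. (X w)\<^sup>2)"
    using distributed_integrable[OF X, of "\<lambda>x. x\<^sup>2"] by simp
qed

lemma covar_sum:
  fixes X X' :: "'t \<Rightarrow> 'a \<Rightarrow> real"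
  assumes "\<And>t. t \<in> T \<Longrightarrow> integrable M (X t)" "\<And>t. t \<in> T \<Longrightarrow> integrable M (X' t)"
    and "\<And>s t. s \<in> T \<Longrightarrow> t \<in> T \<Longrightarrow> integrable M (\<lambda>\<omega>. X s \<omega> * X' t \<omega>)"
  shows "covar M (\<lambda>\<omega>. \<Sum>t\<in>T. l t * X t \<omega>) (\<lambda>\<omega>. \<Sum>t\<in>T. l t * X' t \<omega>) = (\<Sum>s\<in>T. \<Sum>t\<in>T. l s * l t * covar M (X s) (X' t))"
proof -
  have "(\<integral>\<omega>. (\<Sum>t\<in>T. l t * X t \<omega>) * (\<Sum>t\<in>T. l t * X' t \<omega>) \<partial>M) = (\<integral>\<omega>. (\<Sum>s\<in>T. \<Sum>t\<in>T. (l s * l t) * (X s \<omega> * X' t \<omega>)) \<partial>M)"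
    unfolding sum_product by (simp only: mult.assoc mult.left_commute)
  also have "\<dots> = (\<Sum>s\<in>T. \<integral>\<omega>. (\<Sum>t\<in>T. (l s * l t) * (X s \<omega> * X' t \<omega>)) \<partial>M)"
    using assms(3) by (intro Bochner_Integration.integral_sum Bochner_Integration.integrable_sum integrable_mult_right) auto
  also have "\<dots> = (\<Sum>s\<in>T. \<Sum>t\<in>T. \<integral>\<omega>. (l s * l t) * (X s \<omega> * X' t \<omega>) \<partial>M)"
    using assms(3) by (intro sum.cong refl Bochner_Integration.integral_sum integrable_mult_right) auto
  also have "\<dots> = (\<Sum>s\<in>T. \<Sum>t\<in>T. l s * l t * (\<integral>\<omega>. X s \<omega> * X' t \<omega> \<partial>M))"
    by (intro sum.cong refl) (rule integral_mult_right_zero)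
  finally have 1: "(\<integral>\<omega>. (\<Sum>t\<in>T. l t * X t \<omega>) * (\<Sum>t\<in>T. l t * X' t \<omega>) \<partial>M) = (\<Sum>s\<in>T. \<Sum>t\<in>T. l s * l t * (\<integral>\<omega>. X s \<omega> * X' t \<omega> \<partial>M))" .
  have 2: "(\<integral>\<omega>. (\<Sum>t\<in>T. l t * X t \<omega>) \<partial>M) = (\<Sum>t\<in>T. l t * (\<integral>\<omega>. X t \<omega> \<partial>M))"
    using assms(1) by (subst Bochner_Integration.integral_sum) auto
  have 3: "(\<integral>\<omega>. (\<Sum>t\<in>T. l t * X' t \<omega>) \<partial>M) = (\<Sum>t\<in>T. l t * (\<integral>\<omega>. X' t \<omega> \<partial>M))"
    using assms(2) by (subst Bochner_Integration.integral_sum) auto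
  show ?thesis
    unfolding covar_def 1 2 3 unfolding sum_product by (simp add: right_diff_distrib sum_subtractf ac_simps)
qed

lemma BL1_lipschitz:
  assumes h: "h \<in> BL1 \<F>" and b: "0 \<le> b" "\<And>f. f \<in> \<F> \<Longrightarrow> \<bar>x f - z f\<bar> \<le> b"
  shows "\<bar>h x - h z\<bar> \<le> b"
proof -
  have "ennreal \<bar>h x - h z\<bar> \<le> (SUP f\<in>\<F>. ennreal \<bar>x f - z f\<bar>)" using h by (simp add: BL1_def)
  also have "\<dots> \<le> ennreal b" using b(2) by (intro SUP_least ennreal_leI)
  finally show ?thesis using b(1) by simp
qed

lemma BL1_bound: "h \<in> BL1 \<F> \<Longrightarrow> \<bar>h x\<bar> \<le> 1"
  by (simp add: BL1_def)

lemma BL1_cong: "h \<in> BL1 \<F> \<Longrightarrow> (\<And>f. f \<in> \<F> \<Longrightarrow> x f = z f) \<Longrightarrow> h x = h z"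
  using BL1_lipschitz[of h \<F> 0 x z] by simp

text \<open>A finite supremum is itself an admissible \<open>b\<close>; for an infinite one the
  Lipschitz condition is void.\<close>

lemma BL1_I:
  assumes "\<And>x. \<bar>h x\<bar> \<le> 1"
    and lip: "\<And>x z b. 0 \<le> b \<Longrightarrow> (\<And>f. f \<in> \<F> \<Longrightarrow> \<bar>x f - z f\<bar> \<le> b) \<Longrightarrow> \<bar>h x - h z\<bar> \<le> b"
  shows "h \<in> BL1 \<F>"
proof -
  have "ennreal \<bar>h x - h z\<bar> \<le> (SUP f\<in>\<F>. ennreal \<bar>x f - z f\<bar>)" for x z
  proof (cases "(SUP f\<in>\<F>. ennreal \<bar>x f - z f\<bar>)" rule: ennreal_cases)
    case (real b)
    have "\<bar>x f - z f\<bar> \<le> b" if "f \<in> \<F>" for f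
    proof -
      have "ennreal \<bar>x f - z f\<bar> \<le> ennreal b" unfolding real(2) [symmetric] using that by (rule SUP_upper)
      then show ?thesis using real(1) by simp
    qed
    then have "\<bar>h x - h z\<bar> \<le> b" by (rule lip[OF real(1)])
    then show ?thesis unfolding real(2) by (rule ennreal_leI)
  next
    case top
    show ?thesis unfolding top by (rule top_greatest)
  qed
  then show ?thesis using assms(1) by (simp add: BL1_def)
qed

lemma outer_prob_le: "B \<in> sets M \<Longrightarrow> A \<subseteq> B \<Longrightarrow> outer_prob M A \<le> measure M B"
  unfolding outer_prob_def by (rule cInf_lower) (auto intro!: bdd_belowI[of _ 0])

lemma outer_prob_nonneg:
  assumes "A \<subseteq> space M"
  shows "0 \<le> outer_prob M A"
  unfolding outer_prob_def using assms by (intro cInf_greatest) auto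

section \<open>Cell sums of the class and the covariance kernel\<close>

locale bootstrap_data = exch_array M "data N Y" cellspace
  for M :: "'a measure" and N :: "'a \<Rightarrow> ('k::finite \<Rightarrow> nat) \<Rightarrow> nat" and Y :: "'a \<Rightarrow> ('k \<Rightarrow> nat) \<Rightarrow> nat \<Rightarrow> 'y::topological_space" +
  fixes Ysp :: "'y set" and \<F> :: "('y \<Rightarrow> real) set" and Fenv :: "'y \<Rightarrow> real"
    and lam :: "'k \<Rightarrow> real" and Cs :: "nat \<Rightarrow> 'k \<Rightarrow> nat" and Q :: "'w measure" and G :: "'w \<Rightarrow> ('y \<Rightarrow> real) \<Rightarrow> real"
  assumes Ysp: "\<And>\<omega> j l. \<omega> \<in> space M \<Longrightarrow> Y \<omega> j l \<in> Ysp"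
    and pm: "pointwise_measurable Ysp \<F>"
    and class_meas: "\<And>f. f \<in> \<F> \<Longrightarrow> f \<in> borel_measurable (restrict_space borel Ysp)"
    and A3: "A3 M N Y Ysp \<F> Fenv"
    and Cs: "filterlim (\<lambda>n. Cmin (Cs n)) at_top sequentially"
    and lam: "\<And>i. (\<lambda>n. real (Cmin (Cs n)) / real (Cs n i)) \<longlonglongrightarrow> lam i"
    and Gauss: "tight_gaussian_process Q G \<F> (kernel M N Y lam)"
begin

text \<open>The cell sum made measurable on the whole cell space by a Borel extension of
  \<open>f\<close>; on data cells nothing changes, because all units lie in
  \<open>Ysp\<close>.\<close>

definition \<phi> :: "('y \<Rightarrow> real) \<Rightarrow> nat \<times> (nat \<Rightarrow> 'y) \<Rightarrow> real" where
  "\<phi> f = cS (borel_ext Ysp f)"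

lemma env_measurable: "Fenv \<in> borel_measurable (restrict_space borel Ysp)"
  and env_bound: "\<And>f y. f \<in> \<F> \<Longrightarrow> y \<in> Ysp \<Longrightarrow> \<bar>f y\<bar> \<le> Fenv y"
  using A3 by (auto simp: A3_def)

lemma \<phi>_measurable:
  "f \<in> borel_measurable (restrict_space borel Ysp) \<Longrightarrow> \<phi> f \<in> borel_measurable cellspace"
  unfolding \<phi>_def by (intro cS_measurable borel_ext)

lemma \<phi>_data:
  "f \<in> borel_measurable (restrict_space borel Ysp) \<Longrightarrow> \<omega> \<in> space M \<Longrightarrow> \<phi> f (data N Y \<omega> j) = cellsum N Y f j \<omega>"
  unfolding \<phi>_def cS_data by (simp add: cellsum_def borel_ext(2) Ysp)

lemma cQ_data_ext:
  assumes "f \<in> borel_measurable (restrict_space borel Ysp)"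
  shows "\<exists>g\<in>borel_measurable cellspace. \<forall>\<omega>\<in>space M. \<forall>j. g (data N Y \<omega> j) = cQ f (data N Y \<omega> j)"
  by (rule bexI[of _ "cQ (borel_ext Ysp f)"])
    (use assms in \<open>auto simp: cQ_data cellsum_def borel_ext(2) Ysp intro!: cQ_measurable borel_ext\<close>)

lemma env_integrable:
  assumes "(\<integral>\<^sup>+ \<omega>. ennreal (real (N \<omega> cell1) * cellsum N Y (\<lambda>y. (Fenv y)\<^sup>2) cell1 \<omega>) \<partial>M) < \<infinity>"
  shows "integrable M (\<lambda>\<omega>. cQ Fenv (data N Y \<omega> cell1))"
proof (rule integrableI_nonneg)
  obtain g where g: "g \<in> borel_measurable cellspace" "\<forall>\<omega>\<in>space M. \<forall>j. g (data N Y \<omega> j) = cQ Fenv (data N Y \<omega> j)"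
    using cQ_data_ext[OF env_measurable] by blast
  have "(\<lambda>\<omega>. g (data N Y \<omega> cell1)) \<in> borel_measurable M" by (rule measurable_compose[OF cell_measurable g(1)])
  then show "(\<lambda>\<omega>. cQ Fenv (data N Y \<omega> cell1)) \<in> borel_measurable M"
    by (rule measurable_cong[THEN iffD1, rotated]) (use g(2) in auto)
  show "(\<integral>\<^sup>+ \<omega>. ennreal (cQ Fenv (data N Y \<omega> cell1)) \<partial>M) < \<infinity>" using assms by (simp only: cQ_data)
qed simp

lemma \<phi>_square_integrable:
  assumes f: "f \<in> \<F>"
  shows "integrable M (\<lambda>\<omega>. (\<phi> f (data N Y \<omega> j))\<^sup>2)"
proof -
  note fm = class_meas[OF f]
  have sq: "(\<lambda>z. (\<phi> f z)\<^sup>2) \<in> borel_measurable cellspace" using \<phi>_measurable[OF fm] by measurable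
  have m: "(\<lambda>\<omega>. (\<phi> f (data N Y \<omega> cell1))\<^sup>2) \<in> borel_measurable M"
    by (rule measurable_compose[OF cell_measurable sq])
  consider (a) "(\<integral>\<^sup>+ \<omega>. ennreal ((cellsum N Y Fenv cell1 \<omega>)\<^sup>2) \<partial>M) < \<infinity>"
    | (b) "(\<integral>\<^sup>+ \<omega>. ennreal (real (N \<omega> cell1) * cellsum N Y (\<lambda>y. (Fenv y)\<^sup>2) cell1 \<omega>) \<partial>M) < \<infinity>"
    using A3 unfolding A3_def by blast
  then have "(\<integral>\<^sup>+ \<omega>. ennreal ((\<phi> f (data N Y \<omega> cell1))\<^sup>2) \<partial>M) < \<infinity>"
  proof cases
    case a
    have "(\<phi> f (data N Y \<omega> cell1))\<^sup>2 \<le> (cellsum N Y Fenv cell1 \<omega>)\<^sup>2" if \<omega>: "\<omega> \<in> space M" for \<omega>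
    proof -
      have "\<bar>cellsum N Y f cell1 \<omega>\<bar> \<le> cellsum N Y Fenv cell1 \<omega>"
        unfolding cellsum_def by (intro order_trans[OF sum_abs] sum_mono env_bound f Ysp \<omega>)
      then show ?thesis unfolding \<phi>_data[OF fm \<omega>] by (intro abs_le_square_iff[THEN iffD1]) linarith
    qed
    then have "(\<integral>\<^sup>+ \<omega>. ennreal ((\<phi> f (data N Y \<omega> cell1))\<^sup>2) \<partial>M) \<le> (\<integral>\<^sup>+ \<omega>. ennreal ((cellsum N Y Fenv cell1 \<omega>)\<^sup>2) \<partial>M)"
      by (intro nn_integral_mono ennreal_leI)
    then show ?thesis using a by (rule le_less_trans)
  next
    case b
    have "(\<phi> f (data N Y \<omega> cell1))\<^sup>2 \<le> real (N \<omega> cell1) * cellsum N Y (\<lambda>y. (Fenv y)\<^sup>2) cell1 \<omega>" if \<omega>: "\<omega> \<in> space M" for \<omega>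
    proof -
      have "(\<phi> f (data N Y \<omega> cell1))\<^sup>2 = (cS f (data N Y \<omega> cell1))\<^sup>2" by (simp only: \<phi>_data[OF fm \<omega>] cS_data)
      also have "\<dots> \<le> cQ f (data N Y \<omega> cell1)" by (rule cS_square_le)
      also have "\<dots> \<le> cQ Fenv (data N Y \<omega> cell1)"
      proof (rule cQ_mono)
        fix l
        have "\<bar>f (Y \<omega> cell1 l)\<bar> \<le> Fenv (Y \<omega> cell1 l)" by (intro env_bound f Ysp \<omega>)
        then show "\<bar>f (snd (data N Y \<omega> cell1) l)\<bar> \<le> \<bar>Fenv (snd (data N Y \<omega> cell1) l)\<bar>" by (simp add: data_def)
      qed
      finally show ?thesis by (simp only: cQ_data)
    qed
    then have "(\<integral>\<^sup>+ \<omega>. ennreal ((\<phi> f (data N Y \<omega> cell1))\<^sup>2) \<partial>M) \<le> (\<integral>\<^sup>+ \<omega>. ennreal (real (N \<omega> cell1) * cellsum N Y (\<lambda>y. (Fenv y)\<^sup>2) cell1 \<omega>) \<partial>M)"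
      by (intro nn_integral_mono ennreal_leI)
    then show ?thesis using b by (rule le_less_trans)
  qed
  then have "integrable M (\<lambda>\<omega>. (\<phi> f (data N Y \<omega> cell1))\<^sup>2)" by (intro integrableI_nonneg m) auto
  then show ?thesis unfolding marginal_integrable[OF sq, of j] .
qed

lemma \<phi>_cell_measurable: "f \<in> \<F> \<Longrightarrow> (\<lambda>\<omega>. \<phi> f (data N Y \<omega> j)) \<in> borel_measurable M"
  by (rule measurable_compose[OF cell_measurable \<phi>_measurable[OF class_meas]])

lemma \<phi>_integrable: "f \<in> \<F> \<Longrightarrow> integrable M (\<lambda>\<omega>. \<phi> f (data N Y \<omega> j))"
  using \<phi>_square_integrable \<phi>_cell_measurable by (rule integral_abs_le_sqrt(1))

lemma \<phi>_mult_integrable: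
  assumes "f \<in> \<F>" "g \<in> \<F>"
  shows "integrable M (\<lambda>\<omega>. \<phi> f (data N Y \<omega> j) * \<phi> g (data N Y \<omega> j'))"
proof (rule Bochner_Integration.integrable_bound)
  show "integrable M (\<lambda>\<omega>. (\<phi> f (data N Y \<omega> j))\<^sup>2 + (\<phi> g (data N Y \<omega> j'))\<^sup>2)"
    using assms by (intro Bochner_Integration.integrable_add \<phi>_square_integrable)
  show "(\<lambda>\<omega>. \<phi> f (data N Y \<omega> j) * \<phi> g (data N Y \<omega> j')) \<in> borel_measurable M"
    using assms by (intro borel_measurable_times \<phi>_cell_measurable)
qed (auto intro!: AE_I2 abs_mult_le_squares order_trans[OF abs_mult_le_squares])

lemma kernel_covar:
  assumes "f \<in> \<F>" "g \<in> \<F>"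
  shows "kernel M N Y lam f g =
    (\<Sum>i\<in>UNIV. lam i * covar M (\<lambda>\<omega>. \<phi> f (data N Y \<omega> cell1)) (\<lambda>\<omega>. \<phi> g (data N Y \<omega> (cell2 i))))"
proof -
  note m = class_meas[OF assms(1)] class_meas[OF assms(2)]
  have "covar M (cellsum N Y f cell1) (cellsum N Y g j) = covar M (\<lambda>\<omega>. \<phi> f (data N Y \<omega> cell1)) (\<lambda>\<omega>. \<phi> g (data N Y \<omega> j))" for j
    unfolding covar_def
    by (intro arg_cong2[where f = "(-)"] arg_cong2[where f = "(*)"] Bochner_Integration.integral_cong refl) (simp_all add: \<phi>_data m)
  then show ?thesis unfolding kernel_def by simp
qed

text \<open>By bilinearity the variance prescribed for a linear combination of \<open>G\<close> is
  the limit variance of the same combination of cell sums. This makes the two families of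
  characteristic functions agree.\<close>

lemma kernel_sum:
  assumes T: "T \<subseteq> \<F>"
  shows "(\<Sum>f\<in>T. \<Sum>g\<in>T. l f * l g * kernel M N Y lam f g) = cov_limit lam (\<lambda>z. \<Sum>t\<in>T. l t * \<phi> t z)"
proof -
  define c where "c i f g = covar M (\<lambda>\<omega>. \<phi> f (data N Y \<omega> cell1)) (\<lambda>\<omega>. \<phi> g (data N Y \<omega> (cell2 i)))" for i f g
  define \<Phi> where "\<Phi> z = (\<Sum>t\<in>T. l t * \<phi> t z)" for z
  have \<Phi>m: "\<Phi> \<in> borel_measurable cellspace"
    unfolding \<Phi>_def [abs_def] using T by (intro borel_measurable_sum borel_measurable_times borel_measurable_const \<phi>_measurable class_meas) auto
  have "(\<Sum>f\<in>T. \<Sum>g\<in>T. l f * l g * kernel M N Y lam f g) = (\<Sum>f\<in>T. \<Sum>g\<in>T. \<Sum>i\<in>UNIV. lam i * (l f * l g * c i f g))"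
  proof (intro sum.cong refl)
    fix f g assume "f \<in> T" "g \<in> T"
    then have fg: "f \<in> \<F>" "g \<in> \<F>" using T by auto
    show "l f * l g * kernel M N Y lam f g = (\<Sum>i\<in>UNIV. lam i * (l f * l g * c i f g))"
      unfolding kernel_covar[OF fg] c_def sum_distrib_left by (intro sum.cong refl) (simp only: ac_simps)
  qed
  also have "\<dots> = (\<Sum>f\<in>T. \<Sum>i\<in>UNIV. \<Sum>g\<in>T. lam i * (l f * l g * c i f g))"
    by (intro sum.cong refl sum.swap)
  also have "\<dots> = (\<Sum>i\<in>UNIV. \<Sum>f\<in>T. \<Sum>g\<in>T. lam i * (l f * l g * c i f g))"
    by (rule sum.swap)
  also have "\<dots> = (\<Sum>i\<in>UNIV. lam i * (\<Sum>f\<in>T. \<Sum>g\<in>T. l f * l g * c i f g))"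
    by (simp only: sum_distrib_left)
  also have "\<dots> = (\<Sum>i\<in>UNIV. lam i * covar M (\<lambda>\<omega>. \<Phi> (data N Y \<omega> cell1)) (\<lambda>\<omega>. \<Phi> (data N Y \<omega> (cell2 i))))"
  proof (intro sum.cong refl arg_cong2[where f = "(*)"])
    fix i
    show "(\<Sum>f\<in>T. \<Sum>g\<in>T. l f * l g * c i f g) = covar M (\<lambda>\<omega>. \<Phi> (data N Y \<omega> cell1)) (\<lambda>\<omega>. \<Phi> (data N Y \<omega> (cell2 i)))"
      unfolding \<Phi>_def c_def
      by (rule covar_sum[symmetric]) (use T in \<open>auto intro!: \<phi>_integrable \<phi>_mult_integrable\<close>)
  qed
  also have "\<dots> = cov_limit lam \<Phi>"
    unfolding cov_limit_def covar_def marginal_integral[OF \<Phi>m, of "cell2 _"] power2_eq_square ..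
  finally show ?thesis unfolding \<Phi>_def .
qed

text \<open>Exchanging 0 and 1 in every coordinate except \<open>i\<close> swaps the two cells
  entering the covariance, and exchangeability leaves the law unchanged.\<close>

lemma kernel_sym:
  assumes "f \<in> \<F>" "g \<in> \<F>"
  shows "kernel M N Y lam f g = kernel M N Y lam g f"
proof -
  note m = \<phi>_measurable[OF class_meas[OF assms(1)]] \<phi>_measurable[OF class_meas[OF assms(2)]]
  have "(\<integral>\<omega>. \<phi> f (data N Y \<omega> cell1) * \<phi> g (data N Y \<omega> (cell2 i)) \<partial>M)
    = (\<integral>\<omega>. \<phi> f (data N Y \<omega> (cell2 i)) * \<phi> g (data N Y \<omega> cell1) \<partial>M)" for i
  proof -
    define \<pi> where "\<pi> i' = (if i' = i then id else Transposition.transpose 0 (1::nat))" for i'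
    have p: "bij (\<pi> i')" for i' by (simp add: \<pi>_def)
    have c: "(\<lambda>i'. \<pi> i' (cell1 i')) = cell2 i" "(\<lambda>i'. \<pi> i' (cell2 i i')) = cell1"
      by (auto simp: \<pi>_def cell1_def cell2_def)
    have comp: "(\<lambda>x. q (x j)) \<in> borel_measurable (\<Pi>\<^sub>M j\<in>UNIV. cellspace)"
      if "q \<in> borel_measurable cellspace" for q :: "nat \<times> (nat \<Rightarrow> 'y) \<Rightarrow> real" and j :: "'k \<Rightarrow> nat"
      by (rule measurable_compose[OF _ that]) (rule measurable_component_singleton, simp)
    have "(\<lambda>x. \<phi> f (x cell1) * \<phi> g (x (cell2 i))) \<in> borel_measurable (\<Pi>\<^sub>M j\<in>UNIV. cellspace)"
      by (rule borel_measurable_times[OF comp[OF m(1)] comp[OF m(2)]])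
    from transfer_integral[where \<pi> = \<pi>, OF p this] show ?thesis unfolding c .
  qed
  then show ?thesis
    unfolding kernel_covar[OF assms] kernel_covar[OF assms(2,1)] covar_def
      marginal_integral[OF m(1), of "cell2 _"] marginal_integral[OF m(2), of "cell2 _"] by (simp add: mult.commute)
qed

lemma lam_bounds: "0 \<le> lam i" "lam i \<le> 1"
proof -
  show "0 \<le> lam i" by (rule LIMSEQ_le_const[OF lam[of i]]) auto
  have "real (Cmin (Cs n)) / real (Cs n i) \<le> 1" for n
    using Cmin_le[of "Cs n" i] by (cases "Cs n i = 0") (auto simp: divide_le_eq)
  then show "lam i \<le> 1" by (intro LIMSEQ_le_const2[OF lam[of i]]) auto
qed

text \<open>The paths of \<open>G\<close> are uniformly continuous for the semimetric of the kernel.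
  Dominating its square by a mean squared distance makes them uniformly continuous for the distance
  in which nets are available.\<close>

lemma kernel_semimetric_le:
  assumes "f \<in> \<F>" "g \<in> \<F>"
  shows "kernel M N Y lam f f + kernel M N Y lam g g - 2 * kernel M N Y lam f g
    \<le> 2 * real CARD('k) * (\<integral>\<omega>. (\<phi> f (data N Y \<omega> cell1) - \<phi> g (data N Y \<omega> cell1))\<^sup>2 \<partial>M)"
proof (cases "f = g")
  case False
  define \<psi> where "\<psi> z = \<phi> f z - \<phi> g z" for z
  define S where "S = (\<integral>\<omega>. (\<psi> (data N Y \<omega> cell1))\<^sup>2 \<partial>M)"
  have \<psi>m: "\<psi> \<in> borel_measurable cellspace" and \<psi>2m: "(\<lambda>z. (\<psi> z)\<^sup>2) \<in> borel_measurable cellspace"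
    using \<phi>_measurable[OF class_meas[OF assms(1)]] \<phi>_measurable[OF class_meas[OF assms(2)]] unfolding \<psi>_def [abs_def] by measurable
  have \<psi>2: "integrable M (\<lambda>\<omega>. (\<psi> (data N Y \<omega> j))\<^sup>2)" for j
    unfolding \<psi>_def power2_diff mult.assoc using assms
    by (intro Bochner_Integration.integrable_add Bochner_Integration.integrable_diff \<phi>_square_integrable integrable_mult_right \<phi>_mult_integrable)
  have S: "(\<integral>\<omega>. (\<psi> (data N Y \<omega> j))\<^sup>2 \<partial>M) = S" for j
    unfolding S_def by (rule marginal_integral[OF \<psi>2m])
  have S0: "0 \<le> S" unfolding S_def by (rule integral_nonneg_AE) simp
  \<comment> \<open>The squared semimetric is the quadratic form of the kernel with coefficients 1
    at \<open>f\<close> and -1 at \<open>g\<close>.\<close>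
  define l where "l t = (if t = f then 1 else - 1 :: real)" for t
  have "kernel M N Y lam f f + kernel M N Y lam g g - 2 * kernel M N Y lam f g
    = (\<Sum>s\<in>{f, g}. \<Sum>t\<in>{f, g}. l s * l t * kernel M N Y lam s t)"
    using False kernel_sym[OF assms] by (simp add: l_def)
  also have "\<dots> = cov_limit lam (\<lambda>z. \<Sum>t\<in>{f, g}. l t * \<phi> t z)" by (rule kernel_sum) (use assms in auto)
  also have "(\<lambda>z. \<Sum>t\<in>{f, g}. l t * \<phi> t z) = \<psi>" using False by (auto simp: l_def \<psi>_def)
  also have "cov_limit lam \<psi> \<le> (\<Sum>i\<in>(UNIV :: 'k set). 2 * S)"
    unfolding cov_limit_def
  proof (rule sum_mono)
    fix i
    have "(\<integral>\<omega>. \<psi> (data N Y \<omega> cell1) * \<psi> (data N Y \<omega> (cell2 i)) \<partial>M) \<le> (\<integral>\<omega>. (\<psi> (data N Y \<omega> cell1))\<^sup>2 + (\<psi> (data N Y \<omega> (cell2 i)))\<^sup>2 \<partial>M)"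
    proof (rule integral_mono_AE')
      show "integrable M (\<lambda>\<omega>. (\<psi> (data N Y \<omega> cell1))\<^sup>2 + (\<psi> (data N Y \<omega> (cell2 i)))\<^sup>2)"
        by (intro Bochner_Integration.integrable_add \<psi>2)
      show "AE \<omega> in M. \<psi> (data N Y \<omega> cell1) * \<psi> (data N Y \<omega> (cell2 i)) \<le> (\<psi> (data N Y \<omega> cell1))\<^sup>2 + (\<psi> (data N Y \<omega> (cell2 i)))\<^sup>2"
        by (intro AE_I2 order_trans[OF abs_ge_self abs_mult_le_squares])
    qed simp
    also have "\<dots> = 2 * S" using \<psi>2 by (simp add: S)
    finally have "(\<integral>\<omega>. \<psi> (data N Y \<omega> cell1) * \<psi> (data N Y \<omega> (cell2 i)) \<partial>M) - (\<integral>\<omega>. \<psi> (data N Y \<omega> cell1) \<partial>M)\<^sup>2 \<le> 2 * S"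
      using zero_le_power2[of "\<integral>\<omega>. \<psi> (data N Y \<omega> cell1) \<partial>M"] by linarith
    then have "lam i * ((\<integral>\<omega>. \<psi> (data N Y \<omega> cell1) * \<psi> (data N Y \<omega> (cell2 i)) \<partial>M) - (\<integral>\<omega>. \<psi> (data N Y \<omega> cell1) \<partial>M)\<^sup>2) \<le> lam i * (2 * S)"
      by (rule mult_left_mono) (rule lam_bounds)
    also have "\<dots> \<le> 1 * (2 * S)" using S0 lam_bounds by (intro mult_right_mono) auto
    finally show "lam i * ((\<integral>\<omega>. \<psi> (data N Y \<omega> cell1) * \<psi> (data N Y \<omega> (cell2 i)) \<partial>M) - (\<integral>\<omega>. \<psi> (data N Y \<omega> cell1) \<partial>M)\<^sup>2) \<le> 2 * S" by simp
  qed
  finally show ?thesis by (simp add: S_def \<psi>_def)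
qed simp

sublocale Q: prob_space Q
  using Gauss by (simp add: tight_gaussian_process_def)

lemma G_combination:
  assumes "finite S" "S \<subseteq> \<F>"
  shows "(\<lambda>w. \<Sum>f\<in>S. a f * G w f) \<in> borel_measurable Q"
    and "0 < (\<Sum>f\<in>S. \<Sum>g\<in>S. a f * a g * kernel M N Y lam f g) \<Longrightarrow>
      distributed Q lborel (\<lambda>w. \<Sum>f\<in>S. a f * G w f) (normal_density 0 (sqrt (\<Sum>f\<in>S. \<Sum>g\<in>S. a f * a g * kernel M N Y lam f g)))"
    and "(\<Sum>f\<in>S. \<Sum>g\<in>S. a f * a g * kernel M N Y lam f g) \<le> 0 \<Longrightarrow> AE w in Q. (\<Sum>f\<in>S. a f * G w f) = 0"
  using Gauss assms unfolding tight_gaussian_process_def Let_def by blast+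

lemma G_measurable:
  assumes "f \<in> \<F>"
  shows "(\<lambda>w. G w f) \<in> borel_measurable Q"
  using G_combination(1)[of "{f}" "\<lambda>_. 1"] assms by simp

lemma G_square_integrable:
  assumes f: "f \<in> \<F>"
  shows "integrable Q (\<lambda>w. (G w f)\<^sup>2)"
proof (cases "0 < kernel M N Y lam f f")
  case True
  then have "distributed Q lborel (\<lambda>w. G w f) (normal_density 0 (sqrt (kernel M N Y lam f f)))"
    using G_combination(2)[of "{f}" "\<lambda>_. 1"] f by simp
  then show ?thesis by (rule normal_char(2)[OF Q.prob_space_axioms _ True])
next
  case False
  then have "AE w in Q. G w f = 0" using G_combination(3)[of "{f}" "\<lambda>_. 1"] f by simp
  then have "AE w in Q. (G w f)\<^sup>2 = 0" by eventually_elim simp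
  then have "integrable Q (\<lambda>w. (G w f)\<^sup>2) \<longleftrightarrow> integrable Q (\<lambda>_. 0 :: real)"
    using G_measurable[OF f] by (intro integrable_cong_AE) auto
  then show ?thesis by simp
qed

lemma G_char:
  assumes T: "finite T" "T \<subseteq> \<F>"
  shows "(\<integral>w. iexp (\<Sum>t\<in>T. l t * G w t) \<partial>Q) = complex_of_real (exp (- (max 0 (cov_limit lam (\<lambda>z. \<Sum>t\<in>T. l t * \<phi> t z)) / 2)))"
proof (cases "0 < cov_limit lam (\<lambda>z. \<Sum>t\<in>T. l t * \<phi> t z)")
  case True
  have "(\<integral>w. iexp (\<Sum>t\<in>T. l t * G w t) \<partial>Q) = complex_of_real (exp (- (cov_limit lam (\<lambda>z. \<Sum>t\<in>T. l t * \<phi> t z) / 2)))"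
    by (rule normal_char(1)[OF Q.prob_space_axioms G_combination(2)[OF T, of l, unfolded kernel_sum[OF T(2)], OF True] True])
  then show ?thesis using True by (simp add: max_def)
next
  case False
  then have "AE w in Q. (\<Sum>t\<in>T. l t * G w t) = 0"
    using G_combination(3)[OF T, of l] unfolding kernel_sum[OF T(2)] by simp
  then have "AE w in Q. iexp (\<Sum>t\<in>T. l t * G w t) = 1" by eventually_elim simp
  then have "(\<integral>w. iexp (\<Sum>t\<in>T. l t * G w t) \<partial>Q) = (\<integral>w. 1 \<partial>Q)"
    by (intro integral_cong_AE measurable_compose[OF G_combination(1)[OF T]]) auto
  then show ?thesis using False by (simp add: max_def Q.prob_space)
qed

end

section \<open>From finite nets to the whole class\<close>

context bootstrap_data
begin

definition boot :: "nat \<Rightarrow> 'a \<Rightarrow> ('k \<Rightarrow> nat \<Rightarrow> nat) \<Rightarrow> ('y \<Rightarrow> real) \<Rightarrow> real" where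
  "boot n \<omega> d f = boot_val (Cs n) (\<lambda>j. cellsum N Y f j \<omega>) d"

lemma BL1_measurable: "h \<in> BL1 \<F> \<Longrightarrow> (\<lambda>w. h (G w)) \<in> borel_measurable Q"
  using Gauss by (simp add: tight_gaussian_process_def)

lemma BL1_integrable: "h \<in> BL1 \<F> \<Longrightarrow> integrable Q (\<lambda>w. h (G w))"
  by (rule Q.integrable_const_bound[of _ 1]) (auto simp: BL1_measurable BL1_bound)

lemma BL1_project:
  assumes h: "h \<in> BL1 \<F>" and p: "\<And>f. f \<in> \<F> \<Longrightarrow> p f \<in> \<F>"
  shows "(\<lambda>x. h (\<lambda>f. x (p f))) \<in> BL1 \<F>"
  by (rule BL1_I) (auto intro!: BL1_bound[OF h] BL1_lipschitz[OF h] p)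

text \<open>It suffices to compare the bootstrap process and the Gaussian process with their projections
  to a finite net.\<close>

lemma projection_argument:
  assumes T: "finite T" "T \<subseteq> \<F>" and p: "\<And>f. f \<in> \<F> \<Longrightarrow> p f \<in> T" and \<kappa>: "0 < \<kappa>"
    and boot: "\<forall>\<^sub>F n in sequentially. \<exists>U. integrable M U \<and> (\<integral>\<omega>. U \<omega> \<partial>M) \<le> \<kappa> \<and>
      (\<forall>\<omega>\<in>space M. \<forall>h\<in>BL1 \<F>. avg (draws (Cs n)) (\<lambda>d. \<bar>h (boot n \<omega> d) - h (\<lambda>f. boot n \<omega> d (p f))\<bar>) \<le> U \<omega>)"
    and gauss: "\<And>h. h \<in> BL1 \<F> \<Longrightarrow> \<bar>(\<integral>w. h (\<lambda>f. G w (p f)) \<partial>Q) - (\<integral>w. h (G w) \<partial>Q)\<bar> \<le> \<kappa>"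
  shows "\<forall>\<^sub>F n in sequentially. \<exists>U. integrable M U \<and> (\<integral>\<omega>. U \<omega> \<partial>M) \<le> 3 * \<kappa> \<and>
      (\<forall>\<omega>\<in>space M. \<forall>h\<in>BL1 \<F>. \<bar>avg (draws (Cs n)) (\<lambda>d. h (boot n \<omega> d)) - (\<integral>w. h (G w) \<partial>Q)\<bar> \<le> U \<omega>)"
proof -
  have fd: "\<forall>\<^sub>F n in sequentially. \<exists>U. integrable M U \<and> (\<integral>\<omega>. U \<omega> \<partial>M) \<le> \<kappa> \<and>
     (\<forall>\<omega> H. (\<forall>x. \<bar>H x\<bar> \<le> 1) \<longrightarrow> (\<forall>x z. \<bar>H x - H z\<bar> \<le> (\<Sum>t\<in>T. \<bar>x t - z t\<bar>)) \<longrightarrow> (\<lambda>w. H (G w)) \<in> borel_measurable Q \<longrightarrow>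
       \<bar>avg (draws (Cs n)) (\<lambda>d. H (\<lambda>t. boot_val (Cs n) (\<lambda>j. \<phi> t (data N Y \<omega> j)) d)) - (\<integral>w. H (G w) \<partial>Q)\<bar> \<le> U \<omega>)"
    by (rule boot_findim[OF T(1) _ _ Cs lam Q.prob_space_axioms _ _ G_char[OF T] \<kappa>])
      (use T in \<open>auto intro!: \<phi>_measurable class_meas \<phi>_square_integrable G_measurable G_square_integrable\<close>)
  from boot fd show ?thesis
  proof eventually_elim
    case (elim n)
    obtain U where U: "integrable M U" "(\<integral>\<omega>. U \<omega> \<partial>M) \<le> \<kappa>"
      "\<And>\<omega> h. \<omega> \<in> space M \<Longrightarrow> h \<in> BL1 \<F> \<Longrightarrow> avg (draws (Cs n)) (\<lambda>d. \<bar>h (boot n \<omega> d) - h (\<lambda>f. boot n \<omega> d (p f))\<bar>) \<le> U \<omega>"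
      using elim(1) by blast
    obtain V where V: "integrable M V" "(\<integral>\<omega>. V \<omega> \<partial>M) \<le> \<kappa>"
      "\<And>\<omega> H. (\<forall>x. \<bar>H x\<bar> \<le> 1) \<Longrightarrow> (\<forall>x z. \<bar>H x - H z\<bar> \<le> (\<Sum>t\<in>T. \<bar>x t - z t\<bar>)) \<Longrightarrow> (\<lambda>w. H (G w)) \<in> borel_measurable Q \<Longrightarrow>
       \<bar>avg (draws (Cs n)) (\<lambda>d. H (\<lambda>t. boot_val (Cs n) (\<lambda>j. \<phi> t (data N Y \<omega> j)) d)) - (\<integral>w. H (G w) \<partial>Q)\<bar> \<le> V \<omega>"
      using elim(2) by blast
    have bound: "\<bar>avg (draws (Cs n)) (\<lambda>d. h (boot n \<omega> d)) - (\<integral>w. h (G w) \<partial>Q)\<bar> \<le> U \<omega> + V \<omega> + \<kappa>"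
      if \<omega>: "\<omega> \<in> space M" and h: "h \<in> BL1 \<F>" for \<omega> h
    proof -
      define H where "H x = h (\<lambda>f. x (p f))" for x :: "('y \<Rightarrow> real) \<Rightarrow> real"
      have pF: "p f \<in> \<F>" if "f \<in> \<F>" for f using p[OF that] T(2) by blast
      have HBL: "H \<in> BL1 \<F>" unfolding H_def [abs_def] by (rule BL1_project[OF h pF])
      \<comment> \<open>The projection takes values in the finite \<open>T\<close>, so the uniform
        distance of projected paths is at most the sum of the distances on \<open>T\<close>, as
        \<open>boot_findim\<close> requires.\<close>
      have Hlip: "\<bar>H x - H z\<bar> \<le> (\<Sum>t\<in>T. \<bar>x t - z t\<bar>)" for x z
        unfolding H_def
      proof (rule BL1_lipschitz[OF h])
        fix f assume "f \<in> \<F>"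
        then show "\<bar>x (p f) - z (p f)\<bar> \<le> (\<Sum>t\<in>T. \<bar>x t - z t\<bar>)"
          using T(1) p by (intro member_le_sum[where f = "\<lambda>t. \<bar>x t - z t\<bar>"]) auto
      qed (intro sum_nonneg, simp)
      have Hboot: "H (\<lambda>t. boot_val (Cs n) (\<lambda>j. \<phi> t (data N Y \<omega> j)) d) = h (\<lambda>f. boot n \<omega> d (p f))" for d
        unfolding H_def boot_def by (rule BL1_cong[OF h]) (simp add: \<phi>_data class_meas pF \<omega>)
      have 1: "\<bar>avg (draws (Cs n)) (\<lambda>d. h (boot n \<omega> d)) - avg (draws (Cs n)) (\<lambda>d. h (\<lambda>f. boot n \<omega> d (p f)))\<bar> \<le> U \<omega>"
        unfolding avg_diff [symmetric] by (rule order_trans[OF abs_avg_le U(3)[OF \<omega> h]])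
      have 2: "\<bar>avg (draws (Cs n)) (\<lambda>d. h (\<lambda>f. boot n \<omega> d (p f))) - (\<integral>w. H (G w) \<partial>Q)\<bar> \<le> V \<omega>"
        using V(3)[of H \<omega>] Hlip BL1_bound[OF HBL] BL1_measurable[OF HBL] unfolding Hboot by blast
      have 3: "\<bar>(\<integral>w. H (G w) \<partial>Q) - (\<integral>w. h (G w) \<partial>Q)\<bar> \<le> \<kappa>" unfolding H_def by (rule gauss[OF h])
      show ?thesis using 1 2 3 by linarith
    qed
    have "integrable M (\<lambda>\<omega>. U \<omega> + V \<omega> + \<kappa>)" using U(1) V(1) by simp
    moreover have "(\<integral>\<omega>. U \<omega> + V \<omega> + \<kappa> \<partial>M) \<le> 3 * \<kappa>" using U V by (simp add: prob_space)
    ultimately show ?case using bound by (intro exI[of _ "\<lambda>\<omega>. U \<omega> + V \<omega> + \<kappa>"]) blast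
  qed
qed

definition cell_dist :: "('y \<Rightarrow> real) \<Rightarrow> ('y \<Rightarrow> real) \<Rightarrow> real" where
  "cell_dist f g = (\<integral>\<omega>. cQ (dif (f, g)) (data N Y \<omega> cell1) \<partial>M)"

text \<open>The oscillation of \<open>G\<close> over pairs at small distance tends to 0 for every
  outcome by uniform continuity of the paths. A supremum over uncountably many pairs has no evident
  measurability; scaled and capped it becomes a member of \<open>BL1 \<F>\<close>, whose composition
  with \<open>G\<close> is measurable by the definition of the process, so dominated convergence
  applies.\<close>

lemma gauss_projection:
  assumes ne: "\<F> \<noteq> {}" and \<kappa>: "0 < \<kappa>"
    and rho: "\<And>f g. f \<in> \<F> \<Longrightarrow> g \<in> \<F> \<Longrightarrow>
      kernel M N Y lam f f + kernel M N Y lam g g - 2 * kernel M N Y lam f g \<le> 2 * real CARD('k) * cell_dist f g"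
  shows "\<exists>\<delta>>0. \<forall>p. (\<forall>f\<in>\<F>. p f \<in> \<F> \<and> cell_dist f (p f) < \<delta>) \<longrightarrow>
    (\<forall>h\<in>BL1 \<F>. \<bar>(\<integral>w. h (\<lambda>f. G w (p f)) \<partial>Q) - (\<integral>w. h (G w) \<partial>Q)\<bar> \<le> \<kappa>)"
proof -
  define E where "E n = {q\<in>\<F> \<times> \<F>. cell_dist (fst q) (snd q) < inverse (real (Suc n))}" for n
  \<comment> \<open>Halving makes it 1-Lipschitz, as both values of a pair may move; the cap gives
    the bound by 1.\<close>
  define osc where "osc n x = (SUP q\<in>E n. min 1 (\<bar>x (fst q) - x (snd q)\<bar> / 2))" for n and x :: "('y \<Rightarrow> real) \<Rightarrow> real"
  obtain f0 where f0: "f0 \<in> \<F>" using ne by blast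
  have E0: "(f0, f0) \<in> E n" for n using f0 by (simp add: E_def cell_dist_def cQ_def dif_def)
  then have Ene: "E n \<noteq> {}" for n by blast
  have EF: "fst q \<in> \<F>" "snd q \<in> \<F>" if "q \<in> E n" for q n using that by (auto simp: E_def)
  have bdd: "bdd_above ((\<lambda>q. min 1 (\<bar>x (fst q) - x (snd q)\<bar> / 2)) ` E n)" for n and x :: "('y \<Rightarrow> real) \<Rightarrow> real"
    by (rule bdd_aboveI[of _ 1]) auto
  have up: "min 1 (\<bar>x (fst q) - x (snd q)\<bar> / 2) \<le> osc n x" if "q \<in> E n" for n q x
    unfolding osc_def by (rule cSUP_upper[OF that bdd])
  have le1: "osc n x \<le> 1" for n x unfolding osc_def by (rule cSUP_least[OF Ene]) simp
  have ge0: "0 \<le> osc n x" for n x using up[OF E0, of x n] by simp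
  have lip: "osc n x \<le> osc n z + b" if b: "\<And>f. f \<in> \<F> \<Longrightarrow> \<bar>x f - z f\<bar> \<le> b" for n x z b
  proof (unfold osc_def [of n x], rule cSUP_least[OF Ene])
    fix q assume q: "q \<in> E n"
    note bq = b[OF EF(1)[OF q]] b[OF EF(2)[OF q]]
    have b0: "0 \<le> b" using bq(1) abs_ge_zero order_trans by blast
    have "\<bar>x (fst q) - x (snd q)\<bar> \<le> \<bar>z (fst q) - z (snd q)\<bar> + 2 * b" using bq by linarith
    then have "min 1 (\<bar>x (fst q) - x (snd q)\<bar> / 2) \<le> min 1 (\<bar>z (fst q) - z (snd q)\<bar> / 2) + b"
      using b0 by (auto simp: min_def)
    then show "min 1 (\<bar>x (fst q) - x (snd q)\<bar> / 2) \<le> osc n z + b" using up[OF q, of z] by linarith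
  qed
  have BL: "osc n \<in> BL1 \<F>" for n
  proof (rule BL1_I)
    show "\<bar>osc n x\<bar> \<le> 1" for x using le1[of n x] ge0[of n x] by simp
    show "\<bar>osc n x - osc n z\<bar> \<le> b" if xz: "\<And>f. f \<in> \<F> \<Longrightarrow> \<bar>x f - z f\<bar> \<le> b" for x z b
    proof -
      have zx: "\<bar>z f - x f\<bar> \<le> b" if "f \<in> \<F>" for f using xz[OF that] by (simp only: abs_minus_commute[of "z f"])
      have "osc n x \<le> osc n z + b" by (rule lip) (rule xz)
      moreover have "osc n z \<le> osc n x + b" by (rule lip) (rule zx)
      ultimately show ?thesis by linarith
    qed
  qed
  have conv: "(\<lambda>n. osc n (G w)) \<longlonglongrightarrow> 0" if w: "w \<in> space Q" for w
  proof (rule LIMSEQ_I)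
    fix e :: real assume e: "0 < e"
    have "\<forall>e>0. \<exists>d>0. \<forall>f\<in>\<F>. \<forall>g\<in>\<F>.
        sqrt (kernel M N Y lam f f + kernel M N Y lam g g - 2 * kernel M N Y lam f g) < d \<longrightarrow> \<bar>G w f - G w g\<bar> < e"
      by (rule Gauss[unfolded tight_gaussian_process_def Let_def, THEN conjunct2, THEN conjunct2, THEN conjunct1, THEN conjunct2, THEN bspec, OF w, THEN conjunct2])
    then obtain d where d: "0 < d" "\<And>f g. f \<in> \<F> \<Longrightarrow> g \<in> \<F> \<Longrightarrow>
        sqrt (kernel M N Y lam f f + kernel M N Y lam g g - 2 * kernel M N Y lam f g) < d \<Longrightarrow> \<bar>G w f - G w g\<bar> < e"
      using e by blast
    define K where "K = 2 * real CARD('k)"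
    have K: "0 < K" by (simp add: K_def)
    obtain m where m: "inverse (real (Suc m)) < d\<^sup>2 / K" using reals_Archimedean[of "d\<^sup>2 / K"] d(1) K by auto
    have "norm (osc n (G w) - 0) < e" if n: "m \<le> n" for n
    proof -
      have "osc n (G w) \<le> e / 2" unfolding osc_def
      proof (rule cSUP_least[OF Ene])
        fix q assume q: "q \<in> E n"
        have "cell_dist (fst q) (snd q) < inverse (real (Suc n))" using q by (simp add: E_def)
        also have "\<dots> \<le> inverse (real (Suc m))" using n by simp
        finally have "cell_dist (fst q) (snd q) < d\<^sup>2 / K" using m by linarith
        then have "K * cell_dist (fst q) (snd q) < d\<^sup>2" using K by (simp add: field_simps)
        then have "kernel M N Y lam (fst q) (fst q) + kernel M N Y lam (snd q) (snd q) - 2 * kernel M N Y lam (fst q) (snd q) < d\<^sup>2"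
          using rho[OF EF[OF q]] by (simp only: K_def)
        then have "sqrt (kernel M N Y lam (fst q) (fst q) + kernel M N Y lam (snd q) (snd q) - 2 * kernel M N Y lam (fst q) (snd q)) < d"
          using d(1) by (intro real_less_lsqrt) auto
        then have "\<bar>G w (fst q) - G w (snd q)\<bar> < e" by (rule d(2)[OF EF[OF q]])
        then have "\<bar>G w (fst q) - G w (snd q)\<bar> / 2 \<le> e / 2" by simp
        then show "min 1 (\<bar>G w (fst q) - G w (snd q)\<bar> / 2) \<le> e / 2" by (rule min.coboundedI2)
      qed
      then show ?thesis using ge0[of n "G w"] e by simp
    qed
    then show "\<exists>m. \<forall>n\<ge>m. norm (osc n (G w) - 0) < e" by blast
  qed
  have "(\<lambda>n. \<integral>w. osc n (G w) \<partial>Q) \<longlonglongrightarrow> (\<integral>w. 0 \<partial>Q)"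
  proof (rule integral_dominated_convergence[where w = "\<lambda>_. 1"])
    show "AE w in Q. (\<lambda>n. osc n (G w)) \<longlonglongrightarrow> 0" using conv by (intro AE_I2)
    show "AE w in Q. norm (osc n (G w)) \<le> 1" for n using le1 ge0 by (intro AE_I2) auto
  qed (use BL1_measurable[OF BL] in auto)
  then have "\<forall>\<^sub>F n in sequentially. (\<integral>w. osc n (G w) \<partial>Q) < \<kappa> / 2" using \<kappa> by (intro order_tendstoD) auto
  then obtain n where n: "(\<integral>w. osc n (G w) \<partial>Q) < \<kappa> / 2" using eventually_happens by fastforce
  have "\<bar>(\<integral>w. h (\<lambda>f. G w (p f)) \<partial>Q) - (\<integral>w. h (G w) \<partial>Q)\<bar> \<le> \<kappa>"
    if p: "\<forall>f\<in>\<F>. p f \<in> \<F> \<and> cell_dist f (p f) < inverse (real (Suc n))" and h: "h \<in> BL1 \<F>" for p h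
  proof -
    have pE: "(f, p f) \<in> E n" if "f \<in> \<F>" for f using p that by (simp add: E_def)
    have hp: "(\<lambda>x. h (\<lambda>f. x (p f))) \<in> BL1 \<F>" using p by (intro BL1_project[OF h]) blast
    note I = BL1_integrable[OF hp] BL1_integrable[OF h] BL1_integrable[OF BL[of n]]
    \<comment> \<open>If the capped oscillation reaches 1, the trivial bound 2 suffices; otherwise
      the cap is inactive and twice \<open>osc\<close> bounds every increment.\<close>
    have pt: "\<bar>h (\<lambda>f. G w (p f)) - h (G w)\<bar> \<le> 2 * osc n (G w)" for w
    proof (cases "1 \<le> osc n (G w)")
      case True
      then show ?thesis using BL1_bound[OF h, of "\<lambda>f. G w (p f)"] BL1_bound[OF h, of "G w"] by linarith
    next
      case False
      show ?thesis
      proof (rule BL1_lipschitz[OF h])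
        fix f assume "f \<in> \<F>"
        then show "\<bar>G w (p f) - G w f\<bar> \<le> 2 * osc n (G w)"
          using up[OF pE, of f "G w"] False by (auto simp: min_def abs_minus_commute split: if_splits)
      qed (use ge0 in simp)
    qed
    have "\<bar>(\<integral>w. h (\<lambda>f. G w (p f)) \<partial>Q) - (\<integral>w. h (G w) \<partial>Q)\<bar> = \<bar>\<integral>w. h (\<lambda>f. G w (p f)) - h (G w) \<partial>Q\<bar>"
      using I by simp
    also have "\<dots> \<le> (\<integral>w. \<bar>h (\<lambda>f. G w (p f)) - h (G w)\<bar> \<partial>Q)" by (rule integral_abs_bound)
    also have "\<dots> \<le> (\<integral>w. 2 * osc n (G w) \<partial>Q)" using I pt by (intro integral_mono) auto
    also have "\<dots> \<le> \<kappa>" using n by simp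
    finally show ?thesis .
  qed
  then show ?thesis by (intro exI[of _ "inverse (real (Suc n))"]) auto
qed

lemma bootstrap_entropy_case:
  assumes ne: "\<F> \<noteq> {}" and \<kappa>: "0 < \<kappa>"
    and env2: "(\<integral>\<^sup>+ \<omega>. ennreal (real (N \<omega> cell1) * cellsum N Y (\<lambda>y. (Fenv y)\<^sup>2) cell1 \<omega>) \<partial>M) < \<infinity>"
    and ent: "uniform_entropy_integral Ysp \<F> Fenv < \<infinity>"
  shows "\<forall>\<^sub>F n in sequentially. \<exists>U. integrable M U \<and> (\<integral>\<omega>. U \<omega> \<partial>M) \<le> 3 * \<kappa> \<and>
      (\<forall>\<omega>\<in>space M. \<forall>h\<in>BL1 \<F>. \<bar>avg (draws (Cs n)) (\<lambda>d. h (boot n \<omega> d)) - (\<integral>w. h (G w) \<partial>Q)\<bar> \<le> U \<omega>)"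
proof -
  obtain Nn where "entropy_class Ysp \<F> Fenv Nn"
    using entropy_class_of_uniform_entropy[OF ent ne] env_bound by blast
  then interpret entropy_class Ysp \<F> Fenv Nn .
  have dif_meas: "dif (f, g) \<in> borel_measurable (restrict_space borel Ysp)" if "f \<in> \<F>" "g \<in> \<F>" for f g
    unfolding dif_def using class_meas[OF that(1)] class_meas[OF that(2)] by simp
  interpret B: boot_class M "data N Y" cellspace Ysp \<F> Fenv Nn
  proof
    show "good (data N Y \<omega> j)" if "\<omega> \<in> space M" for \<omega> j using Ysp[OF that] by (simp add: good_def data_def)
    show "\<exists>g\<in>borel_measurable cellspace. \<forall>\<omega>\<in>space M. \<forall>j. g (data N Y \<omega> j) = cQ (dif p) (data N Y \<omega> j)"
      if "p \<in> \<F> \<times> \<F>" for p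
      using that by (intro cQ_data_ext) (auto intro: dif_meas)
    show "\<exists>g\<in>borel_measurable cellspace. \<forall>\<omega>\<in>space M. \<forall>j. g (data N Y \<omega> j) = cQ Fenv (data N Y \<omega> j)"
      by (rule cQ_data_ext[OF env_measurable])
    show "integrable M (\<lambda>\<omega>. cQ Fenv (data N Y \<omega> cell1))" by (rule env_integrable[OF env2])
  qed
  have cd: "B.pdist (f, g) = cell_dist f g" for f g by (simp add: B.pdist_def cell_dist_def)
  have \<phi>_dist: "(\<integral>\<omega>. (\<phi> f (data N Y \<omega> cell1) - \<phi> g (data N Y \<omega> cell1))\<^sup>2 \<partial>M) \<le> cell_dist f g" if fg: "f \<in> \<F>" "g \<in> \<F>" for f g
    unfolding cell_dist_def
  proof (rule integral_mono_AE')
    show "integrable M (\<lambda>\<omega>. cQ (dif (f, g)) (data N Y \<omega> cell1))" using fg by (intro B.sq_integral) auto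
    show "AE \<omega> in M. (\<phi> f (data N Y \<omega> cell1) - \<phi> g (data N Y \<omega> cell1))\<^sup>2 \<le> cQ (dif (f, g)) (data N Y \<omega> cell1)"
    proof (rule AE_I2)
      fix \<omega> assume \<omega>: "\<omega> \<in> space M"
      have "(\<phi> f (data N Y \<omega> cell1) - \<phi> g (data N Y \<omega> cell1))\<^sup>2 = (cS (dif (f, g)) (data N Y \<omega> cell1))\<^sup>2"
        unfolding cS_dif fst_conv snd_conv
        by (simp only: \<phi>_data[OF class_meas[OF fg(1)] \<omega>] \<phi>_data[OF class_meas[OF fg(2)] \<omega>] cS_data)
      then show "(\<phi> f (data N Y \<omega> cell1) - \<phi> g (data N Y \<omega> cell1))\<^sup>2 \<le> cQ (dif (f, g)) (data N Y \<omega> cell1)"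
        using cS_square_le by simp
    qed
  qed simp
  have rho: "kernel M N Y lam f f + kernel M N Y lam g g - 2 * kernel M N Y lam f g \<le> 2 * real CARD('k) * cell_dist f g"
    if "f \<in> \<F>" "g \<in> \<F>" for f g
    using kernel_semimetric_le[OF that] mult_left_mono[OF \<phi>_dist[OF that], of "2 * real CARD('k)"] by linarith
  obtain \<delta>2 where \<delta>2: "0 < \<delta>2" "\<And>p h. (\<forall>f\<in>\<F>. p f \<in> \<F> \<and> cell_dist f (p f) < \<delta>2) \<Longrightarrow> h \<in> BL1 \<F> \<Longrightarrow>
      \<bar>(\<integral>w. h (\<lambda>f. G w (p f)) \<partial>Q) - (\<integral>w. h (G w) \<partial>Q)\<bar> \<le> \<kappa>"
    using gauss_projection[OF ne \<kappa> rho] by blast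
  have \<kappa>2: "0 < \<kappa> / 2" using \<kappa> by simp
  obtain \<delta>1 where \<delta>1: "0 < \<delta>1" "\<And>T. finite T \<Longrightarrow> T \<subseteq> \<F> \<Longrightarrow> (\<forall>\<^sub>F n in sequentially. \<exists>U. integrable M U \<and> (\<integral>\<omega>. U \<omega> \<partial>M) \<le> \<kappa> / 2 \<and>
     (\<forall>\<omega>\<in>space M. \<forall>I. finite I \<longrightarrow> I \<noteq> {} \<longrightarrow> I \<subseteq> \<F> \<times> T \<longrightarrow> (\<forall>p\<in>I. B.pdist p < \<delta>1) \<longrightarrow>
        avg (draws (Cs n)) (\<lambda>d. mx I (\<lambda>p. \<bar>boot_val (Cs n) (\<lambda>j. cS (dif p) (data N Y \<omega> j)) d\<bar>)) \<le> U \<omega>))"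
    using B.asymptotic_equicontinuity[OF pm Cs \<kappa>2] by blast
  \<comment> \<open>Both radii are fixed before the net, so one net serves the bootstrap process and
    \<open>G\<close>.\<close>
  have "0 < min \<delta>1 \<delta>2" using \<delta>1(1) \<delta>2(1) by simp
  from B.totally_bounded[OF this] obtain T where T: "finite T" "T \<subseteq> \<F>" "\<forall>f\<in>\<F>. \<exists>t\<in>T. B.pdist (f, t) < min \<delta>1 \<delta>2" by blast
  then obtain p where p: "\<forall>f\<in>\<F>. p f \<in> T \<and> B.pdist (f, p f) < min \<delta>1 \<delta>2" by metis
  have pT: "p f \<in> T" if "f \<in> \<F>" for f using p that by blast
  show ?thesis
  proof (rule projection_argument[OF T(1,2) pT \<kappa>])
    show "\<bar>(\<integral>w. h (\<lambda>f. G w (p f)) \<partial>Q) - (\<integral>w. h (G w) \<partial>Q)\<bar> \<le> \<kappa>" if "h \<in> BL1 \<F>" for h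
      by (rule \<delta>2(2)[OF _ that]) (use p T(2) in \<open>auto simp: cd\<close>)
    show "\<forall>\<^sub>F n in sequentially. \<exists>U. integrable M U \<and> (\<integral>\<omega>. U \<omega> \<partial>M) \<le> \<kappa> \<and>
      (\<forall>\<omega>\<in>space M. \<forall>h\<in>BL1 \<F>. avg (draws (Cs n)) (\<lambda>d. \<bar>h (boot n \<omega> d) - h (\<lambda>f. boot n \<omega> d (p f))\<bar>) \<le> U \<omega>)"
      using \<delta>1(2)[OF T(1,2)] filterlim_at_top[THEN iffD1, OF Cs, rule_format, of 1]
    proof eventually_elim
      case (elim n)
      have pos: "0 < Cs n i" for i using elim(2) Cmin_le[of "Cs n" i] by linarith
      have dne: "draws (Cs n) \<noteq> {}" by (rule draws_nonempty[OF pos])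
      obtain U where U: "integrable M U" "(\<integral>\<omega>. U \<omega> \<partial>M) \<le> \<kappa> / 2"
        "\<forall>\<omega>\<in>space M. \<forall>I. finite I \<longrightarrow> I \<noteq> {} \<longrightarrow> I \<subseteq> \<F> \<times> T \<longrightarrow> (\<forall>p\<in>I. B.pdist p < \<delta>1) \<longrightarrow>
          avg (draws (Cs n)) (\<lambda>d. mx I (\<lambda>p. \<bar>boot_val (Cs n) (\<lambda>j. cS (dif p) (data N Y \<omega> j)) d\<bar>)) \<le> U \<omega>"
        using elim(1) by (elim exE conjE) (rule that; assumption)
      have bound: "avg (draws (Cs n)) (\<lambda>d. \<bar>h (boot n \<omega> d) - h (\<lambda>f. boot n \<omega> d (p f))\<bar>) \<le> U \<omega> + \<kappa> / 2"
        if \<omega>: "\<omega> \<in> space M" and h: "h \<in> BL1 \<F>" for \<omega> h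
      proof -
        define a where "a d = \<bar>h (boot n \<omega> d) - h (\<lambda>f. boot n \<omega> d (p f))\<bar>" for d
        \<comment> \<open>If every function fell short by more than half of \<kappa>, the Lipschitz
          property would give \<open>a d <= a d - \<kappa> / 2\<close>. Thus one function per draw
          nearly witnesses the uniform distance.\<close>
        have "\<exists>f\<in>\<F>. a d \<le> \<bar>boot n \<omega> d f - boot n \<omega> d (p f)\<bar> + \<kappa> / 2" for d
        proof (rule ccontr)
          assume "\<not> (\<exists>f\<in>\<F>. a d \<le> \<bar>boot n \<omega> d f - boot n \<omega> d (p f)\<bar> + \<kappa> / 2)"
          then have less: "\<bar>boot n \<omega> d f - boot n \<omega> d (p f)\<bar> \<le> a d - \<kappa> / 2" if "f \<in> \<F>" for f
            using that by (meson diff_le_eq le_diff_eq linear)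
          obtain f0 where "f0 \<in> \<F>" using ne by blast
          from less[OF this] have nn: "0 \<le> a d - \<kappa> / 2" by linarith
          have "a d \<le> a d - \<kappa> / 2" unfolding a_def [of d, symmetric]
            by (rule BL1_lipschitz[OF h nn, of "boot n \<omega> d" "\<lambda>f. boot n \<omega> d (p f)", folded a_def]) (rule less)
          then show False using \<kappa> by linarith
        qed
        then obtain F where F: "\<And>d. F d \<in> \<F>" "\<And>d. a d \<le> \<bar>boot n \<omega> d (F d) - boot n \<omega> d (p (F d))\<bar> + \<kappa> / 2" by metis
        \<comment> \<open>There are finitely many draws, so the witnesses form a finite set of
          pairs, depending on the outcome and on \<open>h\<close>; the bound by \<open>U\<close>
          does not.\<close>
        define I where "I = (\<lambda>d. (F d, p (F d))) ` draws (Cs n)"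
        have I: "finite I" "I \<noteq> {}" "I \<subseteq> \<F> \<times> T" "\<And>q. q \<in> I \<Longrightarrow> B.pdist q < \<delta>1" using dne F(1) p by (auto simp: I_def)
        have b: "boot_val (Cs n) (\<lambda>j. cS (dif (f, g)) (data N Y \<omega> j)) d = boot n \<omega> d f - boot n \<omega> d g" for f g d
          unfolding cS_dif unfolding fst_conv snd_conv boot_val_diff cS_data boot_def ..
        have "avg (draws (Cs n)) a \<le> avg (draws (Cs n)) (\<lambda>d. mx I (\<lambda>q. \<bar>boot_val (Cs n) (\<lambda>j. cS (dif q) (data N Y \<omega> j)) d\<bar>) + \<kappa> / 2)"
        proof (rule avg_mono)
          fix d assume "d \<in> draws (Cs n)"
          then have q: "(F d, p (F d)) \<in> I" by (simp add: I_def)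
          have "\<bar>boot n \<omega> d (F d) - boot n \<omega> d (p (F d))\<bar> \<le> mx I (\<lambda>q. \<bar>boot_val (Cs n) (\<lambda>j. cS (dif q) (data N Y \<omega> j)) d\<bar>)"
            using mx_ge[OF I(1) q, where f = "\<lambda>q. \<bar>boot_val (Cs n) (\<lambda>j. cS (dif q) (data N Y \<omega> j)) d\<bar>"] unfolding b .
          then show "a d \<le> mx I (\<lambda>q. \<bar>boot_val (Cs n) (\<lambda>j. cS (dif q) (data N Y \<omega> j)) d\<bar>) + \<kappa> / 2" using F(2)[of d] by linarith
        qed
        also have "\<dots> \<le> U \<omega> + \<kappa> / 2" using U(3)[rule_format, OF \<omega> I] dne by (simp add: avg_add)
        finally show ?thesis unfolding a_def .
      qed
      have "integrable M (\<lambda>\<omega>. U \<omega> + \<kappa> / 2)" using U(1) by simp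
      moreover have "(\<integral>\<omega>. U \<omega> + \<kappa> / 2 \<partial>M) \<le> \<kappa>" using U by (simp add: prob_space)
      ultimately show ?case using bound by (intro exI[of _ "\<lambda>\<omega>. U \<omega> + \<kappa> / 2"]) blast
    qed
  qed
qed

text \<open>A finite class, possibly empty, is its own net and the projection costs nothing; an
  infinite one must satisfy the entropy alternative of \<open>A3\<close>.\<close>

lemma bootstrap_bound:
  assumes \<kappa>: "0 < \<kappa>"
  shows "\<forall>\<^sub>F n in sequentially. \<exists>U. integrable M U \<and> (\<integral>\<omega>. U \<omega> \<partial>M) \<le> 3 * \<kappa> \<and>
      (\<forall>\<omega>\<in>space M. \<forall>h\<in>BL1 \<F>. \<bar>avg (draws (Cs n)) (\<lambda>d. h (boot n \<omega> d)) - (\<integral>w. h (G w) \<partial>Q)\<bar> \<le> U \<omega>)"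
proof (cases "finite \<F>")
  case True
  show ?thesis
  proof (rule projection_argument[OF True subset_refl _ \<kappa>, where p = "\<lambda>f. f"])
    show "\<forall>\<^sub>F n in sequentially. \<exists>U. integrable M U \<and> (\<integral>\<omega>. U \<omega> \<partial>M) \<le> \<kappa> \<and>
      (\<forall>\<omega>\<in>space M. \<forall>h\<in>BL1 \<F>. avg (draws (Cs n)) (\<lambda>d. \<bar>h (boot n \<omega> d) - h (\<lambda>f. boot n \<omega> d f)\<bar>) \<le> U \<omega>)"
      using \<kappa> by (intro always_eventually allI exI[of _ "\<lambda>_. 0"]) simp
  qed (use \<kappa> in auto)
next
  case False
  then show ?thesis using A3 unfolding A3_def by (intro bootstrap_entropy_case \<kappa>) auto
qed

theorem bootstrap_consistency:
  assumes \<epsilon>: "0 < \<epsilon>"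
  shows "(\<lambda>n. outer_prob M {\<omega>\<in>space M.
            (SUP h\<in>BL1 \<F>. \<bar>measure_pmf.expectation (boot_weights (Cs n))
                               (\<lambda>W. h (boot_process (Cs n) N Y \<omega> W))
                           - (\<integral>w. h (G w) \<partial>Q)\<bar>) > \<epsilon>}) \<longlonglongrightarrow> 0"
proof (rule LIMSEQ_I)
  fix r :: real assume r: "0 < r"
  define D where "D n \<omega> h = \<bar>measure_pmf.expectation (boot_weights (Cs n)) (\<lambda>W. h (boot_process (Cs n) N Y \<omega> W)) - (\<integral>w. h (G w) \<partial>Q)\<bar>"
    for n \<omega> and h :: "(('y \<Rightarrow> real) \<Rightarrow> real) \<Rightarrow> real"
  define A where "A n = {\<omega>\<in>space M. (SUP h\<in>BL1 \<F>. D n \<omega> h) > \<epsilon>}" for n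
  \<comment> \<open>Markov's inequality then yields
    \<open>3 * \<kappa> / \<epsilon> = r / 2\<close>.\<close>
  define \<kappa> where "\<kappa> = \<epsilon> * r / 6"
  have \<kappa>: "0 < \<kappa>" using \<epsilon> r by (simp add: \<kappa>_def)
  \<comment> \<open>Besides making the supremum over a nonempty set, the zero functional has error
    at least 0 and thereby forces \<open>U\<close> to be nonnegative on \<open>space M\<close>, as
    Markov requires.\<close>
  have zero: "(\<lambda>_. 0) \<in> BL1 \<F>" by (rule BL1_I) auto
  have "\<forall>\<^sub>F n in sequentially. norm (outer_prob M (A n) - 0) < r"
    using bootstrap_bound[OF \<kappa>] filterlim_at_top[THEN iffD1, OF Cs, rule_format, of 1]
  proof eventually_elim
    case (elim n)
    have pos: "0 < Cs n i" for i using elim(2) Cmin_le[of "Cs n" i] by linarith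
    have D: "D n \<omega> h = \<bar>avg (draws (Cs n)) (\<lambda>d. h (boot n \<omega> d)) - (\<integral>w. h (G w) \<partial>Q)\<bar>" for \<omega> h
    proof -
      have "avg (draws (Cs n)) (\<lambda>d. h (boot_process (Cs n) N Y \<omega> (counts (Cs n) d))) = avg (draws (Cs n)) (\<lambda>d. h (boot n \<omega> d))"
      proof (intro avg_cong refl)
        fix d assume "d \<in> draws (Cs n)"
        then have "boot_process (Cs n) N Y \<omega> (counts (Cs n) d) = boot n \<omega> d" by (intro ext) (simp only: boot_process_counts boot_def)
        then show "h (boot_process (Cs n) N Y \<omega> (counts (Cs n) d)) = h (boot n \<omega> d)" by (simp only:)
      qed
      then show ?thesis unfolding D_def boot_expectation[OF pos] by (simp only:)
    qed
    obtain U where U: "integrable M U" "(\<integral>\<omega>. U \<omega> \<partial>M) \<le> 3 * \<kappa>" "\<And>\<omega> h. \<omega> \<in> space M \<Longrightarrow> h \<in> BL1 \<F> \<Longrightarrow> D n \<omega> h \<le> U \<omega>"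
      using elim(1) unfolding D by blast
    have U0: "0 \<le> U \<omega>" if "\<omega> \<in> space M" for \<omega>
      using U(3)[OF that zero] by (rule order_trans[rotated]) (simp add: D_def)
    define B where "B = {\<omega>\<in>space M. \<epsilon> \<le> U \<omega>}"
    have "A n \<subseteq> B"
    proof
      fix \<omega> assume \<omega>: "\<omega> \<in> A n"
      then have s: "\<omega> \<in> space M" by (simp add: A_def)
      have "(SUP h\<in>BL1 \<F>. D n \<omega> h) \<le> U \<omega>" by (rule cSUP_least) (use zero U(3)[OF s] in blast)+
      then show "\<omega> \<in> B" using \<omega> by (simp add: A_def B_def)
    qed
    moreover have "B \<in> sets M" unfolding B_def using U(1) by measurable
    ultimately have "outer_prob M (A n) \<le> measure M B" by (intro outer_prob_le)
    also have "\<dots> \<le> (\<integral>\<omega>. U \<omega> \<partial>M) / \<epsilon>"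
      unfolding B_def by (rule integral_Markov_inequality_measure[OF U(1) sets.top _ \<epsilon>]) (use U0 in \<open>intro AE_I2\<close>)
    also have "\<dots> \<le> 3 * \<kappa> / \<epsilon>" using U(2) \<epsilon> by (intro divide_right_mono) auto
    also have "\<dots> < r" using \<epsilon> r by (simp add: \<kappa>_def)
    finally show ?case using outer_prob_nonneg[of "A n" M] by (simp add: A_def)
  qed
  then show "\<exists>no. \<forall>n\<ge>no. norm (outer_prob M {\<omega>\<in>space M.
            (SUP h\<in>BL1 \<F>. \<bar>measure_pmf.expectation (boot_weights (Cs n))
                               (\<lambda>W. h (boot_process (Cs n) N Y \<omega> W))
                           - (\<integral>w. h (G w) \<partial>Q)\<bar>) > \<epsilon>} - 0) < r"
    unfolding A_def D_def eventually_sequentially .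
qed

end

theorem theorem2:
  fixes M :: "'a measure"
    and N :: "'a \<Rightarrow> ('k::finite \<Rightarrow> nat) \<Rightarrow> nat"
    and Y :: "'a \<Rightarrow> ('k \<Rightarrow> nat) \<Rightarrow> nat \<Rightarrow> real ^ 'l"
    and Ysp :: "(real ^ 'l) set"
    and \<F> :: "(real ^ 'l \<Rightarrow> real) set"
    and Fenv :: "real ^ 'l \<Rightarrow> real"
    and lam :: "'k \<Rightarrow> real"
    and Cs :: "nat \<Rightarrow> ('k \<Rightarrow> nat)"
    and Q :: "'w measure"
    and G :: "'w \<Rightarrow> (real ^ 'l \<Rightarrow> real) \<Rightarrow> real"
  assumes "prob_space M"
    and "A1 M N Y"
    and "\<forall>\<omega>\<in>space M. \<forall>j l. Y \<omega> j l \<in> Ysp"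
    and "pointwise_measurable Ysp \<F>"
    and "\<forall>f\<in>\<F>. f \<in> borel_measurable (restrict_space borel Ysp)"
    and "A3 M N Y Ysp \<F> Fenv"
    and "filterlim (\<lambda>n. Cmin (Cs n)) at_top sequentially"
    and "\<forall>i. (\<lambda>n. real (Cmin (Cs n)) / real (Cs n i)) \<longlonglongrightarrow> lam i"
    and "tight_gaussian_process Q G \<F> (kernel M N Y lam)"
  shows "\<forall>\<epsilon>>0. (\<lambda>n. outer_prob M {\<omega>\<in>space M.
            (SUP h\<in>BL1 \<F>. \<bar>measure_pmf.expectation (boot_weights (Cs n))
                               (\<lambda>W. h (boot_process (Cs n) N Y \<omega> W))
                           - (\<integral>w. h (G w) \<partial>Q)\<bar>) > \<epsilon>}) \<longlonglongrightarrow> 0"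
proof -
  interpret exch_array M "data N Y" cellspace using assms(1,2) by (rule exch_array_data)
  interpret bootstrap_data M N Y Ysp \<F> Fenv lam Cs Q G
    using assms(3-9) by unfold_locales auto
  show ?thesis using bootstrap_consistency by blast
qed

end
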